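(* Let $\mathcal{M}$ be a semi-finite von Neumann algebra with a distinguished faithful, normal, semi-finite trace $\tau$. Let $E$ be an order-continuous symmetric Banach function space on $\mathbb{R}^+$ with the Fatou property. Let $\{x_n\}_{n=1}^\infty$ be a bounded sequence in $E(\mathcal{M},\tau)$. Then there exist a subsequence $\{x_{n_k}\}_{k=1}^\infty$ of $\{x_n\}_{n=1}^\infty$, bounded sequences $\{\varphi_k\}_{k=1}^\infty$ and $\{\zeta_k\}_{k=1}^\infty$ in $E(\mathcal{M},\tau)$, and a mutually disjoint sequence of projections $\{e_k\}_{k=1}^\infty$ in $\mathcal{M}$ such that: (i) $x_{n_k}=\varphi_k+\zeta_k$ for all $k\ge1$; (ii) $\{\varphi_k:k\ge1\}$ is $E$-equi-integrable and $e_k\varphi_ke_k=0$ for all $k\ge1$; (iii) $e_k\zeta_ke_k=\zeta_k$ for all $k\ge1$.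
   Context: $\mathcal{M}$ acts on a Hilbert space $H$. A closed densely defined operator $x$ affiliated with $\mathcal{M}$ is $\tau$-measurable if for every $\epsilon>0$ there is a projection $p\in\mathcal{M}$ with $p(H)\subseteq \operatorname{dom}(x)$, $\tau(\mathbf{1}-p)<\epsilon$ and $xp\in\mathcal{M}$; $\widetilde{\mathcal{M}}$ is the $*$-algebra of all $\tau$-measurable operators (strong sum, strong product, adjoint). For $x\in\widetilde{\mathcal{M}}$ and $t\ge0$, $\mu_t(x)=\inf\{s\ge 0:\tau(e^{|x|}(s,\infty))\le t\}$, where $e^{|x|}$ is the spectral measure of $|x|$; $\mu(x)$ denotes the function $t\mapsto\mu_t(x)$. $\mathbb{R}^+=[0,\infty)$ carries Lebesgue measure $m$ and $L^0(\mathbb{R}^+,m)$ is the space of (classes of) measurable functions. A symmetric Banach function space $E$ on $\mathbb{R}^+$ is a Banach lattice of measurable functions that is an order ideal in $L^0(\mathbb{R}^+,m)$, is rearrangement invariant (if $f\in E$ and $g\in L^0(\mathbb{R}^+,m)$ have the same decreasing rearrangement of absolute values, then $g\in E$ and $\|g\|_E=\|f\|_E$), and contains all finitely supported simple functions. $E$ is order-continuous if $\|f_\beta\|_E\to0$ whenever $f_\beta\downarrow 0$ is a downward directed net in $E$. $E$ has the Fatou property if, whenever $0\le f_n\uparrow f$ a.e. with $f_n\in E$, $f\in L^0(\mathbb{R}^+,m)$ and $\sup_n\|f_n\|_E<\infty$, one has $f\in E$ and $\|f\|_E=\sup_n\|f_n\|_E$. $E(\mathcal{M},\tau)=\{x\in\widetilde{\mathcal{M}}:\mu(x)\in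 E\}$ with $\|x\|_{E(\mathcal{M},\tau)}=\|\mu(x)\|_E$. Projections are self-adjoint; mutually disjoint projections are pairwise orthogonal ones ($e_ke_l=0$ for $k\neq l$); $e_n\downarrow_n 0$ means that the sequence is decreasing with infimum $0$. A bounded subset $K$ of $E(\mathcal{M},\tau)$ is $E$-equi-integrable if $\lim_{n\to\infty}\sup_{x\in K}\|e_nxe_n\|_{E(\mathcal{M},\tau)}=0$ for every decreasing sequence $\{e_n\}_{n=1}^\infty$ of projections in $\mathcal{M}$ with $e_n\downarrow_n0$. *)

theory Defs
  imports "HOL-Analysis.Analysis"
begin

section \<open>Complex Hilbert spaces and bounded operators\<close>

text \<open>The inner product is linear in its first argument; \<^const>\<open>inner\<close> is its real part, so norm and
  topology are the usual ones.\<close>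

class complex_hilbert = real_inner + complete_space +
  fixes scaleC :: "complex \<Rightarrow> 'a \<Rightarrow> 'a" (infixr "*\<^sub>C" 75)
    and cinner :: "'a \<Rightarrow> 'a \<Rightarrow> complex"
  assumes scaleC_of_real: "complex_of_real r *\<^sub>C x = r *\<^sub>R x"
    and scaleC_add_right: "c *\<^sub>C (x + y) = c *\<^sub>C x + c *\<^sub>C y"
    and scaleC_add_left: "(c + d) *\<^sub>C x = c *\<^sub>C x + d *\<^sub>C x"
    and scaleC_scaleC: "c *\<^sub>C (d *\<^sub>C x) = (c * d) *\<^sub>C x"
    and cinner_commute: "cinner x y = cnj (cinner y x)"
    and cinner_add_left: "cinner (x + y) z = cinner x z + cinner y z"
    and cinner_scaleC_left: "cinner (c *\<^sub>C x) y = c * cinner x y"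
    and Re_cinner: "Re (cinner x y) = inner x y"

instantiation complex :: complex_hilbert
begin

definition scaleC_complex :: "complex \<Rightarrow> complex \<Rightarrow> complex"
  where "scaleC_complex c x = c * x"

definition cinner_complex :: "complex \<Rightarrow> complex \<Rightarrow> complex"
  where "cinner_complex x y = x * cnj y"

instance
  by standard
    (auto simp: scaleC_complex_def cinner_complex_def scaleR_conv_of_real algebra_simps
      inner_complex_def)

end

definition bounded_ops :: "('a::complex_hilbert \<Rightarrow>\<^sub>L 'a) set"
  where "bounded_ops = {a :: 'a \<Rightarrow>\<^sub>L 'a. \<forall>c x. a (c *\<^sub>C x) = c *\<^sub>C a x}"

definition adj :: "('a::complex_hilbert \<Rightarrow>\<^sub>L 'a) \<Rightarrow> ('a \<Rightarrow>\<^sub>L 'a)"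
  where "adj a = (THE b :: 'a \<Rightarrow>\<^sub>L 'a. \<forall>x y. cinner (a x) y = cinner x (b y))"

definition positive_op :: "('a::complex_hilbert \<Rightarrow>\<^sub>L 'a) \<Rightarrow> bool"
  where "positive_op a \<longleftrightarrow> a \<in> bounded_ops \<and> (\<forall>x. cinner (a x) x \<in> \<real>\<^sub>\<ge>\<^sub>0)"

definition le_op :: "('a::complex_hilbert \<Rightarrow>\<^sub>L 'a) \<Rightarrow> ('a \<Rightarrow>\<^sub>L 'a) \<Rightarrow> bool"
  where "le_op a b \<longleftrightarrow> positive_op (b - a)"

definition unitary_op :: "('a::complex_hilbert \<Rightarrow>\<^sub>L 'a) \<Rightarrow> bool"
  where "unitary_op u \<longleftrightarrow>
    u \<in> bounded_ops \<and> adj u o\<^sub>L u = id_blinfun \<and> u o\<^sub>L adj u = id_blinfun"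

definition projection_op :: "('a::complex_hilbert \<Rightarrow>\<^sub>L 'a) \<Rightarrow> bool"
  where "projection_op p \<longleftrightarrow> p \<in> bounded_ops \<and> p o\<^sub>L p = p \<and> adj p = p"


section \<open>Von Neumann algebras and traces\<close>

definition commutant :: "('a::complex_hilbert \<Rightarrow>\<^sub>L 'a) set \<Rightarrow> ('a \<Rightarrow>\<^sub>L 'a) set"
  where "commutant M = {b \<in> bounded_ops. \<forall>a\<in>M. b o\<^sub>L a = a o\<^sub>L b}"

text \<open>A von Neumann algebra is a self-adjoint set of bounded operators that equals its bicommutant;
  it is then automatically a unital \<open>*\<close>-subalgebra.\<close>

definition von_neumann_algebra :: "('a::complex_hilbert \<Rightarrow>\<^sub>L 'a) set \<Rightarrow> bool"
  where "von_neumann_algebra M \<longleftrightarrow>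
    M \<subseteq> bounded_ops \<and> (\<forall>a\<in>M. adj a \<in> M) \<and> commutant (commutant M) = M"

definition positive_cone :: "('a::complex_hilbert \<Rightarrow>\<^sub>L 'a) set \<Rightarrow> ('a \<Rightarrow>\<^sub>L 'a) set"
  where "positive_cone M = {a \<in> M. positive_op a}"

definition projections :: "('a::complex_hilbert \<Rightarrow>\<^sub>L 'a) set \<Rightarrow> ('a \<Rightarrow>\<^sub>L 'a) set"
  where "projections M = {p \<in> M. projection_op p}"

text \<open>Only the values of \<open>\<tau>\<close> on the positive cone matter. In \<open>normal\<close>, an increasing net is
  represented by its range, an upward directed set.\<close>

locale fns_trace =
  fixes M :: "('a::complex_hilbert \<Rightarrow>\<^sub>L 'a) set" and \<tau> :: "('a \<Rightarrow>\<^sub>L 'a) \<Rightarrow> ennreal"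
  assumes additive:
      "\<lbrakk>a \<in> positive_cone M; b \<in> positive_cone M\<rbrakk> \<Longrightarrow> \<tau> (a + b) = \<tau> a + \<tau> b"
    and homogeneous:
      "\<lbrakk>a \<in> positive_cone M; 0 \<le> r\<rbrakk> \<Longrightarrow> \<tau> (r *\<^sub>R a) = ennreal r * \<tau> a"
    and tracial: "a \<in> M \<Longrightarrow> \<tau> (adj a o\<^sub>L a) = \<tau> (a o\<^sub>L adj a)"
    and faithful: "\<lbrakk>a \<in> positive_cone M; \<tau> a = 0\<rbrakk> \<Longrightarrow> a = 0"
    and normal:
      "\<lbrakk>D \<subseteq> positive_cone M; D \<noteq> {}; \<forall>a\<in>D. \<forall>b\<in>D. \<exists>c\<in>D. le_op a c \<and> le_op b c;
        s \<in> positive_cone M; \<forall>a\<in>D. le_op a s;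
        \<forall>u\<in>positive_cone M. (\<forall>a\<in>D. le_op a u) \<longrightarrow> le_op s u\<rbrakk>
       \<Longrightarrow> \<tau> s = (SUP a\<in>D. \<tau> a)"
    and semifinite:
      "\<lbrakk>a \<in> positive_cone M; a \<noteq> 0\<rbrakk>
       \<Longrightarrow> \<exists>b\<in>positive_cone M. b \<noteq> 0 \<and> le_op b a \<and> \<tau> b < \<infinity>"


section \<open>Unbounded operators\<close>

text \<open>An unbounded operator is identified with its graph, a subset of \<open>H \<times> H\<close>. The algebraic product
  \<open>xy\<close> (first \<open>y\<close>, then \<open>x\<close>) is the relational composition \<open>y O x\<close>, and the closure of an operator
  is the topological closure of its graph.\<close>

definition op_graph :: "('a::complex_hilbert \<Rightarrow>\<^sub>L 'a) \<Rightarrow> ('a \<times> 'a) set"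
  where "op_graph a = {(h, a h) | h. True}"

definition linear_graph :: "('a::complex_hilbert \<times> 'a) set \<Rightarrow> bool"
  where "linear_graph x \<longleftrightarrow> single_valued x \<and> (0, 0) \<in> x \<and>
    (\<forall>g h g' h'. (g, h) \<in> x \<and> (g', h') \<in> x \<longrightarrow> (g + g', h + h') \<in> x) \<and>
    (\<forall>c g h. (g, h) \<in> x \<longrightarrow> (c *\<^sub>C g, c *\<^sub>C h) \<in> x)"

definition densely_defined :: "('a::complex_hilbert \<times> 'a) set \<Rightarrow> bool"
  where "densely_defined x \<longleftrightarrow> closure (Domain x) = UNIV"

definition adj_graph :: "('a::complex_hilbert \<times> 'a) set \<Rightarrow> ('a \<times> 'a) set"
  where "adj_graph x = {(g', h'). \<forall>(g, h)\<in>x. cinner h g' = cinner g h'}"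

definition positive_self_adjoint :: "('a::complex_hilbert \<times> 'a) set \<Rightarrow> bool"
  where "positive_self_adjoint x \<longleftrightarrow> linear_graph x \<and> densely_defined x \<and> adj_graph x = x \<and>
    (\<forall>(g, h)\<in>x. cinner h g \<in> \<real>\<^sub>\<ge>\<^sub>0)"

text \<open>\<open>|x|\<close> is the positive self-adjoint square root of \<open>x\<^sup>*x\<close>.\<close>

definition abs_graph :: "('a::complex_hilbert \<times> 'a) set \<Rightarrow> ('a \<times> 'a) set"
  where "abs_graph x = (THE y. positive_self_adjoint y \<and> y O y = x O adj_graph x)"

definition strong_sum ::
  "('a::complex_hilbert \<times> 'a) set \<Rightarrow> ('a \<times> 'a) set \<Rightarrow> ('a \<times> 'a) set"
  where "strong_sum x y = closure {(g, h + h') | g h h'. (g, h) \<in> x \<and> (g, h') \<in> y}"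

definition strong_prod ::
  "('a::complex_hilbert \<times> 'a) set \<Rightarrow> ('a \<times> 'a) set \<Rightarrow> ('a \<times> 'a) set"
  where "strong_prod x y = closure (y O x)"

definition compress ::
  "('a::complex_hilbert \<Rightarrow>\<^sub>L 'a) \<Rightarrow> ('a \<times> 'a) set \<Rightarrow> ('a \<times> 'a) set"
  where "compress e x = strong_prod (strong_prod (op_graph e) x) (op_graph e)"


section \<open>Spectral measures\<close>

definition projection_valued_measure :: "(real set \<Rightarrow> ('a::complex_hilbert \<Rightarrow>\<^sub>L 'a)) \<Rightarrow> bool"
  where "projection_valued_measure e \<longleftrightarrow>
    (\<forall>B\<in>sets borel. projection_op (e B)) \<and> e UNIV = id_blinfun \<and>
    (\<forall>F::nat \<Rightarrow> real set. range F \<subseteq> sets borel \<and> disjoint_family F \<longrightarrow>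
      (\<forall>h. (\<lambda>n. e (F n) h) sums e (\<Union>n. F n) h))"

definition scalar_measure ::
  "(real set \<Rightarrow> ('a::complex_hilbert \<Rightarrow>\<^sub>L 'a)) \<Rightarrow> 'a \<Rightarrow> real measure"
  where "scalar_measure e h = measure_of UNIV (sets borel) (\<lambda>B. ennreal (Re (cinner (e B h) h)))"

text \<open>\<open>x = \<integral>\<lambda> de(\<lambda>)\<close>: the domain consists of the \<open>h\<close> with \<open>\<integral>\<lambda>\<^sup>2 d\<langle>e(\<lambda>)h,h\<rangle> < \<infinity>\<close>, and there
  \<open>\<langle>xh,h\<rangle> = \<integral>\<lambda> d\<langle>e(\<lambda>)h,h\<rangle>\<close>, which determines \<open>x\<close> by polarization.\<close>

definition is_spectral_measure ::
  "('a::complex_hilbert \<times> 'a) set \<Rightarrow> (real set \<Rightarrow> ('a \<Rightarrow>\<^sub>L 'a)) \<Rightarrow> bool"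
  where "is_spectral_measure x e \<longleftrightarrow> projection_valued_measure e \<and> linear_graph x \<and>
    Domain x = {h. integrable (scalar_measure e h) (\<lambda>t. t\<^sup>2)} \<and>
    (\<forall>(g, h)\<in>x. cinner h g = complex_of_real (\<integral>t. t \<partial>scalar_measure e g))"

text \<open>For self-adjoint \<open>x\<close> the values on Borel sets are uniquely determined; no other sets are used.\<close>

definition spectral_measure ::
  "('a::complex_hilbert \<times> 'a) set \<Rightarrow> real set \<Rightarrow> ('a \<Rightarrow>\<^sub>L 'a)"
  where "spectral_measure x = (SOME e. is_spectral_measure x e)"


section \<open>Measurable operators and generalised singular values\<close>

definition affiliated ::
  "('a::complex_hilbert \<Rightarrow>\<^sub>L 'a) set \<Rightarrow> ('a \<times> 'a) set \<Rightarrow> bool"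
  where "affiliated M x \<longleftrightarrow>
    (\<forall>u\<in>commutant M. unitary_op u \<longrightarrow> (\<lambda>(g, h). (u g, u h)) ` x = x)"

definition measurable_ops ::
  "('a::complex_hilbert \<Rightarrow>\<^sub>L 'a) set \<Rightarrow> (('a \<Rightarrow>\<^sub>L 'a) \<Rightarrow> ennreal) \<Rightarrow> ('a \<times> 'a) set set"
  where "measurable_ops M \<tau> = {x. linear_graph x \<and> closed x \<and> densely_defined x \<and> affiliated M x \<and>
    (\<forall>\<epsilon>>0. \<exists>p\<in>projections M. range (blinfun_apply p) \<subseteq> Domain x \<and> \<tau> (id_blinfun - p) < ennreal \<epsilon> \<and>
      (\<exists>a\<in>M. op_graph p O x = op_graph a))}"

definition singular_value ::
  "(('a::complex_hilbert \<Rightarrow>\<^sub>L 'a) \<Rightarrow> ennreal) \<Rightarrow> ('a \<times> 'a) set \<Rightarrow> real \<Rightarrow> ennreal"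
  where "singular_value \<tau> x t =
    Inf {ennreal s | s. 0 \<le> s \<and> \<tau> (spectral_measure (abs_graph x) {s<..}) \<le> ennreal t}"

text \<open>For measurable \<open>x\<close> the singular values are finite at every \<open>t > 0\<close>, so passing to real values
  affects at most the null set \<open>{0}\<close>.\<close>

definition singular_fun ::
  "(('a::complex_hilbert \<Rightarrow>\<^sub>L 'a) \<Rightarrow> ennreal) \<Rightarrow> ('a \<times> 'a) set \<Rightarrow> real \<Rightarrow> real"
  where "singular_fun \<tau> x t = enn2real (singular_value \<tau> x t)"


section \<open>Symmetric Banach function spaces\<close>

text \<open>Elements of \<open>L\<^sup>0\<close> are represented by functions, and all relations between them are
  understood almost everywhere on \<open>[0,\<infinity>)\<close>; values at negative arguments are irrelevant. Order ideals
  are automatically closed under almost everywhere equality.\<close>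

abbreviation halfline :: "real measure"
  where "halfline \<equiv> lebesgue_on {0..}"

definition decreasing_rearrangement :: "(real \<Rightarrow> real) \<Rightarrow> real \<Rightarrow> ennreal"
  where "decreasing_rearrangement f t =
    Inf {ennreal s | s. 0 \<le> s \<and> emeasure halfline {u \<in> space halfline. s < \<bar>f u\<bar>} \<le> ennreal t}"

locale symmetric_function_space =
  fixes E :: "(real \<Rightarrow> real) set" and N :: "(real \<Rightarrow> real) \<Rightarrow> real"
  assumes measurable: "f \<in> E \<Longrightarrow> f \<in> borel_measurable halfline"
    and add_closed: "\<lbrakk>f \<in> E; g \<in> E\<rbrakk> \<Longrightarrow> (\<lambda>t. f t + g t) \<in> E"
    and scale_closed: "f \<in> E \<Longrightarrow> (\<lambda>t. c * f t) \<in> E"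
    and norm_triangle: "\<lbrakk>f \<in> E; g \<in> E\<rbrakk> \<Longrightarrow> N (\<lambda>t. f t + g t) \<le> N f + N g"
    and norm_scale: "f \<in> E \<Longrightarrow> N (\<lambda>t. c * f t) = \<bar>c\<bar> * N f"
    and norm_definite: "\<lbrakk>f \<in> E; N f = 0\<rbrakk> \<Longrightarrow> AE t in halfline. f t = 0"
    and complete:
      "\<lbrakk>\<And>n::nat. F n \<in> E; \<forall>\<epsilon>>0. \<exists>K. \<forall>m\<ge>K. \<forall>n\<ge>K. N (\<lambda>t. F m t - F n t) < \<epsilon>\<rbrakk>
       \<Longrightarrow> \<exists>f\<in>E. (\<lambda>n. N (\<lambda>t. F n t - f t)) \<longlonglongrightarrow> 0"
    and ideal:
      "\<lbrakk>f \<in> E; g \<in> borel_measurable halfline; AE t in halfline. \<bar>g t\<bar> \<le> \<bar>f t\<bar>\<rbrakk> \<Longrightarrow> g \<in> E"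
    and norm_mono: "\<lbrakk>f \<in> E; g \<in> E; AE t in halfline. \<bar>g t\<bar> \<le> \<bar>f t\<bar>\<rbrakk> \<Longrightarrow> N g \<le> N f"
    and rearrangement_invariant:
      "\<lbrakk>f \<in> E; g \<in> borel_measurable halfline;
        \<forall>t\<ge>0. decreasing_rearrangement g t = decreasing_rearrangement f t\<rbrakk>
       \<Longrightarrow> g \<in> E \<and> N g = N f"
    and simple_functions:
      "\<lbrakk>simple_function halfline f; emeasure halfline {t \<in> space halfline. f t \<noteq> 0} < \<infinity>\<rbrakk> \<Longrightarrow> f \<in> E"

text \<open>A net \<open>f\<^sub>\<beta> \<down> 0\<close> is represented by its range, a downward directed set with infimum \<open>0\<close>.\<close>

definition order_continuous :: "(real \<Rightarrow> real) set \<Rightarrow> ((real \<Rightarrow> real) \<Rightarrow> real) \<Rightarrow> bool"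
  where "order_continuous E N \<longleftrightarrow> (\<forall>D. D \<subseteq> E \<and> D \<noteq> {} \<and>
      (\<forall>f\<in>D. \<forall>g\<in>D. \<exists>h\<in>D. (AE t in halfline. h t \<le> f t) \<and> (AE t in halfline. h t \<le> g t)) \<and>
      (\<forall>f\<in>D. AE t in halfline. 0 \<le> f t) \<and>
      (\<forall>g\<in>E. (\<forall>f\<in>D. AE t in halfline. g t \<le> f t) \<longrightarrow> (AE t in halfline. g t \<le> 0)) \<longrightarrow>
    (\<forall>\<epsilon>>0. \<exists>f\<in>D. \<forall>g\<in>D. (AE t in halfline. g t \<le> f t) \<longrightarrow> N g < \<epsilon>))"

definition fatou_property :: "(real \<Rightarrow> real) set \<Rightarrow> ((real \<Rightarrow> real) \<Rightarrow> real) \<Rightarrow> bool"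
  where "fatou_property E N \<longleftrightarrow> (\<forall>(F::nat \<Rightarrow> real \<Rightarrow> real) f.
      (\<forall>n. F n \<in> E) \<and> f \<in> borel_measurable halfline \<and>
      (\<forall>n. AE t in halfline. 0 \<le> F n t \<and> F n t \<le> F (Suc n) t) \<and>
      (AE t in halfline. (\<lambda>n. F n t) \<longlonglongrightarrow> f t) \<and>
      bdd_above (range (\<lambda>n. N (F n))) \<longrightarrow>
    f \<in> E \<and> N f = (SUP n. N (F n)))"


section \<open>Noncommutative function spaces\<close>

definition nc_space ::
  "('a::complex_hilbert \<Rightarrow>\<^sub>L 'a) set \<Rightarrow> (('a \<Rightarrow>\<^sub>L 'a) \<Rightarrow> ennreal) \<Rightarrow> (real \<Rightarrow> real) set
    \<Rightarrow> ('a \<times> 'a) set set"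
  where "nc_space M \<tau> E = {x \<in> measurable_ops M \<tau>. singular_fun \<tau> x \<in> E}"

definition nc_norm ::
  "(('a::complex_hilbert \<Rightarrow>\<^sub>L 'a) \<Rightarrow> ennreal) \<Rightarrow> ((real \<Rightarrow> real) \<Rightarrow> real) \<Rightarrow> ('a \<times> 'a) set \<Rightarrow> real"
  where "nc_norm \<tau> N x = N (singular_fun \<tau> x)"

definition nc_bounded ::
  "('a::complex_hilbert \<Rightarrow>\<^sub>L 'a) set \<Rightarrow> (('a \<Rightarrow>\<^sub>L 'a) \<Rightarrow> ennreal) \<Rightarrow> (real \<Rightarrow> real) set
    \<Rightarrow> ((real \<Rightarrow> real) \<Rightarrow> real) \<Rightarrow> ('a \<times> 'a) set set \<Rightarrow> bool"
  where "nc_bounded M \<tau> E N K \<longleftrightarrow> K \<subseteq> nc_space M \<tau> E \<and> (\<exists>C. \<forall>x\<in>K. nc_norm \<tau> N x \<le> C)"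

definition decreases_to_zero ::
  "('a::complex_hilbert \<Rightarrow>\<^sub>L 'a) set \<Rightarrow> (nat \<Rightarrow> ('a \<Rightarrow>\<^sub>L 'a)) \<Rightarrow> bool"
  where "decreases_to_zero M e \<longleftrightarrow> (\<forall>n. e n \<in> projections M) \<and> (\<forall>n. le_op (e (Suc n)) (e n)) \<and>
    (\<forall>p\<in>projections M. (\<forall>n. le_op p (e n)) \<longrightarrow> p = 0)"

definition equi_integrable ::
  "('a::complex_hilbert \<Rightarrow>\<^sub>L 'a) set \<Rightarrow> (('a \<Rightarrow>\<^sub>L 'a) \<Rightarrow> ennreal) \<Rightarrow> (real \<Rightarrow> real) set
    \<Rightarrow> ((real \<Rightarrow> real) \<Rightarrow> real) \<Rightarrow> ('a \<times> 'a) set set \<Rightarrow> bool"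
  where "equi_integrable M \<tau> E N K \<longleftrightarrow> nc_bounded M \<tau> E N K \<and>
    (\<forall>e. decreases_to_zero M e \<longrightarrow>
      (\<lambda>n. SUP x\<in>K. ennreal (nc_norm \<tau> N (compress (e n) x))) \<longlonglongrightarrow> 0)"

end

(*
  A closed operator x is encoded by the bounded operators C = (1 + x* x)^(-1/2) and D = x C; the
  spectral projections of |x| are those of the bounded operators S - s C with S = (1 - C^2)^(1/2), and
  the singular values are handled through the projections p on which x p is bounded.

  Approximate x_k in norm by bounded X_k with supports of finite trace, and pass to a subsequence along
  which decreasing majorants h_k of the singular value functions converge to some g. By the Fatou
  property g lies in E, so by order continuity min(h_k, c) is uniformly small near 0 and infinity, up to
  an error that vanishes in the limit. Two-sided truncations y_k of X_k are bounded in L^2; along a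
  further subsequence tau(y_k f_m y_k* ) converges for every m, where the projections f_m increase, have
  finite trace and support X_0, ..., X_m. Along a rapidly increasing sequence k_i, remove from f_m, with
  m = k_(i-1), the small spectral parts where X_(k_j) is large for some j >= i. This leaves increasing
  projections R_i; put e_i = R_(i+1) - R_i and split x = (x - e x e) + e x e. In
    X - e X e = X R + R X (1 - R) + small,   R = R_i,
  the convergence of the traces shows that X R is close to y f_l for a fixed l, and symmetrically for
  R X. Hence x - e x e is close to u f + f w with f of finite trace and u, w bounded, uniformly in i,
  and such families are equi-integrable.
*)
theory Submission
 imports Defs
begin

section \<open>Hilbert space geometry\<close>

text \<open>No spectral theorem or polar decomposition is assumed. The modulus and the spectral
  measure in the definitions are chosen by description, so both are constructed and then shown to be
  unique, the measure on half-lines; after that only traces of bounded projections occur. Singular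
  values are bounded by a predicate that makes sense for graphs that are not closed, so estimates
  precede closures. Its sum rule halves the argument, and N (f (t/2)) \<le> 2 N f holds in the
  symmetric space; the repeated factors 2 come from there.

  The obstacle is that X_i is unknown while the projection R_i that must not see it is prepared: R_i
  lies below a level f_m fixed before X_i is selected, R_(i+1) below a later level that supports
  X_i. The norm of X_i is not bounded in i, so the trace discarded from the later level is adapted
  to that norm afterwards. Compactness in L^2 enters only through numbers: tau (y f_m radj y)
  increases with m, its limits along the subsequence form a bounded increasing, hence Cauchy,
  sequence, and this makes y (f_m - f_l) small in L^2.\<close>

type_synonym 'a op = "'a \<Rightarrow>\<^sub>L 'a"

abbreviation "I \<equiv> id_blinfun"

lemmas blin = blinfun.add_left blinfun.add_right blinfun.diff_left blinfun.diff_right blinfun.minus_left blinfun.minus_right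

instance complex_hilbert \<subseteq> banach ..

lemma inner_eqI: "(\<And>x. inner x u = inner x v) \<Longrightarrow> u = (v::'a::real_inner)"
 using inner_eq_zero_iff[of "u - v"] by (metis inner_diff_right right_minus_eq)

lemma parallelogram:
 fixes u v :: "'a::real_inner"
 shows "(norm (u + v))\<^sup>2 + (norm (u - v))\<^sup>2 = 2 * (norm u)\<^sup>2 + 2 * (norm v)\<^sup>2"
 by (simp add: power2_norm_eq_inner inner_add inner_diff algebra_simps inner_commute)

text \<open>Real inner products are used so that the lemma serves both for H and for a closed graph
  inside H x H. A minimizing sequence is Cauchy by the parallelogram law; minimality along lines
  through p in S gives orthogonality.\<close>

lemma projection_exists:
 fixes S :: "'a::{real_inner,banach} set"
 assumes S: "closed S" "subspace S"
 shows "\<exists>p\<in>S. \<forall>y\<in>S. inner (x - p) y = 0"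
proof -
 define d where "d = Inf ((\<lambda>y. (norm (x - y))\<^sup>2) ` S)"
 have ne: "S \<noteq> {}" using subspace_0[OF S(2)] by auto
 have bdd: "bdd_below ((\<lambda>y. (norm (x - y))\<^sup>2) ` S)" by (rule bdd_belowI[of _ 0]) auto
 have d_le: "d \<le> (norm (x - y))\<^sup>2" if "y \<in> S" for y unfolding d_def using cINF_lower[OF bdd that] by simp
 have "\<exists>y\<in>S. (norm (x - y))\<^sup>2 < d + 1 / Suc n" for n using cINF_less_iff[OF ne bdd, of "d + 1 / Suc n"] unfolding d_def by auto
 then obtain y where y: "\<And>n. y n \<in> S" "\<And>n. (norm (x - y n))\<^sup>2 < d + 1 / Suc n" by metis
 have diff: "(norm (y n - y m))\<^sup>2 \<le> 2 / Suc n + 2 / Suc m" for n m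
 proof -
  have "(1/2) *\<^sub>R (y n + y m) \<in> S" using S(2) y(1) by (intro subspace_scale subspace_add) auto
  from d_le[OF this] have "4 * d \<le> (2 * norm (x - (1/2) *\<^sub>R (y n + y m)))\<^sup>2" by (simp add: power_mult_distrib)
  also have "2 * norm (x - (1/2) *\<^sub>R (y n + y m)) = norm (2 *\<^sub>R (x - (1/2) *\<^sub>R (y n + y m)))" by simp
  also have "2 *\<^sub>R (x - (1/2) *\<^sub>R (y n + y m)) = (x - y n) + (x - y m)" by (simp add: algebra_simps scaleR_2)
  finally have "4 * d \<le> (norm ((x - y n) + (x - y m)))\<^sup>2" .
  moreover have "(norm ((x - y n) - (x - y m)))\<^sup>2 = (norm (y n - y m))\<^sup>2" by (simp add: norm_minus_commute)
  ultimately show ?thesis using parallelogram[of "x - y n" "x - y m"] y(2)[of n] y(2)[of m] by linarith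
 qed
 have "Cauchy y"
 proof (rule CauchyI)
  fix e :: real assume e: "0 < e"
  obtain K where K: "4 / Suc K < e\<^sup>2" using reals_Archimedean[of "e\<^sup>2 / 4"] e by (auto simp: field_simps)
  show "\<exists>M. \<forall>m\<ge>M. \<forall>n\<ge>M. norm (y m - y n) < e"
  proof (intro exI allI impI)
   fix m n assume mn: "K \<le> m" "K \<le> n"
   have "2 / Suc m \<le> 2 / Suc K" "2 / Suc n \<le> 2 / Suc K" using mn by (auto simp: frac_le)
   then have "(norm (y m - y n))\<^sup>2 < e\<^sup>2" using diff[of m n] K by linarith
   then show "norm (y m - y n) < e" using e by (simp add: power_less_imp_less_base)
  qed
 qed
 then obtain p where p: "y \<longlonglongrightarrow> p" using Cauchy_convergent convergent_def by blast
 have pS: "p \<in> S" using closed_sequentially[OF S(1) y(1) p] .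
 have "(\<lambda>n. (norm (x - y n))\<^sup>2) \<longlonglongrightarrow> (norm (x - p))\<^sup>2" by (intro tendsto_intros p)
 moreover have "(\<lambda>n. d + 1 / real (Suc n)) \<longlonglongrightarrow> d + 0" by (intro tendsto_intros LIMSEQ_Suc[OF lim_1_over_n])
 ultimately have pd: "(norm (x - p))\<^sup>2 \<le> d"
  using LIMSEQ_le[of _ _ _ "d + 0"] y(2) less_imp_le by (metis (no_types, lifting) add.right_neutral)
 have "inner (x - p) z = 0" if z: "z \<in> S" for z
 proof (cases "z = 0")
  case False
  \<comment> \<open>The minimizer of the quadratic t -> norm (x - p - t z)^2; comparison with t = 0
    forces the inner product to vanish.\<close>
  define t where "t = inner (x - p) z / (norm z)\<^sup>2"
  have "p + t *\<^sub>R z \<in> S" using S(2) pS z by (intro subspace_scale subspace_add) auto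
  from order_trans[OF pd d_le[OF this]] have "(norm (x - p))\<^sup>2 \<le> (norm (x - (p + t *\<^sub>R z)))\<^sup>2" .
  also have "\<dots> = (norm (x - p))\<^sup>2 - 2 * t * inner (x - p) z + t\<^sup>2 * (norm z)\<^sup>2"
   unfolding power2_norm_eq_inner by (simp add: inner_add inner_diff algebra_simps inner_commute power2_eq_square)
  finally have "2 * t * inner (x - p) z \<le> t\<^sup>2 * (norm z)\<^sup>2" by simp
  moreover have "t * (norm z)\<^sup>2 = inner (x - p) z" using False by (simp add: t_def)
  ultimately have "2 * (t * inner (x - p) z) \<le> t * inner (x - p) z"
   by (metis mult.assoc power2_eq_square mult.commute mult.left_commute)
  then have "t * inner (x - p) z \<le> 0" by simp
  then have "(inner (x - p) z)\<^sup>2 / (norm z)\<^sup>2 \<le> 0" by (simp add: t_def power2_eq_square)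
  then show ?thesis using False by (simp add: divide_le_0_iff)
 qed simp
 then show ?thesis using pS by blast
qed

lemma projection_unique:
 fixes S :: "'a::{real_inner,banach} set"
 assumes S: "subspace S" "p \<in> S" "q \<in> S" "\<And>y. y \<in> S \<Longrightarrow> inner (x - p) y = 0" "\<And>y. y \<in> S \<Longrightarrow> inner (x - q) y = 0"
 shows "p = q"
proof -
 have "p - q \<in> S" using S subspace_diff by blast
 then have "inner (x - q) (p - q) - inner (x - p) (p - q) = 0" using S by simp
 then have "inner (p - q) (p - q) = 0" by (simp add: inner_diff)
 then show ?thesis by simp
qed

definition proj :: "'a::{real_inner,banach} set \<Rightarrow> 'a op"
 where "proj S = Blinfun (\<lambda>x. THE p. p \<in> S \<and> (\<forall>y\<in>S. inner (x - p) y = 0))"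

context
 fixes S :: "'a::{real_inner,banach} set"
 assumes S: "closed S" "subspace S"
begin

private definition pr where "pr x = (THE p. p \<in> S \<and> (\<forall>y\<in>S. inner (x - p) y = 0))"

private lemma pr: "pr x \<in> S" "y \<in> S \<Longrightarrow> inner (x - pr x) y = 0"
proof -
 have "\<exists>!p. p \<in> S \<and> (\<forall>y\<in>S. inner (x - p) y = 0)" using projection_exists[OF S, of x] projection_unique[OF S(2)] by blast
 from theI'[OF this] show "pr x \<in> S" "y \<in> S \<Longrightarrow> inner (x - pr x) y = 0" unfolding pr_def by blast+
qed

private lemma prI: "p \<in> S \<Longrightarrow> (\<And>y. y \<in> S \<Longrightarrow> inner (x - p) y = 0) \<Longrightarrow> pr x = p" using projection_unique[OF S(2) pr(1)] pr(2) by blast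

private lemma bl: "bounded_linear pr"
proof (rule bounded_linear_intro[where K = 1])
 fix x y
 show "pr (x + y) = pr x + pr y"
 proof (rule prI)
  show "pr x + pr y \<in> S" using pr S(2) subspace_add by blast
  fix z assume "z \<in> S"
  then show "inner (x + y - (pr x + pr y)) z = 0" using pr(2)[of z x] pr(2)[of z y] by (simp add: inner_add inner_diff)
 qed
next
 fix r x
 show "pr (r *\<^sub>R x) = r *\<^sub>R pr x"
 proof (rule prI)
  show "r *\<^sub>R pr x \<in> S" using pr S(2) subspace_scale by blast
  fix z assume "z \<in> S"
  then show "inner (r *\<^sub>R x - r *\<^sub>R pr x) z = 0" using pr(2)[of z x] by (simp flip: scaleR_diff_right)
 qed
next
 fix x
 have "inner (x - pr x) (pr x) = 0" using pr by blast
 then have "(norm (pr x))\<^sup>2 = inner x (pr x)" by (simp add: inner_diff power2_norm_eq_inner)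
 also have "\<dots> \<le> norm x * norm (pr x)" by (rule norm_cauchy_schwarz)
 finally show "norm (pr x) \<le> norm x * 1" by (cases "norm (pr x) = 0") (auto simp: power2_eq_square mult.commute)
qed

private lemma proj_pr: "blinfun_apply (proj S) x = pr x"
 unfolding proj_def pr_def[symmetric] by (simp add: bounded_linear_Blinfun_apply[OF bl])

lemma proj_in: "proj S x \<in> S" by (simp add: proj_pr pr)
lemma proj_orth: "y \<in> S \<Longrightarrow> inner (x - proj S x) y = 0" by (simp add: proj_pr pr)
lemma proj_eqI: "p \<in> S \<Longrightarrow> (\<And>y. y \<in> S \<Longrightarrow> inner (x - p) y = 0) \<Longrightarrow> proj S x = p" by (simp add: proj_pr prI)
lemma proj_id: "x \<in> S \<Longrightarrow> proj S x = x" by (rule proj_eqI) auto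
lemma proj_idem: "proj S (proj S x) = proj S x" using proj_id[OF proj_in] .
lemma proj_sa: "inner (proj S x) y = inner x (proj S y)"
 using proj_orth[OF proj_in, of x y] proj_orth[OF proj_in, of y x] by (simp add: inner_diff inner_commute)
lemma proj_fix_iff: "proj S x = x \<longleftrightarrow> x \<in> S" using proj_id proj_in by metis
lemma proj_0_iff: "proj S x = 0 \<longleftrightarrow> (\<forall>y\<in>S. inner x y = 0)" using proj_orth[of _ x] proj_eqI[of 0 x] subspace_0[OF S(2)] by fastforce

end

lemma riesz:
 fixes f :: "'a::{real_inner,banach} \<Rightarrow> real"
 assumes "bounded_linear f"
 shows "\<exists>z. \<forall>x. f x = inner x z"
proof -
 interpret f: bounded_linear f by fact
 define S where "S = {x. f x = 0}"
 have S: "closed S" "subspace S"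
 proof -
  have "closed (f -` {0})" by (intro closed_vimage) (auto intro: f.continuous_on continuous_intros)
  then show "closed S" unfolding S_def vimage_def by simp
  show "subspace S" unfolding S_def by (auto intro!: subspaceI simp: f.add f.scaleR f.zero)
 qed
 show ?thesis
 proof (cases "\<forall>x. f x = 0")
  case True then show ?thesis by (intro exI[of _ 0]) simp
 next
  case False
  then obtain u where u: "f u \<noteq> 0" by blast
  define v where "v = u - proj S u"
  have fv: "f v = f u" using proj_in[OF S, of u] by (simp add: v_def f.diff S_def)
  have vS: "inner v y = 0" if "y \<in> S" for y using proj_orth[OF S that] by (simp add: v_def)
  have v0: "v \<noteq> 0" using fv u f.zero by metis
  show ?thesis
  proof (intro exI[of _ "(f v / inner v v) *\<^sub>R v"] allI)
   fix x
   have "x - (f x / f v) *\<^sub>R v \<in> S" using fv u by (simp add: S_def f.diff f.scaleR)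
   from vS[OF this] have "inner v x = f x / f v * inner v v" by (simp add: inner_diff)
   then show "f x = inner x ((f v / inner v v) *\<^sub>R v)" using v0 fv u by (simp add: inner_commute)
  qed
 qed
qed

lemma radj_exists:
 fixes b :: "'a::{real_inner,banach} op"
 shows "\<exists>c::'a op. \<forall>x y. inner (b x) y = inner x (c y)"
proof -
 have "\<exists>z. \<forall>x. inner (b x) y = inner x z" for y by (rule riesz) (intro bounded_linear_intros)
 then obtain c where c: "\<And>x y. inner (b x) y = inner x (c y)" by metis
 have "bounded_linear c"
 proof (rule bounded_linear_intro[where K = "norm b"])
  show "c (x + y) = c x + c y" for x y by (rule inner_eqI) (simp add: c[symmetric] inner_add)
  show "c (r *\<^sub>R x) = r *\<^sub>R c x" for r x by (rule inner_eqI) (simp add: c[symmetric])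
  fix x
  have "(norm (c x))\<^sup>2 = inner (b (c x)) x" by (simp add: c power2_norm_eq_inner)
  also have "\<dots> \<le> norm (b (c x)) * norm x" by (rule norm_cauchy_schwarz)
  also have "\<dots> \<le> norm b * norm (c x) * norm x" by (intro mult_right_mono norm_blinfun) auto
  finally show "norm (c x) \<le> norm x * norm b" by (cases "norm (c x) = 0") (auto simp: power2_eq_square mult_ac)
 qed
 then show ?thesis using c by (intro exI[of _ "Blinfun c"]) (simp add: bounded_linear_Blinfun_apply)
qed

text \<open>Adjoint for the real inner product. On \<open>bounded_ops\<close> it coincides with the
  complex adjoint \<open>adj\<close>, see \<open>adj_radj\<close>.\<close>

definition radj :: "('a::{real_inner,banach} op) \<Rightarrow> 'a op"
 where "radj b = (SOME c :: 'a op. \<forall>x y. inner (b x) y = inner x (c y))"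

lemma radj: "inner (blinfun_apply b x) y = inner x (radj b y)" using someI_ex[OF radj_exists, of b] unfolding radj_def by blast

lemma radj': "inner y (blinfun_apply b x) = inner (radj b y) x" by (metis radj inner_commute)

section \<open>Positive operators\<close>

definition commute :: "('a::real_normed_vector op) \<Rightarrow> 'a op \<Rightarrow> bool"
 where "commute a b \<longleftrightarrow> (\<forall>x. a (b x) = b (a x))"

definition sa :: "('a::real_inner op) \<Rightarrow> bool"
 where "sa a \<longleftrightarrow> (\<forall>x y. inner (a x) y = inner x (a y))"

definition pos :: "('a::real_inner op) \<Rightarrow> bool"
 where "pos a \<longleftrightarrow> sa a \<and> (\<forall>x. 0 \<le> inner (a x) x)"

lemma commuteD: "commute a b \<Longrightarrow> a (b x) = b (a x)" by (simp add: commute_def)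
lemma commute_sym: "commute a b \<Longrightarrow> commute b a" by (simp add: commute_def)
lemma saD: "sa a \<Longrightarrow> inner (a x) y = inner x (a y)" by (simp add: sa_def)
lemma pos_sa: "pos a \<Longrightarrow> sa a" by (simp add: pos_def)
lemma posD: "pos a \<Longrightarrow> 0 \<le> inner (a x) x" by (simp add: pos_def)

lemma commute_add: "commute a b \<Longrightarrow> commute a c \<Longrightarrow> commute a (b + c)" by (simp add: commute_def blin)
lemma commute_diff: "commute a b \<Longrightarrow> commute a c \<Longrightarrow> commute a (b - c)" by (simp add: commute_def blin)
lemma commute_scaleR: "commute a b \<Longrightarrow> commute a (r *\<^sub>R b)" by (simp add: commute_def blinfun.scaleR_left blinfun.scaleR_right)
lemma commute_comp: "commute a b \<Longrightarrow> commute a c \<Longrightarrow> commute a (b o\<^sub>L c)" by (simp add: commute_def)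
lemma commute_id: "commute a I" by (simp add: commute_def)
lemma commute_zero: "commute a 0" by (simp add: commute_def)
lemma commute_refl: "commute a a" by (simp add: commute_def)
lemmas commute_intros = commute_add commute_diff commute_scaleR commute_comp commute_id commute_zero commute_refl

lemma sa_add: "sa a \<Longrightarrow> sa b \<Longrightarrow> sa (a + b)" by (simp add: sa_def blin inner_add)
lemma sa_diff: "sa a \<Longrightarrow> sa b \<Longrightarrow> sa (a - b)" by (simp add: sa_def blin inner_diff)
lemma sa_scaleR: "sa a \<Longrightarrow> sa (r *\<^sub>R a)" by (simp add: sa_def blinfun.scaleR_left)
lemma sa_id: "sa I" by (simp add: sa_def)
lemma sa_zero: "sa 0" by (simp add: sa_def)
lemma sa_comp: "sa a \<Longrightarrow> sa b \<Longrightarrow> commute a b \<Longrightarrow> sa (a o\<^sub>L b)" by (simp add: sa_def commute_def)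
lemmas sa_intros = sa_add sa_diff sa_scaleR sa_id sa_zero

lemma blinfun_limit_apply:
 assumes "Y \<longlonglongrightarrow> (y :: 'a::real_normed_vector \<Rightarrow>\<^sub>L 'b::real_normed_vector)"
 shows "(\<lambda>n. blinfun_apply (Y n) x) \<longlonglongrightarrow> y x" using assms by (intro tendsto_intros)

lemma pos_cauchy_schwarz:
 assumes "pos a"
 shows "(inner (blinfun_apply a x) y)\<^sup>2 \<le> inner (a x) x * inner (a y) y"
proof -
 have form: "0 \<le> inner (a x) x + 2 * t * inner (a x) y + t\<^sup>2 * inner (a y) y" for t x y
  using posD[OF assms, of "x + t *\<^sub>R y"] saD[OF pos_sa[OF assms], of y x]
  by (simp add: blin blinfun.scaleR_right inner_add power2_eq_square algebra_simps inner_commute)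
 show ?thesis
 proof (cases "inner (a y) y = 0")
  case True
  have "inner (a x) y = 0"
  proof (rule ccontr)
   assume n: "inner (a x) y \<noteq> 0"
   \<comment> \<open>For isotropic y this t gives the form the value -1 at x + t y.\<close>
   define t where "t = - (inner (a x) x + 1) / (2 * inner (a x) y)"
   have "2 * t * inner (a x) y = - (inner (a x) x + 1)" using n by (simp add: t_def)
   then show False using form[of x t y] True by simp
  qed
  then show ?thesis using posD[OF assms] True by simp
 next
  case False
  then have p: "0 < inner (a y) y" using posD[OF assms, of y] by simp
  define t where "t = - inner (a x) y / inner (a y) y"
  have "t * inner (a y) y = - inner (a x) y" using p by (simp add: t_def)
  then have "t\<^sup>2 * inner (a y) y = - t * inner (a x) y" by (simp add: power2_eq_square mult.assoc)
  then have "0 \<le> inner (a x) x + t * inner (a x) y" using form[of x t y] by simp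
  then have "0 \<le> (inner (a x) x + t * inner (a x) y) * inner (a y) y" using p by simp
  also have "\<dots> = inner (a x) x * inner (a y) y - (inner (a x) y)\<^sup>2" using p by (simp add: t_def field_simps power2_eq_square)
  finally show ?thesis by simp
 qed
qed

lemma pos_form_zero: "pos a \<Longrightarrow> inner (blinfun_apply a x) x = 0 \<Longrightarrow> a x = 0" using pos_cauchy_schwarz[of a x "a x"] by simp

text \<open>A bound on the quadratic form of a positive operator bounds its norm: Cauchy-Schwarz for
  the form, with second vector a x.\<close>

lemma pos_norm_le:
 assumes "pos a" "\<And>x. inner (blinfun_apply a x) x \<le> c * (norm x)\<^sup>2"
 shows "norm (a x) \<le> c * norm x"
proof (cases "a x = 0")
 case True
 have "c * (norm x)\<^sup>2 \<ge> 0" using assms(2)[of x] posD[OF assms(1), of x] by linarith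
 then have "c * norm x \<ge> 0" by (cases "x = 0") (auto simp: zero_le_mult_iff)
 then show ?thesis using True by simp
next
 case False
 then have x0: "x \<noteq> 0" by (auto simp: blinfun.zero_right)
 have "0 \<le> c * (norm x)\<^sup>2" using assms(2)[of x] posD[OF assms(1), of x] by linarith
 then have c0: "0 \<le> c" using x0 by (simp add: zero_le_mult_iff)
 have "((norm (a x))\<^sup>2)\<^sup>2 = (inner (a x) (a x))\<^sup>2" by (simp add: power2_norm_eq_inner)
 also have "\<dots> \<le> inner (a x) x * inner (a (a x)) (a x)" by (rule pos_cauchy_schwarz[OF assms(1)])
 also have "\<dots> \<le> (c * (norm x)\<^sup>2) * (c * (norm (a x))\<^sup>2)" by (intro mult_mono assms(2) posD[OF assms(1)]) (simp add: c0)
 finally have "(norm (a x))\<^sup>2 * (norm (a x))\<^sup>2 \<le> (c * norm x)\<^sup>2 * (norm (a x))\<^sup>2" by (simp add: power2_eq_square mult_ac)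
 then have "(norm (a x))\<^sup>2 \<le> (c * norm x)\<^sup>2" using False by (meson mult_right_le_imp_le zero_less_norm_iff zero_less_power)
 then show ?thesis using c0 by (meson mult_nonneg_nonneg norm_ge_zero power2_le_imp_le)
qed

lemma sa_pos_iff_norm:
 assumes "sa a" "\<And>x. norm (blinfun_apply a x) \<le> norm x"
 shows "pos (I - a)" unfolding pos_def
proof (intro conjI allI sa_intros assms)
 fix x
 have "inner (a x) x \<le> norm (a x) * norm x" by (rule norm_cauchy_schwarz)
 also have "\<dots> \<le> norm x * norm x" by (intro mult_right_mono assms) auto
 finally show "0 \<le> inner ((I - a) x) x" by (simp add: blin inner_diff power2_norm_eq_inner[symmetric] power2_eq_square)
qed

text \<open>The square root of \<open>1 - Z\<close> is \<open>1 - Y\<close>, where \<open>Y\<close> is the limit of the iteration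
 \<open>Y \<mapsto> (Z + Y\<^sup>2) / 2\<close> started at \<open>0\<close>; the scalar iteration for \<open>Z = 1\<close> majorizes it, so that
 convergence holds in norm.\<close>

primrec sqrt_iter :: "('a::real_normed_vector op) \<Rightarrow> nat \<Rightarrow> 'a op" where
 "sqrt_iter Z 0 = 0"
| "sqrt_iter Z (Suc n) = (1/2) *\<^sub>R (Z + (sqrt_iter Z n o\<^sub>L sqrt_iter Z n))"

primrec sqrt_scal :: "nat \<Rightarrow> real" where
 "sqrt_scal 0 = 0"
| "sqrt_scal (Suc n) = (1 + (sqrt_scal n)\<^sup>2) / 2"

lemma sqrt_scal_bounds: "0 \<le> sqrt_scal n \<and> sqrt_scal n \<le> 1"
proof (induction n)
 case (Suc n)
 then have "(sqrt_scal n)\<^sup>2 \<le> 1" by (simp add: power_le_one)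
 then show ?case by simp
qed simp

lemma sqrt_scal_mono: "sqrt_scal n \<le> sqrt_scal (Suc n)" using sum_squares_bound[of "sqrt_scal n" 1] by (simp add: algebra_simps)

lemma sqrt_iter_bounds:
 assumes "norm Z \<le> 1"
 shows "norm (sqrt_iter Z n) \<le> sqrt_scal n"
  and "norm (sqrt_iter Z (Suc n) - sqrt_iter Z n) \<le> sqrt_scal (Suc n) - sqrt_scal n"
proof -
 show b: "norm (sqrt_iter Z n) \<le> sqrt_scal n" for n
 proof (induction n)
  case (Suc n)
  have "norm (sqrt_iter Z (Suc n)) \<le> (norm Z + norm (sqrt_iter Z n o\<^sub>L sqrt_iter Z n)) / 2" by (simp add: norm_triangle_ineq)
  also have "norm (sqrt_iter Z n o\<^sub>L sqrt_iter Z n) \<le> norm (sqrt_iter Z n) * norm (sqrt_iter Z n)" by (rule norm_blinfun_compose)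
  also have "\<dots> \<le> sqrt_scal n * sqrt_scal n" by (intro mult_mono Suc) (auto simp: sqrt_scal_bounds)
  finally show ?case using assms by (simp add: power2_eq_square)
 qed simp
 show "norm (sqrt_iter Z (Suc n) - sqrt_iter Z n) \<le> sqrt_scal (Suc n) - sqrt_scal n"
 proof (induction n)
  case 0 then show ?case using assms by simp
 next
  case (Suc n)
  let ?Y = "sqrt_iter Z" and ?y = sqrt_scal
  \<comment> \<open>A difference of squares written as Y' (Y' - Y) + (Y' - Y) Y, which needs no
    commutation.\<close>
  have "?Y (Suc (Suc n)) - ?Y (Suc n) =
   (1/2) *\<^sub>R ((?Y (Suc n) o\<^sub>L (?Y (Suc n) - ?Y n)) + ((?Y (Suc n) - ?Y n) o\<^sub>L ?Y n))"
   by (rule blinfun_eqI) (simp add: blin blinfun.scaleR_left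
     blin blinfun.scaleR_right algebra_simps)
  also have "norm \<dots> \<le> (1/2) * (norm (?Y (Suc n)) * norm (?Y (Suc n) - ?Y n) + norm (?Y (Suc n) - ?Y n) * norm (?Y n))"
   unfolding norm_scaleR by (intro mult_mono order_trans[OF norm_triangle_ineq] add_mono norm_blinfun_compose) auto
  also have "\<dots> \<le> (1/2) * (?y (Suc n) * (?y (Suc n) - ?y n) + (?y (Suc n) - ?y n) * ?y n)"
   by (intro mult_left_mono add_mono mult_mono b Suc) (auto simp: sqrt_scal_bounds sqrt_scal_mono simp del: sqrt_scal.simps)
  also have "\<dots> = ?y (Suc (Suc n)) - ?y (Suc n)" by (simp add: power2_eq_square algebra_simps)
  finally show ?case .
 qed
qed

lemma sqrt_iter_convergent:
 fixes Z :: "'a::banach op"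
 assumes "norm Z \<le> 1"
 shows "convergent (sqrt_iter Z)"
proof -
 have "convergent sqrt_scal" by (rule Bseq_mono_convergent[OF BseqI'[of _ 1]])
   (use sqrt_scal_bounds sqrt_scal_mono in \<open>auto intro: lift_Suc_mono_le simp del: sqrt_scal.simps\<close>)
 then have c: "Cauchy sqrt_scal" by (rule convergent_Cauchy)
 have le: "norm (sqrt_iter Z (n + k) - sqrt_iter Z n) \<le> sqrt_scal (n + k) - sqrt_scal n" for n k
 proof (induction k)
  case (Suc k)
  show ?case using sqrt_iter_bounds(2)[OF assms, of "n + k"] Suc
    norm_triangle_ineq[of "sqrt_iter Z (Suc (n + k)) - sqrt_iter Z (n + k)" "sqrt_iter Z (n + k) - sqrt_iter Z n"]
   by (simp del: sqrt_iter.simps sqrt_scal.simps)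
 qed simp
 have le2: "norm (sqrt_iter Z m - sqrt_iter Z n) \<le> \<bar>sqrt_scal m - sqrt_scal n\<bar>" for m n
  using le[of n "m - n"] le[of m "n - m"] by (cases "n \<le> m") (auto simp: norm_minus_commute)
 have "Cauchy (sqrt_iter Z)"
 proof (rule CauchyI)
  fix e :: real assume "0 < e"
  with c obtain M where "\<And>m n. m \<ge> M \<Longrightarrow> n \<ge> M \<Longrightarrow> norm (sqrt_scal m - sqrt_scal n) < e" using CauchyD by blast
  then show "\<exists>M. \<forall>m\<ge>M. \<forall>n\<ge>M. norm (sqrt_iter Z m - sqrt_iter Z n) < e" using le2 by (metis order.strict_trans1 real_norm_def)
 qed
 then show ?thesis by (rule Cauchy_convergent)
qed

lemma pos_sqrt_contr:
 fixes A :: "'a::{real_inner,banach} op"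
 assumes A: "pos A" "\<And>x. inner (A x) x \<le> (norm x)\<^sup>2"
 shows "\<exists>R. pos R \<and> (\<forall>x. R (R x) = A x) \<and> (\<forall>b. commute b A \<longrightarrow> commute b R)"
proof -
 define Z where "Z = I - A"
 have Zapp: "Z x = x - A x" for x by (simp add: Z_def blin)
 have Z: "pos Z" unfolding pos_def
  using A(2) unfolding Zapp by (auto simp: inner_diff power2_norm_eq_inner Z_def intro!: sa_intros pos_sa[OF A(1)])
 have "norm (Z x) \<le> 1 * norm x" for x
  by (rule pos_norm_le[OF Z]) (use posD[OF A(1)] in \<open>simp add: Zapp inner_diff power2_norm_eq_inner\<close>)
 then have nZ: "norm Z \<le> 1" by (intro norm_blinfun_bound) auto
 obtain Y where Y: "sqrt_iter Z \<longlonglongrightarrow> Y" using sqrt_iter_convergent[OF nZ] convergent_def by blast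
 have Yx: "(\<lambda>n. sqrt_iter Z n x) \<longlonglongrightarrow> Y x" for x by (rule blinfun_limit_apply[OF Y])
 have YY: "Y (Y x) = 2 *\<^sub>R Y x - Z x" for x
 proof -
  have "(\<lambda>n. (1/2) *\<^sub>R (Z x + sqrt_iter Z n (sqrt_iter Z n x))) \<longlonglongrightarrow> (1/2) *\<^sub>R (Z x + Y (Y x))" by (intro tendsto_intros Y)
  then have "(\<lambda>n. sqrt_iter Z (Suc n) x) \<longlonglongrightarrow> (1/2) *\<^sub>R (Z x + Y (Y x))" by (simp add: blinfun.scaleR_left blin)
  then have "(1/2) *\<^sub>R (Z x + Y (Y x)) = Y x" using LIMSEQ_Suc[OF Yx[of x]] LIMSEQ_unique by blast
  then have "2 *\<^sub>R ((1/2) *\<^sub>R (Z x + Y (Y x))) = 2 *\<^sub>R Y x" by simp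
  then show ?thesis by (simp add: algebra_simps)
 qed
 have Ysa: "sa Y" unfolding sa_def
 proof (intro allI)
  fix x y
  have it: "sa (sqrt_iter Z n)" for n by (induction n) (auto intro!: sa_intros sa_comp pos_sa[OF Z] commute_refl)
  have "(\<lambda>n. inner (sqrt_iter Z n x) y) \<longlonglongrightarrow> inner (Y x) y" by (intro tendsto_intros Y)
  moreover have "(\<lambda>n. inner x (sqrt_iter Z n y)) \<longlonglongrightarrow> inner x (Y y)" by (intro tendsto_intros Y)
  ultimately show "inner (Y x) y = inner x (Y y)" using saD[OF it] LIMSEQ_unique by fastforce
 qed
 have nY: "norm (Y x) \<le> norm x" for x
 proof -
  have "norm (sqrt_iter Z n x) \<le> norm x" for n
   using norm_blinfun[of "sqrt_iter Z n" x] sqrt_iter_bounds(1)[OF nZ, of n] sqrt_scal_bounds[of n]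
   by (meson mult_left_le_one_le norm_ge_zero order_trans)
  then show ?thesis using tendsto_norm[OF Yx[of x]] by (meson LIMSEQ_le_const2)
 qed
 \<comment> \<open>The fixed point equation Y = (Z + Y^2) / 2 gives (1 - Y)^2 = 1 - Z = A, and 1 - Y
   is positive because Y is a self-adjoint contraction.\<close>
 define R where "R = I - Y"
 have Rapp: "R x = x - Y x" for x by (simp add: R_def blin)
 show ?thesis
 proof (intro exI[of _ R] conjI allI impI)
  show "pos R" unfolding R_def by (rule sa_pos_iff_norm[OF Ysa nY])
  show "R (R x) = A x" for x by (simp add: Rapp blin YY Zapp scaleR_2)
  fix b assume b: "commute b A"
  have "commute b Z" unfolding Z_def by (intro commute_intros b)
  then have "commute b (sqrt_iter Z n)" for n by (induction n) (auto intro!: commute_intros)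
  then have it: "b (sqrt_iter Z n x) = sqrt_iter Z n (b x)" for n x by (simp add: commute_def)
  have "b (Y x) = Y (b x)" for x
  proof -
   have "(\<lambda>n. b (sqrt_iter Z n x)) \<longlonglongrightarrow> b (Y x)" by (intro tendsto_intros Y)
   then show ?thesis unfolding it using Yx LIMSEQ_unique by blast
  qed
  then show "commute b R" by (simp add: commute_def Rapp blin)
 qed
qed

lemma pos_sqrt:
 fixes A :: "'a::{real_inner,banach} op"
 assumes A: "pos A"
 shows "\<exists>R. pos R \<and> (\<forall>x. R (R x) = A x) \<and> (\<forall>b. commute b A \<longrightarrow> commute b R)"
proof -
 \<comment> \<open>The summand 1 keeps the scaling factor positive when A = 0.\<close>
 define c where "c = norm A + 1"
 have c: "c > 0" "norm A \<le> c" by (auto simp: c_def add_nonneg_pos)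
 have "pos ((1/c) *\<^sub>R A)" using A c unfolding pos_def by (auto intro!: sa_intros simp: blinfun.scaleR_left)
 moreover have "inner (((1/c) *\<^sub>R A) x) x \<le> (norm x)\<^sup>2" for x
 proof -
  have "inner (A x) x \<le> norm (A x) * norm x" by (rule norm_cauchy_schwarz)
  also have "\<dots> \<le> c * norm x * norm x" by (intro mult_right_mono order_trans[OF norm_blinfun] c) auto
  finally show ?thesis using c by (simp add: blinfun.scaleR_left field_simps power2_eq_square)
 qed
 ultimately obtain R where R: "pos R" "\<And>x. R (R x) = ((1/c) *\<^sub>R A) x" "\<And>b. commute b ((1/c) *\<^sub>R A) \<Longrightarrow> commute b R"
  using pos_sqrt_contr[of "(1/c) *\<^sub>R A"] by metis
 show ?thesis
 proof (intro exI[of _ "sqrt c *\<^sub>R R"] conjI allI impI)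
  show "pos (sqrt c *\<^sub>R R)" using R(1) c unfolding pos_def by (auto intro!: sa_intros simp: blinfun.scaleR_left)
  show "(sqrt c *\<^sub>R R) ((sqrt c *\<^sub>R R) x) = A x" for x using c by (simp add: blinfun.scaleR_left blinfun.scaleR_right R)
  show "commute b (sqrt c *\<^sub>R R)" if "commute b A" for b by (intro commute_scaleR R(3) that)
 qed
qed

definition psqrt :: "('a::{real_inner,banach} op) \<Rightarrow> 'a op"
 where "psqrt A = (SOME R. pos R \<and> (\<forall>x. R (R x) = A x) \<and> (\<forall>b. commute b A \<longrightarrow> commute b R))"

lemma psqrt:
 fixes A :: "'a::{real_inner,banach} op"
 assumes "pos A"
 shows psqrt_pos: "pos (psqrt A)" and psqrt_sq: "psqrt A (psqrt A x) = A x"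
  and psqrt_commute: "commute b A \<Longrightarrow> commute b (psqrt A)" using someI_ex[OF pos_sqrt[OF assms]] unfolding psqrt_def by blast+

text \<open>With r the square root of a, commutation turns the form of ab at x into the form of b at
  r x.\<close>

lemma pos_comp:
 fixes a b :: "'a::{real_inner,banach} op"
 assumes "pos a" "pos b" "commute a b"
 shows "pos (a o\<^sub>L b)" unfolding pos_def
proof (intro conjI allI sa_comp pos_sa assms)
 fix x
 let ?r = "psqrt a"
 have c: "b (?r y) = ?r (b y)" for y by (rule commuteD[OF psqrt_commute[OF assms(1) commute_sym[OF assms(3)]]])
 then have "inner ((a o\<^sub>L b) x) x = inner (b (?r x)) (?r x)"
  using saD[OF pos_sa[OF psqrt_pos[OF assms(1)]], of "?r (b x)" x] by (simp add: psqrt_sq[OF assms(1)])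
 then show "0 \<le> inner ((a o\<^sub>L b) x) x" using posD[OF assms(2)] by simp
qed

lemma pos_square: "sa a \<Longrightarrow> pos (a o\<^sub>L a)"
 unfolding pos_def by (metis blinfun_apply_blinfun_compose commute_refl inner_ge_zero saD sa_comp)

text \<open>D commutes with A and hence with its root R. For u = (D - R) x one gets (D + R) u = 0,
  so D u = R u = 0 by positivity, and then the square of norm u is the inner product of (D - R) u
  with x, which is 0.\<close>

lemma psqrt_unique:
 fixes D A :: "'a::{real_inner,banach} op"
 assumes D: "pos D" "\<And>x. D (D x) = A x" and A: "pos A"
 shows "D = psqrt A"
proof (rule blinfun_eqI)
 fix x
 let ?R = "psqrt A"
 have "commute D A" unfolding commute_def by (simp flip: D(2))
 then have c: "D (?R x) = ?R (D x)" for x using psqrt_commute[OF A] commuteD by blast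
 define u where "u = D x - ?R x"
 have "D u + ?R u = 0" by (simp add: u_def blin D psqrt_sq[OF A] c)
 then have "inner (D u) u + inner (?R u) u = 0" by (metis inner_add_left inner_zero_left)
 then have "D u = 0" "?R u = 0" using posD[OF D(1), of u] posD[OF psqrt_pos[OF A], of u]
  by (auto intro!: pos_form_zero D psqrt_pos A)
 then have "inner u (D x - ?R x) = 0"
  by (simp add: inner_diff_right saD[OF pos_sa[OF D(1)], symmetric] saD[OF pos_sa[OF psqrt_pos[OF A]], symmetric])
 then show "D x = ?R x" by (simp add: u_def)
qed

section \<open>Projections and spectral projections\<close>

definition isproj :: "('a::real_inner op) \<Rightarrow> bool"
 where "isproj p \<longleftrightarrow> sa p \<and> (\<forall>x. p (p x) = p x)"

lemma isproj_sa: "isproj p \<Longrightarrow> sa p" by (simp add: isproj_def)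
lemma isproj_idem: "isproj p \<Longrightarrow> p (p x) = p x" by (simp add: isproj_def)

lemma isproj_inner: "isproj p \<Longrightarrow> inner (p x) x = (norm (p x))\<^sup>2" by (metis isproj_def power2_norm_eq_inner sa_def)

lemma isproj_pos: "isproj p \<Longrightarrow> pos p" by (simp add: pos_def isproj_sa isproj_inner)

lemma isproj_compl: "isproj p \<Longrightarrow> isproj (I - p)" by (auto simp: isproj_def blin intro!: sa_intros)

lemma isproj_pythagoras: "isproj p \<Longrightarrow> (norm x)\<^sup>2 = (norm (p x))\<^sup>2 + (norm (x - p x))\<^sup>2"
 using isproj_inner[of p x] unfolding power2_norm_eq_inner by (simp add: inner_diff inner_commute)

lemma isproj_norm: "isproj p \<Longrightarrow> norm (p x) \<le> norm x"
 using isproj_pythagoras[of p x] by (metis le_add_same_cancel1 norm_ge_zero power2_le_imp_le zero_le_power2)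

lemma isproj_norm1: "isproj p \<Longrightarrow> norm p \<le> 1" by (intro norm_blinfun_bound) (auto simp: isproj_norm)

lemma isproj_proj: "closed S \<Longrightarrow> subspace S \<Longrightarrow> isproj (proj S)" by (simp add: isproj_def sa_def proj_sa proj_idem)

text \<open>Equal fixed spaces give pq = q and qp = p, so that (p - q)^2 = 0.\<close>

lemma isproj_eqI:
 fixes p q :: "'a::real_inner op"
 assumes "isproj p" "isproj q" "\<And>x. p x = x \<longleftrightarrow> q x = x"
 shows "p = q"
proof (rule blinfun_eqI)
 fix x
 have pq: "p (q y) = q y" "q (p y) = p y" for y using assms isproj_idem by metis+
 have "inner (p x - q x) (p x - q x) = inner x (p (p x) - q (p x) - p (q x) + q (q x))"
  unfolding inner_diff_left saD[OF isproj_sa[OF assms(1)]] saD[OF isproj_sa[OF assms(2)]]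
  by (simp add: inner_diff_right inner_add_right blin)
 also have "p (p x) - q (p x) - p (q x) + q (q x) = 0" by (simp add: pq isproj_idem assms)
 finally show "p x = q x" by simp
qed

lemma closed_kernel:
 fixes a :: "'a::real_normed_vector \<Rightarrow>\<^sub>L 'b::real_normed_vector"
 shows "closed {x. a x = 0}" "subspace {x. a x = 0}"
proof -
 have "closed ((\<lambda>x. blinfun_apply a x) -` {0})" by (intro closed_vimage continuous_intros closed_singleton)
 then show "closed {x. a x = 0}" by (simp add: vimage_def)
 show "subspace {x. a x = 0}" by (auto intro!: subspaceI simp: blin blinfun.scaleR_right)
qed

lemma commute_projI:
 fixes b :: "'a::{real_inner,banach} op"
 assumes S: "closed S" "subspace S"
  and b: "\<And>x. x \<in> S \<Longrightarrow> b x \<in> S" "\<And>x. x \<in> S \<Longrightarrow> radj b x \<in> S"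
 shows "commute b (proj S)" unfolding commute_def
proof
 fix x
 show "b (proj S x) = proj S (b x)"
 proof (rule sym, rule proj_eqI[OF S])
  show "b (proj S x) \<in> S" using b(1) proj_in[OF S] by blast
  fix y assume "y \<in> S"
  then have "inner (x - proj S x) (radj b y) = 0" using b(2) proj_orth[OF S] by blast
  then show "inner (b x - b (proj S x)) y = 0" by (simp add: radj[symmetric] blin)
 qed
qed

lemma commute_radj: "sa a \<Longrightarrow> commute b a \<Longrightarrow> commute (radj b) a"
proof -
 assume a: "sa a" "commute b a"
 have "radj b (a x) = a (radj b x)" for x
 proof (rule inner_eqI)
  fix y
  have "inner y (radj b (a x)) = inner (a (b y)) x" using a(1) by (simp add: radj[symmetric] saD)
  also have "\<dots> = inner (b (a y)) x" by (simp add: commuteD[OF a(2)])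
  finally show "inner y (radj b (a x)) = inner y (a (radj b x))" using saD[OF a(1), of y] by (simp add: radj)
 qed
 then show ?thesis by (simp add: commute_def)
qed

section \<open>Absolute value and spectral projection of the positive half-line\<close>

definition absop :: "('a::{real_inner,banach} op) \<Rightarrow> 'a op"
 where "absop A = psqrt (A o\<^sub>L A)"

text \<open>The spectral projection of A for the open half-line (0, \<infinity>): |A| + A is twice
  the positive part of A, and its kernel is the spectral subspace for (-\<infinity>, 0].\<close>

definition specproj :: "('a::{real_inner,banach} op) \<Rightarrow> 'a op"
 where "specproj A = I - proj {x. (absop A + A) x = 0}"

context
 fixes A :: "'a::{real_inner,banach} op"
 assumes A: "sa A"
begin

lemma absop_pos: "pos (absop A)" unfolding absop_def by (rule psqrt_pos[OF pos_square[OF A]])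
lemma absop_sq: "absop A (absop A x) = A (A x)" unfolding absop_def by (simp add: psqrt_sq[OF pos_square[OF A]])
lemma absop_commute: "commute b A \<Longrightarrow> commute b (absop A)" unfolding absop_def by (intro psqrt_commute pos_square A commute_intros)

lemma specproj_isproj: "isproj (specproj A)" unfolding specproj_def by (intro isproj_compl isproj_proj closed_kernel)

lemma specproj_commute:
 assumes b: "commute b A"
 shows "commute b (specproj A)" unfolding specproj_def
proof (intro commute_intros commute_projI closed_kernel)
 have "commute b (absop A + A)" "commute (radj b) (absop A + A)"
  using absop_commute[OF b] absop_commute[OF commute_radj[OF A b]] commute_radj[OF A b] b by (auto intro!: commute_intros)
 then show "b x \<in> {x. (absop A + A) x = 0}" "radj b x \<in> {x. (absop A + A) x = 0}"
  if "x \<in> {x. (absop A + A) x = 0}" for x using that by (auto simp: commute_def) (metis blinfun.zero_right)+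
qed

lemma specproj_off:
 assumes "specproj A x = 0" shows "A x = - absop A x"
proof -
 have "proj {x. (absop A + A) x = 0} x = x" using assms by (simp add: specproj_def blin)
 then have "(absop A + A) x = 0" unfolding proj_fix_iff[OF closed_kernel] by simp
 then show ?thesis by (simp add: blin eq_neg_iff_add_eq_0 add.commute)
qed

lemma specproj_on:
 assumes "specproj A x = x" shows "A x = absop A x"
proof -
 let ?R = "absop A"
 have "proj {x. (?R + A) x = 0} x = 0" using assms by (simp add: specproj_def blin)
 then have orth: "inner x y = 0" if "?R y + A y = 0" for y using that unfolding proj_0_iff[OF closed_kernel] by (simp add: blin)
 have c: "?R (A y) = A (?R y)" for y using absop_commute[OF commute_refl] by (simp add: commute_def)
 \<comment> \<open>(|A| + A)(|A| - A) = 0, so (|A| - A)^2 x lies in the kernel to which x is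
   orthogonal; hence (|A| - A) x = 0.\<close>
 have "inner x (?R (?R x - A x) - A (?R x - A x)) = 0" by (rule orth) (simp add: blin absop_sq c)
 then have "inner (?R x - A x) (?R x - A x) = 0"
  unfolding inner_diff_left[of "?R x"] saD[OF A] saD[OF pos_sa[OF absop_pos]] by (simp add: inner_diff_right)
 then show ?thesis by simp
qed

lemma specproj_inj:
 assumes "specproj A x = x" "A x = 0" shows "x = 0"
proof -
 have "(absop A + A) x = 0" using specproj_on[OF assms(1)] assms(2) by (simp add: blin)
 then have "proj {x. (absop A + A) x = 0} x = x" unfolding proj_fix_iff[OF closed_kernel] by simp
 then show ?thesis using assms(1) by (simp add: specproj_def blin)
qed

text \<open>Positivity is tested against a commuting positive C because the bounded substitutes for
  |x| - s are later paired with different weights: \<open>ct\<close> for quadratic forms,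
  \<open>st + s ct\<close> for norms.\<close>

lemma specproj_on_pos:
 assumes C: "pos C" "commute C A" and x: "specproj A x = x"
 shows "0 \<le> inner (A x) (C x)"
  and "(\<And>y. C y = 0 \<Longrightarrow> y = 0) \<Longrightarrow> inner (A x) (C x) = 0 \<Longrightarrow> x = 0"
proof -
 have p: "pos (C o\<^sub>L absop A)" by (intro pos_comp C absop_pos absop_commute)
 have eq: "inner (A x) (C x) = inner ((C o\<^sub>L absop A) x) x"
  using specproj_on[OF x] saD[OF pos_sa[OF C(1)], of "absop A x" x] by simp
 show "0 \<le> inner (A x) (C x)" unfolding eq by (rule posD[OF p])
 assume "\<And>y. C y = 0 \<Longrightarrow> y = 0" "inner (A x) (C x) = 0"
 then have "absop A x = 0" using pos_form_zero[OF p, of x] eq by simp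
 then show "x = 0" using specproj_inj[OF x] specproj_on[OF x] by simp
qed

lemma specproj_off_neg:
 assumes C: "pos C" "commute C A" and x: "specproj A x = 0"
 shows "inner (A x) (C x) \<le> 0"
proof -
 have p: "pos (C o\<^sub>L absop A)" by (intro pos_comp C absop_pos absop_commute)
 have eq: "inner (A x) (C x) = - inner ((C o\<^sub>L absop A) x) x"
  using specproj_off[OF x] saD[OF pos_sa[OF C(1)], of "absop A x" x] by simp
 show ?thesis unfolding eq using posD[OF p] by simp
qed

end

section \<open>Complex structure\<close>

lemma subspace_closure:
 fixes S :: "'a::real_normed_vector set"
 assumes "subspace S" shows "subspace (closure S)"
proof (rule subspaceI)
 show "0 \<in> closure S" using subspace_0[OF assms] closure_subset by blast
 show "x + y \<in> closure S" if "x \<in> closure S" "y \<in> closure S" for x y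
 proof -
  obtain s t where "\<And>n. s n \<in> S" "s \<longlonglongrightarrow> x" "\<And>n. t n \<in> S" "t \<longlonglongrightarrow> y"
   using \<open>x \<in> closure S\<close> \<open>y \<in> closure S\<close> unfolding closure_sequential by metis
  then show ?thesis unfolding closure_sequential
   using subspace_add[OF assms] by (intro exI[of _ "\<lambda>n. s n + t n"]) (auto intro: tendsto_add)
 qed
 show "c *\<^sub>R x \<in> closure S" if x: "x \<in> closure S" for c x
 proof -
  obtain s where "\<And>n. s n \<in> S" "s \<longlonglongrightarrow> x" using x unfolding closure_sequential by metis
  then show ?thesis unfolding closure_sequential
   using subspace_scale[OF assms] by (intro exI[of _ "\<lambda>n. c *\<^sub>R s n"]) (auto intro: tendsto_scaleR)
 qed
qed

lemma cinner_scaleC_right: "cinner x (c *\<^sub>C y) = cnj c * cinner x (y::'a::complex_hilbert)"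
 by (metis cinner_commute cinner_scaleC_left complex_cnj_mult)

lemma cinner_Complex: "cinner x (y::'a::complex_hilbert) = Complex (inner x y) (inner x (\<i> *\<^sub>C y))"
 using Re_cinner[of x "\<i> *\<^sub>C y"] Re_cinner[of x y] by (simp add: cinner_scaleC_right complex_eq_iff)

lemma cinner_self: "cinner x (x::'a::complex_hilbert) = complex_of_real ((norm x)\<^sup>2)"
proof -
 have "Im (cinner x x) = 0" using cinner_commute[of x x] by (metis Im_complex_of_real complex_In_mult_cnj_zero Reals_cnj_iff complex_is_Real_iff)
 then show ?thesis by (simp add: complex_eq_iff Re_cinner power2_norm_eq_inner)
qed

lemma norm_scaleC: "norm (c *\<^sub>C x) = cmod c * norm (x::'a::complex_hilbert)"
proof -
 have "complex_of_real ((norm (c *\<^sub>C x))\<^sup>2) = (c * cnj c) * complex_of_real ((norm x)\<^sup>2)"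
  unfolding cinner_self[symmetric] by (simp add: cinner_scaleC_left cinner_scaleC_right)
 also have "\<dots> = complex_of_real ((cmod c * norm x)\<^sup>2)"
  by (simp add: power_mult_distrib complex_norm_square[symmetric] flip: of_real_power)
 finally have "(norm (c *\<^sub>C x))\<^sup>2 = (cmod c * norm x)\<^sup>2" using of_real_eq_iff by blast
 then show ?thesis by (simp add: power2_eq_iff_nonneg)
qed

lemma bounded_linear_scaleC: "bounded_linear (\<lambda>x::'a::complex_hilbert. c *\<^sub>C x)"
proof (rule bounded_linear_intro[where K = "cmod c"])
 show "c *\<^sub>C (x + y) = c *\<^sub>C x + c *\<^sub>C y" for x y :: 'a by (rule scaleC_add_right)
 show "c *\<^sub>C (r *\<^sub>R x) = r *\<^sub>R c *\<^sub>C x" for r and x :: 'a by (simp add: scaleC_of_real[symmetric] scaleC_scaleC mult.commute)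
 show "norm (c *\<^sub>C x) \<le> norm x * cmod c" for x :: 'a by (simp add: norm_scaleC mult.commute)
qed

text \<open>Scalar multiplication as a real-linear operator. It turns complex linearity into a
  commutation relation (\<open>bounded_ops_iff\<close>), so the square roots and spectral
  projections above inherit it through their commutation properties.\<close>

definition sc :: "complex \<Rightarrow> 'a::complex_hilbert op" where "sc c = Blinfun (scaleC c)"

lemma sc_apply [simp]: "blinfun_apply (sc c) x = c *\<^sub>C x" by (simp add: sc_def bounded_linear_Blinfun_apply bounded_linear_scaleC)

lemma scaleC_zero [simp]: "c *\<^sub>C 0 = (0::'a::complex_hilbert)" by (metis sc_apply blinfun.zero_right)
lemma scaleC_minus: "c *\<^sub>C (- x) = - (c *\<^sub>C (x::'a::complex_hilbert))" using blinfun.minus_right[of "sc c"] by simp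
lemma scaleC_diff: "c *\<^sub>C (x - y) = c *\<^sub>C x - c *\<^sub>C (y::'a::complex_hilbert)" using blinfun.diff_right[of "sc c"] by simp

lemma scaleC_minus_left: "(- c) *\<^sub>C x = - (c *\<^sub>C (x::'a::complex_hilbert))"
 using scaleC_scaleC[of "complex_of_real (-1)" c x] unfolding scaleC_of_real by simp

lemma inner_scaleC: "inner (c *\<^sub>C x) y = inner x (cnj c *\<^sub>C (y::'a::complex_hilbert))"
 by (simp add: Re_cinner[symmetric] cinner_scaleC_left cinner_scaleC_right)

lemma scaleC_Complex: "c *\<^sub>C x = Re c *\<^sub>R x + Im c *\<^sub>R (\<i> *\<^sub>C (x::'a::complex_hilbert))"
proof -
 have "c *\<^sub>C x = (complex_of_real (Re c) + complex_of_real (Im c) * \<i>) *\<^sub>C x" by (metis complex_eq mult.commute)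
 then show ?thesis by (simp only: scaleC_add_left scaleC_scaleC[symmetric] scaleC_of_real)
qed

lemma bounded_ops_iff: "a \<in> bounded_ops \<longleftrightarrow> (\<forall>c. commute a (sc c))" by (auto simp: bounded_ops_def commute_def)

lemma bounded_opsD: "a \<in> bounded_ops \<Longrightarrow> a (c *\<^sub>C x) = c *\<^sub>C a x" by (simp add: bounded_ops_def)

lemma bounded_opsI:
 fixes a :: "'a::complex_hilbert op"
 assumes "\<And>x. a (\<i> *\<^sub>C x) = \<i> *\<^sub>C a x" shows "a \<in> bounded_ops"
proof -
 have "a (c *\<^sub>C x) = c *\<^sub>C a x" for c x by (subst (1 2) scaleC_Complex) (simp add: blin blinfun.scaleR_right assms)
 then show ?thesis by (simp add: bounded_ops_def)
qed

lemma radj_bounded_ops: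
 assumes "a \<in> bounded_ops" shows "radj a \<in> bounded_ops"
proof (rule bounded_opsI, rule inner_eqI)
 fix x y
 have "inner y (radj a (\<i> *\<^sub>C x)) = inner (a y) (\<i> *\<^sub>C x)" by (simp add: radj)
 also have "\<dots> = inner (a ((- \<i>) *\<^sub>C y)) x" using inner_scaleC[of "- \<i>" "a y" x] by (simp add: bounded_opsD[OF assms])
 also have "\<dots> = inner ((-\<i>) *\<^sub>C y) (radj a x)" by (simp add: radj)
 finally show "inner y (radj a (\<i> *\<^sub>C x)) = inner y (\<i> *\<^sub>C radj a x)" by (simp add: inner_scaleC)
qed

lemma adj_radj:
 assumes "a \<in> bounded_ops" shows "adj a = radj a" unfolding adj_def
proof (rule the_equality)
 show "\<forall>x y. cinner (a x) y = cinner x (radj a y)"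
  by (auto simp: cinner_Complex radj bounded_opsD[OF radj_bounded_ops[OF assms], symmetric])
 fix b :: "'a op" assume b: "\<forall>x y. cinner (a x) y = cinner x (b y)"
 show "b = radj a" by (rule blinfun_eqI, rule inner_eqI) (metis b Re_cinner radj)
qed

lemma sa_adj: "a \<in> bounded_ops \<Longrightarrow> sa a \<longleftrightarrow> adj a = a"
proof -
 assume a: "a \<in> bounded_ops"
 have "a = radj a" if "sa a" by (rule blinfun_eqI, rule inner_eqI) (metis that saD radj)
 then show ?thesis using a by (auto simp: adj_radj sa_def radj)
qed

lemma projection_op_iff: "projection_op p \<longleftrightarrow> p \<in> bounded_ops \<and> isproj p"
 unfolding projection_op_def isproj_def using sa_adj by (metis blinfun_apply_blinfun_compose blinfun_eqI)

lemma positive_op_iff: "positive_op a \<longleftrightarrow> a \<in> bounded_ops \<and> pos a"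
proof
 assume a: "positive_op a"
 then have ab: "a \<in> bounded_ops" and re: "\<And>x. cinner (a x) x \<in> \<real>\<^sub>\<ge>\<^sub>0" by (auto simp: positive_op_def)
 have nn: "0 \<le> inner (a x) x" and im: "inner (a x) (\<i> *\<^sub>C x) = 0" for x
  using re[of x] by (auto simp: cinner_Complex complex_nonneg_Reals_iff)
 have "inner (a x) y = inner x (a y)" for x y
 proof -
  \<comment> \<open>The form is real at every vector. At y + i x the mixed terms of its vanishing
    imaginary part are exactly the symmetry of a at x and y.\<close>
  have "inner (a (y + \<i> *\<^sub>C x)) (\<i> *\<^sub>C (y + \<i> *\<^sub>C x)) = 0" by (rule im)
  then have "inner (a y) (\<i> *\<^sub>C (\<i> *\<^sub>C x)) + inner (\<i> *\<^sub>C a x) (\<i> *\<^sub>C y) = 0" using im[of y] im[of "\<i> *\<^sub>C x"]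
   by (simp add: blin scaleC_add_right inner_add bounded_opsD[OF ab])
  moreover have "\<i> *\<^sub>C (\<i> *\<^sub>C x) = - x" using scaleC_of_real[of "-1" x] by (simp add: scaleC_scaleC)
  moreover have "inner (\<i> *\<^sub>C a x) (\<i> *\<^sub>C y) = inner (a x) y"
   using scaleC_of_real[of 1 y] by (simp add: inner_scaleC scaleC_scaleC)
  ultimately show ?thesis by (simp add: inner_commute)
 qed
 then show "a \<in> bounded_ops \<and> pos a" using ab nn by (auto simp: pos_def sa_def)
next
 assume a: "a \<in> bounded_ops \<and> pos a"
 then have sa: "sa a" and ab: "a \<in> bounded_ops" by (auto simp: pos_sa)
 have "inner (a x) (\<i> *\<^sub>C x) = 0" for x
 proof -
  have "inner (a x) (\<i> *\<^sub>C x) = inner x (\<i> *\<^sub>C a x)" using saD[OF sa, of x "\<i> *\<^sub>C x"] by (simp add: bounded_opsD[OF ab])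
  also have "\<dots> = inner (cnj \<i> *\<^sub>C x) (a x)" by (simp add: inner_scaleC)
  also have "\<dots> = - inner (a x) (\<i> *\<^sub>C x)" by (simp add: scaleC_minus_left inner_commute)
  finally show ?thesis by simp
 qed
 then show "positive_op a" using a posD[of a] by (auto simp: positive_op_def cinner_Complex complex_nonneg_Reals_iff)
qed

section \<open>Linear graphs and their adjoints\<close>

lemma linear_graph_subspace: "linear_graph x \<Longrightarrow> subspace x"
 unfolding linear_graph_def subspace_def by (auto simp: zero_prod_def simp flip: scaleC_of_real)

lemma linear_graph_unique: "linear_graph x \<Longrightarrow> (g, h) \<in> x \<Longrightarrow> (g, h') \<in> x \<Longrightarrow> h = h'"
 unfolding linear_graph_def by (meson single_valuedD)

lemma linear_graph_diff: "linear_graph x \<Longrightarrow> (g, h) \<in> x \<Longrightarrow> (g', h') \<in> x \<Longrightarrow> (g - g', h - h') \<in> x"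
 using subspace_diff[OF linear_graph_subspace, of x "(g,h)" "(g',h')"] by simp

lemma linear_graph_scaleC: "linear_graph x \<Longrightarrow> (g, h) \<in> x \<Longrightarrow> (c *\<^sub>C g, c *\<^sub>C h) \<in> x" unfolding linear_graph_def by blast

text \<open>The graph is closed under complex multiples, so the real identity at (g, h) and at its
  multiple by -i gives both parts of the complex one.\<close>

lemma adj_graph_iff:
 assumes "linear_graph x"
 shows "(g', h') \<in> adj_graph x \<longleftrightarrow> (\<forall>g h. (g, h) \<in> x \<longrightarrow> inner h g' = inner g h')"
proof
 assume "(g', h') \<in> adj_graph x"
 then show "\<forall>g h. (g, h) \<in> x \<longrightarrow> inner h g' = inner g h'" unfolding adj_graph_def by (auto simp flip: Re_cinner)
next
 assume a: "\<forall>g h. (g, h) \<in> x \<longrightarrow> inner h g' = inner g h'"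
 have "cinner h g' = cinner g h'" if "(g, h) \<in> x" for g h
 proof -
  have "inner (cnj \<i> *\<^sub>C h) g' = inner (cnj \<i> *\<^sub>C g) h'" using a linear_graph_scaleC[OF assms that] by blast
  then show ?thesis using a that by (simp add: cinner_Complex inner_scaleC)
 qed
 then show "(g', h') \<in> adj_graph x" unfolding adj_graph_def by auto
qed

section \<open>The bounded transform of a closed operator\<close>

text \<open>The operator (1 + T)^(-1), where T is the adjoint of x times x, in von Neumann's form:
  the orthogonal projection of (k, 0) onto the closed graph is a pair (g, x g) with k - g = T
  g.\<close>

definition bt :: "('a::complex_hilbert \<times> 'a) set \<Rightarrow> 'a op"
 where "bt x = Blinfun (\<lambda>k. fst (proj x (k, 0)))"

definition ct :: "('a::complex_hilbert \<times> 'a) set \<Rightarrow> 'a op" where "ct x = psqrt (bt x)"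
definition st :: "('a::complex_hilbert \<times> 'a) set \<Rightarrow> 'a op" where "st x = psqrt (I - bt x)"
definition dt :: "('a::complex_hilbert \<times> 'a) set \<Rightarrow> 'a op"
 where "dt x = Blinfun (\<lambda>h. THE d. (ct x h, d) \<in> x)"

text \<open>One notion for two uses: multiplication by i, which gives complex linearity of the
  transforms, and unitaries of the commutant, which put the transforms into the algebra.\<close>

definition preserves :: "('a::complex_hilbert op) \<Rightarrow> ('a \<times> 'a) set \<Rightarrow> bool"
 where "preserves u x \<longleftrightarrow> (\<forall>g h. inner (u g) (u h) = inner g h) \<and> (\<lambda>(g, h). (u g, u h)) ` x = x"

definition closed_op :: "('a::complex_hilbert \<times> 'a) set \<Rightarrow> bool"
 where "closed_op x \<longleftrightarrow> linear_graph x \<and> closed x \<and> densely_defined x"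

context
 fixes x :: "('a::complex_hilbert \<times> 'a) set"
 assumes x: "closed_op x"
begin

private lemma lin: "linear_graph x" and clo: "closed x" and sub: "subspace x"
 using x by (auto simp: closed_op_def linear_graph_subspace)

lemma dense_orth: "(\<And>g h. (g, h) \<in> x \<Longrightarrow> inner k g = 0) \<Longrightarrow> k = 0"
proof -
 assume a: "\<And>g h. (g, h) \<in> x \<Longrightarrow> inner k g = 0"
 have "closed {g. inner k g = 0}" by (intro closed_Collect_eq continuous_intros)
 then have "closure (Domain x) \<subseteq> {g. inner k g = 0}" by (intro closure_minimal) (use a in auto)
 moreover have "closure (Domain x) = UNIV" using x by (simp add: closed_op_def densely_defined_def)
 ultimately have "k \<in> {g. inner k g = 0}" by blast
 then show ?thesis by simp
qed

lemma bt_apply: "bt x k = fst (proj x (k, 0))"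
 unfolding bt_def by (subst bounded_linear_Blinfun_apply) (auto intro!: bounded_linear_intros bounded_linear_fst bounded_linear_Pair)

lemma bt_in: "\<exists>d. (bt x k, d) \<in> x \<and> (d, k - bt x k) \<in> adj_graph x \<and> (norm d)\<^sup>2 = inner (bt x k) (k - bt x k)"
proof -
 define d where "d = snd (proj x (k, 0))"
 have e: "proj x (k, 0) = (bt x k, d)" by (simp add: bt_apply d_def)
 have i: "(bt x k, d) \<in> x" using proj_in[OF clo sub, of "(k, 0)"] e by simp
 have o: "inner (k - bt x k) g - inner d h = 0" if "(g, h) \<in> x" for g h
  using proj_orth[OF clo sub that, of "(k, 0)"] by (simp add: e)
 then have "(d, k - bt x k) \<in> adj_graph x" by (subst adj_graph_iff[OF lin]) (auto simp: inner_commute algebra_simps)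
 moreover have "(norm d)\<^sup>2 = inner (bt x k) (k - bt x k)" using o[OF i] by (simp add: power2_norm_eq_inner inner_commute)
 ultimately show ?thesis using i by blast
qed

lemma bt_eqI:
 assumes "(g, d) \<in> x" "(d, k - g) \<in> adj_graph x"
 shows "bt x k = g"
proof -
 have "proj x (k, 0) = (g, d)"
 proof (rule proj_eqI[OF clo sub assms(1)])
  fix y assume "y \<in> x"
  then show "inner ((k, 0) - (g, d)) y = 0" using assms(2) by (cases y) (auto simp: adj_graph_iff[OF lin] inner_commute)
 qed
 then show ?thesis by (simp add: bt_apply)
qed

lemma bt_pos: "pos (bt x)" unfolding pos_def sa_def
proof (intro conjI allI)
 fix k l
 show "inner (bt x k) l = inner k (bt x l)"
  using proj_sa[OF clo sub, of "(k, 0)" "(l, 0)"] by (cases "proj x (k,0)"; cases "proj x (l,0)") (simp add: bt_apply)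
 obtain d :: 'a where "(norm d)\<^sup>2 = inner (bt x k) (k - bt x k)" using bt_in[of k] by blast
 then have "inner (bt x k) k = (norm d)\<^sup>2 + inner (bt x k) (bt x k)" by (simp add: inner_diff)
 then show "0 \<le> inner (bt x k) k" by simp
qed

lemma bt_compl_pos: "pos (I - bt x)" unfolding pos_def
proof (intro conjI allI sa_intros pos_sa[OF bt_pos])
 fix k
 obtain d :: 'a where d: "(norm d)\<^sup>2 = inner (bt x k) (k - bt x k)" using bt_in[of k] by blast
 have "inner (k - bt x k) k = (norm (k - bt x k))\<^sup>2 + inner (bt x k) (k - bt x k)"
  by (simp add: power2_norm_eq_inner inner_diff inner_commute)
 then show "0 \<le> inner ((I - bt x) k) k" by (simp add: blinfun.diff_left flip: d)
qed

lemma bt_inj: "bt x k = 0 \<Longrightarrow> k = 0"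
proof -
 assume k: "bt x k = 0"
 obtain d where "(0, d) \<in> x" "(d, k) \<in> adj_graph x" using bt_in[of k] k by auto
 moreover have "(0, 0) \<in> x" using lin by (simp add: linear_graph_def)
 ultimately have "(0, k) \<in> adj_graph x" using linear_graph_unique[OF lin] by blast
 then show "k = 0" by (intro dense_orth) (auto simp: adj_graph_iff[OF lin] inner_commute)
qed

lemma ct_pos: "pos (ct x)" unfolding ct_def by (rule psqrt_pos[OF bt_pos])
lemma st_pos: "pos (st x)" unfolding st_def by (rule psqrt_pos[OF bt_compl_pos])
lemma ct_sq: "ct x (ct x k) = bt x k" unfolding ct_def by (rule psqrt_sq[OF bt_pos])
lemma st_sq: "st x (st x k) = k - bt x k" unfolding st_def using psqrt_sq[OF bt_compl_pos] by (simp add: blin)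
lemma ct_commute: "commute b (bt x) \<Longrightarrow> commute b (ct x)" unfolding ct_def by (rule psqrt_commute[OF bt_pos])
lemma st_commute: "commute b (bt x) \<Longrightarrow> commute b (st x)" unfolding st_def by (intro psqrt_commute[OF bt_compl_pos] commute_intros)
lemma ct_st: "commute (ct x) (st x)" by (intro st_commute commute_sym[OF ct_commute] commute_refl)
lemma ct_inj: "ct x k = 0 \<Longrightarrow> k = 0" using bt_inj ct_sq by (metis blinfun.zero_right)

lemma ct_st_norm: "(norm (ct x k))\<^sup>2 + (norm (st x k))\<^sup>2 = (norm k)\<^sup>2"
 unfolding power2_norm_eq_inner saD[OF pos_sa[OF ct_pos]] saD[OF pos_sa[OF st_pos]] by (simp add: ct_sq st_sq inner_diff)

lemma sa_inj_dense:
 assumes "sa (a::'a op)" "\<And>y. a y = 0 \<Longrightarrow> y = 0"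
 shows "closure (range (blinfun_apply a)) = UNIV"
proof -
 let ?S = "closure (range (blinfun_apply a))"
 have "subspace (range (blinfun_apply a))"
  using linear_subspace_image[OF _ subspace_UNIV] blinfun.bounded_linear_right bounded_linear.linear by blast
 then have S: "closed ?S" "subspace ?S" by (auto intro: subspace_closure)
 have "h \<in> ?S" for h
 proof -
  have "inner (h - proj ?S h) (a y) = 0" for y by (rule proj_orth[OF S]) (use closure_subset[of "range (blinfun_apply a)"] in auto)
  then have "inner y (a (h - proj ?S h)) = inner y 0" for y using saD[OF assms(1)] by (metis inner_commute inner_zero_right)
  then have "a (h - proj ?S h) = 0" by (rule inner_eqI)
  then show ?thesis using assms(2) proj_in[OF S, of h] by (metis eq_iff_diff_eq_0)
 qed
 then show ?thesis by blast
qed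

lemma ct_dense: "closure (range (ct x)) = UNIV" by (rule sa_inj_dense[OF pos_sa[OF ct_pos] ct_inj])

text \<open>On the range of \<open>ct\<close> the value comes from \<open>bt_in\<close>, with norm
  given by \<open>st\<close>. The range is dense and the graph is closed, so the equality of norms
  extends the value to all of H.\<close>

lemma ct_ex: "\<exists>d. (ct x h, d) \<in> x \<and> norm d = norm (st x h)"
proof -
 have base: "\<exists>d. (ct x (ct x k), d) \<in> x \<and> norm d = norm (st x (ct x k))" for k
 proof -
  obtain d where d: "(bt x k, d) \<in> x" "(norm d)\<^sup>2 = inner (bt x k) (k - bt x k)" using bt_in[of k] by blast
  have "(norm (st x (ct x k)))\<^sup>2 = inner (st x (st x (ct x k))) (ct x k)"
   using saD[OF pos_sa[OF st_pos], of "st x (ct x k)" "ct x k"] by (simp add: power2_norm_eq_inner)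
  also have "\<dots> = inner (ct x (k - bt x k)) (ct x k)" by (simp add: st_sq blin ct_sq[symmetric])
  also have "\<dots> = (norm d)\<^sup>2" using saD[OF pos_sa[OF ct_pos], of "k - bt x k" "ct x k"] d(2) by (simp add: ct_sq inner_commute)
  finally have "norm d = norm (st x (ct x k))" by (simp add: power2_eq_iff_nonneg)
  then show ?thesis using d(1) by (auto simp: ct_sq)
 qed
 then obtain f where f: "\<And>k. (ct x (ct x k), f k) \<in> x" "\<And>k. norm (f k) = norm (st x (ct x k))" by metis
 have fd: "norm (f k - f l) = norm (st x (ct x k) - st x (ct x l))" for k l
 proof -
  have "(ct x (ct x (k - l)), f k - f l) \<in> x" using linear_graph_diff[OF lin f(1)[of k] f(1)[of l]] by (simp add: blin)
  then have "f k - f l = f (k - l)" using linear_graph_unique[OF lin _ f(1)] by blast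
  then show ?thesis using f(2)[of "k - l"] by (simp add: blin)
 qed
 obtain k where k: "(\<lambda>n. ct x (k n)) \<longlonglongrightarrow> h"
 proof -
  have "h \<in> closure (range (ct x))" using ct_dense by simp
  then obtain s where s: "\<And>n. s n \<in> range (ct x)" "s \<longlonglongrightarrow> h" unfolding closure_sequential by metis
  then have "\<forall>n. \<exists>l. s n = ct x l" by blast
  then obtain l where "\<And>n. s n = ct x (l n)" by metis
  then have "s = (\<lambda>n. ct x (l n))" by blast
  then show ?thesis using that s(2) by blast
 qed
 have s: "(\<lambda>n. st x (ct x (k n))) \<longlonglongrightarrow> st x h" by (intro tendsto_intros k)
 have "Cauchy (\<lambda>n. f (k n))" using LIMSEQ_imp_Cauchy[OF s] unfolding Cauchy_def dist_norm fd .
 then obtain d where d: "(\<lambda>n. f (k n)) \<longlonglongrightarrow> d" using Cauchy_convergent convergent_def by blast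
 have "(\<lambda>n. (ct x (ct x (k n)), f (k n))) \<longlonglongrightarrow> (ct x h, d)" by (intro tendsto_intros k d)
 from closed_sequentially[OF clo _ this] have "(ct x h, d) \<in> x" using f(1) by simp
 moreover have "norm d = norm (st x h)" using LIMSEQ_unique[OF tendsto_norm[OF d]] tendsto_norm[OF s] f(2) by simp
 ultimately show ?thesis by blast
qed

private lemma dt_fun: "(THE d. (ct x h, d) \<in> x) = d" if "(ct x h, d) \<in> x" for h d using that linear_graph_unique[OF lin] by blast

lemma dt_apply: "dt x h = (THE d. (ct x h, d) \<in> x)"
proof -
 let ?f = "\<lambda>h. THE d. (ct x h, d) \<in> x"
 have f: "(ct x h, ?f h) \<in> x" "norm (?f h) = norm (st x h)" for h using ct_ex[of h] dt_fun by auto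
 have "bounded_linear ?f"
 proof (rule bounded_linear_intro[where K = "norm (st x)"])
  show "?f (g + h) = ?f g + ?f h" for g h using subspace_add[OF sub f(1)[of g] f(1)[of h]] by (intro dt_fun) (simp add: blin)
  show "?f (r *\<^sub>R h) = r *\<^sub>R ?f h" for r h
   using subspace_scale[OF sub f(1)[of h], of r] by (intro dt_fun) (simp add: blinfun.scaleR_right)
  show "norm (?f h) \<le> norm h * norm (st x)" for h unfolding f(2) by (metis mult.commute norm_blinfun)
 qed
 then show ?thesis unfolding dt_def by (simp add: bounded_linear_Blinfun_apply)
qed

lemma dt_in: "(ct x h, dt x h) \<in> x" and dt_norm: "norm (dt x h) = norm (st x h)"
 using ct_ex[of h] dt_fun[of h] by (auto simp: dt_apply)

lemma dt_unique: "(ct x h, d) \<in> x \<Longrightarrow> d = dt x h" using dt_fun by (simp add: dt_apply)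

text \<open>h -> (ct h, dt h) is an isometry into the graph, and the required h is its adjoint
  applied to (g, d). The remainder lies in the graph and is orthogonal to the image; pairing it with
  the points of \<open>bt_in\<close> shows that its first component vanishes.\<close>

lemma graph_param:
 assumes "(g, d) \<in> x" obtains h where "g = ct x h" "d = dt x h"
proof -
 define h where "h = ct x g + radj (dt x) d"
 have iso: "inner (ct x k) (ct x l) + inner (dt x k) (dt x l) = inner k l" for k l
 proof -
  have n: "(norm (ct x m))\<^sup>2 + (norm (dt x m))\<^sup>2 = (norm m)\<^sup>2" for m by (simp add: dt_norm ct_st_norm)
  show ?thesis using n[of "k + l"] n[of k] n[of l] by (simp add: power2_norm_eq_inner blin inner_add inner_commute)
 qed
 have h: "inner (ct x k) g + inner (dt x k) d = inner k h" for k
  using saD[OF pos_sa[OF ct_pos], of k g] radj[of "dt x" k d] by (simp add: h_def inner_add_right)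
 define g' d' where "g' = g - ct x h" and "d' = d - dt x h"
 have o: "inner (ct x k) g' + inner (dt x k) d' = 0" for k using h[of k] iso[of k h] by (simp add: g'_def d'_def inner_diff)
 have i: "(g', d') \<in> x" unfolding g'_def d'_def by (rule linear_graph_diff[OF lin assms dt_in])
 have "inner k g' = 0" for k
 proof -
  obtain e where e: "(bt x k, e) \<in> x" "(e, k - bt x k) \<in> adj_graph x" using bt_in by blast
  have "e = dt x (ct x k)" using dt_unique e(1) by (simp add: ct_sq)
  then have "inner (bt x k) g' + inner e d' = 0" using o[of "ct x k"] by (simp add: ct_sq)
  moreover have "inner d' e = inner g' (k - bt x k)" using e(2) i adj_graph_iff[OF lin] by blast
  ultimately show ?thesis by (simp add: inner_diff inner_commute)
 qed
 then have "g' = 0" by (metis inner_eq_zero_iff)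
 moreover have "d' = 0" using linear_graph_unique[OF lin] i \<open>g' = 0\<close> lin by (metis linear_graph_def)
 ultimately show ?thesis using that by (simp add: g'_def d'_def)
qed

lemma preserves_bt:
 assumes u: "preserves u x" shows "commute u (bt x)" unfolding commute_def
proof
 fix k
 obtain d where d: "(bt x k, d) \<in> x" "(d, k - bt x k) \<in> adj_graph x" using bt_in by blast
 have "(u (bt x k), u d) \<in> x" using u d(1) unfolding preserves_def by force
 moreover have "(u d, u k - u (bt x k)) \<in> adj_graph x" unfolding adj_graph_iff[OF lin]
 proof (intro allI impI)
  fix g h assume "(g, h) \<in> x"
  then obtain g' h' where gh: "(g', h') \<in> x" "g = u g'" "h = u h'" using u unfolding preserves_def by force
  then show "inner h (u d) = inner g (u k - u (bt x k))"
   using d(2) u by (simp add: adj_graph_iff[OF lin] preserves_def flip: blinfun.diff_right)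
 qed
 ultimately show "u (bt x k) = bt x (u k)" using bt_eqI by metis
qed

lemma preserves_dt:
 assumes u: "preserves u x" shows "commute u (dt x)" unfolding commute_def
proof
 fix h
 have "(u (ct x h), u (dt x h)) \<in> x" using u dt_in[of h] unfolding preserves_def by force
 then show "u (dt x h) = dt x (u h)" using dt_unique commuteD[OF ct_commute[OF preserves_bt[OF u]]] by metis
qed

lemma preserves_ii: "preserves (sc \<i>) x"
proof -
 have "inner (\<i> *\<^sub>C g) (\<i> *\<^sub>C h) = inner g h" for g h :: 'a using scaleC_of_real[of 1 h] by (simp add: inner_scaleC scaleC_scaleC)
 moreover have "(\<lambda>(g, h). (\<i> *\<^sub>C g, \<i> *\<^sub>C h)) ` x = x"
 proof -
  have "(g, h) \<in> (\<lambda>(g, h). (\<i> *\<^sub>C g, \<i> *\<^sub>C h)) ` x" if "(g, h) \<in> x" for g h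
  proof (rule image_eqI[of _ _ "((-\<i>) *\<^sub>C g, (-\<i>) *\<^sub>C h)"])
   show "(g, h) = (case (- \<i> *\<^sub>C g, - \<i> *\<^sub>C h) of (g, h) \<Rightarrow> (\<i> *\<^sub>C g, \<i> *\<^sub>C h))"
    using scaleC_of_real[of 1 h] scaleC_of_real[of 1 g] by (simp add: scaleC_scaleC)
  qed (rule linear_graph_scaleC[OF lin that])
  then show ?thesis using linear_graph_scaleC[OF lin] by auto
 qed
 ultimately show ?thesis by (simp add: preserves_def)
qed

lemma bt_bounded: "bt x \<in> bounded_ops" and ct_bounded: "ct x \<in> bounded_ops"
 and st_bounded: "st x \<in> bounded_ops" and dt_bounded: "dt x \<in> bounded_ops"
 using preserves_bt[OF preserves_ii] ct_commute[OF preserves_bt[OF preserves_ii]]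
  st_commute[OF preserves_bt[OF preserves_ii]] preserves_dt[OF preserves_ii] by (auto intro!: bounded_opsI simp: commute_def)

lemma mod_sq_graph: "x O adj_graph x = {(bt x k, k - bt x k) | k. True}"
proof (rule set_eqI)
 fix p :: "'a \<times> 'a"
 obtain g h where p: "p = (g, h)" by (cases p)
 show "p \<in> x O adj_graph x \<longleftrightarrow> p \<in> {(bt x k, k - bt x k) | k. True}"
 proof
  assume "p \<in> x O adj_graph x"
  then obtain d where d: "(g, d) \<in> x" "(d, h) \<in> adj_graph x" using p by auto
  then have "bt x (g + h) = g" using bt_eqI[of g d "g + h"] by simp
  then show "p \<in> {(bt x k, k - bt x k) | k. True}" using p by (auto intro!: exI[of _ "g + h"])
 next
  assume "p \<in> {(bt x k, k - bt x k) | k. True}"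
  then show "p \<in> x O adj_graph x" using bt_in by blast
 qed
qed

end

section \<open>The modulus of a closed operator\<close>

text \<open>|x| as \<open>st\<close> times the inverse of \<open>ct\<close>, written as a graph so
  that its domain is the range of \<open>ct\<close>.\<close>

definition modulus :: "('a::complex_hilbert \<times> 'a) set \<Rightarrow> ('a \<times> 'a) set"
 where "modulus x = {(ct x h, st x h) | h. True}"

context
 fixes x :: "('a::complex_hilbert \<times> 'a) set"
 assumes x: "closed_op x"
begin

lemma modulus_iff: "(g, k) \<in> modulus x \<longleftrightarrow> (\<exists>h. g = ct x h \<and> k = st x h)" by (auto simp: modulus_def)

lemma modulus_linear: "linear_graph (modulus x)" unfolding linear_graph_def
proof (intro conjI allI impI)
 show "single_valued (modulus x)"
 proof (rule single_valuedI)
  fix g k l assume "(g, k) \<in> modulus x" "(g, l) \<in> modulus x"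
  then obtain h h' where h: "g = ct x h" "k = st x h" "g = ct x h'" "l = st x h'" unfolding modulus_iff by blast
  then have "ct x (h - h') = 0" by (simp add: blin)
  then have "h = h'" using ct_inj[OF x] by (metis right_minus_eq)
  then show "k = l" using h by simp
 qed
 show "(0, 0) \<in> modulus x" by (auto simp: modulus_iff intro!: exI[of _ 0] simp: blinfun.zero_right)
 show "(g + g', h + h') \<in> modulus x" if "(g, h) \<in> modulus x \<and> (g', h') \<in> modulus x" for g h g' h'
  using that by (auto simp: modulus_iff blinfun.add_right[symmetric])
 show "(c *\<^sub>C g, c *\<^sub>C h) \<in> modulus x" if "(g, h) \<in> modulus x" for c g h
  using that by (auto simp: modulus_iff bounded_opsD[OF ct_bounded[OF x], symmetric] bounded_opsD[OF st_bounded[OF x], symmetric])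
qed

lemma modulus_adj: "adj_graph (modulus x) = modulus x"
proof (rule set_eqI)
 fix p :: "'a \<times> 'a"
 obtain g k where p: "p = (g, k)" by (cases p)
 have c: "ct x (st x h) = st x (ct x h)" for h using commuteD[OF ct_st[OF x]] .
 have "(g, k) \<in> adj_graph (modulus x) \<longleftrightarrow> (\<forall>h. inner (st x h) g = inner (ct x h) k)"
  unfolding adj_graph_iff[OF modulus_linear] by (auto simp: modulus_iff)
 also have "\<dots> \<longleftrightarrow> st x g = ct x k" unfolding saD[OF pos_sa[OF ct_pos[OF x]]] saD[OF pos_sa[OF st_pos[OF x]]] by (metis inner_eqI)
 also have "\<dots> \<longleftrightarrow> (g, k) \<in> modulus x"
 proof
  assume e: "st x g = ct x k"
  \<comment> \<open>Since ct^2 + st^2 = 1, this vector solves ct h = g and st h = k as soon as st g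
    = ct k.\<close>
  let ?h = "ct x g + st x k"
  have "ct x ?h = g" by (simp add: blin c e[symmetric] ct_sq[OF x] st_sq[OF x])
  moreover have "st x ?h = k" by (simp add: blin c[symmetric] e ct_sq[OF x] st_sq[OF x])
  ultimately show "(g, k) \<in> modulus x" unfolding modulus_iff by metis
 qed (auto simp: modulus_iff c)
 finally show "p \<in> adj_graph (modulus x) \<longleftrightarrow> p \<in> modulus x" using p by simp
qed

lemma modulus_nonneg: "0 \<le> inner (st x h) (ct x h)"
 using posD[OF pos_comp[OF ct_pos[OF x] st_pos[OF x] ct_st[OF x]], of h] by (simp add: saD[OF pos_sa[OF ct_pos[OF x]]])

lemma modulus_psa: "positive_self_adjoint (modulus x)" unfolding positive_self_adjoint_def
proof (intro conjI modulus_linear modulus_adj ballI)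
 have "Domain (modulus x) = range (ct x)" by (auto simp: modulus_def)
 then show "densely_defined (modulus x)" unfolding densely_defined_def using ct_dense[OF x] by simp
 fix p assume p: "p \<in> modulus x"
 show "case p of (g, h) \<Rightarrow> cinner h g \<in> \<real>\<^sub>\<ge>\<^sub>0"
 proof (cases p)
  case (Pair g k)
  then obtain h where h: "g = ct x h" "k = st x h" using p by (auto simp: modulus_iff)
  have s: "inner (st x h) (ct x h) = inner (ct x h) (st x h)" by (rule inner_commute)
  have "(\<i> *\<^sub>C g, \<i> *\<^sub>C k) \<in> modulus x" using linear_graph_scaleC[OF modulus_linear] p Pair by blast
  then have "inner k (\<i> *\<^sub>C g) = inner g (\<i> *\<^sub>C k)" using p Pair modulus_adj adj_graph_iff[OF modulus_linear] by metis
  also have "\<dots> = - inner (\<i> *\<^sub>C g) k" by (simp add: inner_scaleC scaleC_minus_left)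
  finally have "inner k (\<i> *\<^sub>C g) = 0" by (simp add: inner_commute)
  then show ?thesis using Pair h modulus_nonneg by (simp add: cinner_Complex complex_nonneg_Reals_iff)
 qed
qed

lemma modulus_sq: "modulus x O modulus x = {(bt x k, k - bt x k) | k. True}"
proof (rule set_eqI)
 fix p :: "'a \<times> 'a"
 obtain g l where p: "p = (g, l)" by (cases p)
 have c: "ct x (st x h) = st x (ct x h)" for h using commuteD[OF ct_st[OF x]] .
 show "p \<in> modulus x O modulus x \<longleftrightarrow> p \<in> {(bt x k, k - bt x k) | k. True}"
 proof
  assume "p \<in> modulus x O modulus x"
  then obtain h h' where h: "g = ct x h" "st x h = ct x h'" "l = st x h'" using p by (auto simp: modulus_iff)
  define k where "k = ct x h + st x h'"
  have 1: "ct x k = h" by (simp add: k_def blin c h(2)[symmetric] ct_sq[OF x] st_sq[OF x])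
  have 2: "st x k = h'" by (simp add: k_def blin c[symmetric] h(2) ct_sq[OF x] st_sq[OF x])
  have "bt x k = g" using h(1) 1 ct_sq[OF x] by metis
  moreover have "k - bt x k = l" using h(3) 2 st_sq[OF x] by metis
  ultimately show "p \<in> {(bt x k, k - bt x k) | k. True}" using p by blast
 next
  assume "p \<in> {(bt x k, k - bt x k) | k. True}"
  then obtain k where "p = (ct x (ct x k), st x (st x k))" by (auto simp: ct_sq[OF x] st_sq[OF x])
  then show "p \<in> modulus x O modulus x" using c by (auto simp: modulus_iff relcomp_unfold)
 qed
qed

text \<open>Discharges the description in \<open>abs_graph\<close>. For a competitor y the operator
  Y = y (1 + y^2)^(-1) is bounded and positive with Y^2 = bt (1 - bt), so Y = st ct by uniqueness of
  bounded square roots. Density of the range of \<open>ct\<close> puts the modulus inside y, and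
  taking adjoints of two self-adjoint operators reverses the inclusion.\<close>

lemma modulus_unique:
 assumes y: "positive_self_adjoint y" and yy: "y O y = {(bt x k, k - bt x k) | k. True}"
 shows "y = modulus x"
proof -
 have lin: "linear_graph y" and adj: "adj_graph y = y" using y by (auto simp: positive_self_adjoint_def)
 have sym: "inner h g' = inner g h'" if "(g, h) \<in> y" "(g', h') \<in> y" for g h g' h' using that adj adj_graph_iff[OF lin] by blast
 have nn: "0 \<le> inner h g" if "(g, h) \<in> y" for g h
 proof -
  have "cinner h g \<in> \<real>\<^sub>\<ge>\<^sub>0" using y that by (auto simp: positive_self_adjoint_def)
  then show ?thesis by (simp add: complex_nonneg_Reals_iff Re_cinner)
 qed
 have bteq: "bt x w = u" if "(u, m) \<in> y" "(m, w - u) \<in> y" for u m w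
 proof -
  have "(u, w - u) \<in> y O y" using that by blast
  then obtain k where "u = bt x k" "w - u = k - bt x k" unfolding yy by blast
  then show ?thesis by simp
 qed
 have "\<exists>m. (bt x k, m) \<in> y \<and> (m, k - bt x k) \<in> y" for k
 proof -
  have "(bt x k, k - bt x k) \<in> y O y" unfolding yy by blast
  then show ?thesis by blast
 qed
 then obtain Y where Y: "\<And>k. (bt x k, Y k) \<in> y" "\<And>k. (Y k, k - bt x k) \<in> y" by metis
 have Yu: "(bt x k, m) \<in> y \<Longrightarrow> m = Y k" for k m using linear_graph_unique[OF lin] Y(1) by blast
 have bl: "bounded_linear Y"
 proof (rule bounded_linear_intro[where K = "norm (st x o\<^sub>L ct x)"])
  show "Y (k + l) = Y k + Y l" for k l using subspace_add[OF linear_graph_subspace[OF lin] Y(1)[of k] Y(1)[of l]]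
   by (intro Yu[symmetric]) (simp add: blin)
  show "Y (r *\<^sub>R k) = r *\<^sub>R Y k" for r k using subspace_scale[OF linear_graph_subspace[OF lin] Y(1)[of k], of r]
   by (intro Yu[symmetric]) (simp add: blinfun.scaleR_right)
  fix k
  have "(norm (Y k))\<^sup>2 = inner (bt x k) (k - bt x k)" using sym[OF Y(1)[of k] Y(2)[of k]] by (simp add: power2_norm_eq_inner)
  also have "\<dots> = inner (bt x k) (st x (st x k))" by (simp add: st_sq[OF x])
  also have "\<dots> = inner (ct x (st x k)) (ct x (st x k))" using saD[OF pos_sa[OF ct_pos[OF x]], of "ct x k" "st x (st x k)"]
    saD[OF pos_sa[OF st_pos[OF x]], of "ct x k" "ct x (st x k)"] by (simp add: ct_sq[OF x] commuteD[OF ct_st[OF x]])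
  finally have "norm (Y k) = norm ((st x o\<^sub>L ct x) k)"
   by (simp add: power2_norm_eq_inner[symmetric] power2_eq_iff_nonneg commuteD[OF ct_st[OF x]])
  then show "norm (Y k) \<le> norm k * norm (st x o\<^sub>L ct x)" by (metis mult.commute norm_blinfun)
 qed
 define D where "D = Blinfun Y"
 have D: "D k = Y k" for k by (simp add: D_def bounded_linear_Blinfun_apply[OF bl])
 have posD: "pos D" unfolding pos_def sa_def
 proof (intro conjI allI)
  fix k l
  have "inner (Y k) (bt x l) = inner (bt x k) (Y l)" by (rule sym[OF Y(1) Y(1)])
  moreover have "inner (k - bt x k) (Y l) = inner (Y k) (l - bt x l)" by (rule sym[OF Y(2) Y(2)])
  ultimately show "inner (D k) l = inner k (D l)" by (simp add: D inner_diff)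
  have "0 \<le> inner (Y k) (bt x k)" "0 \<le> inner (k - bt x k) (Y k)" using nn Y by blast+
  then show "0 \<le> inner (D k) k" by (simp add: D inner_diff inner_commute)
 qed
 have comm: "bt x (Y k) = Y (bt x k)" for k by (rule bteq[OF Y(2)]) (rule linear_graph_diff[OF lin Y(1) Y(1)])
 have DD: "D (D k) = (bt x o\<^sub>L (I - bt x)) k" for k
 proof -
  have "(Y (bt x k), Y (Y k)) \<in> y" using Y(1)[of "Y k"] by (simp add: comm)
  then have "Y (Y k) = bt x k - bt x (bt x k)" using linear_graph_unique[OF lin _ Y(2)] by blast
  then show ?thesis by (simp add: D blin)
 qed
 have pA: "pos (bt x o\<^sub>L (I - bt x))" by (intro pos_comp bt_pos bt_compl_pos x commute_intros)
 have "D = psqrt (bt x o\<^sub>L (I - bt x))" by (rule psqrt_unique[OF posD DD pA])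
 moreover have "st x o\<^sub>L ct x = psqrt (bt x o\<^sub>L (I - bt x))"
 proof (rule psqrt_unique[OF _ _ pA])
  show "pos (st x o\<^sub>L ct x)" by (intro pos_comp st_pos ct_pos x commute_sym[OF ct_st])
  show "(st x o\<^sub>L ct x) ((st x o\<^sub>L ct x) k) = (bt x o\<^sub>L (I - bt x)) k" for k
   by (simp add: commuteD[OF ct_st[OF x]] st_sq[OF x] ct_sq[OF x] blin)
 qed
 ultimately have DS: "Y k = st x (ct x k)" for k by (metis D blinfun_apply_blinfun_compose)
 have sub: "modulus x \<subseteq> y"
 proof
  fix p assume "p \<in> modulus x"
  then obtain h where p: "p = (ct x h, st x h)" by (auto simp: modulus_def)
  have "inner h' (ct x h) = inner g (st x h)" if gh: "(g, h') \<in> y" for g h'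
  proof -
   have "closed {h. inner h' (ct x h) = inner g (st x h)}" by (intro closed_Collect_eq continuous_intros)
   moreover have "range (ct x) \<subseteq> {h. inner h' (ct x h) = inner g (st x h)}" using sym[OF gh Y(1)] by (auto simp: DS ct_sq[OF x])
   ultimately have "closure (range (ct x)) \<subseteq> {h. inner h' (ct x h) = inner g (st x h)}" by (rule closure_minimal[rotated])
   then show ?thesis using ct_dense[OF x] by blast
  qed
  then have "(ct x h, st x h) \<in> adj_graph y" unfolding adj_graph_iff[OF lin] by blast
  then show "p \<in> y" using p adj by simp
 qed
 moreover have "y \<subseteq> modulus x"
 proof -
  have "adj_graph y \<subseteq> adj_graph (modulus x)" using sub unfolding adj_graph_def by blast
  then show ?thesis using adj modulus_adj by simp
 qed
 ultimately show ?thesis by blast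
qed

lemma abs_graph_modulus: "abs_graph x = modulus x" unfolding abs_graph_def mod_sq_graph[OF x]
 by (rule the_equality, rule conjI[OF modulus_psa modulus_sq], erule conjE, rule modulus_unique)

end

section \<open>Monotone sequences of projections\<close>

lemma isproj_le_norm:
 assumes "isproj p" "isproj q" "\<And>h. q (p h) = p h"
 shows "p (q h) = p h"
proof (rule inner_eqI)
 fix y
 have "inner y (p (q h)) = inner (q (p y)) h"
  using saD[OF isproj_sa[OF assms(1)], of y "q h"] saD[OF isproj_sa[OF assms(2)], of "p y" h] by simp
 then show "inner y (p (q h)) = inner y (p h)" using saD[OF isproj_sa[OF assms(1)], of y h] by (simp add: assms(3))
qed

text \<open>Pythagoras makes the squared norms increase; being bounded they are Cauchy, and their
  differences are the squared norms of the increments.\<close>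

lemma orthogonal_increments_convergent:
 fixes g :: "nat \<Rightarrow> 'a::{real_inner,banach}"
 assumes norms: "\<And>n m. n \<le> m \<Longrightarrow> (norm (g m))\<^sup>2 = (norm (g n))\<^sup>2 + (norm (g m - g n))\<^sup>2" and bound: "\<And>n. (norm (g n))\<^sup>2 \<le> B"
 shows "convergent g"
proof -
 have "incseq (\<lambda>n. (norm (g n))\<^sup>2)" unfolding incseq_def using norms by (metis le_add_same_cancel1 zero_le_power2)
 then have C: "Cauchy (\<lambda>n. (norm (g n))\<^sup>2)" using incseq_convergent bound by (metis LIMSEQ_imp_Cauchy)
 have "Cauchy g"
 proof (rule CauchyI)
  fix e :: real assume e: "0 < e"
  then obtain M where M: "\<And>m n. m \<ge> M \<Longrightarrow> n \<ge> M \<Longrightarrow> norm ((norm (g m))\<^sup>2 - (norm (g n))\<^sup>2) < e\<^sup>2"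
   using CauchyD[OF C, of "e\<^sup>2"] by auto
  have "norm (g m - g n) < e" if "m \<ge> M" "n \<ge> M" for m n
  proof -
   have "(norm (g m - g n))\<^sup>2 < e\<^sup>2" using M[OF that] M[OF that(2,1)] norms[of n m] norms[of m n]
    by (cases "n \<le> m") (auto simp: norm_minus_commute)
   then show ?thesis using e by (simp add: power_less_imp_less_base)
  qed
  then show "\<exists>M. \<forall>m\<ge>M. \<forall>n\<ge>M. norm (g m - g n) < e" by blast
 qed
 then show ?thesis by (rule Cauchy_convergent)
qed

lemma isproj_increasing_limit:
 fixes p :: "nat \<Rightarrow> 'a::{real_inner,banach} op"
 assumes p: "\<And>n. isproj (p n)" and inc: "\<And>n h. p (Suc n) (p n h) = p n h"
 obtains P where "isproj P" "\<And>h. (\<lambda>n. p n h) \<longlonglongrightarrow> P h" "\<And>n h. P (p n h) = p n h"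
proof -
 have le: "p m (p n h) = p n h" if "n \<le> m" for m n h
  using that by (induction m rule: dec_induct) (auto simp: isproj_idem[OF p], metis inc)
 have le2: "p n (p m h) = p n h" if "n \<le> m" for m n h by (rule isproj_le_norm[OF p p le[OF that]])
 have diff: "(norm (p m h - p n h))\<^sup>2 = (norm (p m h))\<^sup>2 - (norm (p n h))\<^sup>2" if "n \<le> m" for m n h
  using isproj_pythagoras[OF p, of "p m h" n] le2[OF that] by simp
 have "convergent (\<lambda>n. p n h)" for h
  by (rule orthogonal_increments_convergent[where B = "(norm h)\<^sup>2"]) (auto simp: diff intro!: power_mono isproj_norm p)
 then have "\<exists>l. (\<lambda>n. p n h) \<longlonglongrightarrow> l" for h by (simp add: convergent_def)
 then obtain L where L: "\<And>h. (\<lambda>n. p n h) \<longlonglongrightarrow> L h" by metis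
 have bl: "bounded_linear L"
 proof (rule bounded_linear_intro[where K = 1])
  show "L (x + y) = L x + L y" for x y using tendsto_add[OF L L, of x y] L[of "x + y"] LIMSEQ_unique by (simp add: blin) blast
  show "L (r *\<^sub>R x) = r *\<^sub>R L x" for r x
   using tendsto_scaleR[OF tendsto_const L, of r x] L[of "r *\<^sub>R x"] LIMSEQ_unique by (simp add: blinfun.scaleR_right) blast
  show "norm (L x) \<le> norm x * 1" for x using LIMSEQ_le_const2[OF tendsto_norm[OF L[of x]]] isproj_norm[OF p] by simp
 qed
 define P where "P = Blinfun L"
 have P: "P h = L h" for h by (simp add: P_def bounded_linear_Blinfun_apply[OF bl])
 have Pp: "P (p n h) = p n h" for n h
 proof -
  have "(\<lambda>m. p m (p n h)) \<longlonglongrightarrow> p n h" by (rule tendsto_eventually) (auto intro!: eventually_sequentiallyI[of n] le)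
  then show ?thesis using L[of "p n h"] LIMSEQ_unique by (simp add: P) blast
 qed
 have "isproj P" unfolding isproj_def sa_def
 proof (intro conjI allI)
  fix x y
  have "(\<lambda>n. inner (p n x) y) \<longlonglongrightarrow> inner (L x) y" "(\<lambda>n. inner x (p n y)) \<longlonglongrightarrow> inner x (L y)" by (intro tendsto_intros L)+
  then show "inner (P x) y = inner x (P y)" using LIMSEQ_unique by (simp add: P saD[OF isproj_sa[OF p]]) blast
  have "(\<lambda>n. P (p n x)) \<longlonglongrightarrow> P (L x)" by (intro tendsto_intros L)
  then show "P (P x) = P x" unfolding Pp using L[of x] LIMSEQ_unique unfolding P by blast
 qed
 then show ?thesis using that L Pp by (simp add: P)
qed

section \<open>From a resolution of the identity to a projection-valued measure\<close>

lemma isproj_eq_norm: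
 fixes p q :: "'a::{real_inner,banach} op"
 assumes "isproj p" "isproj q" "\<And>h. (norm (p h))\<^sup>2 = (norm (q h))\<^sup>2"
 shows "p = q"
proof -
 have "r x = x \<longleftrightarrow> (norm (r x))\<^sup>2 = (norm x)\<^sup>2" if "isproj r" for r :: "'a op" and x using isproj_pythagoras[OF that, of x] by auto
 then show ?thesis using assms by (intro isproj_eqI) auto
qed

lemma isproj_comp: "isproj p \<Longrightarrow> isproj q \<Longrightarrow> commute p q \<Longrightarrow> isproj (p o\<^sub>L q)" by (auto simp: isproj_def commute_def intro!: sa_comp)

lemma isproj_id: "isproj I" by (simp add: isproj_def sa_id)
lemma isproj_zero: "isproj 0" by (simp add: isproj_def sa_zero)

lemma finite_borel_eqI:
 fixes M N :: "real measure"
 assumes "sets M = sets borel" "sets N = sets borel"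
  and "\<And>s. emeasure M {s<..} = emeasure N {s<..}" "\<And>s. emeasure M {s<..} \<noteq> \<infinity>"
 shows "M = N"
proof (rule measure_eqI_generator_eq[where E = "range greaterThan" and \<Omega> = UNIV and A = "\<lambda>n. {- real n <..}"])
 have "{a<..} \<inter> {b<..} = {max a b<..}" for a b :: real by auto
 then show "Int_stable (range greaterThan :: real set set)" by (auto simp: Int_stable_def)
 have "sets (borel :: real measure) = sigma_sets UNIV (range greaterThan)" by (simp add: borel_Ioi)
 then show "sets M = sigma_sets UNIV (range greaterThan)" "sets N = sigma_sets UNIV (range greaterThan)" using assms by auto
 show "(\<Union>i. {- real i<..}) = UNIV"
 proof -
  have "\<exists>n. - real n < x" for x using reals_Archimedean2[of "- x"] by (auto simp: minus_less_iff)
  then show ?thesis by blast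
 qed
qed (use assms in auto)

text \<open>E s stands for the spectral projection of (s, \<infinity>). This explains right
  continuity, decay at \<infinity>, and the value I for s < 0, which says that the spectrum is
  nonnegative.\<close>

definition resolution :: "(real \<Rightarrow> 'a::{real_inner,banach} op) \<Rightarrow> bool"
 where "resolution E \<longleftrightarrow> (\<forall>s. isproj (E s)) \<and> (\<forall>s t h. E s (E t h) = E (max s t) h) \<and>
  (\<forall>s<0. E s = I) \<and> (\<forall>s h. (\<lambda>n. E (s + 1 / real (Suc n)) h) \<longlonglongrightarrow> E s h) \<and>
  (\<forall>h. ((\<lambda>s. E s h) \<longlongrightarrow> 0) at_top)"

text \<open>The spectral measure of the vector h: its distribution function is the form of 1 - E s
  at h.\<close>

definition mu :: "(real \<Rightarrow> 'a::{real_inner,banach} op) \<Rightarrow> 'a \<Rightarrow> real measure"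
 where "mu E h = interval_measure (\<lambda>s. (norm h)\<^sup>2 - (norm (E s h))\<^sup>2)"

lemma sets_mu [simp, measurable_cong]: "sets (mu E h) = sets borel"
 and space_mu [simp]: "space (mu E h) = UNIV" by (simp_all add: mu_def)

context
 fixes E :: "real \<Rightarrow> 'a::{real_inner,banach} op"
 assumes E: "resolution E"
begin

lemma res_isproj: "isproj (E s)" and res_max: "E s (E t h) = E (max s t) h"
 and res_neg: "s < 0 \<Longrightarrow> E s = I"
 and res_right: "(\<lambda>n. E (s + 1 / real (Suc n)) h) \<longlonglongrightarrow> E s h"
 and res_top: "((\<lambda>s. E s h) \<longlongrightarrow> 0) at_top" using E by (auto simp: resolution_def)

lemma res_commute: "commute (E s) (E t)" by (simp add: commute_def res_max max.commute)

lemma res_mono: "s \<le> t \<Longrightarrow> norm (E t h) \<le> norm (E s h)"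
 using isproj_norm[OF res_isproj, of t "E s h"] by (simp add: res_max max_absorb1)

private abbreviation "F h \<equiv> (\<lambda>s. (norm h)\<^sup>2 - (norm (E s h))\<^sup>2)"

private lemma F_mono: "s \<le> t \<Longrightarrow> F h s \<le> F h t" using power_mono[OF res_mono[of s t h], of 2] by simp

private lemma F_right: "continuous (at_right a) (F h)" unfolding continuous_within
proof (rule order_tendstoI)
 fix l assume "l < F h a"
 then show "\<forall>\<^sub>F x in at_right a. l < F h x"
  by (intro eventually_at_right_less[THEN eventually_mono]) (auto intro: less_le_trans F_mono less_imp_le)
next
 fix u assume u: "F h a < u"
 have "(\<lambda>n. F h (a + 1 / real (Suc n))) \<longlonglongrightarrow> F h a" by (intro tendsto_intros res_right)
 then have "eventually (\<lambda>n. F h (a + 1 / real (Suc n)) < u) sequentially" using order_tendstoD(2) u by fastforce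
 then obtain n where n: "F h (a + 1 / real (Suc n)) < u" unfolding eventually_sequentially by blast
 show "\<forall>\<^sub>F x in at_right a. F h x < u" unfolding eventually_at_right_field
 proof (intro exI[of _ "a + 1 / real (Suc n)"] conjI allI impI)
  fix y assume "a < y" "y < a + 1 / real (Suc n)"
  then have "F h y \<le> F h (a + 1 / real (Suc n))" by (intro F_mono) simp
  then show "F h y < u" using n by linarith
 qed simp
qed

lemma mu_Ioc: "s \<le> t \<Longrightarrow> emeasure (mu E h) {s<..t} = ennreal ((norm (E s h))\<^sup>2 - (norm (E t h))\<^sup>2)"
 unfolding mu_def by (subst emeasure_interval_measure_Ioc[OF _ F_mono F_right]) auto

lemma mu_Ioi: "emeasure (mu E h) {s<..} = ennreal ((norm (E s h))\<^sup>2)"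
proof -
 have U: "(\<Union>n. {s<..s + real n}) = {s<..}"
 proof -
  have "\<exists>n. x \<le> s + real n" for x using real_arch_simple[of "x - s"] by (auto simp: algebra_simps)
  then show ?thesis by auto
 qed
 have "(\<lambda>n. emeasure (mu E h) {s<..s + real n}) \<longlonglongrightarrow> emeasure (mu E h) (\<Union>n. {s<..s + real n})"
  by (rule Lim_emeasure_incseq) (auto simp: incseq_def)
 moreover have "(\<lambda>n. emeasure (mu E h) {s<..s + real n}) \<longlonglongrightarrow> ennreal ((norm (E s h))\<^sup>2 - (norm (0::'a))\<^sup>2)"
 proof -
  have "filterlim (\<lambda>n. s + real n) at_top sequentially"
   by (intro filterlim_tendsto_add_at_top[OF tendsto_const] filterlim_real_sequentially)
  then have "(\<lambda>n. E (s + real n) h) \<longlonglongrightarrow> 0" using filterlim_compose[OF res_top] by blast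
  then show ?thesis unfolding mu_Ioc[of s "s + real _", simplified] by (intro tendsto_intros)
 qed
 ultimately show ?thesis using LIMSEQ_unique unfolding U by force
qed

lemma mu_UNIV: "emeasure (mu E h) UNIV = ennreal ((norm h)\<^sup>2)"
proof -
 have U: "(\<Union>n. {- real (Suc n)<..}) = UNIV"
 proof -
  have "\<exists>n. - real (Suc n) < x" for x
  proof -
   obtain n where "- x < real n" using reals_Archimedean2 by blast
   then have "- real (Suc n) < x" by simp
   then show ?thesis ..
  qed
  then show ?thesis by blast
 qed
 have "(\<lambda>n. emeasure (mu E h) {- real (Suc n)<..}) \<longlonglongrightarrow> emeasure (mu E h) (\<Union>n. {- real (Suc n)<..})"
  by (rule Lim_emeasure_incseq) (auto simp: incseq_def)
 moreover have "emeasure (mu E h) {- real (Suc n)<..} = ennreal ((norm h)\<^sup>2)" for n unfolding mu_Ioi by (subst res_neg) auto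
 ultimately have "(\<lambda>n::nat. ennreal ((norm h)\<^sup>2)) \<longlonglongrightarrow> emeasure (mu E h) UNIV" unfolding U by simp
 from LIMSEQ_unique[OF tendsto_const this] show ?thesis by simp
qed

lemma mu_finite: "finite_measure (mu E h)" by (rule finite_measureI) (simp add: mu_UNIV)

lemma mu_measure_Ioc: "s \<le> t \<Longrightarrow> measure (mu E h) {s<..t} = (norm (E s h))\<^sup>2 - (norm (E t h))\<^sup>2"
 unfolding measure_def by (subst mu_Ioc) (auto simp: power_mono res_mono)

lemma mu_nonneg: "AE t in mu E h. 0 \<le> t"
proof -
 interpret finite_measure "mu E h" by (rule mu_finite)
 have "AE t in mu E h. - 1 / real (Suc n) < t" for n
 proof (rule AE_I)
  have "emeasure (mu E h) (space (mu E h) - {- 1 / real (Suc n)<..}) = emeasure (mu E h) (space (mu E h)) - emeasure (mu E h) {- 1 / real (Suc n)<..}"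
   by (rule emeasure_compl) auto
  also have "\<dots> = 0" unfolding mu_Ioi by (subst res_neg) (auto simp: mu_UNIV)
  finally show "emeasure (mu E h) (- {- 1 / real (Suc n)<..}) = 0" by (simp add: Compl_eq_Diff_UNIV)
 qed auto
 then have "AE t in mu E h. \<forall>n. - 1 / real (Suc n) < t" unfolding AE_all_countable by blast
 then show ?thesis
 proof eventually_elim
  case (elim t)
  show ?case
  proof (rule ccontr)
   assume "\<not> 0 \<le> t"
   then obtain n where "inverse (real (Suc n)) < - t" using reals_Archimedean[of "-t"] by auto
   moreover have "- 1 / real (Suc n) < t" using elim by blast
   ultimately show False by (simp add: field_simps)
  qed
 qed
qed

text \<open>P is the value of the projection-valued measure at B. The norm is prescribed for E s P
  rather than for P alone, so that the measure of P h is the restriction to B of the measure of h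
  (\<open>good_mu\<close>); the commutation clause makes any two such projections commute. With
  both, the property passes to complements, intersections and increasing unions.\<close>

definition good :: "real set \<Rightarrow> 'a op \<Rightarrow> bool"
 where "good B P \<longleftrightarrow> isproj P \<and> (\<forall>b. (\<forall>s. commute b (E s)) \<longrightarrow> commute b P) \<and>
  (\<forall>h s. ennreal ((norm (E s (P h)))\<^sup>2) = emeasure (mu E h) (B \<inter> {s<..}))"

lemma good_isproj: "good B P \<Longrightarrow> isproj P"
 and good_commute: "good B P \<Longrightarrow> (\<And>s. commute b (E s)) \<Longrightarrow> commute b P"
 and good_norm: "good B P \<Longrightarrow> ennreal ((norm (E s (P h)))\<^sup>2) = emeasure (mu E h) (B \<inter> {s<..})" by (auto simp: good_def)

lemma good_mu:
 assumes P: "good B P" and B: "B \<in> sets borel" and A: "A \<in> sets borel"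
 shows "emeasure (mu E (P h)) A = emeasure (mu E h) (B \<inter> A)"
proof -
 have "mu E (P h) = density (mu E h) (indicator B)"
 proof (rule finite_borel_eqI)
  fix s
  show "emeasure (mu E (P h)) {s<..} = emeasure (density (mu E h) (indicator B)) {s<..}"
   using B by (subst emeasure_restricted) (auto simp: mu_Ioi good_norm[OF P])
  show "emeasure (mu E (P h)) {s<..} \<noteq> \<infinity>" by (simp add: mu_Ioi)
 qed auto
 then show ?thesis using A B by (simp add: emeasure_restricted)
qed

lemma good_norm_UNIV:
 assumes P: "good B P" and B: "B \<in> sets borel"
 shows "ennreal ((norm (P h))\<^sup>2) = emeasure (mu E h) B" using good_mu[OF P B, of UNIV h] by (simp add: mu_UNIV)

lemma good_Ioi: "good {s<..} (E s)" unfolding good_def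
proof (intro conjI allI impI res_isproj)
 fix h t
 have "{s<..} \<inter> {t<..} = {max s t<..}" by auto
 then show "ennreal ((norm (E t (E s h)))\<^sup>2) = emeasure (mu E h) ({s<..} \<inter> {t<..})" by (simp add: res_max mu_Ioi max.commute)
qed blast

lemma good_empty: "good {} 0" by (simp add: good_def isproj_zero commute_zero blinfun.zero_right)

lemma good_compl:
 assumes P: "good B P" and B: "B \<in> sets borel"
 shows "good (UNIV - B) (I - P)" unfolding good_def
proof (intro conjI allI impI isproj_compl good_isproj[OF P] commute_intros)
 fix h s
 interpret finite_measure "mu E h" by (rule mu_finite)
 have c: "P (E s h) = E s (P h)" for h using good_commute[OF P res_commute] by (simp add: commute_def)
 have "(norm (E s h))\<^sup>2 = (norm (E s (P h)))\<^sup>2 + (norm (E s (h - P h)))\<^sup>2"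
  using isproj_pythagoras[OF good_isproj[OF P], of "E s h"] by (simp add: c blin)
 then have "(norm (E s (h - P h)))\<^sup>2 = (norm (E s h))\<^sup>2 - (norm (E s (P h)))\<^sup>2" by simp
 also have "ennreal \<dots> = emeasure (mu E h) {s<..} - emeasure (mu E h) (B \<inter> {s<..})"
  by (simp add: ennreal_minus mu_Ioi good_norm[OF P, symmetric])
 also have "\<dots> = emeasure (mu E h) ({s<..} - B \<inter> {s<..})" using B by (intro emeasure_Diff[symmetric]) auto
 also have "{s<..} - B \<inter> {s<..} = (UNIV - B) \<inter> {s<..}" by auto
 finally show "ennreal ((norm (E s ((I - P) h)))\<^sup>2) = emeasure (mu E h) ((UNIV - B) \<inter> {s<..})" by (simp add: blin)
qed (use good_commute[OF P] in blast)

lemma good_Int: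
 assumes P: "good B P" "B \<in> sets borel" and Q: "good D Q" "D \<in> sets borel"
 shows "good (B \<inter> D) (P o\<^sub>L Q)" unfolding good_def
proof (intro conjI allI impI)
 have cP: "commute (E s) P" for s using good_commute[OF P(1) res_commute] .
 have "commute P Q" using good_commute[OF Q(1) commute_sym[OF cP]] .
 then show "isproj (P o\<^sub>L Q)" by (intro isproj_comp good_isproj[OF P(1)] good_isproj[OF Q(1)])
 show "ennreal ((norm (E s ((P o\<^sub>L Q) h)))\<^sup>2) = emeasure (mu E h) (B \<inter> D \<inter> {s<..})" for h s
  using good_norm[OF P(1), of s "Q h"] good_mu[OF Q, of "B \<inter> {s<..}" h] P(2) by (simp add: Int_ac)
qed (use good_commute[OF P(1)] good_commute[OF Q(1)] in \<open>auto intro!: commute_intros\<close>)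

lemma good_mono:
 assumes P: "good B P" "B \<in> sets borel" and Q: "good D Q" "D \<in> sets borel" and "B \<subseteq> D"
 shows "Q (P h) = P h"
proof -
 have "ennreal ((norm (Q (P h)))\<^sup>2) = ennreal ((norm (P h))\<^sup>2)"
  using good_norm_UNIV[OF Q, of "P h"] good_mu[OF P Q(2), of h] good_norm_UNIV[OF P, of h] \<open>B \<subseteq> D\<close> by (simp add: Int_absorb2)
 then have "(norm (Q (P h)))\<^sup>2 = (norm (P h))\<^sup>2" by simp
 then show ?thesis using isproj_pythagoras[OF good_isproj[OF Q(1)], of "P h"] by simp
qed

lemma good_incseq:
 assumes P: "\<And>n. good (B n) (P n)" and B: "\<And>n. B n \<in> sets borel" and inc: "incseq B"
 obtains Q where "good (\<Union>n. B n) Q" "\<And>h. (\<lambda>n. P n h) \<longlonglongrightarrow> Q h"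
proof -
 have "P (Suc n) (P n h) = P n h" for n h by (rule good_mono[OF P B P B]) (use inc in \<open>simp add: incseq_def\<close>)
 then obtain Q where Q: "isproj Q" "\<And>h. (\<lambda>n. P n h) \<longlonglongrightarrow> Q h" using isproj_increasing_limit[of P] good_isproj[OF P] by metis
 have "good (\<Union>n. B n) Q" unfolding good_def
 proof (intro conjI allI impI Q)
  fix b :: "'a op" assume b: "\<forall>s. commute b (E s)"
  then have c: "b (P n h) = P n (b h)" for n h using good_commute[OF P] by (simp add: commute_def)
  have "b (Q h) = Q (b h)" for h
  proof -
   have "(\<lambda>n. b (P n h)) \<longlonglongrightarrow> b (Q h)" by (intro tendsto_intros Q)
   then show ?thesis unfolding c using Q(2) LIMSEQ_unique by blast
  qed
  then show "commute b Q" by (simp add: commute_def)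
 next
  fix h s
  have "(\<lambda>n. ennreal ((norm (E s (P n h)))\<^sup>2)) \<longlonglongrightarrow> ennreal ((norm (E s (Q h)))\<^sup>2)" by (intro tendsto_intros Q)
  moreover have "(\<lambda>n. emeasure (mu E h) (B n \<inter> {s<..})) \<longlonglongrightarrow> emeasure (mu E h) (\<Union>n. B n \<inter> {s<..})"
   by (rule Lim_emeasure_incseq) (use B inc in \<open>auto simp: incseq_def\<close>)
  ultimately show "ennreal ((norm (E s (Q h)))\<^sup>2) = emeasure (mu E h) ((\<Union>n. B n) \<inter> {s<..})"
   unfolding good_norm[OF P] using LIMSEQ_unique by fastforce
 qed
 then show ?thesis using that Q by blast
qed

lemma good_exists: "B \<in> sets borel \<Longrightarrow> \<exists>P. good B P"
proof -
 have eq: "sets (borel :: real measure) = sigma_sets UNIV (range greaterThan)" by (simp add: borel_Ioi)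
 assume "B \<in> sets borel"
 then have "B \<in> sigma_sets UNIV (range greaterThan)" by (simp add: eq)
 then show ?thesis
 proof induction
  case (Basic a) then show ?case using good_Ioi by auto
 next
  case Empty then show ?case using good_empty by blast
 next
  case (Compl a) then show ?case using good_compl eq by blast
 next
  case (Union a)
  then have a: "\<And>i. a i \<in> sets borel" using eq by simp
  obtain P where P: "\<And>i. good (a i) (P i)" using Union by metis
  have "\<exists>Q. good (\<Union>i<n. a i) Q" for n
  proof (induction n)
   case 0 then show ?case using good_empty by auto
  next
   case (Suc n)
   then obtain Q where Q: "good (\<Union>i<n. a i) Q" by blast
   have m: "(\<Union>i<n. a i) \<in> sets borel" using a by auto
   \<comment> \<open>Finite unions are obtained from complements and intersections by De Morgan;
     countable unions are then increasing limits.\<close>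
   have "good (UNIV - ((UNIV - (\<Union>i<n. a i)) \<inter> (UNIV - a n))) (I - ((I - Q) o\<^sub>L (I - P n)))"
    using m a by (intro good_compl good_Int Q P) auto
   moreover have "UNIV - ((UNIV - (\<Union>i<n. a i)) \<inter> (UNIV - a n)) = (\<Union>i<Suc n. a i)" by (auto simp: less_Suc_eq)
   ultimately show ?case by metis
  qed
  then obtain Q where Q: "\<And>n. good (\<Union>i<n. a i) (Q n)" by metis
  have "incseq (\<lambda>n. \<Union>i<n. a i)" unfolding incseq_def by (intro allI impI UN_mono) auto
  moreover have "(\<Union>i<n. a i) \<in> sets borel" for n using a by auto
  ultimately obtain R where R: "good (\<Union>n. \<Union>i<n. a i) R" using good_incseq[where B = "\<lambda>n. \<Union>i<n. a i" and P = Q, OF Q] by blast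
  have "(\<Union>n. \<Union>i<n. a i) = (\<Union>i. a i)" by auto
  with R show ?case by auto
 qed
qed

definition pvm :: "real set \<Rightarrow> 'a op" where "pvm B = (SOME P. good B P)"

lemma pvm_good: "B \<in> sets borel \<Longrightarrow> good B (pvm B)" unfolding pvm_def using good_exists by (metis someI_ex)

lemma good_unique: "good B P \<Longrightarrow> good B Q \<Longrightarrow> B \<in> sets borel \<Longrightarrow> P = Q"
proof (rule isproj_eq_norm)
 assume a: "good B P" "good B Q" "B \<in> sets borel"
 show "isproj P" "isproj Q" using a good_isproj by auto
 show "(norm (P h))\<^sup>2 = (norm (Q h))\<^sup>2" for h using good_norm_UNIV[OF a(1,3), of h] good_norm_UNIV[OF a(2,3), of h]
  by (metis ennreal_inj zero_le_power2)
qed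

lemma pvm_disjoint_Un:
 assumes "B \<in> sets borel" "D \<in> sets borel" "B \<inter> D = {}"
 shows "pvm (B \<union> D) h = pvm B h + pvm D h"
proof -
 let ?Q = "pvm (B \<union> D)"
 have eqD: "(B \<union> D) \<inter> (UNIV - B) = D" using assms(3) by auto
 have m: "B \<union> D \<in> sets borel" using assms by auto
 have eqB: "(B \<union> D) \<inter> B = B" by auto
 have "good ((B \<union> D) \<inter> B) (?Q o\<^sub>L pvm B)" by (rule good_Int[OF pvm_good[OF m] m pvm_good[OF assms(1)] assms(1)])
 from good_unique[OF this[unfolded eqB] pvm_good[OF assms(1)] assms(1)]
 have "?Q o\<^sub>L pvm B = pvm B" .
 moreover have "good ((B \<union> D) \<inter> (UNIV - B)) (?Q o\<^sub>L (I - pvm B))"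
  by (rule good_Int[OF pvm_good[OF m] m good_compl[OF pvm_good[OF assms(1)] assms(1)]]) (use assms in auto)
 from good_unique[OF this[unfolded eqD] pvm_good[OF assms(2)] assms(2)]
 have "?Q o\<^sub>L (I - pvm B) = pvm D" .
 ultimately have "?Q (pvm B h) = pvm B h" "?Q (h - pvm B h) = pvm D h"
  by (metis blinfun_apply_blinfun_compose, metis blinfun_apply_blinfun_compose blinfun.diff_left id_blinfun.rep_eq)
 then show ?thesis by (simp add: blin algebra_simps)
qed

end

lemma pvm_projection_valued:
 fixes E :: "real \<Rightarrow> 'a::complex_hilbert op"
 assumes E: "resolution E" and b: "\<And>s. E s \<in> bounded_ops"
 shows "projection_valued_measure (pvm E)" unfolding projection_valued_measure_def
proof (intro conjI ballI allI impI)
 fix B :: "real set" assume B: "B \<in> sets borel"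
 have "commute (sc c) (pvm E B)" for c using good_commute[OF E pvm_good[OF E B]] b by (metis bounded_ops_iff commute_sym)
 then show "projection_op (pvm E B)"
  using good_isproj[OF E pvm_good[OF E B]] by (simp add: projection_op_iff bounded_ops_iff commute_sym)
next
 have "good E UNIV I" using good_compl[OF E good_empty[OF E]] by simp
 then show "pvm E UNIV = I" using good_unique[OF E pvm_good[OF E]] by simp
next
 fix F :: "nat \<Rightarrow> real set" and h
 assume F: "range F \<subseteq> sets borel \<and> disjoint_family F"
 define U where "U n = (\<Union>i<n. F i)" for n
 have Fm: "F n \<in> sets borel" for n using F by auto
 have Um: "U n \<in> sets borel" for n unfolding U_def using Fm by auto
 have inc: "incseq U" unfolding incseq_def U_def by (intro allI impI UN_mono) auto
 obtain Q where Q: "good E (\<Union>n. U n) Q" "\<And>h. (\<lambda>n. pvm E (U n) h) \<longlonglongrightarrow> Q h" using good_incseq[OF E pvm_good[OF E Um] Um inc] by blast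
 have UU: "(\<Union>n. U n) = (\<Union>n. F n)" unfolding U_def by auto
 have "(\<Union>n. F n) \<in> sets borel" using Fm by auto
 then have "Q = pvm E (\<Union>n. F n)" using good_unique[OF E Q(1) pvm_good[OF E]] unfolding UU by blast
 moreover have "(\<Sum>i<n. pvm E (F i) h) = pvm E (U n) h" for n
 proof (induction n)
  case 0
  have "pvm E {} = 0" using good_unique[OF E pvm_good[OF E] good_empty[OF E]] by simp
  then show ?case by (simp add: U_def)
 next
  case (Suc n)
  have "F i \<inter> F n = {}" if "i < n" for i using F that by (intro disjoint_family_onD[of F UNIV]) auto
  then have "U n \<inter> F n = {}" unfolding U_def by blast
  then have "pvm E (U n \<union> F n) h = pvm E (U n) h + pvm E (F n) h" by (rule pvm_disjoint_Un[OF E Um Fm])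
  moreover have "U (Suc n) = U n \<union> F n" unfolding U_def by (auto simp: less_Suc_eq)
  ultimately show ?case using Suc by simp
 qed
 ultimately show "(\<lambda>n. pvm E (F n) h) sums pvm E (\<Union>n. F n) h" unfolding sums_def using Q(2)[of h] by simp
qed

lemma scalar_measure_pvm:
 fixes E :: "real \<Rightarrow> 'a::complex_hilbert op"
 assumes E: "resolution E"
 shows "scalar_measure (pvm E) h = mu E h"
proof -
 have "scalar_measure (pvm E) h = measure_of UNIV (sets borel) (emeasure (mu E h))" unfolding scalar_measure_def
 proof (rule measure_of_eq)
  fix B :: "real set" assume "B \<in> sigma_sets UNIV (sets borel)"
  then have B: "B \<in> sets borel" using sets.sigma_sets_eq[of "borel :: real measure"] by simp
  show "ennreal (Re (cinner (pvm E B h) h)) = emeasure (mu E h) B"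
   using good_norm_UNIV[OF E pvm_good[OF E B] B] isproj_inner[OF good_isproj[OF E pvm_good[OF E B]]] by (simp add: Re_cinner)
 qed auto
 also have "\<dots> = mu E h" using measure_of_of_measure[of "mu E h"] by simp
 finally show ?thesis .
qed

section \<open>A Stieltjes integral\<close>

text \<open>Cutting [0, b] into n + 1 equal pieces bounds the total change by K b / (n + 1) times
  the change of m, because the increments of m telescope.\<close>

lemma lipschitz_product_constant:
 fixes D m :: "real \<Rightarrow> real"
 assumes "0 \<le> b" and K: "0 \<le> K"
  and D: "\<And>s t. 0 \<le> s \<Longrightarrow> s \<le> t \<Longrightarrow> t \<le> b \<Longrightarrow> \<bar>D t - D s\<bar> \<le> K * (t - s) * (m t - m s)"
 shows "D b = D 0"
proof -
 have le: "\<bar>D b - D 0\<bar> \<le> K * b * (m b - m 0) / real (Suc n)" for n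
 proof -
  define s where "s i = real i * b / real (Suc n)" for i
  have s: "s 0 = 0" "s (Suc n) = b" by (auto simp: s_def)
  have step: "s (Suc i) - s i = b / real (Suc n)" for i unfolding s_def by (simp add: ring_distribs flip: diff_divide_distrib)
  have "D b - D 0 = (\<Sum>i<Suc n. D (s (Suc i)) - D (s i))" using sum_lessThan_telescope[of "\<lambda>i. D (s i)" "Suc n"] s by simp
  also have "\<bar>\<dots>\<bar> \<le> (\<Sum>i<Suc n. \<bar>D (s (Suc i)) - D (s i)\<bar>)" by (rule sum_abs)
  also have "\<dots> \<le> (\<Sum>i<Suc n. K * (b / real (Suc n)) * (m (s (Suc i)) - m (s i)))"
  proof (rule sum_mono)
   fix i assume "i \<in> {..<Suc n}"
   then have "0 \<le> s i" "s i \<le> s (Suc i)" "s (Suc i) \<le> b" using \<open>0 \<le> b\<close> unfolding s_def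
    using mult_right_mono[of "real (Suc i)" "real (Suc n)" b] by (auto simp: field_simps)
   from D[OF this] show "\<bar>D (s (Suc i)) - D (s i)\<bar> \<le> K * (b / real (Suc n)) * (m (s (Suc i)) - m (s i))" unfolding step .
  qed
  also have "\<dots> = K * (b / real (Suc n)) * (m b - m 0)" unfolding sum_distrib_left[symmetric]
   using sum_lessThan_telescope[of "\<lambda>i. m (s i)" "Suc n"] s by simp
  finally show ?thesis by simp
 qed
 have "(\<lambda>n. K * b * (m b - m 0) * (1 / real (Suc n))) \<longlonglongrightarrow> K * b * (m b - m 0) * 0"
  by (intro tendsto_intros LIMSEQ_Suc[OF lim_1_over_n])
 then have "(\<lambda>n. K * b * (m b - m 0) / real (Suc n)) \<longlonglongrightarrow> 0" by simp
 from LIMSEQ_le_const[OF this] have "\<bar>D b - D 0\<bar> \<le> 0" using le by blast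
 then show ?thesis by simp
qed

text \<open>G and the true integral over (0, t] satisfy the same two-sided estimate on every (s, t],
  so they differ there by at most (f t - f s) N(s, t], and the preceding lemma applies. Monotone
  convergence then passes to the whole half-line; f 0 = 0 disposes of an atom at 0.\<close>

lemma stieltjes_integral:
 fixes N :: "real measure" and f G :: "real \<Rightarrow> real"
 assumes fin: "finite_measure N" and sN [measurable_cong]: "sets N = sets borel" and nn: "AE t in N. 0 \<le> t"
  and fm [measurable]: "f \<in> borel_measurable borel" and f0: "f 0 = 0"
  and fmono: "\<And>s t. 0 \<le> s \<Longrightarrow> s \<le> t \<Longrightarrow> f s \<le> f t"
  and flip: "\<And>b. \<exists>K\<ge>0. \<forall>s t. 0 \<le> s \<longrightarrow> s \<le> t \<longrightarrow> t \<le> b \<longrightarrow> f t - f s \<le> K * (t - s)"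
  and G: "\<And>s t. 0 \<le> s \<Longrightarrow> s \<le> t \<Longrightarrow> f s * measure N {s<..t} \<le> G t - G s"
   "\<And>s t. 0 \<le> s \<Longrightarrow> s \<le> t \<Longrightarrow> G t - G s \<le> f t * measure N {s<..t}"
  and G0: "G 0 = 0" and lim: "(\<lambda>n. G (real n)) \<longlonglongrightarrow> L"
 shows "integrable N f" "integral\<^sup>L N f = L"
proof -
 interpret finite_measure N by fact
 define J where "J s = (\<integral>t. indicator {0<..s} t * f t \<partial>N)" for s
 have fnn: "0 \<le> f s" if "0 \<le> s" for s using fmono[of 0 s] f0 that by simp
 have int: "integrable N (\<lambda>u. indicator {s<..t} u * f u)" if "0 \<le> s" for s t
 proof (rule integrable_const_bound[of _ "f (max 0 t)"])
  show "AE u in N. norm (indicator {s<..t} u * f u) \<le> f (max 0 t)"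
  proof (rule AE_I2)
   fix u
   show "norm (indicator {s<..t} u * f u) \<le> f (max 0 t)" using that fnn[of u] fnn[of "max 0 t"] fmono[of u t]
    by (auto split: split_indicator simp: max_def)
  qed
 qed measurable
 have Jdiff: "J t - J s = (\<integral>u. indicator {s<..t} u * f u \<partial>N)" if "0 \<le> s" "s \<le> t" for s t
 proof -
  have "J t = (\<integral>u. indicator {0<..s} u * f u + indicator {s<..t} u * f u \<partial>N)"
   unfolding J_def by (rule Bochner_Integration.integral_cong) (use that in \<open>auto split: split_indicator\<close>)
  also have "\<dots> = J s + (\<integral>u. indicator {s<..t} u * f u \<partial>N)"
   unfolding J_def by (rule Bochner_Integration.integral_add) (auto intro!: int that)
  finally show ?thesis by simp
 qed
 have const: "(\<integral>u. indicator {s<..t} u * c \<partial>N) = c * measure N {s<..t}"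
  "integrable N (\<lambda>u. indicator {s<..t} u * c)" for s t c :: real
 proof -
  have i: "integrable N (indicator {s<..t} :: real \<Rightarrow> real)"
   by (rule integrable_real_indicator) (auto simp: sN less_top[symmetric])
  show "(\<integral>u. indicator {s<..t} u * c \<partial>N) = c * measure N {s<..t}"
   "integrable N (\<lambda>u. indicator {s<..t} u * c)" using i sets_eq_imp_space_eq[OF sN] by (auto simp: mult.commute)
 qed
 have J1: "f s * measure N {s<..t} \<le> J t - J s" if "0 \<le> s" "s \<le> t" for s t unfolding Jdiff[OF that] const(1)[symmetric]
  by (intro integral_mono const int that) (use that fmono in \<open>auto split: split_indicator\<close>)
 have J2: "J t - J s \<le> f t * measure N {s<..t}" if "0 \<le> s" "s \<le> t" for s t unfolding Jdiff[OF that] const(1)[symmetric]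
  by (intro integral_mono const int that) (use that fmono in \<open>auto split: split_indicator\<close>)
 have mdiff: "measure N {0<..t} - measure N {0<..s} = measure N {s<..t}" if "0 \<le> s" "s \<le> t" for s t
 proof -
  have "measure N ({0<..s} \<union> {s<..t}) = measure N {0<..s} + measure N {s<..t}" by (rule finite_measure_Union) (auto simp: sN)
  moreover have "{0<..s} \<union> {s<..t} = {0<..t}" using that by auto
  ultimately show ?thesis by simp
 qed
 have GJ: "G b = J b" if b: "0 \<le> b" for b
 proof -
  obtain K where K: "K \<ge> 0" "\<And>s t. 0 \<le> s \<Longrightarrow> s \<le> t \<Longrightarrow> t \<le> b \<Longrightarrow> f t - f s \<le> K * (t - s)" using flip by blast
  have "G b - J b = G 0 - J 0"
  proof (rule lipschitz_product_constant[OF b K(1)])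
   fix s t :: real assume st: "0 \<le> s" "s \<le> t" "t \<le> b"
   have "\<bar>(G t - J t) - (G s - J s)\<bar> \<le> (f t - f s) * measure N {s<..t}"
    using G(1,2)[OF st(1,2)] J1[OF st(1,2)] J2[OF st(1,2)] by (simp add: algebra_simps abs_le_iff)
   also have "\<dots> \<le> K * (t - s) * measure N {s<..t}" by (intro mult_right_mono K(2) st) auto
   finally show "\<bar>(G t - J t) - (G s - J s)\<bar> \<le> K * (t - s) * (measure N {0<..t} - measure N {0<..s})" using mdiff st by simp
  qed
  then show ?thesis by (simp add: G0 J_def)
 qed
 have i: "integrable N (\<lambda>u. indicator {0<..real n} u * f u)" for n by (rule int) simp
 have mono: "AE u in N. mono (\<lambda>n. indicator {0<..real n} u * f u)"
 proof (rule AE_I2)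
  fix u :: real
  show "mono (\<lambda>n. indicator {0<..real n} u * f u)" by (rule monoI) (use fnn[of u] in \<open>auto split: split_indicator\<close>)
 qed
 have lm: "AE u in N. (\<lambda>n. indicator {0<..real n} u * f u) \<longlonglongrightarrow> f u" using nn
 proof eventually_elim
  case (elim u)
  show ?case
  proof (cases "u = 0")
   case False
   obtain n where "u \<le> real n" using real_arch_simple by blast
   then show ?thesis using elim False by (intro tendsto_eventually eventually_sequentiallyI[of n]) (auto split: split_indicator)
  qed (simp add: f0)
 qed
 have J: "(\<lambda>n. \<integral>u. indicator {0<..real n} u * f u \<partial>N) \<longlonglongrightarrow> L" using lim GJ by (simp add: J_def)
 have fN: "f \<in> borel_measurable N" by measurable
 show "integrable N f" by (rule integrable_monotone_convergence[OF i mono lm J fN])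
 show "integral\<^sup>L N f = L" by (rule integral_monotone_convergence[OF i mono lm J fN])
qed

section \<open>The spectral family of the modulus\<close>

definition aop :: "('a::complex_hilbert \<times> 'a) set \<Rightarrow> real \<Rightarrow> 'a op"
 where "aop x s = st x - s *\<^sub>R ct x"

definition sf :: "('a::complex_hilbert \<times> 'a) set \<Rightarrow> real \<Rightarrow> 'a op"
 where "sf x s = specproj (aop x s)"

lemma aop_apply: "aop x s h = st x h - s *\<^sub>R ct x h" by (simp add: aop_def blin blinfun.scaleR_left)

context
 fixes x :: "('a::complex_hilbert \<times> 'a) set"
 assumes x: "closed_op x"
begin

lemma aop_sa: "sa (aop x s)" unfolding aop_def by (intro sa_intros pos_sa st_pos ct_pos x)

lemma ct_aop: "commute (ct x) (aop x s)" unfolding aop_def by (intro commute_intros ct_st x)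

lemma st_aop: "commute (st x) (aop x s)" unfolding aop_def by (intro commute_intros commute_sym[OF ct_st[OF x]])

lemma sf_isproj: "isproj (sf x s)" unfolding sf_def by (rule specproj_isproj[OF aop_sa])

lemma sf_commute: "commute b (ct x) \<Longrightarrow> commute b (st x) \<Longrightarrow> commute b (sf x s)"
 unfolding sf_def by (rule specproj_commute[OF aop_sa]) (auto simp: aop_def intro!: commute_intros)

lemma sf_ct: "sf x s (ct x h) = ct x (sf x s h)" and sf_st: "sf x s (st x h) = st x (sf x s h)"
 using sf_commute[OF commute_refl ct_st[OF x]] sf_commute[OF commute_sym[OF ct_st[OF x]] commute_refl]
 by (simp_all add: commute_def)

lemma sf_sf: "sf x s (sf x t h) = sf x t (sf x s h)"
proof -
 have "commute (sf x s) (sf x t)" by (rule sf_commute) (simp_all add: commute_def sf_ct sf_st)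
 then show ?thesis by (simp add: commute_def)
qed

lemma sf_on:
 assumes "sf x s h = h"
 shows "0 \<le> inner (aop x s h) (ct x h)" and "inner (aop x s h) (ct x h) = 0 \<Longrightarrow> h = 0"
 using specproj_on_pos[OF aop_sa ct_pos[OF x] ct_aop] assms ct_inj[OF x] unfolding sf_def by blast+

lemma sf_off:
 assumes "sf x s h = 0" shows "inner (aop x s h) (ct x h) \<le> 0"
 using specproj_off_neg[OF aop_sa ct_pos[OF x] ct_aop] assms unfolding sf_def by blast

text \<open>(S - s C)(S + s C) = S^2 - s^2 C^2: testing against S + s C turns signs of forms into
  comparisons of norms.\<close>

private abbreviation "cc s \<equiv> st x + s *\<^sub>R ct x"

private lemma cc: "0 \<le> s \<Longrightarrow> pos (cc s)" "commute (cc s) (aop x t)"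
 "inner (aop x s h) (cc s h) = (norm (st x h))\<^sup>2 - s\<^sup>2 * (norm (ct x h))\<^sup>2"
proof -
 show "pos (cc s)" if "0 \<le> s" using that posD[OF st_pos[OF x]] posD[OF ct_pos[OF x]] unfolding pos_def
  by (auto intro!: sa_intros pos_sa[OF st_pos[OF x]] pos_sa[OF ct_pos[OF x]] simp: blin blinfun.scaleR_left inner_add)
 show "commute (cc s) (aop x t)" by (intro commute_sym[of "aop x t"] commute_intros commute_sym[OF st_aop] commute_sym[OF ct_aop])
 show "inner (aop x s h) (cc s h) = (norm (st x h))\<^sup>2 - s\<^sup>2 * (norm (ct x h))\<^sup>2" unfolding power2_norm_eq_inner
  by (simp add: aop_apply blin blinfun.scaleR_left inner_add inner_diff power2_eq_square inner_commute algebra_simps)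
qed

lemma sf_on_norm: "sf x s h = h \<Longrightarrow> 0 \<le> s \<Longrightarrow> s\<^sup>2 * (norm (ct x h))\<^sup>2 \<le> (norm (st x h))\<^sup>2"
 using specproj_on_pos(1)[OF aop_sa cc(1) cc(2), of s s h] unfolding sf_def cc(3) by simp

lemma sf_off_norm: "sf x s h = 0 \<Longrightarrow> 0 \<le> s \<Longrightarrow> (norm (st x h))\<^sup>2 \<le> s\<^sup>2 * (norm (ct x h))\<^sup>2"
 using specproj_off_neg[OF aop_sa cc(1) cc(2), of s s h] unfolding sf_def cc(3) by simp

text \<open>Reflects that the half-line (s, \<infinity>) is open. For s = 0 the weight
  \<open>cc 0\<close> is \<open>st\<close> and may fail to be injective, so that case is
  separate.\<close>

lemma sf_on_strict:
 assumes h: "sf x s h = h" and "0 \<le> s" and le: "norm (st x h) \<le> s * norm (ct x h)"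
 shows "h = 0"
proof (cases "s = 0")
 case True
 then have "aop x s h = 0" using le by (simp add: aop_apply)
 then show ?thesis using specproj_inj[OF aop_sa] h unfolding sf_def by blast
next
 case False
 have inj: "k = 0" if "cc s k = 0" for k
 proof -
  have "inner (st x k) k + s * inner (ct x k) k = 0"
   using that by (metis blinfun.add_left blinfun.scaleR_left inner_add_left inner_scaleR_left inner_zero_left)
  moreover have "0 \<le> s * inner (ct x k) k" using posD[OF ct_pos[OF x]] assms(2) by simp
  ultimately have "s * inner (ct x k) k = 0" using posD[OF st_pos[OF x], of k] by linarith
  then have "ct x k = 0" using False pos_form_zero[OF ct_pos[OF x]] by simp
  then show ?thesis by (rule ct_inj[OF x])
 qed
 have "(norm (st x h))\<^sup>2 \<le> (s * norm (ct x h))\<^sup>2" by (rule power_mono[OF le]) simp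
 then have "inner (aop x s h) (cc s h) = 0" using sf_on_norm[OF h assms(2)] by (simp add: cc(3) power_mult_distrib)
 then show ?thesis using specproj_on_pos(2)[OF aop_sa cc(1)[OF assms(2)] cc(2) _ inj] h unfolding sf_def by blast
qed

lemma aop_shift: "inner (aop x s h) (ct x h) = inner (aop x t h) (ct x h) + (t - s) * (norm (ct x h))\<^sup>2"
 by (simp add: aop_apply inner_diff power2_norm_eq_inner algebra_simps)

text \<open>A vector fixed by \<open>sf x t\<close> and killed by \<open>sf x s\<close> has
  nonnegative form at t and nonpositive form at s, whereas the form does not increase from s to t;
  so both vanish.\<close>

lemma sf_le:
 assumes "s \<le> t" shows "sf x s (sf x t h) = sf x t h"
proof -
 define w where "w = sf x t h - sf x s (sf x t h)"
 have t: "sf x t w = w" by (simp add: w_def blin sf_sf[of t s] isproj_idem[OF sf_isproj])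
 have s: "sf x s w = 0" by (simp add: w_def blin isproj_idem[OF sf_isproj])
 have "0 \<le> (t - s) * (norm (ct x w))\<^sup>2" using assms by simp
 then have "inner (aop x t w) (ct x w) = 0" using sf_off[OF s] sf_on(1)[OF t] aop_shift[of s w t] by linarith
 then have "w = 0" using sf_on(2)[OF t] by blast
 then show ?thesis by (simp add: w_def)
qed

lemma sf_resolution: "resolution (sf x)" unfolding resolution_def
proof (intro conjI allI impI sf_isproj)
 show "sf x s (sf x t h) = sf x (max s t) h" for s t h
  using sf_le[of s t h] sf_le[of t s h] sf_sf[of s t h] by (auto simp: max_def)
next
 fix s :: real assume s: "s < 0"
 show "sf x s = I"
 proof (rule blinfun_eqI)
  fix h
  define w where "w = h - sf x s h"
  have w: "sf x s w = 0" by (simp add: w_def blin isproj_idem[OF sf_isproj])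
  have "inner (st x w) (ct x w) + (- s) * (norm (ct x w))\<^sup>2 \<le> 0"
   using sf_off[OF w] by (simp add: aop_apply inner_diff power2_norm_eq_inner)
  moreover have "0 \<le> (- s) * (norm (ct x w))\<^sup>2" using s by (intro mult_nonneg_nonneg) auto
  ultimately have "(- s) * (norm (ct x w))\<^sup>2 = 0" using modulus_nonneg[OF x, of w] by linarith
  then have "ct x w = 0" using s by simp
  then have "w = 0" by (rule ct_inj[OF x])
  then show "sf x s h = I h" by (simp add: w_def)
 qed
next
 fix s h
 define p where "p n = sf x (s + 1 / real (Suc n))" for n
 have p: "isproj (p n)" for n by (simp add: p_def sf_isproj)
 have "p (Suc n) (p n h) = p n h" for n h unfolding p_def by (rule sf_le) (simp add: frac_le)
 then obtain P where P: "isproj P" "\<And>h. (\<lambda>n. p n h) \<longlonglongrightarrow> P h" "\<And>n h. P (p n h) = p n h"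
  using isproj_increasing_limit[of p] p by metis
 \<comment> \<open>w is fixed by \<open>sf x s\<close> and killed by every
   \<open>sf x (s + 1/(n+1))\<close>. Its form at s is therefore at most norm (ct w)^2 / (n + 1) for
   all n, which forces w = 0.\<close>
 define w where "w = sf x s h - P h"
 have sw: "sf x s w = w"
 proof -
  have "(\<lambda>n. sf x s (p n h)) \<longlonglongrightarrow> sf x s (P h)" by (intro tendsto_intros P)
  moreover have "sf x s (p n h) = p n h" for n unfolding p_def by (rule sf_le) simp
  ultimately have "sf x s (P h) = P h" using P(2) LIMSEQ_unique by simp blast
  then show ?thesis by (simp add: w_def blin isproj_idem[OF sf_isproj])
 qed
 have pw: "p n w = 0" for n
 proof -
  have "p n (sf x s h) = p n h" unfolding p_def using sf_le[of s "s + 1 / real (Suc n)" h] by (simp add: sf_sf)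
  moreover have "p n (P h) = p n h" by (rule isproj_le_norm[OF p P(1) P(3)])
  ultimately show ?thesis by (simp add: w_def blin)
 qed
 have "inner (aop x s w) (ct x w) \<le> 1 / real (Suc n) * (norm (ct x w))\<^sup>2" for n
  using sf_off[of "s + 1 / real (Suc n)" w] pw[of n] aop_shift[of "s" w "s + 1 / real (Suc n)"] by (simp add: p_def)
 moreover have "(\<lambda>n. 1 / real (Suc n) * (norm (ct x w))\<^sup>2) \<longlonglongrightarrow> 0 * (norm (ct x w))\<^sup>2"
  by (intro tendsto_intros LIMSEQ_Suc[OF lim_1_over_n])
 ultimately have "inner (aop x s w) (ct x w) \<le> 0" using LIMSEQ_le_const[of _ "0 * (norm (ct x w))\<^sup>2"] by auto
 then have "w = 0" using sf_on[OF sw] by linarith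
 then show "(\<lambda>n. sf x (s + 1 / real (Suc n)) h) \<longlonglongrightarrow> sf x s h" using P(2)[of h] by (simp add: w_def p_def)
next
 fix h
 define p where "p n = I - sf x (real n)" for n
 have p: "isproj (p n)" for n by (simp add: p_def isproj_compl sf_isproj)
 have "p (Suc n) (p n h) = p n h" for n h using sf_le[of "real n" "real (Suc n)" h] by (simp add: p_def blin sf_sf)
 then obtain P where P: "isproj P" "\<And>h. (\<lambda>n. p n h) \<longlonglongrightarrow> P h" "\<And>n h. P (p n h) = p n h"
  using isproj_increasing_limit[of p] p by metis
 define w where "w = h - P h"
 have nw: "sf x (real n) w = w" for n
 proof -
  have "p n (P h) = p n h" by (rule isproj_le_norm[OF p P(1) P(3)])
  then show ?thesis by (simp add: w_def p_def blin algebra_simps)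
 qed
 have le: "real n * (norm (ct x w))\<^sup>2 \<le> inner (st x w) (ct x w)" for n
  using sf_on(1)[OF nw[of n]] by (simp add: aop_apply inner_diff power2_norm_eq_inner)
 have "(norm (ct x w))\<^sup>2 = 0"
 proof (rule ccontr)
  assume "(norm (ct x w))\<^sup>2 \<noteq> 0"
  then have pos: "(norm (ct x w))\<^sup>2 > 0" by simp
  obtain n where "inner (st x w) (ct x w) / (norm (ct x w))\<^sup>2 < real n" using reals_Archimedean2 by blast
  then show False using le[of n] pos by (simp add: field_simps)
 qed
 then have "ct x w = 0" by simp
 then have "w = 0" by (rule ct_inj[OF x])
 then have "(\<lambda>n. h - p n h) \<longlonglongrightarrow> h - h" using P(2)[of h] by (intro tendsto_intros) (simp add: w_def)
 then have L: "(\<lambda>n. sf x (real n) h) \<longlonglongrightarrow> 0" by (simp add: p_def blin)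
 have mono: "norm (sf x t h) \<le> norm (sf x s h)" if "s \<le> t" for s t
  using isproj_norm[OF sf_isproj, of t "sf x s h"] sf_le[OF that, of h] by (simp add: sf_sf)
 show "((\<lambda>s. sf x s h) \<longlongrightarrow> 0) at_top"
 proof (rule tendstoI)
  fix e :: real assume "0 < e"
  then obtain n where "norm (sf x (real n) h) < e" using L by (auto simp: lim_sequentially)
  then show "\<forall>\<^sub>F s in at_top. dist (sf x s h) 0 < e"
   using mono[of "real n"] by (intro eventually_mono[OF eventually_ge_at_top[of "real n"]]) (auto intro: le_less_trans)
 qed
qed

lemma sf_bounded: "sf x s \<in> bounded_ops"
proof -
 have "commute (sc c) (sf x s)" for c
  by (rule sf_commute) (use ct_bounded[OF x] st_bounded[OF x] in \<open>auto simp: bounded_ops_iff commute_def\<close>)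
 then show ?thesis by (simp add: bounded_ops_iff commute_def)
qed

private definition w where "w s g = g - sf x s g" for s g

text \<open>X and Y commute with the spectral projections, and w s g is orthogonal to the spectral
  increment, so the mixed terms vanish.\<close>

private lemma form_increment:
 fixes X Y :: "'a op"
 assumes X: "\<And>s h. sf x s (X h) = X (sf x s h)" and Y: "\<And>s h. sf x s (Y h) = Y (sf x s h)" and st: "s \<le> t"
 shows "inner (blinfun_apply X (w t g)) (blinfun_apply Y (w t g)) - inner (X (w s g)) (Y (w s g)) =
  inner (X (sf x s g - sf x t g)) (Y (sf x s g - sf x t g))"
proof -
 let ?d = "sf x s g - sf x t g"
 have d: "sf x s ?d = ?d" by (simp add: blin isproj_idem[OF sf_isproj] sf_le[OF st])
 have ws: "sf x s (w s g) = 0" by (simp add: w_def blin isproj_idem[OF sf_isproj])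
 have o: "inner (sf x s u) (k - sf x s k) = 0" for u k
  using saD[OF isproj_sa[OF sf_isproj], of s u] by (simp add: inner_diff isproj_idem[OF sf_isproj])
 have wt: "w t g = w s g + ?d" by (simp add: w_def)
 have "inner (X (w s g)) (Y ?d) = 0" "inner (X ?d) (Y (w s g)) = 0"
  using o[of "Y ?d" "X (w s g)"] o[of "X ?d" "Y (w s g)"] by (simp_all add: X Y d ws blinfun.zero_right inner_commute)
 then show ?thesis unfolding wt by (simp add: blin inner_add)
qed

private lemma mu_Ioc_ct: "s \<le> t \<Longrightarrow> measure (mu (sf x) (ct x g)) {s<..t} = (norm (ct x (sf x s g - sf x t g)))\<^sup>2"
proof -
 assume st: "s \<le> t"
 have "(norm (sf x s (ct x g)))\<^sup>2 - (norm (sf x t (ct x g)))\<^sup>2 = (norm (sf x s (ct x g) - sf x t (ct x g)))\<^sup>2"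
  using isproj_pythagoras[OF sf_isproj, of "sf x s (ct x g)" t] sf_le[OF st, of "ct x g"] by (simp add: sf_sf[of t s])
 then show ?thesis using mu_measure_Ioc[OF sf_resolution st] by (simp add: sf_ct blin)
qed

private lemma w_lim: "(\<lambda>n. w (real n) g) \<longlonglongrightarrow> g"
proof -
 have "((\<lambda>s. sf x s g) \<longlongrightarrow> 0) at_top" using sf_resolution by (auto simp: resolution_def)
 then have "(\<lambda>n. sf x (real n) g) \<longlonglongrightarrow> 0" using filterlim_compose filterlim_real_sequentially by blast
 then have "(\<lambda>n. g - sf x (real n) g) \<longlonglongrightarrow> g - 0" by (intro tendsto_intros)
 then show ?thesis by (simp add: w_def)
qed

private lemma dif: "s \<le> t \<Longrightarrow> sf x s (sf x s g - sf x t g) = sf x s g - sf x t g"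
 "s \<le> t \<Longrightarrow> sf x t (sf x s g - sf x t g) = 0" "sf x s (w s g) = 0"
 using sf_le[of s t g] by (simp_all add: w_def blin isproj_idem[OF sf_isproj] sf_sf[of t s])

text \<open>Q s is the form of the part of g below level s. Over (s, t] its increment lies between s
  and t times the spectral mass, by \<open>sf_on\<close> and \<open>sf_off\<close>; this is the
  sandwich that the Stieltjes lemma requires.\<close>

lemma modulus_integral:
 shows "integrable (mu (sf x) (ct x g)) (\<lambda>t. t)" "(\<integral>t. t \<partial>mu (sf x) (ct x g)) = inner (st x g) (ct x g)"
proof -
 define Q where "Q s = inner (st x (w s g)) (ct x (w s g))" for s
 have Q0: "Q 0 = 0" using sf_off[OF dif(3), of 0 g] modulus_nonneg[OF x, of "w 0 g"] by (simp add: Q_def aop_apply)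
 have Qd: "Q t - Q s = inner (st x (sf x s g - sf x t g)) (ct x (sf x s g - sf x t g))" if "s \<le> t" for s t
  unfolding Q_def by (rule form_increment[OF sf_st sf_ct that])
 have 1: "s * measure (mu (sf x) (ct x g)) {s<..t} \<le> Q t - Q s" if "0 \<le> s" "s \<le> t" for s t
  using sf_on(1)[OF dif(1)[OF that(2)]] unfolding Qd[OF that(2)] mu_Ioc_ct[OF that(2)]
  by (simp add: aop_apply inner_diff_left power2_norm_eq_inner)
 have 2: "Q t - Q s \<le> t * measure (mu (sf x) (ct x g)) {s<..t}" if "0 \<le> s" "s \<le> t" for s t
  using sf_off[OF dif(2)[OF that(2)]] unfolding Qd[OF that(2)] mu_Ioc_ct[OF that(2)]
  by (simp add: aop_apply inner_diff_left power2_norm_eq_inner)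
 have L: "(\<lambda>n. Q (real n)) \<longlonglongrightarrow> inner (st x g) (ct x g)" unfolding Q_def by (intro tendsto_intros w_lim)
 show "integrable (mu (sf x) (ct x g)) (\<lambda>t. t)" "(\<integral>t. t \<partial>mu (sf x) (ct x g)) = inner (st x g) (ct x g)"
  by (rule stieltjes_integral[OF mu_finite[OF sf_resolution] sets_mu mu_nonneg[OF sf_resolution] _ _ _ _ 1 2 Q0 L];
    auto intro!: exI[of _ 1])+
qed

lemma modulus_integral_sq:
 shows "integrable (mu (sf x) (ct x g)) (\<lambda>t. t\<^sup>2)" "(\<integral>t. t\<^sup>2 \<partial>mu (sf x) (ct x g)) = (norm (st x g))\<^sup>2"
proof -
 define Q where "Q s = inner (st x (w s g)) (st x (w s g))" for s
 have Q0: "Q 0 = 0" using sf_off_norm[OF dif(3), of 0 g] by (simp add: Q_def)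
 have Qd: "Q t - Q s = inner (st x (sf x s g - sf x t g)) (st x (sf x s g - sf x t g))" if "s \<le> t" for s t
  unfolding Q_def by (rule form_increment[OF sf_st sf_st that])
 have 1: "s\<^sup>2 * measure (mu (sf x) (ct x g)) {s<..t} \<le> Q t - Q s" if "0 \<le> s" "s \<le> t" for s t
  using sf_on_norm[OF dif(1)[OF that(2)] that(1)] unfolding Qd[OF that(2)] mu_Ioc_ct[OF that(2)]
  by (simp add: power2_norm_eq_inner)
 have 2: "Q t - Q s \<le> t\<^sup>2 * measure (mu (sf x) (ct x g)) {s<..t}" if "0 \<le> s" "s \<le> t" for s t
  using sf_off_norm[OF dif(2)[OF that(2)]] that unfolding Qd[OF that(2)] mu_Ioc_ct[OF that(2)] by (simp add: power2_norm_eq_inner)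
 have L: "(\<lambda>n. Q (real n)) \<longlonglongrightarrow> (norm (st x g))\<^sup>2" unfolding Q_def power2_norm_eq_inner by (intro tendsto_intros w_lim)
 have lip: "\<exists>K\<ge>0. \<forall>s t. 0 \<le> s \<longrightarrow> s \<le> t \<longrightarrow> t \<le> b \<longrightarrow> t\<^sup>2 - s\<^sup>2 \<le> K * (t - s)" for b :: real
 proof (intro exI[of _ "2 * \<bar>b\<bar>"] conjI allI impI)
  fix s t assume st: "0 \<le> s" "s \<le> t" "t \<le> b"
  have "t\<^sup>2 - s\<^sup>2 = (t + s) * (t - s)" by (simp add: power2_eq_square algebra_simps)
  also have "\<dots> \<le> 2 * \<bar>b\<bar> * (t - s)" using st by (intro mult_right_mono) auto
  finally show "t\<^sup>2 - s\<^sup>2 \<le> 2 * \<bar>b\<bar> * (t - s)" .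
 qed simp
 show "integrable (mu (sf x) (ct x g)) (\<lambda>t. t\<^sup>2)" "(\<integral>t. t\<^sup>2 \<partial>mu (sf x) (ct x g)) = (norm (st x g))\<^sup>2"
  by (rule stieltjes_integral[OF mu_finite[OF sf_resolution] sets_mu mu_nonneg[OF sf_resolution] _ _ _ lip 1 2 Q0 L];
    auto intro: power_mono)+
qed

text \<open>Below level n the operator \<open>ct\<close> is bounded below, norm u \<le> (1 + n) norm
  (ct u), so the truncation of h at n has a preimage g n under \<open>ct\<close>. The second moment
  of h bounds the norms of the g n, their increments are orthogonal, and their limit is a preimage
  of h.\<close>

lemma modulus_domain:
 assumes h: "integrable (mu (sf x) h) (\<lambda>t. t\<^sup>2)"
 shows "h \<in> range (ct x)"
proof -
 note R = sf_resolution
 define hn where "hn n = h - sf x (real n) h" for n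
 have "\<exists>g. ct x g = hn n \<and> sf x (real n) g = 0" for n
 proof -
  have "hn n \<in> closure (range (ct x))" using ct_dense[OF x] by simp
  then obtain s where s: "\<And>j. s j \<in> range (ct x)" "s \<longlonglongrightarrow> hn n" unfolding closure_sequential by metis
  then have "\<forall>j. \<exists>l. s j = ct x l" by blast
  then obtain l where l: "\<And>j. s j = ct x (l j)" by metis
  define k where "k j = l j - sf x (real n) (l j)" for j
  have k0: "sf x (real n) (k j) = 0" for j by (simp add: k_def blin isproj_idem[OF sf_isproj])
  have ck: "ct x (k j) = s j - sf x (real n) (s j)" for j by (simp add: k_def l blin sf_ct)
  have "(\<lambda>j. s j - sf x (real n) (s j)) \<longlonglongrightarrow> hn n - sf x (real n) (hn n)" by (intro tendsto_intros s)
  moreover have "sf x (real n) (hn n) = 0" by (simp add: hn_def blin isproj_idem[OF sf_isproj])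
  ultimately have lim: "(\<lambda>j. ct x (k j)) \<longlonglongrightarrow> hn n" by (simp add: ck)
  have bd: "norm u \<le> (1 + real n) * norm (ct x u)" if u: "sf x (real n) u = 0" for u
  proof -
   have "(norm u)\<^sup>2 \<le> (norm (ct x u))\<^sup>2 + (real n)\<^sup>2 * (norm (ct x u))\<^sup>2" using sf_off_norm[OF u] ct_st_norm[OF x, of u] by simp
   also have "\<dots> \<le> ((1 + real n) * norm (ct x u))\<^sup>2" by (simp add: power_mult_distrib power2_eq_square algebra_simps)
   finally show ?thesis by (rule power2_le_imp_le) simp
  qed
  have "Cauchy k"
  proof (rule CauchyI)
   fix e :: real assume e: "0 < e"
   then obtain M where M: "\<And>i j. i \<ge> M \<Longrightarrow> j \<ge> M \<Longrightarrow> norm (ct x (k i) - ct x (k j)) < e / (1 + real n)"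
    using CauchyD[OF LIMSEQ_imp_Cauchy[OF lim], of "e / (1 + real n)"] by auto
   have "norm (k i - k j) < e" if "i \<ge> M" "j \<ge> M" for i j
   proof -
    have "norm (k i - k j) \<le> (1 + real n) * norm (ct x (k i) - ct x (k j))" using bd[of "k i - k j"] k0 by (simp add: blin)
    also have "\<dots> < e" using M[OF that] by (simp add: field_simps)
    finally show ?thesis .
   qed
   then show "\<exists>M. \<forall>i\<ge>M. \<forall>j\<ge>M. norm (k i - k j) < e" by blast
  qed
  then obtain g where g: "k \<longlonglongrightarrow> g" using Cauchy_convergent convergent_def by blast
  have 1: "(\<lambda>j. ct x (k j)) \<longlonglongrightarrow> ct x g" and 2: "(\<lambda>j. sf x (real n) (k j)) \<longlonglongrightarrow> sf x (real n) g" by (intro tendsto_intros g)+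
  show ?thesis using LIMSEQ_unique[OF 1 lim] LIMSEQ_unique[OF 2[unfolded k0] tendsto_const] by blast
 qed
 then obtain g where g: "\<And>n. ct x (g n) = hn n" "\<And>n. sf x (real n) (g n) = 0" by metis
 have gg: "g m - sf x (real n) (g m) = g n" if "n \<le> m" for n m
 proof -
  have "ct x (g m - sf x (real n) (g m)) = hn m - sf x (real n) (hn m)" by (simp add: blinfun.diff_right g flip: sf_ct)
  also have "\<dots> = hn n" using sf_le[of "real n" "real m" h] that by (simp add: hn_def blin)
  finally have "ct x (g m - sf x (real n) (g m) - g n) = 0" by (simp add: blin g)
  then show ?thesis using ct_inj[OF x] by (metis eq_iff_diff_eq_0)
 qed
 have norms: "(norm (g m))\<^sup>2 = (norm (g n))\<^sup>2 + (norm (g m - g n))\<^sup>2" if "n \<le> m" for n m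
  using isproj_pythagoras[OF sf_isproj, of "g m" "real n"] by (simp add: gg[OF that, symmetric])
 have bound: "(norm (g n))\<^sup>2 \<le> (norm h)\<^sup>2 + (\<integral>t. t\<^sup>2 \<partial>mu (sf x) h)" for n
 proof -
  have P: "good (sf x) (UNIV - {real n<..}) (I - sf x (real n))" by (rule good_compl[OF R good_Ioi[OF R]]) simp
  have "mu (sf x) (hn n) = density (mu (sf x) h) (indicator (UNIV - {real n<..}))"
  proof (rule measure_eqI)
   fix A assume "A \<in> sets (mu (sf x) (hn n))"
   then show "emeasure (mu (sf x) (hn n)) A = emeasure (density (mu (sf x) h) (indicator (UNIV - {real n<..}))) A"
    using good_mu[OF R P, of A h] by (simp add: hn_def blin emeasure_restricted)
  qed simp
  note eq = this
  have "(\<integral>\<^sup>+t. ennreal (t\<^sup>2) \<partial>mu (sf x) (hn n)) \<le> (\<integral>\<^sup>+t. ennreal (t\<^sup>2) \<partial>mu (sf x) h)"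
   unfolding eq by (subst nn_integral_density) (auto intro!: nn_integral_mono split: split_indicator)
  moreover have "(\<integral>\<^sup>+t. ennreal (t\<^sup>2) \<partial>mu (sf x) (hn n)) = ennreal (\<integral>t. t\<^sup>2 \<partial>mu (sf x) (hn n))"
   by (rule nn_integral_eq_integral) (use modulus_integral_sq(1)[of "g n"] in \<open>auto simp: g\<close>)
  moreover have "(\<integral>\<^sup>+t. ennreal (t\<^sup>2) \<partial>mu (sf x) h) = ennreal (\<integral>t. t\<^sup>2 \<partial>mu (sf x) h)" by (rule nn_integral_eq_integral[OF h]) auto
  ultimately have "ennreal (\<integral>t. t\<^sup>2 \<partial>mu (sf x) (hn n)) \<le> ennreal (\<integral>t. t\<^sup>2 \<partial>mu (sf x) h)" by simp
  then have "(norm (st x (g n)))\<^sup>2 \<le> (\<integral>t. t\<^sup>2 \<partial>mu (sf x) h)"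
   using modulus_integral_sq(2)[of "g n"] by (simp add: g ennreal_le_iff)
  moreover have "(norm (hn n))\<^sup>2 \<le> (norm h)\<^sup>2" using isproj_pythagoras[OF sf_isproj, of h "real n"] by (simp add: hn_def)
  ultimately show ?thesis using ct_st_norm[OF x, of "g n"] unfolding g by linarith
 qed
 obtain g0 where g0: "g \<longlonglongrightarrow> g0" using orthogonal_increments_convergent[of g, OF norms bound] by (auto simp: convergent_def)
 have "(\<lambda>n. ct x (g n)) \<longlonglongrightarrow> ct x g0" by (intro tendsto_intros g0)
 moreover have "(\<lambda>n. ct x (g n)) \<longlonglongrightarrow> h" using w_lim[of h] by (simp add: g hn_def w_def)
 ultimately have "h = ct x g0" using LIMSEQ_unique by blast
 then show ?thesis by blast
qed

lemma modulus_spectral_measure: "is_spectral_measure (modulus x) (pvm (sf x))"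
 unfolding is_spectral_measure_def scalar_measure_pvm[OF sf_resolution]
proof (intro conjI pvm_projection_valued sf_resolution sf_bounded modulus_linear x)
 have "Domain (modulus x) = range (ct x)" by (auto simp: modulus_def)
 then show "Domain (modulus x) = {h. integrable (mu (sf x) h) (\<lambda>t. t\<^sup>2)}" using modulus_integral_sq(1) modulus_domain by auto
 show "\<forall>(g, h)\<in>modulus x. cinner h g = complex_of_real (\<integral>t. t \<partial>mu (sf x) g)"
 proof (intro ballI, clarify)
  fix g k assume gk: "(g, k) \<in> modulus x"
  then obtain h where h: "g = ct x h" "k = st x h" by (auto simp: modulus_def)
  have "cinner k g \<in> \<real>\<^sub>\<ge>\<^sub>0" using modulus_psa[OF x] gk by (auto simp: positive_self_adjoint_def)
  then have "cinner k g = complex_of_real (Re (cinner k g))" by (simp add: complex_nonneg_Reals_iff complex_eq_iff)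
  then show "cinner k g = complex_of_real (\<integral>t. t \<partial>mu (sf x) g)" by (simp add: Re_cinner h modulus_integral(2))
 qed
qed

end

section \<open>Uniqueness of the spectral projections of half-lines\<close>

context
 fixes e :: "real set \<Rightarrow> ('a::complex_hilbert op)"
 assumes e: "projection_valued_measure e"
begin

lemma pv_isproj: "B \<in> sets borel \<Longrightarrow> isproj (e B)"
 and pv_UNIV: "e UNIV = I"
 and pv_sums: "range F \<subseteq> sets borel \<Longrightarrow> disjoint_family F \<Longrightarrow> (\<lambda>n. e (F n) h) sums e (\<Union>n::nat. F n) h"
 using e by (auto simp: projection_valued_measure_def projection_op_iff)

lemma pv_empty: "e {} = 0"
proof (rule blinfun_eqI)
 fix h
 have "(\<lambda>n::nat. e {} h) sums e {} h" using pv_sums[of "\<lambda>_. {}"] by (auto simp: disjoint_family_on_def)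
 then have "(\<lambda>n::nat. e {} h) \<longlonglongrightarrow> 0" by (intro summable_LIMSEQ_zero) (auto simp: sums_iff)
 from LIMSEQ_unique[OF tendsto_const this] show "e {} h = blinfun_apply 0 h" by simp
qed

lemma pv_Un:
 assumes "A \<in> sets borel" "B \<in> sets borel" "A \<inter> B = {}"
 shows "e (A \<union> B) h = e A h + e B h"
proof -
 define F where "F = (\<lambda>n::nat. if n = 0 then A else if n = 1 then B else {})"
 have "(\<lambda>n. e (F n) h) sums e (\<Union>n. F n) h" by (rule pv_sums) (use assms in \<open>auto simp: F_def disjoint_family_on_def\<close>)
 moreover have "(\<Union>n. F n) = A \<union> B" by (auto simp: F_def split: if_splits)
 moreover have "(\<lambda>n. e (F n) h) sums (\<Sum>n\<in>{0,1}. e (F n) h)" by (rule sums_finite) (auto simp: F_def pv_empty)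
 ultimately show ?thesis using sums_unique2 by (fastforce simp: F_def)
qed

lemma pv_compl: "A \<in> sets borel \<Longrightarrow> e (- A) h = h - e A h" using pv_Un[of A "- A" h] pv_UNIV by (simp add: eq_diff_eq add.commute)

text \<open>For projections P, Q with idempotent sum, PQ + QP = 0. Multiplying by P from the left
  and from the right gives PQ = -PQP = QP, hence PQ = 0.\<close>

lemma pv_disjoint:
 assumes "A \<in> sets borel" "B \<in> sets borel" "A \<inter> B = {}"
 shows "e A (e B h) = 0"
proof -
 note p = isproj_idem[OF pv_isproj]
 have m: "A \<union> B \<in> sets borel" using assms by auto
 have 0: "e A (e B k) + e B (e A k) = 0" for k using p[OF m, of k] p[OF assms(1), of k] p[OF assms(2), of k]
  by (simp add: pv_Un[OF assms] blin add.commute)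
 have 1: "e A (e B h) + e A (e B (e A h)) = 0"
  using arg_cong[OF 0[of h], of "e A"] p[OF assms(1)] by (simp add: blin blinfun.zero_right)
 have 2: "e A (e B (e A h)) + e B (e A h) = 0" using 0[of "e A h"] p[OF assms(1)] by simp
 have "2 *\<^sub>R e A (e B h) = (e A (e B h) + e A (e B (e A h))) - (e A (e B (e A h)) + e B (e A h)) + (e A (e B h) + e B (e A h))"
  by (simp add: scaleR_2)
 then show ?thesis unfolding 0 1 2 by simp
qed

lemma pv_Int:
 assumes "A \<in> sets borel" "B \<in> sets borel"
 shows "e A (e B h) = e (A \<inter> B) h"
proof -
 have m: "A \<inter> B \<in> sets borel" "B - A \<in> sets borel" "A - B \<in> sets borel" using assms by auto
 have "(A \<inter> B) \<union> (B - A) = B" by auto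
 then have B: "e B h = e (A \<inter> B) h + e (B - A) h" using pv_Un[OF m(1,2), of h] by auto
 have A: "e A k = e (A \<inter> B) k + e (A - B) k" for k
 proof -
  have "(A \<inter> B) \<union> (A - B) = A" by auto
  then show ?thesis using pv_Un[OF m(1,3), of k] by fastforce
 qed
 have "e A (e (B - A) h) = 0" by (rule pv_disjoint) (use assms m in auto)
 moreover have "e (A - B) (e (A \<inter> B) h) = 0" by (rule pv_disjoint) (use assms m in auto)
 ultimately show ?thesis unfolding B by (simp add: blin A[of "e (A \<inter> B) h"] isproj_idem[OF pv_isproj[OF m(1)]])
qed

lemma sets_scalar_measure [simp, measurable_cong]: "sets (scalar_measure e h) = sets borel"
 and space_scalar_measure [simp]: "space (scalar_measure e h) = UNIV" using sets.sigma_sets_eq[of "borel :: real measure"]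
 by (simp_all add: scalar_measure_def sets_measure_of_conv space_measure_of_conv)

lemma emeasure_scalar_measure:
 assumes "B \<in> sets borel"
 shows "emeasure (scalar_measure e h) B = ennreal ((norm (e B h))\<^sup>2)"
proof -
 let ?f = "\<lambda>B. ennreal (Re (cinner (e B h) h))"
 have f: "?f B = ennreal ((norm (e B h))\<^sup>2)" if "B \<in> sets borel" for B
  using isproj_inner[OF pv_isproj[OF that], of h] by (simp add: Re_cinner)
 have "emeasure (scalar_measure e h) B = ?f B"
 proof (rule emeasure_measure_of[OF scalar_measure_def])
  show "positive (sets (scalar_measure e h)) ?f" by (simp add: positive_def pv_empty Re_cinner)
  show "countably_additive (sets (scalar_measure e h)) ?f"
  proof (rule countably_additiveI)
   fix F :: "nat \<Rightarrow> real set" assume F: "range F \<subseteq> sets (scalar_measure e h)" "disjoint_family F"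
   have "(\<lambda>n. inner (e (F n) h) h) sums inner (e (\<Union>n. F n) h) h"
    using bounded_linear.sums[OF bounded_linear_inner_left pv_sums[of F h]] F by auto
   moreover have "0 \<le> inner (e (F n) h) h" for n using F isproj_inner[OF pv_isproj[of "F n"], of h] by auto
   ultimately show "(\<Sum>i. ?f (F i)) = ?f (\<Union>n. F n)" unfolding Re_cinner by (intro suminf_ennreal_eq) auto
  qed
 qed (use assms in auto)
 then show ?thesis using f assms by simp
qed

lemma scalar_measure_finite: "finite_measure (scalar_measure e h)" by (rule finite_measureI) (simp add: emeasure_scalar_measure)

lemma scalar_measure_restrict:
 assumes A: "A \<in> sets borel"
 shows "scalar_measure e (e A h) = density (scalar_measure e h) (\<lambda>t. ennreal (indicator A t))"
proof (rule measure_eqI)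
 fix B assume "B \<in> sets (scalar_measure e (e A h))"
 then have B: "B \<in> sets borel" by simp
 show "emeasure (scalar_measure e (e A h)) B = emeasure (density (scalar_measure e h) (\<lambda>t. ennreal (indicator A t))) B"
  using A B by (simp add: ennreal_indicator emeasure_restricted emeasure_scalar_measure pv_Int Int_commute)
qed simp

lemma scalar_integrable_restrict:
 assumes A: "A \<in> sets borel" and f: "integrable (scalar_measure e h) (f :: real \<Rightarrow> real)"
 shows "integrable (scalar_measure e (e A h)) f"
  "(\<integral>t. f t \<partial>scalar_measure e (e A h)) = (\<integral>t. indicator A t * f t \<partial>scalar_measure e h)"
proof -
 have fm: "f \<in> borel_measurable (scalar_measure e h)" and im: "indicator A \<in> borel_measurable (scalar_measure e h)"
  using f A by (auto intro: borel_measurable_integrable borel_measurable_indicator)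
 show "integrable (scalar_measure e (e A h)) f" unfolding scalar_measure_restrict[OF A]
  by (subst integrable_density[OF fm im]) (use f A in \<open>auto intro!: integrable_mult_indicator[of A _ f, simplified]\<close>)
 show "(\<integral>t. f t \<partial>scalar_measure e (e A h)) = (\<integral>t. indicator A t * f t \<partial>scalar_measure e h)"
  unfolding scalar_measure_restrict[OF A] by (subst integral_density[OF fm im]) auto
qed

lemma scalar_integrable_id:
 assumes "integrable (scalar_measure e h) (\<lambda>t. t\<^sup>2)"
 shows "integrable (scalar_measure e h) (\<lambda>t. t)"
proof (rule Bochner_Integration.integrable_bound)
 interpret finite_measure "scalar_measure e h" by (rule scalar_measure_finite)
 show "integrable (scalar_measure e h) (\<lambda>t. 1 + t\<^sup>2)" using assms by simp
 show "AE t in scalar_measure e h. norm t \<le> norm (1 + t\<^sup>2)"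
 proof (rule AE_I2)
  fix t :: real
  have "0 \<le> (\<bar>t\<bar> - 1)\<^sup>2" by simp
  then have "2 * \<bar>t\<bar> \<le> 1 + t\<^sup>2" by (simp add: power2_eq_square algebra_simps)
  then show "norm t \<le> norm (1 + t\<^sup>2)" by simp
 qed
qed simp

end

context
 fixes x :: "('a::complex_hilbert \<times> 'a) set" and e :: "real set \<Rightarrow> 'a op"
 assumes x: "closed_op x" and se: "is_spectral_measure (modulus x) e"
begin

private lemma e: "projection_valued_measure e" using se by (simp add: is_spectral_measure_def)

private lemma dom: "(\<exists>g. h = ct x g) \<longleftrightarrow> integrable (scalar_measure e h) (\<lambda>t. t\<^sup>2)"
proof -
 have "Domain (modulus x) = {h. \<exists>g. h = ct x g}" by (auto simp: modulus_def)
 then show ?thesis using se by (auto simp: is_spectral_measure_def)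
qed

private lemma form: "inner (st x h) (ct x h) = (\<integral>t. t \<partial>scalar_measure e (ct x h))"
proof -
 have "(ct x h, st x h) \<in> modulus x" by (auto simp: modulus_def)
 then have "cinner (st x h) (ct x h) = complex_of_real (\<integral>t. t \<partial>scalar_measure e (ct x h))"
  using se by (auto simp: is_spectral_measure_def)
 then show ?thesis by (metis Re_cinner Re_complex_of_real)
qed

private lemma integr: "integrable (scalar_measure e (ct x h)) (\<lambda>t. t)" by (rule scalar_integrable_id[OF e]) (use dom in blast)

private lemma sym: "inner (st x h) (ct x k) = inner (ct x h) (st x k)"
 using saD[OF pos_sa[OF st_pos[OF x]], of h "ct x k"] saD[OF pos_sa[OF ct_pos[OF x]], of h "st x k"]
 by (simp add: commuteD[OF ct_st[OF x]])

text \<open>A spectral measure is tied to |x| through its domain and the diagonal values of its form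
  only. Splitting the integral for u + v over A and its complement cancels the mixed terms, which
  makes |x| leave the range of e A invariant.\<close>

private lemma reduce:
 assumes A: "A \<in> sets borel"
 obtains k where "e A (ct x h) = ct x k" "e A (st x h) = st x k"
proof -
 note idem = isproj_idem[OF pv_isproj[OF e A]]
 have ex: "\<exists>k. e A (ct x h) = ct x k" if "A \<in> sets borel" for A h
  using scalar_integrable_restrict(1)[OF e that, of "ct x h" "\<lambda>t. t\<^sup>2"] dom by blast
 have zero: "inner (st x u) (ct x v) = 0" if u: "e A (ct x u) = ct x u" and v: "e A (ct x v) = 0" and A: "A \<in> sets borel" for A u v
 proof -
  have 1: "e A (ct x (u + v)) = ct x u" by (simp add: blin u v)
  have mA: "- A \<in> sets borel" using A by auto
  have 2: "e (- A) (ct x (u + v)) = ct x v" using pv_compl[OF e A, of "ct x (u + v)"] by (simp add: 1) (simp add: blin)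
  note int = integr[of "u + v"]
  have "(\<integral>t. t \<partial>scalar_measure e (ct x u)) + (\<integral>t. t \<partial>scalar_measure e (ct x v))
   = (\<integral>t. indicator A t * t \<partial>scalar_measure e (ct x (u + v))) + (\<integral>t. indicator (- A) t * t \<partial>scalar_measure e (ct x (u + v)))"
   using scalar_integrable_restrict(2)[OF e A int] scalar_integrable_restrict(2)[OF e mA int] 1 2 by simp
  also have "\<dots> = (\<integral>t. indicator A t * t + indicator (- A) t * t \<partial>scalar_measure e (ct x (u + v)))"
   using A mA int integrable_mult_indicator[of A _ "\<lambda>t. t", OF _ int] integrable_mult_indicator[of "- A" _ "\<lambda>t. t", OF _ int] e
   by (intro Bochner_Integration.integral_add[symmetric]) auto
  also have "\<dots> = (\<integral>t. t \<partial>scalar_measure e (ct x (u + v)))"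
   by (rule Bochner_Integration.integral_cong) (auto split: split_indicator)
  finally have "inner (st x u) (ct x u) + inner (st x v) (ct x v) = inner (st x (u + v)) (ct x (u + v))" unfolding form .
  then have "inner (st x u) (ct x v) + inner (st x v) (ct x u) = 0" by (simp add: blin inner_add)
  moreover have "inner (st x v) (ct x u) = inner (st x u) (ct x v)" using sym[of v u] by (simp add: inner_commute)
  ultimately show ?thesis by simp
 qed
 have stay: "e A (st x u) = st x u" if u: "e A (ct x u) = ct x u" and A: "A \<in> sets borel" for A u
 proof -
  have mA: "- A \<in> sets borel" using A by auto
  let ?S = "{w. inner (st x u) (e (- A) w) = 0}"
  have "closed ?S" by (intro closed_Collect_eq continuous_intros)
  moreover have "range (ct x) \<subseteq> ?S"
  proof clarify
   fix h
   obtain v where v: "e (- A) (ct x h) = ct x v" using ex[OF mA] by blast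
   have "e A (e (- A) (ct x h)) = 0" by (rule pv_disjoint[OF e A mA]) simp
   then have "e A (ct x v) = 0" by (simp add: v)
   then show "inner (st x u) (e (- A) (ct x h)) = 0" using zero[OF u _ A] v by simp
  qed
  ultimately have "closure (range (ct x)) \<subseteq> ?S" by (rule closure_minimal[rotated])
  then have "inner (st x u) (e (- A) (st x u)) = 0" using ct_dense[OF x] by blast
  then have "e (- A) (st x u) = 0" using isproj_inner[OF pv_isproj[OF e mA], of "st x u"] by (simp add: inner_commute)
  then show ?thesis using pv_compl[OF e A, of "st x u"] by simp
 qed
 obtain k where k: "e A (ct x h) = ct x k" using ex[OF A] by blast
 have mA: "- A \<in> sets borel" using A by auto
 have "e A (st x k) = st x k" by (rule stay[OF _ A]) (simp add: idem flip: k)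
 moreover have "e (- A) (ct x (h - k)) = ct x (h - k)"
  using pv_compl[OF e A, of "ct x h"] pv_Int[OF e mA mA, of "ct x h"] by (simp add: blin k)
 from stay[OF this mA] have "e A (st x (h - k)) = 0" using pv_compl[OF e A, of "st x (h - k)"] by simp
 ultimately have "e A (st x h) = st x k" by (simp add: blin)
 then show ?thesis using that k by blast
qed

text \<open>Reducing |x| twice shows that e A reduces |x|^2, so it commutes with (1 + |x|^2)^(-1) =
  bt and hence with the square roots \<open>ct\<close> and \<open>st\<close>.\<close>

private lemma comm:
 assumes A: "A \<in> sets borel"
 shows "e A (ct x h) = ct x (e A h)" "e A (st x h) = st x (e A h)"
proof -
 have "e A (bt x h) = bt x (e A h)" for h
 proof -
  obtain k where k: "e A (ct x (ct x h)) = ct x k" "e A (st x (ct x h)) = st x k" using reduce[OF A] by blast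
  obtain l where l: "e A (ct x (st x h)) = ct x l" "e A (st x (st x h)) = st x l" using reduce[OF A] by blast
  have "st x k = ct x l" using k(2) l(1) by (simp add: commuteD[OF ct_st[OF x]])
  then have "(ct x k, st x l) \<in> modulus x O modulus x" by (auto simp: modulus_def)
  then obtain m where m: "ct x k = bt x m" "st x l = m - bt x m" using modulus_sq[OF x] by blast
  have "e A h = e A (bt x h) + e A (h - bt x h)" by (simp add: blin)
  also have "\<dots> = m" using k(1) l(2) m by (simp add: ct_sq[OF x] st_sq[OF x])
  finally show ?thesis using k(1) m(1) by (simp add: ct_sq[OF x])
 qed
 then have "commute (e A) (bt x)" by (simp add: commute_def)
 then show "e A (ct x h) = ct x (e A h)" "e A (st x h) = st x (e A h)"
  using ct_commute[OF x] st_commute[OF x] by (auto simp: commute_def)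
qed

text \<open>The two projections commute. On a vector fixed by one and killed by the other, the
  integral of t - s is computed by both and gets opposite signs; so the vector is 0.\<close>

lemma spectral_halfline: "e {s<..} = sf x s"
proof (rule isproj_eqI)
 let ?A = "{s<..} :: real set"
 have A: "?A \<in> sets borel" by simp
 show "isproj (e ?A)" by (rule pv_isproj[OF e A])
 show "isproj (sf x s)" by (rule sf_isproj[OF x])
 have c: "e ?A (sf x s h) = sf x s (e ?A h)" for h using sf_commute[OF x, of "e ?A"] comm[OF A] by (simp add: commute_def)
 have aform: "inner (aop x s w) (ct x w) = (\<integral>t. t - s \<partial>scalar_measure e (ct x w))" for w
 proof -
  interpret finite_measure "scalar_measure e (ct x w)" by (rule scalar_measure_finite[OF e])
  have "measure (scalar_measure e (ct x w)) UNIV = (norm (ct x w))\<^sup>2"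
   using emeasure_scalar_measure[OF e, of UNIV "ct x w"] pv_UNIV[OF e] by (simp add: measure_def)
  then show ?thesis using integr[of w] e by (simp add: aop_apply inner_diff_left power2_norm_eq_inner form mult.commute)
 qed
 have null: "AE t in scalar_measure e h. t \<notin> B" if "e B h = 0" "B \<in> sets borel" for B h
  by (rule AE_I[of _ _ B]) (use that e in \<open>auto simp: emeasure_scalar_measure\<close>)
 have 1: "w = 0" if w: "e ?A w = w" "sf x s w = 0" for w
 proof -
  let ?M = "scalar_measure e (ct x w)"
  interpret finite_measure ?M by (rule scalar_measure_finite[OF e])
  have "e (- ?A) (ct x w) = 0" using pv_compl[OF e A, of "ct x w"] comm[OF A] w by simp
  then have pos: "AE t in ?M. t \<notin> - ?A" by (rule null) auto
  then have nn: "AE t in ?M. 0 \<le> t - s" by eventually_elim auto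
  have int: "integrable ?M (\<lambda>t. t - s)" using integr by simp
  have "(\<integral>t. t - s \<partial>?M) = 0" using sf_off[OF x w(2)] aform[of w] integral_nonneg_AE[OF nn] by simp
  then have "AE t in ?M. t - s = 0" using integral_nonneg_eq_0_iff_AE[OF int nn] by blast
  then have "AE t in ?M. False" using pos by eventually_elim auto
  then have "emeasure ?M UNIV = 0" using AE_iff_null_sets[of UNIV ?M] e by (auto simp: eventually_False ae_filter_eq_bot_iff)
  then have "ct x w = 0" using emeasure_scalar_measure[OF e, of UNIV "ct x w"] pv_UNIV[OF e] by simp
  then show ?thesis by (rule ct_inj[OF x])
 qed
 have 2: "w = 0" if w: "e ?A w = 0" "sf x s w = w" for w
 proof -
  let ?M = "scalar_measure e (ct x w)"
  have "e ?A (ct x w) = 0" using comm[OF A] w by (simp add: blinfun.zero_right)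
  then have "AE t in ?M. t \<notin> ?A" by (rule null) auto
  then have "AE t in ?M. 0 \<le> - (t - s)" by eventually_elim auto
  then have "0 \<le> (\<integral>t. - (t - s) \<partial>?M)" by (rule integral_nonneg_AE)
  then have "(\<integral>t. t - s \<partial>?M) \<le> 0" by (simp only: Bochner_Integration.integral_minus)
  then show ?thesis using sf_on[OF x w(2)] aform[of w] by linarith
 qed
 fix h
 show "e ?A h = h \<longleftrightarrow> sf x s h = h"
 proof
  assume h: "e ?A h = h"
  have "h - sf x s h = 0" by (rule 1) (simp_all add: blin c h isproj_idem[OF sf_isproj[OF x]])
  then show "sf x s h = h" by simp
 next
  assume h: "sf x s h = h"
  have "h - e ?A h = 0" by (rule 2) (simp_all add: blinfun.diff_right h isproj_idem[OF pv_isproj[OF e A]] flip: c)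
  then show "e ?A h = h" by simp
 qed
qed

end

text \<open>Resolves both choices in the definition of singular values: from here on they refer only
  to the projections \<open>sf x s\<close>.\<close>

theorem spectral_measure_abs:
 assumes x: "closed_op x"
 shows "spectral_measure (abs_graph x) {s<..} = sf x s"
proof -
 have "is_spectral_measure (modulus x) (spectral_measure (modulus x))"
  unfolding spectral_measure_def by (rule someI[of "is_spectral_measure (modulus x)"]) (rule modulus_spectral_measure[OF x])
 then show ?thesis unfolding abs_graph_modulus[OF x] by (rule spectral_halfline[OF x])
qed

section \<open>Von Neumann algebras\<close>

lemma scaleC_one: "1 *\<^sub>C x = (x::'a::complex_hilbert)" using scaleC_of_real[of 1 x] by simp

lemma radj_radj: "radj (radj a) = a" by (rule blinfun_eqI, rule inner_eqI) (metis radj inner_commute)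

lemma radj_comp: "radj (a o\<^sub>L b) = radj b o\<^sub>L radj a" by (rule blinfun_eqI, rule inner_eqI) (simp add: radj[symmetric])

lemma radj_add: "radj (a + b) = radj a + radj b"
 by (rule blinfun_eqI, rule inner_eqI) (simp add: radj[symmetric] blinfun.add_left inner_add)

lemma radj_diff: "radj (a - b) = radj a - radj b"
 by (rule blinfun_eqI, rule inner_eqI) (simp add: radj[symmetric] blinfun.diff_left inner_diff)

lemma radj_sa: "sa a \<Longrightarrow> radj a = a" by (rule blinfun_eqI, rule inner_eqI) (simp add: radj[symmetric] sa_def)

lemma radj_id: "radj I = I" by (rule radj_sa) (rule sa_id)

lemma radj_sc: "radj (sc c) = sc (cnj c)" by (rule blinfun_eqI, rule inner_eqI) (simp add: radj[symmetric] inner_scaleC)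

lemma radj_scaleR: "radj (r *\<^sub>R a) = r *\<^sub>R radj a"
 by (rule blinfun_eqI, rule inner_eqI) (simp add: radj[symmetric] blinfun.scaleR_left)

lemma norm_radj_le: "norm (radj a) \<le> norm a"
proof (rule norm_blinfun_bound)
 fix x
 have "(norm (radj a x))\<^sup>2 = inner (a (radj a x)) x" by (simp add: radj power2_norm_eq_inner)
 also have "\<dots> \<le> norm (a (radj a x)) * norm x" by (rule norm_cauchy_schwarz)
 also have "\<dots> \<le> norm a * norm (radj a x) * norm x" by (intro mult_right_mono norm_blinfun) auto
 finally show "norm (radj a x) \<le> norm a * norm x" by (cases "norm (radj a x) = 0") (auto simp: power2_eq_square mult_ac)
qed simp

lemma norm_radj: "norm (radj a) = norm a" using norm_radj_le[of a] norm_radj_le[of "radj a"] by (simp add: radj_radj)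

lemma pos_radj_self: "pos (radj a o\<^sub>L a)" unfolding pos_def sa_def by (simp add: radj[symmetric] radj'[symmetric])

lemma commute_radj2: "commute b (radj a) \<Longrightarrow> commute (radj b) a"
proof -
 assume c: "commute b (radj a)"
 have "radj (b o\<^sub>L radj a) = radj (radj a o\<^sub>L b)" by (rule arg_cong[of _ _ radj]) (rule blinfun_eqI, simp add: commuteD[OF c])
 then have "a o\<^sub>L radj b = radj b o\<^sub>L a" by (simp add: radj_comp radj_radj)
 then show ?thesis unfolding commute_def by (metis blinfun_apply_blinfun_compose)
qed

lemma commutant_iff: "b \<in> commutant M \<longleftrightarrow> b \<in> bounded_ops \<and> (\<forall>a\<in>M. commute b a)"
proof -
 have "commute b a \<longleftrightarrow> b o\<^sub>L a = a o\<^sub>L b" for a unfolding commute_def by (metis blinfun_apply_blinfun_compose blinfun_eqI)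
 then show ?thesis by (auto simp: commutant_def)
qed

text \<open>Supports are expressed through kernels: \<open>I - kerp a\<close> is the right support
  of a and \<open>I - kerp (radj a)\<close> the left support.\<close>

definition kerp :: "('a::{real_inner,banach} op) \<Rightarrow> 'a op"
 where "kerp a = proj {x. a x = 0}"

lemma kerp_isproj: "isproj (kerp a)" unfolding kerp_def by (intro isproj_proj closed_kernel)
lemma kerp_fix: "kerp a x = x \<longleftrightarrow> a x = 0" unfolding kerp_def by (subst proj_fix_iff[OF closed_kernel]) simp
lemma kerp_apply: "a (kerp a x) = 0" using kerp_fix isproj_idem[OF kerp_isproj] by blast

locale nc_algebra = fns_trace M \<tau>
 for M :: "('a::complex_hilbert op) set" and \<tau> +
 assumes vna: "von_neumann_algebra M"
begin

abbreviation "Proj \<equiv> projections M"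
abbreviation "\<tau>c p \<equiv> \<tau> (I - p)"

lemma mem_iff: "a \<in> M \<longleftrightarrow> a \<in> bounded_ops \<and> (\<forall>b\<in>commutant M. commute b a)"
proof -
 have "a \<in> M \<longleftrightarrow> a \<in> commutant (commutant M)" using vna by (simp add: von_neumann_algebra_def)
 then show ?thesis by (auto simp: commutant_iff[of a] commute_sym)
qed

lemma mem_bounded: "a \<in> M \<Longrightarrow> a \<in> bounded_ops" by (simp add: mem_iff)
lemma mem_commute: "a \<in> M \<Longrightarrow> b \<in> commutant M \<Longrightarrow> commute b a" by (simp add: mem_iff)

lemma memI_commute: "a \<in> M \<Longrightarrow> (\<And>b. commute b a \<Longrightarrow> commute b c) \<Longrightarrow> c \<in> M" unfolding mem_iff bounded_ops_iff by (meson commute_sym)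

lemma mem_radj: "a \<in> M \<Longrightarrow> radj a \<in> M" using vna adj_radj[OF mem_bounded] by (metis von_neumann_algebra_def)

lemma commutant_radj: "b \<in> commutant M \<Longrightarrow> radj b \<in> commutant M"
 unfolding commutant_iff by (auto intro: radj_bounded_ops commute_radj2 mem_radj)

lemma mem_intros:
 shows mem_add: "a \<in> M \<Longrightarrow> b \<in> M \<Longrightarrow> a + b \<in> M"
  and mem_diff: "a \<in> M \<Longrightarrow> b \<in> M \<Longrightarrow> a - b \<in> M"
  and mem_scaleR: "a \<in> M \<Longrightarrow> r *\<^sub>R a \<in> M"
  and mem_comp: "a \<in> M \<Longrightarrow> b \<in> M \<Longrightarrow> a o\<^sub>L b \<in> M"
  and mem_id: "I \<in> M" and mem_zero: "0 \<in> M" by (auto simp: mem_iff bounded_ops_iff commute_sym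
   intro!: commute_intros commute_sym[OF commute_add] commute_sym[OF commute_diff] commute_sym[OF commute_scaleR]
    commute_sym[OF commute_comp] commute_sym[OF commute_id] commute_sym[OF commute_zero])

lemma mem_limit:
 fixes a :: "nat \<Rightarrow> 'a op" and b :: "'a op"
 assumes "\<And>n. a n \<in> M" "\<And>h. (\<lambda>n. a n h) \<longlonglongrightarrow> b h"
 shows "b \<in> M"
proof -
 have "commute c b" if c: "\<And>n. commute c (a n)" for c unfolding commute_def
 proof
  fix h
  have "(\<lambda>n. c (a n h)) \<longlonglongrightarrow> c (b h)" by (intro tendsto_intros assms)
  then show "c (b h) = b (c h)" unfolding commuteD[OF c] using assms(2) LIMSEQ_unique by blast
 qed
 then show ?thesis using assms(1) unfolding mem_iff bounded_ops_iff by (meson commute_sym)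
qed

lemma mem_psqrt: "pos a \<Longrightarrow> a \<in> M \<Longrightarrow> psqrt a \<in> M" by (erule memI_commute) (rule psqrt_commute)

lemma mem_specproj: "sa a \<Longrightarrow> a \<in> M \<Longrightarrow> specproj a \<in> M" by (erule memI_commute) (rule specproj_commute)

lemma mem_proj:
 assumes S: "closed S" "subspace S" and c: "\<And>c x. x \<in> S \<Longrightarrow> c *\<^sub>C x \<in> S"
  and b: "\<And>b x. b \<in> commutant M \<Longrightarrow> x \<in> S \<Longrightarrow> b x \<in> S"
 shows "proj S \<in> M" unfolding mem_iff bounded_ops_iff
proof (intro conjI allI ballI)
 show "commute (proj S) (sc k)" for k by (rule commute_sym, rule commute_projI[OF S]) (auto simp: c radj_sc)
 show "commute b' (proj S)" if "b' \<in> commutant M" for b' by (rule commute_projI[OF S]) (use b that commutant_radj in auto)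
qed

lemma mem_kerp: "a \<in> M \<Longrightarrow> kerp a \<in> M" unfolding kerp_def
proof (rule mem_proj)
 assume a: "a \<in> M"
 show "c *\<^sub>C x \<in> {x. a x = 0}" if "x \<in> {x. a x = 0}" for c x using that bounded_opsD[OF mem_bounded[OF a]] by simp
 show "b x \<in> {x. a x = 0}" if "b \<in> commutant M" "x \<in> {x. a x = 0}" for b x
  using that commuteD[OF mem_commute[OF a that(1)], of x] by (simp add: blinfun.zero_right)
qed (rule closed_kernel)+

lemma projections_iff: "p \<in> Proj \<longleftrightarrow> p \<in> M \<and> isproj p" by (auto simp: projections_def projection_op_iff mem_bounded)

lemma proj_mem: "p \<in> Proj \<Longrightarrow> p \<in> M" and proj_isproj: "p \<in> Proj \<Longrightarrow> isproj p" by (simp_all add: projections_iff)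

lemma proj_kerp: "a \<in> M \<Longrightarrow> kerp a \<in> Proj" by (simp add: projections_iff mem_kerp kerp_isproj)

lemma pr_sa: "p \<in> Proj \<Longrightarrow> sa p" and pr_idem: "p \<in> Proj \<Longrightarrow> p (p h) = p h"
 and pr_norm: "p \<in> Proj \<Longrightarrow> norm (p h) \<le> norm h" and pr_radj: "p \<in> Proj \<Longrightarrow> radj p = p"
 and pr_inner: "p \<in> Proj \<Longrightarrow> inner (p x) y = inner x (p y)"
 by (auto simp: projections_iff isproj_idem isproj_norm radj_sa isproj_sa saD)

lemma proj_compl: "p \<in> Proj \<Longrightarrow> I - p \<in> Proj" by (simp add: projections_iff mem_intros isproj_compl)

lemma positive_cone_iff: "a \<in> positive_cone M \<longleftrightarrow> a \<in> M \<and> pos a" by (auto simp: positive_cone_def positive_op_iff mem_bounded)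

lemma proj_cone: "p \<in> Proj \<Longrightarrow> p \<in> positive_cone M" by (simp add: positive_cone_iff projections_iff isproj_pos)

lemma le_op_iff: "a \<in> M \<Longrightarrow> b \<in> M \<Longrightarrow> le_op a b \<longleftrightarrow> pos (b - a)"
 using mem_bounded[OF mem_diff] by (auto simp: le_op_def positive_op_iff)

text \<open>With c the square root of 1 - b^2, the operators b + i c and b - i c are unitary and
  have sum 2b. Affiliation only tests unitaries of the commutant, while membership in M tests all of
  it.\<close>

lemma self_adjoint_unitary:
 assumes b: "b \<in> commutant M" "sa b" "norm b \<le> 1"
 obtains u v where "u \<in> commutant M" "unitary_op u" "v \<in> commutant M" "unitary_op v" "2 *\<^sub>R b = u + v"
proof -
 define c where "c = psqrt (I - (b o\<^sub>L b))"
 have nb: "norm (b x) \<le> norm x" for x using norm_blinfun[of b x] b(3) by (meson mult_left_le_one_le norm_ge_zero order_trans)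
 have P: "pos (I - (b o\<^sub>L b))"
 proof (rule sa_pos_iff_norm)
  show "sa (b o\<^sub>L b)" by (rule sa_comp[OF b(2) b(2) commute_refl])
  show "norm ((b o\<^sub>L b) x) \<le> norm x" for x using nb[of x] nb[of "b x"] by simp
 qed
 have cc: "commute d c" if "commute d b" for d unfolding c_def by (rule psqrt_commute[OF P]) (intro commute_intros that)
 have csa: "sa c" unfolding c_def by (rule pos_sa[OF psqrt_pos[OF P]])
 have csq: "c (c x) = x - b (b x)" for x unfolding c_def psqrt_sq[OF P] by (simp add: blin)
 have cb: "b (c x) = c (b x)" for x by (rule commuteD[OF cc[OF commute_refl]])
 have bM: "b \<in> bounded_ops" "\<And>a. a \<in> M \<Longrightarrow> commute b a" using b(1) by (auto simp: commutant_iff)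
 have cM: "c \<in> commutant M" unfolding commutant_iff bounded_ops_iff using bM by (meson bounded_ops_iff cc commute_sym)
 have cbd: "c \<in> bounded_ops" using cM by (simp add: commutant_iff)
 have un: "b + (sc k o\<^sub>L c) \<in> commutant M \<and> unitary_op (b + (sc k o\<^sub>L c))" if k: "k = \<i> \<or> k = - \<i>" for k
 proof
  have kk: "k *\<^sub>C (k *\<^sub>C y) = - y" "cnj k = - k" for y :: 'a using k scaleC_of_real[of "-1" y] by (auto simp: scaleC_scaleC)
  have kb: "b (k *\<^sub>C y) = k *\<^sub>C b y" "c (k *\<^sub>C y) = k *\<^sub>C c y" for y using bounded_opsD[OF bM(1)] bounded_opsD[OF cbd] by auto
  show U: "b + (sc k o\<^sub>L c) \<in> commutant M" unfolding commutant_iff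
  proof (intro conjI ballI)
   show "b + (sc k o\<^sub>L c) \<in> bounded_ops" by (rule bounded_opsI)
     (simp add: blin bounded_opsD[OF bM(1)] bounded_opsD[OF cbd] scaleC_add_right scaleC_scaleC mult.commute)
   fix a assume a: "a \<in> M"
   have "commute a (sc k)" using mem_bounded[OF a] by (simp add: bounded_ops_iff)
   then show "commute (b + (sc k o\<^sub>L c)) a"
    using bM(2)[OF a] cM a by (intro commute_sym[of a] commute_intros) (auto simp: commutant_iff commute_sym)
  qed
  then have Ub: "b + (sc k o\<^sub>L c) \<in> bounded_ops" by (simp add: commutant_iff)
  have ra: "radj (b + (sc k o\<^sub>L c)) = b + (c o\<^sub>L sc (- k))"
   by (simp add: radj_add radj_comp radj_sc radj_sa[OF csa] radj_sa[OF b(2)] kk)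
  show "unitary_op (b + (sc k o\<^sub>L c))" unfolding unitary_op_def adj_radj[OF Ub] ra
  proof (intro conjI Ub)
   show "(b + (c o\<^sub>L sc (- k))) o\<^sub>L (b + (sc k o\<^sub>L c)) = I" by (rule blinfun_eqI)
     (simp add: blin kb kk csq cb scaleC_minus_left blin scaleC_add_right)
   show "(b + (sc k o\<^sub>L c)) o\<^sub>L (b + (c o\<^sub>L sc (- k))) = I" by (rule blinfun_eqI)
     (simp add: blin kb kk csq cb scaleC_minus_left blin scaleC_minus scaleC_add_right scaleC_diff)
  qed
 qed
 have "2 *\<^sub>R b = (b + (sc \<i> o\<^sub>L c)) + (b + (sc (-\<i>) o\<^sub>L c))"
  by (rule blinfun_eqI) (simp add: blinfun.add_left blinfun.scaleR_left scaleC_minus_left scaleR_2)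
 then show ?thesis using that un by blast
qed

text \<open>Every element of the commutant is a combination of its unitaries: split it into real and
  imaginary parts, scale these to contractions and apply
  \<open>self_adjoint_unitary\<close>.\<close>

lemma memI_unitary:
 assumes a: "a \<in> bounded_ops" and u: "\<And>u. u \<in> commutant M \<Longrightarrow> unitary_op u \<Longrightarrow> commute u a"
 shows "a \<in> M"
proof -
 have scal: "commute b a" if "commute (r *\<^sub>R b) a" "r \<noteq> 0" for b r
  using that by (auto simp: commute_def blinfun.scaleR_left blinfun.scaleR_right)
 have comm_scal: "r *\<^sub>R b \<in> commutant M" if "b \<in> commutant M" for b r
  using that by (auto simp: commutant_iff bounded_ops_iff intro!: commute_sym[OF commute_scaleR] intro: commute_sym)
 have sab: "commute b a" if b: "b \<in> commutant M" "sa b" for b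
 proof -
  define r where "r = 1 / (norm b + 1)"
  have r: "r > 0" by (simp add: r_def add_nonneg_pos)
  have "0 < norm b + 1" by (simp add: add_nonneg_pos)
  then have "norm (r *\<^sub>R b) \<le> 1" by (simp add: r_def divide_le_eq)
  then obtain u v where uv: "u \<in> commutant M" "unitary_op u" "v \<in> commutant M" "unitary_op v" "2 *\<^sub>R (r *\<^sub>R b) = u + v"
   using self_adjoint_unitary[of "r *\<^sub>R b"] comm_scal[OF b(1)] sa_scaleR[OF b(2)] by metis
  have "commute (u + v) a" using u[OF uv(1,2)] u[OF uv(3,4)] by (simp add: commute_def blin)
  then have "commute ((2 * r) *\<^sub>R b) a" using uv(5) by simp
  then show ?thesis by (rule scal) (use r in simp)
 qed
 have "commute b a" if b: "b \<in> commutant M" for b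
 proof -
  have rb: "radj b \<in> commutant M" by (rule commutant_radj[OF b])
  have bb: "b \<in> bounded_ops" "radj b \<in> bounded_ops" using b rb by (auto simp: commutant_iff)
  have 1: "commute (b + radj b) a"
  proof (rule sab)
   show "b + radj b \<in> commutant M" using b rb by (auto simp: commutant_iff bounded_ops_iff commute_def blin scaleC_add_right)
   have "radj (b + radj b) = b + radj b" by (simp add: radj_add radj_radj add.commute)
   then show "sa (b + radj b)" by (metis sa_def radj)
  qed
  have 2: "commute (sc \<i> o\<^sub>L (b - radj b)) a"
  proof (rule sab)
   show "sc \<i> o\<^sub>L (b - radj b) \<in> commutant M" unfolding commutant_iff
   proof (intro conjI ballI)
    show "sc \<i> o\<^sub>L (b - radj b) \<in> bounded_ops"
     by (rule bounded_opsI) (simp add: blin bounded_opsD[OF bb(1)] bounded_opsD[OF bb(2)] scaleC_diff)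
    fix d assume d: "d \<in> M"
    have "commute d (sc \<i>)" using mem_bounded[OF d] by (simp add: bounded_ops_iff)
    then show "commute (sc \<i> o\<^sub>L (b - radj b)) d"
     using b rb d by (intro commute_sym[of d] commute_intros) (auto simp: commutant_iff commute_sym)
   qed
   have "radj (sc \<i> o\<^sub>L (b - radj b)) = sc \<i> o\<^sub>L (b - radj b)"
    by (rule blinfun_eqI) (simp add: radj_comp radj_diff radj_radj radj_sc blinfun.diff_left
      bounded_opsD[OF bb(1)] bounded_opsD[OF bb(2)] scaleC_minus_left scaleC_diff blinfun.minus_right)
   then show "sa (sc \<i> o\<^sub>L (b - radj b))" by (metis sa_def radj)
  qed
  have ai: "a (\<i> *\<^sub>C y) = \<i> *\<^sub>C a y" for y by (rule bounded_opsD[OF a])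
  show ?thesis unfolding commute_def
  proof
   fix y
   have 3: "b (a y) + radj b (a y) = a (b y) + a (radj b y)" using 1 by (simp add: commute_def blin)
   have "\<i> *\<^sub>C (b (a y) - radj b (a y)) = \<i> *\<^sub>C (a (b y) - a (radj b y))" using 2 by (simp add: commute_def blin ai scaleC_diff)
   then have "(- \<i>) *\<^sub>C (\<i> *\<^sub>C (b (a y) - radj b (a y))) = (- \<i>) *\<^sub>C (\<i> *\<^sub>C (a (b y) - a (radj b y)))" by simp
   then have 4: "b (a y) - radj b (a y) = a (b y) - a (radj b y)" by (simp add: scaleC_scaleC scaleC_one)
   have "2 *\<^sub>R b (a y) = 2 *\<^sub>R a (b y)" unfolding scaleR_2 using arg_cong2[OF 3 4, of "(+)"] by simp
   then show "b (a y) = a (b y)" by simp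
  qed
 qed
 then show ?thesis using a by (simp add: mem_iff)
qed

end

section \<open>Traces of projections\<close>

lemma isproj_diff: "isproj p \<Longrightarrow> isproj q \<Longrightarrow> (\<And>h. q (p h) = p h) \<Longrightarrow> isproj (q - p)"
 using isproj_le_norm[of p q] by (auto simp: isproj_def blin intro!: sa_intros)

section \<open>Powers of a positive contraction\<close>

primrec opow :: "('a::real_normed_vector op) \<Rightarrow> nat \<Rightarrow> 'a op" where
 "opow Z 0 = I"
| "opow Z (Suc n) = Z o\<^sub>L opow Z n"

text \<open>The geometric sum 1 + Z + ... + Z^(n-1). It exhibits 1 - Z^n as a product of the
  commuting positive operators 1 - Z and \<open>gsum Z n\<close>.\<close>

primrec gsum :: "('a::real_normed_vector op) \<Rightarrow> nat \<Rightarrow> 'a op" where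
 "gsum Z 0 = 0"
| "gsum Z (Suc n) = gsum Z n + opow Z n"

lemma opow_commute: "commute d Z \<Longrightarrow> commute d (opow Z n)" by (induction n) (auto intro!: commute_intros)

lemma gsum_commute: "commute d Z \<Longrightarrow> commute d (gsum Z n)" by (induction n) (auto intro!: commute_intros opow_commute)

lemma opow_pos: "pos Z \<Longrightarrow> pos (opow Z n)" for Z :: "'a::{real_inner,banach} op"
 by (induction n) (auto intro!: pos_comp opow_commute commute_refl simp: pos_def[of I] sa_id)

lemma gsum_pos: "pos Z \<Longrightarrow> pos (gsum Z n)" for Z :: "'a::{real_inner,banach} op"
 by (induction n) (use opow_pos[of Z] in \<open>auto simp: pos_def blin inner_add intro!: sa_intros\<close>)

lemma gsum_telescope: "gsum Z n h - Z (gsum Z n h) = h - opow Z n h" for Z :: "'a::real_normed_vector op"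
proof (induction n)
 case (Suc n)
 have "gsum Z (Suc n) h - Z (gsum Z (Suc n) h) = (gsum Z n h - Z (gsum Z n h)) + opow Z n h - Z (opow Z n h)" by (simp add: blin)
 then show ?case using Suc by simp
qed (simp add: blinfun.zero_right)

lemma opow_intertwine: "(\<And>h. a (Z h) = Z' (a h)) \<Longrightarrow> a (opow Z n h) = opow Z' n (a h)" for a Z Z' :: "'a::real_normed_vector op"
 by (induction n) simp_all

lemma gsum_intertwine: "(\<And>h. a (Z h) = Z' (blinfun_apply a h)) \<Longrightarrow> a (gsum Z n h) = gsum Z' n (a h)" for a Z Z' :: "'a::real_normed_vector op"
 using opow_intertwine[of a Z Z'] by (induction n) (simp_all add: blin blinfun.zero_right)

lemma opow_add: "opow Z (m + n) h = opow Z m (opow Z n h)" by (induction m) simp_all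

text \<open>The moments t n = (Z^n k, k) decrease and converge, and norm (Z^n (k - Z k))^2 \<le> t
  (2n) - t (2n+1). So Z^n tends to 0 on the closed range of 1 - Z, whose orthogonal complement
  consists of the fixed vectors of Z.\<close>

lemma opow_limit:
 fixes Z :: "'a::{real_inner,banach} op"
 assumes Z: "pos Z" "pos (I - Z)"
 shows "(\<lambda>n. opow Z n h) \<longlonglongrightarrow> kerp (I - Z) h"
proof -
 note pp = opow_pos[OF Z(1)]
 have cZ: "opow Z n (Z k) = Z (opow Z n k)" for n k using opow_commute[OF commute_refl, of Z n] by (simp add: commute_def)
 have dec: "0 \<le> inner (opow Z n k - opow Z n (Z k)) k" for n k using posD[OF pos_comp[OF pp Z(2), of n], of k] cZ
  by (simp add: blin commute_def)
 have nZ: "norm (Z k) \<le> norm k" for k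
  using pos_norm_le[OF Z(1), of 1 k] posD[OF Z(2)] by (simp add: blin inner_diff power2_norm_eq_inner)
 have np: "norm (opow Z n k) \<le> norm k" for n k by (induction n) (auto intro: order_trans[OF nZ])
 have ran: "(\<lambda>n. opow Z n (k - Z k)) \<longlonglongrightarrow> 0" for k
 proof -
  define t where "t n = inner (opow Z n k) k" for n
  have tp: "0 \<le> t n" for n unfolding t_def by (rule posD[OF pp])
  have td: "t (Suc n) \<le> t n" for n using dec[of n k] by (simp add: t_def inner_diff cZ)
  have "decseq t" using td by (rule decseq_SucI)
  then have "convergent t" using decseq_convergent[of t 0] tp by (metis convergent_def)
  then obtain l where l: "t \<longlonglongrightarrow> l" by (auto simp: convergent_def)
  have sub: "(\<lambda>n. t (n + n)) \<longlonglongrightarrow> l" "(\<lambda>n. t (Suc (n + n))) \<longlonglongrightarrow> l"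
   by (rule LIMSEQ_subseq_LIMSEQ[OF l, of "\<lambda>n. n + n", unfolded o_def], simp add: strict_mono_def,
     rule LIMSEQ_subseq_LIMSEQ[OF l, of "\<lambda>n. Suc (n + n)", unfolded o_def], simp add: strict_mono_def)
  have lim0: "(\<lambda>n. t (n + n) - t (Suc (n + n))) \<longlonglongrightarrow> 0" using tendsto_diff[OF sub] by simp
  have bd: "(norm (opow Z n (k - Z k)))\<^sup>2 \<le> t (n + n) - t (Suc (n + n))" for n
  proof -
   have "(norm (opow Z n (k - Z k)))\<^sup>2 = inner (opow Z (n + n) (k - Z k)) (k - Z k)"
    by (simp add: power2_norm_eq_inner opow_add saD[OF pos_sa[OF pp], of n "opow Z n (k - Z k)"])
   also have "\<dots> = inner (opow Z (n + n) k - opow Z (n + n) (Z k)) k - inner (opow Z (n + n) (k - Z k)) (Z k)"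
    by (simp add: blin inner_diff)
   also have "inner (opow Z (n + n) (k - Z k)) (Z k) = inner (opow Z (Suc (n + n)) k - opow Z (Suc (n + n)) (Z k)) k"
    using saD[OF pos_sa[OF Z(1)], of "opow Z (n + n) (k - Z k)" k] by (simp add: blin)
   finally show ?thesis using dec[of "Suc (n + n)" k] by (simp add: t_def inner_diff cZ)
  qed
  have "(\<lambda>n. (norm (opow Z n (k - Z k)))\<^sup>2) \<longlonglongrightarrow> 0" by (rule tendsto_sandwich[OF _ _ tendsto_const lim0]) (use bd in auto)
  then have "(\<lambda>n. norm (opow Z n (k - Z k))) \<longlonglongrightarrow> 0" using tendsto_real_sqrt[of "\<lambda>n. (norm (opow Z n (k - Z k)))\<^sup>2" 0] by simp
  then show ?thesis by (rule tendsto_norm_zero_cancel)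
 qed
 let ?R = "closure (range (\<lambda>k. k - Z k))"
 have R: "closed ?R" "subspace ?R"
 proof -
  have "subspace (range (\<lambda>k. k - Z k))" by (intro linear_subspace_image subspace_UNIV bounded_linear.linear bounded_linear_intros)
  then show "subspace ?R" by (rule subspace_closure)
 qed simp
 have ran_cl: "(\<lambda>n. opow Z n s) \<longlonglongrightarrow> 0" if s: "s \<in> ?R" for s
 proof (rule LIMSEQ_I)
  fix r :: real assume r: "0 < r"
  obtain k where k: "norm ((k - Z k) - s) < r / 2"
   using s r by (auto simp: closure_approachable dist_norm dest!: spec[of _ "r / 2"])
  obtain n0 where n0: "\<And>n. n \<ge> n0 \<Longrightarrow> norm (opow Z n (k - Z k)) < r / 2" using LIMSEQ_D[OF ran[of k], of "r / 2"] r by auto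
  have "norm (opow Z n s - 0) < r" if "n \<ge> n0" for n
  proof -
   have "norm (opow Z n s) \<le> norm (opow Z n (k - Z k)) + norm (opow Z n ((k - Z k) - s))"
    using norm_triangle_ineq4[of "opow Z n (k - Z k)" "opow Z n ((k - Z k) - s)"] by (simp add: blin)
   also have "\<dots> < r / 2 + r / 2" using n0[OF that] np[of n "(k - Z k) - s"] k by linarith
   finally show ?thesis by simp
  qed
  then show "\<exists>n0. \<forall>n\<ge>n0. norm (opow Z n s - 0) < r" by blast
 qed
 define k0 where "k0 = h - proj ?R h"
 have k0: "Z k0 = k0"
 proof -
  have "inner k0 (k - Z k) = 0" for k unfolding k0_def
   by (rule proj_orth[OF R]) (use closure_subset[of "range (\<lambda>k. k - Z k)"] in auto)
  then have "inner k (k0 - Z k0) = inner k 0" for k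
   using saD[OF pos_sa[OF Z(1)], of k k0] inner_commute[of k0 k] inner_commute[of k0 "Z k"] by (simp add: inner_diff_right)
  then have "k0 - Z k0 = 0" by (rule inner_eqI)
  then show ?thesis by simp
 qed
 have "opow Z n k0 = k0" for n by (induction n) (simp_all add: k0)
 then have "(\<lambda>n. opow Z n (k0 + proj ?R h)) \<longlonglongrightarrow> k0 + 0"
  unfolding blinfun.add_right by (intro tendsto_add) (auto intro!: ran_cl proj_in[OF R])
 moreover have "kerp (I - Z) h = k0" unfolding kerp_def
 proof (rule proj_eqI[OF closed_kernel])
  show "k0 \<in> {x. (I - Z) x = 0}" using k0 by (simp add: blin)
  fix y assume "y \<in> {x. (I - Z) x = 0}"
  then have y: "Z y = y" by (simp add: blin)
  have "closed {s. inner s y = 0}" by (intro closed_Collect_eq continuous_intros)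
  moreover have "range (\<lambda>k. k - Z k) \<subseteq> {s. inner s y = 0}" using saD[OF pos_sa[OF Z(1)], of _ y] y by (auto simp: inner_diff)
  ultimately have "?R \<subseteq> {s. inner s y = 0}" by (rule closure_minimal[rotated])
  then show "inner (h - k0) y = 0" using proj_in[OF R, of h] by (auto simp: k0_def)
 qed
 ultimately show ?thesis by (simp add: k0_def)
qed

lemma kerp_cong: "(\<And>x. blinfun_apply a x = 0 \<longleftrightarrow> blinfun_apply b x = 0) \<Longrightarrow> kerp a = kerp b" by (simp add: kerp_def)

lemma kerp_radj_self: "kerp (radj a o\<^sub>L a) = kerp a"
proof (rule kerp_cong)
 fix x
 show "(radj a o\<^sub>L a) x = 0 \<longleftrightarrow> a x = 0" using radj[of a x "a x"] by (auto simp: blinfun.zero_right)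
qed

context nc_algebra
begin

lemma tau_zero: "\<tau> 0 = 0" using homogeneous[of 0 0] by (simp add: positive_cone_iff mem_zero pos_def sa_zero)

lemma tau_mono:
 assumes "a \<in> positive_cone M" "b \<in> positive_cone M" "pos (b - a)"
 shows "\<tau> a \<le> \<tau> b" using additive[OF assms(1), of "b - a"] assms by (simp add: positive_cone_iff mem_diff)

lemma tau_proj_mono:
 assumes "p \<in> Proj" "q \<in> Proj" "\<And>h. q (p h) = p h"
 shows "\<tau> p \<le> \<tau> q" using assms by (intro tau_mono proj_cone isproj_pos isproj_diff proj_isproj)

lemma tau_sup:
 fixes a :: "nat \<Rightarrow> 'a op"
 assumes a: "\<And>n. a n \<in> positive_cone M" and s: "s \<in> positive_cone M"
  and inc: "\<And>n m. n \<le> m \<Longrightarrow> pos (a m - a n)" and ub: "\<And>n. pos (s - a n)"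
  and lim: "\<And>h. (\<lambda>n. inner (a n h) h) \<longlonglongrightarrow> inner (s h) h"
 shows "\<tau> s = (SUP n. \<tau> (a n))"
proof -
 have m: "a n \<in> M" "s \<in> M" for n using a s by (auto simp: positive_cone_iff)
 have "\<tau> s = (SUP b\<in>range a. \<tau> b)"
 proof (rule normal)
  show "\<forall>b\<in>range a. \<forall>c\<in>range a. \<exists>d\<in>range a. le_op b d \<and> le_op c d"
  proof clarify
   fix i j
   show "\<exists>d\<in>range a. le_op (a i) d \<and> le_op (a j) d" by (rule bexI[of _ "a (max i j)"]) (simp_all add: le_op_iff m inc)
  qed
  show "\<forall>b\<in>range a. le_op b s" by (simp add: le_op_iff m ub)
  show "\<forall>u\<in>positive_cone M. (\<forall>b\<in>range a. le_op b u) \<longrightarrow> le_op s u"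
  proof (intro ballI impI)
   fix u assume u: "u \<in> positive_cone M" and le: "\<forall>b\<in>range a. le_op b u"
   have um: "u \<in> M" "sa u" using u by (auto simp: positive_cone_iff pos_sa)
   have "inner (a n h) h \<le> inner (u h) h" for n h using le posD[of "u - a n" h] by (simp add: le_op_iff m um blin inner_diff)
   then have "inner (s h) h \<le> inner (u h) h" for h using LIMSEQ_le_const2[OF lim] by blast
   then have "pos (u - s)" using um s by (auto simp: pos_def positive_cone_iff blin inner_diff intro!: sa_intros)
   then show "le_op s u" by (simp add: le_op_iff m um)
  qed
 qed (use a s in auto)
 then show ?thesis by (simp add: image_image)
qed

text \<open>With Z = 1 - radj a a, the fixed vectors of Z form the kernel of a; hence 1 - Z^n
  increases strongly to the right support of a, and normality of the trace applies.\<close>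

lemma tau_range_contr:
 assumes a: "a \<in> M" and n1: "norm a \<le> 1"
 shows "\<tau>c (kerp a) = (SUP n. \<tau> (I - opow (I - (radj a o\<^sub>L a)) n))"
  and "\<tau> (I - opow (I - (radj a o\<^sub>L a)) n) = \<tau> ((radj a o\<^sub>L a) o\<^sub>L gsum (I - (radj a o\<^sub>L a)) n)"
  and "I - opow (I - (radj a o\<^sub>L a)) n \<in> positive_cone M"
proof -
 define A where "A = radj a o\<^sub>L a"
 define Z where "Z = I - A"
 have AM: "A \<in> M" unfolding A_def by (intro mem_intros mem_radj a)
 have ZM: "Z \<in> M" unfolding Z_def by (intro mem_intros AM)
 have opM: "opow Z n \<in> M" for n by (induction n) (auto intro: mem_intros ZM)
 have Apos: "pos A" unfolding A_def by (rule pos_radj_self)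
 have nA: "norm (A x) \<le> norm x" for x
 proof -
  have "norm (A x) \<le> norm (radj a) * (norm a * norm x)" unfolding A_def using norm_blinfun[of "radj a" "a x"] norm_blinfun[of a x]
   by (simp add: mult_left_mono order_trans[OF norm_blinfun mult_left_mono])
  also have "\<dots> \<le> 1 * (1 * norm x)" by (intro mult_mono) (use n1 in \<open>auto simp: norm_radj\<close>)
  finally show ?thesis by simp
 qed
 have Zpos: "pos Z" unfolding Z_def by (rule sa_pos_iff_norm[OF pos_sa[OF Apos] nA])
 have IZ: "I - Z = A" by (simp add: Z_def)
 have IZpos: "pos (I - Z)" using Apos by (simp add: IZ)
 have pp: "pos (opow Z n)" for n by (rule opow_pos[OF Zpos])
 have tele: "I - opow Z n = A o\<^sub>L gsum Z n" for n using gsum_telescope[of Z n] by (intro blinfun_eqI) (simp add: blin Z_def)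
 have cA: "commute A (gsum Z n)" for n by (rule gsum_commute) (simp add: Z_def commute_intros)
 have pos1: "pos (I - opow Z n)" for n unfolding tele by (rule pos_comp[OF Apos gsum_pos[OF Zpos] cA])
 show cone: "I - opow (I - (radj a o\<^sub>L a)) n \<in> positive_cone M" for n
  using pos1[of n] mem_diff[OF mem_id opM, of n] by (simp add: positive_cone_iff Z_def A_def)
 show "\<tau> (I - opow (I - (radj a o\<^sub>L a)) n) = \<tau> ((radj a o\<^sub>L a) o\<^sub>L gsum (I - (radj a o\<^sub>L a)) n)"
  using tele[of n] by (simp add: Z_def A_def)
 have KA: "kerp (I - Z) = kerp a" unfolding IZ A_def by (rule kerp_radj_self)
 have lim: "(\<lambda>n. opow Z n h) \<longlonglongrightarrow> kerp a h" for h using opow_limit[OF Zpos IZpos, of h] unfolding KA .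
 have cop: "opow Z n (opow Z m h) = opow Z m (opow Z n h)" for n m h by (metis add.commute opow_add)
 have fixk: "opow Z n (kerp a h) = kerp a h" for n h
 proof (induction n)
  case (Suc n)
  have "Z (kerp a h) = kerp a h" by (simp add: Z_def A_def blin kerp_apply blinfun.zero_right)
  then show ?case using Suc by simp
 qed simp
 have kfix: "kerp a (opow Z n h) = kerp a h" for n h
 proof (rule inner_eqI)
  fix y
  have "inner y (kerp a (opow Z n h)) = inner (opow Z n (kerp a y)) h"
   using saD[OF isproj_sa[OF kerp_isproj], of a y "opow Z n h"] saD[OF pos_sa[OF pp], of n "kerp a y" h] by simp
  then show "inner y (kerp a (opow Z n h)) = inner y (kerp a h)"
   using saD[OF isproj_sa[OF kerp_isproj], of a y h] by (simp add: fixk)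
 qed
 have "\<tau>c (kerp a) = (SUP n. \<tau>c (opow Z n))"
 proof (rule tau_sup)
  show "I - opow Z n \<in> positive_cone M" for n using cone[of n] by (simp add: Z_def A_def)
  show "I - kerp a \<in> positive_cone M" by (intro proj_cone proj_compl proj_kerp a)
  show "(\<lambda>n. inner ((I - opow Z n) h) h) \<longlonglongrightarrow> inner ((I - kerp a) h) h" for h
   unfolding blinfun.diff_left by (intro tendsto_intros lim)
  show "pos ((I - opow Z m) - (I - opow Z n))" if "n \<le> m" for n m
  proof -
   have "(I - opow Z m) - (I - opow Z n) = opow Z n o\<^sub>L (I - opow Z (m - n))"
    using that by (intro blinfun_eqI) (simp add: blin opow_add[symmetric])
   moreover have "commute (opow Z n) (I - opow Z (m - n))" by (simp add: commute_def blin cop)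
   ultimately show ?thesis using pos_comp[OF pp pos1] by metis
  qed
  show "pos ((I - kerp a) - (I - opow Z n))" for n
  proof -
   have "(I - kerp a) - (I - opow Z n) = opow Z n o\<^sub>L (I - kerp a)" by (intro blinfun_eqI) (simp add: blin fixk)
   moreover have "commute (opow Z n) (I - kerp a)" by (simp add: commute_def blin fixk kfix)
   ultimately show ?thesis using pos_comp[OF pp isproj_pos[OF isproj_compl[OF kerp_isproj]]] by metis
  qed
 qed
 then show "\<tau>c (kerp a) = (SUP n. \<tau> (I - opow (I - (radj a o\<^sub>L a)) n))" by (simp add: Z_def A_def)
qed

text \<open>Murray--von Neumann equivalence of the left and right supports, without polar decomposition: the
 supports are increasing limits of \<open>1 - (1 - a\<^sup>*a)\<^sup>n\<close> and \<open>1 - (1 - aa\<^sup>*)\<^sup>n\<close>, which are of the form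
 \<open>b\<^sup>*b\<close> and \<open>bb\<^sup>*\<close>.\<close>

lemma tau_range:
 assumes a: "a \<in> M"
 shows "\<tau>c (kerp (radj a)) = \<tau>c (kerp a)"
proof -
 have main: "\<tau>c (kerp (radj a)) = \<tau>c (kerp a)" if a: "a \<in> M" and n1: "norm a \<le> 1" for a
 proof -
  define Z where "Z = I - (radj a o\<^sub>L a)"
  define Z' where "Z' = I - (a o\<^sub>L radj a)"
  have inter: "a (Z h) = Z' (a h)" for h by (simp add: Z_def Z'_def blin)
  have eq: "\<tau> ((radj a o\<^sub>L a) o\<^sub>L gsum Z n) = \<tau> ((a o\<^sub>L radj a) o\<^sub>L gsum Z' n)" for n
  proof -
   have ZM: "Z \<in> M" unfolding Z_def by (intro mem_intros mem_radj a)
   have opM: "opow Z n \<in> M" for n by (induction n) (auto intro: mem_intros ZM)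
   have GM: "gsum Z n \<in> M" by (induction n) (auto intro: mem_intros opM)
   have Zpos: "pos Z" unfolding Z_def
   proof (rule sa_pos_iff_norm)
    show "sa (radj a o\<^sub>L a)" by (rule pos_sa[OF pos_radj_self])
    fix x
    have "norm (radj a (a x)) \<le> norm (radj a) * (norm a * norm x)"
     by (rule order_trans[OF norm_blinfun mult_left_mono[OF norm_blinfun]]) simp
    also have "\<dots> \<le> 1 * (1 * norm x)" by (intro mult_mono) (use n1 in \<open>auto simp: norm_radj\<close>)
    finally show "norm ((radj a o\<^sub>L a) x) \<le> norm x" by simp
   qed
   have Gpos: "pos (gsum Z n)" by (rule gsum_pos[OF Zpos])
   define W where "W = psqrt (gsum Z n)"
   have WM: "W \<in> M" unfolding W_def by (rule mem_psqrt[OF Gpos GM])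
   have Wsa: "sa W" unfolding W_def by (rule pos_sa[OF psqrt_pos[OF Gpos]])
   have WW: "W (W h) = gsum Z n h" for h unfolding W_def by (rule psqrt_sq[OF Gpos])
   have "commute (radj a o\<^sub>L a) (gsum Z n)" by (rule gsum_commute) (simp add: Z_def commute_intros)
   then have "commute (radj a o\<^sub>L a) W" unfolding W_def by (rule psqrt_commute[OF Gpos])
   then have cW: "radj a (a (W h)) = W (radj a (a h))" for h by (simp add: commute_def)
   \<comment> \<open>W is the square root of the geometric sum. It commutes with radj a a, and a
     intertwines the two geometric sums; so radj b b and b radj b are the two increasing
     approximations of the supports.\<close>
   define b where "b = a o\<^sub>L W"
   have bM: "b \<in> M" unfolding b_def by (intro mem_intros a WM)
   have bh: "b h = a (W h)" for h by (simp add: b_def)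
   have rb: "radj b = W o\<^sub>L radj a" unfolding b_def by (simp add: radj_comp radj_sa[OF Wsa])
   have 1: "radj b o\<^sub>L b = (radj a o\<^sub>L a) o\<^sub>L gsum Z n" by (intro blinfun_eqI) (simp add: rb bh cW[symmetric] WW)
   have 2: "b o\<^sub>L radj b = (a o\<^sub>L radj a) o\<^sub>L gsum Z' n"
   proof (rule blinfun_eqI)
    fix h
    have c: "commute (a o\<^sub>L radj a) (gsum Z' n)" by (rule gsum_commute) (simp add: Z'_def commute_intros)
    have "a (gsum Z n (radj a h)) = gsum Z' n (a (radj a h))" by (rule gsum_intertwine) (rule inter)
    also have "\<dots> = a (radj a (gsum Z' n h))" using c by (simp add: commute_def)
    finally show "(b o\<^sub>L radj b) h = ((a o\<^sub>L radj a) o\<^sub>L gsum Z' n) h" by (simp add: rb bh WW)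
   qed
   show ?thesis using tracial[OF bM] unfolding adj_radj[OF mem_bounded[OF bM]] 1 2 .
  qed
  have n1': "norm (radj a) \<le> 1" using n1 by (simp add: norm_radj)
  have "\<tau>c (kerp (radj a)) = (SUP n. \<tau> ((a o\<^sub>L radj a) o\<^sub>L gsum Z' n))"
   using tau_range_contr(1)[OF mem_radj[OF a] n1'] tau_range_contr(2)[OF mem_radj[OF a] n1'] by (simp add: Z'_def radj_radj)
  also have "\<dots> = \<tau>c (kerp a)" using tau_range_contr(1)[OF a n1] tau_range_contr(2)[OF a n1] eq by (simp add: Z_def)
  finally show ?thesis .
 qed
 define r where "r = 1 / (norm a + 1)"
 have np: "0 < norm a + 1" by (simp add: add_nonneg_pos)
 then have r: "r > 0" by (simp add: r_def)
 have "norm (r *\<^sub>R a) \<le> 1" using np by (simp add: r_def divide_le_eq)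
 from main[OF mem_scaleR[OF a] this] show ?thesis using r by (simp add: radj_scaleR kerp_def blinfun.scaleR_left)
qed

text \<open>Pulls q back along a, at no cost in trace: the complement of the pullback is the right
  support of (1 - q) a, which is equivalent to its left support, and that one lies below 1 -
  q.\<close>

lemma tau_pull:
 assumes a: "a \<in> M" and q: "q \<in> Proj"
 shows "kerp ((I - q) o\<^sub>L a) \<in> Proj"
  and "\<tau> (I - kerp ((I - q) o\<^sub>L a)) \<le> \<tau>c q"
  and "q (a (kerp ((I - q) o\<^sub>L a) h)) = a (kerp ((I - q) o\<^sub>L a) h)"
proof -
 let ?b = "(I - q) o\<^sub>L a"
 have bM: "?b \<in> M" using proj_mem[OF q] a by (intro mem_intros)
 show K: "kerp ?b \<in> Proj" by (rule proj_kerp[OF bM])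
 have rb: "radj ?b = radj a o\<^sub>L (I - q)" using pr_sa[OF q] by (simp add: radj_comp radj_diff radj_id radj_sa)
 have "\<tau> (I - kerp ?b) = \<tau>c (kerp (radj ?b))" using tau_range[OF bM] by simp
 also have "\<dots> \<le> \<tau>c q"
 proof (rule tau_proj_mono)
  show "I - kerp (radj ?b) \<in> Proj" by (intro proj_compl proj_kerp mem_radj bM)
  show "I - q \<in> Proj" by (rule proj_compl[OF q])
  have k: "kerp (radj ?b) (q h) = q h" for h unfolding kerp_fix rb by (simp add: blin pr_idem[OF q] blinfun.zero_right)
  have "q (kerp (radj ?b) h) = q h" for h by (rule isproj_le_norm[OF proj_isproj[OF q] kerp_isproj k])
  then show "(I - q) ((I - kerp (radj ?b)) h) = (I - kerp (radj ?b)) h" for h by (simp add: blin)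
 qed
 finally show "\<tau> (I - kerp ?b) \<le> \<tau>c q" .
 show "q (a (kerp ?b h)) = a (kerp ?b h)" using kerp_apply[of ?b h] by (simp add: blin)
qed

lemma tau_compl_zero: "p \<in> Proj \<Longrightarrow> (\<And>\<epsilon>. \<epsilon> > 0 \<Longrightarrow> \<tau> p \<le> ennreal \<epsilon>) \<Longrightarrow> p = 0"
proof (rule faithful[OF proj_cone])
 assume a: "\<And>\<epsilon>. \<epsilon> > 0 \<Longrightarrow> \<tau> p \<le> ennreal \<epsilon>"
 show "\<tau> p = 0"
 proof (rule ccontr)
  assume "\<tau> p \<noteq> 0"
  moreover have fin: "\<tau> p < \<infinity>" using a[of 1] by (auto intro: le_less_trans)
  ultimately have "0 < enn2real (\<tau> p)" by (simp add: enn2real_positive_iff zero_less_iff_neq_zero)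
  then have "\<tau> p \<le> ennreal (enn2real (\<tau> p) / 2)" using a by simp
  then have "ennreal (enn2real (\<tau> p)) \<le> ennreal (enn2real (\<tau> p) / 2)" using fin by simp
  then show False using \<open>0 < enn2real (\<tau> p)\<close> by (simp add: ennreal_le_iff)
 qed
qed

text \<open>The infimum of p and q: a sum of two positive operators vanishes at a vector only where
  both do.\<close>

definition pmeet :: "'a op \<Rightarrow> 'a op \<Rightarrow> 'a op"
 where "pmeet p q = kerp ((I - p) + (I - q))"

lemma pmeet:
 assumes p: "p \<in> Proj" and q: "q \<in> Proj"
 shows "pmeet p q \<in> Proj" "pmeet p q h = h \<longleftrightarrow> p h = h \<and> q h = h"
  "p (pmeet p q h) = pmeet p q h" "q (pmeet p q h) = pmeet p q h"
  "\<tau>c (pmeet p q) \<le> \<tau>c p + \<tau>c q"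
proof -
 note pp = proj_isproj[OF p] and qq = proj_isproj[OF q]
 show m: "pmeet p q \<in> Proj" unfolding pmeet_def by (intro proj_kerp mem_intros proj_mem p q)
 show fix_iff: "pmeet p q h = h \<longleftrightarrow> p h = h \<and> q h = h" for h
 proof -
  have "h - p h = 0 \<and> h - q h = 0" if "(h - p h) + (h - q h) = 0"
  proof -
   have "inner (h - p h) h + inner (h - q h) h = 0" using that by (metis inner_add_left inner_zero_left)
   moreover have "inner (h - p h) h = (norm (h - p h))\<^sup>2" "inner (h - q h) h = (norm (h - q h))\<^sup>2"
    using isproj_inner[OF isproj_compl[OF pp], of h] isproj_inner[OF isproj_compl[OF qq], of h] by (simp_all add: blin)
   ultimately show ?thesis by (simp add: sum_power2_eq_zero_iff)
  qed
  then show ?thesis unfolding pmeet_def kerp_fix by (auto simp: blin)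
 qed
 show pm: "p (pmeet p q h) = pmeet p q h" and qm: "q (pmeet p q h) = pmeet p q h" for h
  using fix_iff[of "pmeet p q h"] pr_idem[OF m] by auto
 have dif: "isproj (p - pmeet p q)" by (rule isproj_diff[OF proj_isproj[OF m] pp pm])
 have dM: "p - pmeet p q \<in> Proj" using dif p m by (simp add: projections_iff mem_diff)
 \<comment> \<open>The projection p - (p \<and> q) is the right support of (1 - q) p. By
   \<open>tau_pull\<close> its trace is at most that of 1 - q, the parallelogram rule for
   projections.\<close>
 have K: "kerp ((I - q) o\<^sub>L p) = I - (p - pmeet p q)"
 proof (rule isproj_eqI[OF kerp_isproj isproj_compl[OF dif]])
  fix h
  have "kerp ((I - q) o\<^sub>L p) h = h \<longleftrightarrow> q (p h) = p h" unfolding kerp_fix by (auto simp: blin)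
  also have "\<dots> \<longleftrightarrow> pmeet p q (p h) = p h" using fix_iff[of "p h"] isproj_idem[OF pp] by auto
  also have "pmeet p q (p h) = pmeet p q h" by (rule isproj_le_norm[OF proj_isproj[OF m] pp pm])
  finally show "kerp ((I - q) o\<^sub>L p) h = h \<longleftrightarrow> (I - (p - pmeet p q)) h = h" by (auto simp: blin)
 qed
 have "\<tau> (p - pmeet p q) \<le> \<tau>c q" using tau_pull(2)[OF proj_mem[OF p] q] unfolding K by simp
 moreover have "\<tau>c (pmeet p q) = \<tau>c p + \<tau> (p - pmeet p q)"
  using additive[OF proj_cone[OF proj_compl[OF p]] proj_cone[OF dM]] by simp
 ultimately show "\<tau>c (pmeet p q) \<le> \<tau>c p + \<tau>c q" by (simp add: add_left_mono)
qed

lemma tau_incseq: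
 assumes e: "\<And>n. e n \<in> Proj" and inc: "\<And>n h. e (Suc n) (e n h) = e n h"
 obtains P where "P \<in> Proj" "\<And>h. (\<lambda>n. e n h) \<longlonglongrightarrow> P h" "\<And>n h. P (e n h) = e n h"
  "\<tau> P = (SUP n. \<tau> (e n))"
proof -
 obtain P where P: "isproj P" "\<And>h. (\<lambda>n. e n h) \<longlonglongrightarrow> P h" "\<And>n h. P (e n h) = e n h"
  using isproj_increasing_limit[of e] proj_isproj[OF e] inc by metis
 have PM: "P \<in> Proj" using P(1) mem_limit[OF proj_mem[OF e] P(2)] by (simp add: projections_iff)
 have le: "e m (e n h) = e n h" if "n \<le> m" for m n h
  using that by (induction m rule: dec_induct) (auto simp: pr_idem[OF e], metis inc)
 have "\<tau> P = (SUP n. \<tau> (e n))"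
 proof (rule tau_sup)
  show "e n \<in> positive_cone M" for n by (rule proj_cone[OF e])
  show "P \<in> positive_cone M" by (rule proj_cone[OF PM])
  show "pos (e m - e n)" if "n \<le> m" for n m by (intro isproj_pos isproj_diff proj_isproj e le that)
  show "pos (P - e n)" for n by (intro isproj_pos isproj_diff proj_isproj e P)
  show "(\<lambda>n. inner (e n h) h) \<longlonglongrightarrow> inner (P h) h" for h by (intro tendsto_inner P tendsto_const)
 qed
 then show ?thesis using that P PM by blast
qed

text \<open>Countable subadditivity for complements: iterated infima decrease, their complements
  increase, and the trace is continuous along the latter.\<close>

lemma tau_inf:
 fixes p :: "nat \<Rightarrow> 'a op"
 assumes p: "\<And>n. p n \<in> Proj"
 obtains P where "P \<in> Proj" "\<And>n h. p n (P h) = P h" "\<And>h. (\<And>n. p n h = h) \<Longrightarrow> P h = h"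
  "\<tau>c P \<le> (\<Sum>n. \<tau>c (p n))"
proof -
 define r where "r = rec_nat I (\<lambda>n q. pmeet q (p n))"
 have r0: "r 0 = I" and rS: "r (Suc n) = pmeet (r n) (p n)" for n by (simp_all add: r_def)
 have idP: "I \<in> Proj" by (simp add: projections_iff mem_id isproj_id)
 have rP: "r n \<in> Proj" for n by (induction n) (simp_all add: r0 rS idP pmeet(1) p)
 have dec: "r n (r (Suc n) h) = r (Suc n) h" for n h unfolding rS by (rule pmeet(3)[OF rP p])
 have rfix: "r n h = h" if "\<And>i. p i h = h" for n h by (induction n) (simp_all add: r0 rS pmeet(2)[OF rP p] that)
 have tr: "\<tau>c (r n) \<le> (\<Sum>i<n. \<tau>c (p i))" for n
 proof (induction n)
  case 0 then show ?case by (simp add: r0 tau_zero)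
 next
  case (Suc n)
  show ?case unfolding rS using pmeet(5)[OF rP p, of n n] Suc by (simp add: add_right_mono order_trans)
 qed
 define e where "e n = I - r n" for n
 have eP: "e n \<in> Proj" for n unfolding e_def by (rule proj_compl[OF rP])
 have "e (Suc n) (e n h) = e n h" for n h using isproj_le_norm[OF proj_isproj[OF rP] proj_isproj[OF rP] dec, of n h]
  by (simp add: e_def blin)
 then obtain Q where Q: "Q \<in> Proj" "\<And>h. (\<lambda>n. e n h) \<longlonglongrightarrow> Q h" "\<And>n h. Q (e n h) = e n h"
  "\<tau> Q = (SUP n. \<tau> (e n))" using tau_incseq[of e, OF eP] by metis
 have eQ: "e n (Q h) = e n h" for n h by (rule isproj_le_norm[OF proj_isproj[OF eP] proj_isproj[OF Q(1)] Q(3)])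
 show ?thesis
 proof (rule that[of "I - Q"])
  show "I - Q \<in> Proj" by (rule proj_compl[OF Q(1)])
  fix n h
  have "e (Suc n) (h - Q h) = 0" by (simp add: blin eQ)
  then have "r (Suc n) (h - Q h) = h - Q h" by (simp add: e_def blinfun.diff_left)
  then have "p n (h - Q h) = h - Q h" unfolding rS by (simp add: pmeet(2)[OF rP p])
  then show "p n ((I - Q) h) = (I - Q) h" by (simp add: blin)
 next
  fix h assume "\<And>n. p n h = h"
  then have "e n h = 0" for n by (simp add: e_def blin rfix)
  then have "(\<lambda>n. 0) \<longlonglongrightarrow> Q h" using Q(2)[of h] by simp
  from LIMSEQ_unique[OF tendsto_const this] show "(I - Q) h = h" by (simp add: blin)
 next
  have "\<tau> (e n) \<le> (\<Sum>i. \<tau>c (p i))" for n unfolding e_def by (rule order_trans[OF tr sum_le_suminf]) auto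
  then show "\<tau>c (I - Q) \<le> (\<Sum>n. \<tau>c (p n))" by (simp add: Q(4) SUP_le_iff)
 qed
qed

text \<open>The complements increase strongly to some projection P of M, and I - P lies below every
  e n, so it is 0.\<close>

lemma decreases_to_zero_strong:
 assumes "decreases_to_zero M e"
 shows "(\<lambda>n. e n h) \<longlonglongrightarrow> 0" "e n \<in> Proj" "n \<le> m \<Longrightarrow> e n (e m h) = e m h"
proof -
 show e: "e n \<in> Proj" for n using assms by (simp add: decreases_to_zero_def)
 have dec: "e n (e (Suc n) h) = e (Suc n) h" for n h
 proof -
  have "pos (e n - e (Suc n))" using assms by (simp add: decreases_to_zero_def le_op_iff proj_mem[OF e])
  from posD[OF this, of "e (Suc n) h"]
  have "(norm (e (Suc n) h))\<^sup>2 \<le> (norm (e n (e (Suc n) h)))\<^sup>2" using isproj_inner[OF proj_isproj[OF e], of n "e (Suc n) h"]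
   by (simp add: blin inner_diff pr_idem[OF e] power2_norm_eq_inner)
  then show ?thesis using isproj_pythagoras[OF proj_isproj[OF e], of "e (Suc n) h" n] by simp
 qed
 show "e n (e m h) = e m h" if "n \<le> m" for n m h using that
 proof (induction m arbitrary: h rule: dec_induct)
  case (step m)
  then have "e n (e m (e (Suc m) h)) = e m (e (Suc m) h)" by blast
  then show ?case by (simp add: dec)
 qed (simp add: pr_idem[OF e])
 define p where "p n = I - e n" for n
 have p: "p n \<in> Proj" for n unfolding p_def by (rule proj_compl[OF e])
 have "p (Suc n) (p n h) = p n h" for n h using isproj_le_norm[OF proj_isproj[OF e] proj_isproj[OF e] dec, of n h]
  by (simp add: p_def blin)
 then obtain P where P: "P \<in> Proj" "\<And>h. (\<lambda>n. p n h) \<longlonglongrightarrow> P h" "\<And>n h. P (p n h) = p n h" using tau_incseq[of p, OF p] by metis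
 have pP: "p n (P h) = p n h" for n h by (rule isproj_le_norm[OF proj_isproj[OF p] proj_isproj[OF P(1)] P(3)])
 have Q: "I - P \<in> Proj" by (rule proj_compl[OF P(1)])
 have "le_op (I - P) (e n)" for n
 proof -
  have "isproj (e n - (I - P))"
  proof (rule isproj_diff[OF proj_isproj[OF Q] proj_isproj[OF e]])
   fix h
   show "e n ((I - P) h) = (I - P) h" using pP[of n h] by (simp add: p_def blin algebra_simps)
  qed
  then show ?thesis by (simp add: le_op_iff proj_mem[OF Q] proj_mem[OF e] isproj_pos)
 qed
 then have "I - P = 0" using assms Q unfolding decreases_to_zero_def by blast
 then have "P h = h" for h by (metis blinfun.zero_left blinfun.diff_left eq_iff_diff_eq_0 id_blinfun.rep_eq id_apply)
 then have "(\<lambda>n. h - p n h) \<longlonglongrightarrow> h - h" using P(2)[of h] by (intro tendsto_intros) simp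
 then show "(\<lambda>n. e n h) \<longlonglongrightarrow> 0" by (simp add: p_def blin)
qed

lemma cone_radj: "a \<in> M \<Longrightarrow> radj a o\<^sub>L a \<in> positive_cone M" by (simp add: positive_cone_iff mem_comp mem_radj pos_radj_self)

lemma tau_radj: "a \<in> M \<Longrightarrow> \<tau> (radj a o\<^sub>L a) = \<tau> (a o\<^sub>L radj a)" using tracial[of a] adj_radj[OF mem_bounded] by metis

text \<open>The operators f - f e_n f increase strongly to f, so normality gives convergence of
  their traces; finiteness of the trace of f allows the subtraction.\<close>

lemma tau_compress_to_zero:
 assumes e: "decreases_to_zero M e" and f: "f \<in> Proj" and fin: "\<tau> f < \<infinity>"
 shows "(\<lambda>n. \<tau> (radj (e n o\<^sub>L f) o\<^sub>L (e n o\<^sub>L f))) \<longlonglongrightarrow> 0"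
proof -
 note ep = decreases_to_zero_strong(2)[OF e] and e0 = decreases_to_zero_strong(1)[OF e]
  and ele = decreases_to_zero_strong(3)[OF e]
 have fsa: "sa f" and ff: "f (f h) = f h" for h using pr_sa[OF f] pr_idem[OF f] by auto
 define c where "c n = (radj (e n o\<^sub>L f) o\<^sub>L (e n o\<^sub>L f))" for n
 have ch: "c n h = f (e n (f h))" for n h using pr_idem[OF ep] by (simp add: c_def radj_comp radj_sa[OF fsa] pr_radj[OF ep])
 have cM: "c n \<in> positive_cone M" for n unfolding c_def by (intro cone_radj mem_intros proj_mem ep f)
 have cform: "inner (c n h) h = (norm (e n (f h)))\<^sup>2" for n h
  using saD[OF fsa, of "e n (f h)" h] isproj_inner[OF proj_isproj[OF ep], of n "f h"] by (simp add: ch)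
 have dform: "inner ((f - c n) h) h = (norm (f h - e n (f h)))\<^sup>2" for n h
  using isproj_inner[OF proj_isproj[OF f], of h] isproj_pythagoras[OF proj_isproj[OF ep], of "f h" n]
  by (simp add: blin inner_diff cform)
 have sac: "sa (c n)" for n using cM by (simp add: positive_cone_iff pos_sa)
 have dpos: "pos (f - c n)" for n unfolding pos_def by (simp add: dform sac fsa sa_diff)
 have dM: "f - c n \<in> positive_cone M" for n using dpos cM f by (simp add: positive_cone_iff projections_iff mem_diff)
 have "\<tau> f = (SUP n. \<tau> (f - c n))"
 proof (rule tau_sup[OF dM proj_cone[OF f]])
  show "pos (f - (f - c n))" for n using cM by (simp add: positive_cone_iff)
  show "(\<lambda>n. inner ((f - c n) h) h) \<longlonglongrightarrow> inner (f h) h" for h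
  proof -
   have "(\<lambda>n. inner (f h) h - (norm (e n (f h)))\<^sup>2) \<longlonglongrightarrow> inner (f h) h - (norm (0::'a))\<^sup>2" by (intro tendsto_intros e0)
   then show ?thesis by (simp add: blin inner_diff cform)
  qed
  show "pos ((f - c m) - (f - c n))" if "n \<le> m" for n m
  proof -
   have "(norm (e m (f h)))\<^sup>2 \<le> (norm (e n (f h)))\<^sup>2" for h
   proof -
    have "e m (e n (f h)) = e m (f h)" by (rule isproj_le_norm[OF proj_isproj[OF ep] proj_isproj[OF ep] ele[OF that]])
    then show ?thesis using pr_norm[OF ep, of m "e n (f h)"] by (simp add: power_mono)
   qed
   then show ?thesis unfolding pos_def by (auto simp: blin inner_diff cform intro!: sa_intros sac fsa)
  qed
 qed
 moreover have "incseq (\<lambda>n. \<tau> (f - c n))"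
 proof (rule incseq_SucI, rule tau_mono[OF dM dM])
  fix n
  have "(norm (e (Suc n) (f h)))\<^sup>2 \<le> (norm (e n (f h)))\<^sup>2" for h
  proof -
   have "e (Suc n) (e n (f h)) = e (Suc n) (f h)" by (rule isproj_le_norm[OF proj_isproj[OF ep] proj_isproj[OF ep] ele]) simp
   then show ?thesis using pr_norm[OF ep, of "Suc n" "e n (f h)"] by (simp add: power_mono)
  qed
  then show "pos ((f - c (Suc n)) - (f - c n))" unfolding pos_def by (auto simp: blin inner_diff cform intro!: sa_intros sac fsa)
 qed
 ultimately have lim: "(\<lambda>n. \<tau> (f - c n)) \<longlonglongrightarrow> \<tau> f" using LIMSEQ_SUP by metis
 have "\<tau> (c n) = \<tau> f - \<tau> (f - c n)" for n
 proof -
  have "\<tau> (c n + (f - c n)) = \<tau> (c n) + \<tau> (f - c n)" by (rule additive[OF cM dM])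
  moreover have "\<tau> (f - c n) \<noteq> \<infinity>" using tau_mono[OF dM proj_cone[OF f], of n] cM fin by (auto simp: positive_cone_iff top_unique)
  ultimately show ?thesis by (simp add: ennreal_add_diff_cancel_right)
 qed
 moreover have "(\<lambda>n. \<tau> f - \<tau> (f - c n)) \<longlonglongrightarrow> \<tau> f - \<tau> f"
  by (rule tendsto_diff_ennreal_general[OF tendsto_const lim]) (use fin in auto)
 ultimately show ?thesis using fin by (simp add: c_def)
qed

text \<open>Chebyshev's inequality with E the spectral projection of radj a a - s^2 for (0,
  \<infinity>): s^2 E \<le> radj a a, and a is bounded by s on the complement of E.\<close>

lemma tau_chebyshev:
 assumes a: "a \<in> M" and s: "0 < s"
 obtains p where "p \<in> Proj" "\<And>h. norm (a (p h)) \<le> s * norm h"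
  "ennreal (s\<^sup>2) * \<tau>c p \<le> \<tau> (radj a o\<^sub>L a)"
proof -
 define A where "A = (radj a o\<^sub>L a) - s\<^sup>2 *\<^sub>R I"
 have Asa: "sa A" unfolding A_def by (intro sa_intros pos_sa pos_radj_self)
 have AM: "A \<in> M" unfolding A_def by (intro mem_intros mem_radj a)
 define E where "E = specproj A"
 have E: "E \<in> Proj" "isproj E" unfolding E_def by (simp_all add: projections_iff mem_specproj[OF Asa AM] specproj_isproj[OF Asa])
 have idpos: "pos (I :: 'a op)" by (simp add: pos_def sa_id)
 have Aform: "inner (A h) h = (norm (a h))\<^sup>2 - s\<^sup>2 * (norm h)\<^sup>2" for h
  unfolding power2_norm_eq_inner A_def by (simp add: blin blinfun.scaleR_left inner_diff radj'[symmetric] radj inner_commute)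
 have on: "s\<^sup>2 * (norm (E h))\<^sup>2 \<le> (norm (a (E h)))\<^sup>2" for h
  using specproj_on_pos(1)[OF Asa idpos, of "E h"] isproj_idem[OF E(2)] Aform[of "E h"] by (simp add: E_def commute_def)
 have off: "(norm (a (h - E h)))\<^sup>2 \<le> s\<^sup>2 * (norm (h - E h))\<^sup>2" for h
  using specproj_off_neg[OF Asa idpos, of "h - E h"] isproj_idem[OF E(2)] Aform[of "h - E h"]
  by (simp add: E_def commute_def blin)
 have cE: "radj a (a (E h)) = E (radj a (a h))" for h
 proof -
  have "commute (radj a o\<^sub>L a) A" unfolding A_def by (intro commute_intros)
  from specproj_commute[OF Asa this] show ?thesis by (simp add: commute_def E_def)
 qed
 have pyth: "(norm (a h))\<^sup>2 = (norm (a (E h)))\<^sup>2 + (norm (a (h - E h)))\<^sup>2" for h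
 proof -
  have "inner (a (E h)) (a (h - E h)) = inner (E h) (radj a (a (h - E h)))" by (simp add: radj)
  also have "radj a (a (h - E h)) = radj a (a h) - E (radj a (a h))" by (simp add: blin cE)
  also have "inner (E h) \<dots> = 0" using saD[OF isproj_sa[OF E(2)], of h] isproj_idem[OF E(2)] by (simp add: blin inner_diff)
  finally have o: "inner (a (E h)) (a (h - E h)) = 0" .
  have "a h = a (E h) + a (h - E h)" by (simp add: blin)
  then show ?thesis using o unfolding power2_norm_eq_inner by (simp add: inner_add inner_commute)
 qed
 have "pos ((radj a o\<^sub>L a) - s\<^sup>2 *\<^sub>R E)" unfolding pos_def
 proof (intro conjI allI sa_intros pos_sa[OF pos_radj_self] isproj_sa[OF E(2)])
  fix h
  have "inner (((radj a o\<^sub>L a) - s\<^sup>2 *\<^sub>R E) h) h = (norm (a h))\<^sup>2 - s\<^sup>2 * (norm (E h))\<^sup>2"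
   using isproj_inner[OF E(2), of h] radj[of a h "a h"]
   by (simp add: blin blinfun.scaleR_left inner_diff power2_norm_eq_inner inner_commute)
  also have "\<dots> \<ge> 0" using on[of h] pyth[of h] by (smt (verit) zero_le_power2)
  finally show "0 \<le> inner (((radj a o\<^sub>L a) - s\<^sup>2 *\<^sub>R E) h) h" .
 qed
 moreover have "s\<^sup>2 *\<^sub>R E \<in> positive_cone M" using isproj_pos[OF E(2)] proj_mem[OF E(1)]
  by (auto simp: positive_cone_iff pos_def blinfun.scaleR_left intro!: mem_scaleR sa_scaleR)
 ultimately have "\<tau> (s\<^sup>2 *\<^sub>R E) \<le> \<tau> (radj a o\<^sub>L a)" using cone_radj[OF a] tau_mono by blast
 then have t: "ennreal (s\<^sup>2) * \<tau> E \<le> \<tau> (radj a o\<^sub>L a)" using homogeneous[OF proj_cone[OF E(1)], of "s\<^sup>2"] by simp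
 show ?thesis
 proof (rule that[of "I - E"])
  show "I - E \<in> Proj" by (rule proj_compl[OF E(1)])
  show "ennreal (s\<^sup>2) * \<tau>c (I - E) \<le> \<tau> (radj a o\<^sub>L a)" using t by simp
  fix h
  have "(norm (a (h - E h)))\<^sup>2 \<le> (s * norm (h - E h))\<^sup>2" using off[of h] by (simp add: power_mult_distrib)
  then have "norm (a (h - E h)) \<le> s * norm (h - E h)" by (rule power2_le_imp_le) (use s in simp)
  also have "\<dots> \<le> s * norm h" using isproj_norm[OF isproj_compl[OF E(2)], of h] s by (simp add: blin)
  finally show "norm (a ((I - E) h)) \<le> s * norm h" by (simp add: blin)
 qed
qed

end

section \<open>Measurable operators\<close>

lemma closed_subspace_eq_UNIV:
 fixes S :: "'a::{real_inner,banach} set"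
 assumes "closed S" "subspace S" "\<And>d. (\<And>s. s \<in> S \<Longrightarrow> inner d s = 0) \<Longrightarrow> d = 0"
 shows "S = UNIV"
proof -
 have "h \<in> S" for h
 proof -
  have "h - proj S h = 0" by (rule assms(3)) (rule proj_orth[OF assms(1,2)])
  then show ?thesis using proj_in[OF assms(1,2), of h] by simp
 qed
 then show ?thesis by blast
qed

lemma op_graph_iff [simp]: "(g, k) \<in> op_graph a \<longleftrightarrow> k = a g" by (auto simp: op_graph_def)

definition padd :: "('a::complex_hilbert \<times> 'a) set \<Rightarrow> ('a \<times> 'a) set \<Rightarrow> ('a \<times> 'a) set"
 where "padd x y = {(g, h + h') | g h h'. (g, h) \<in> x \<and> (g, h') \<in> y}"

lemma padd_iff: "(g, k) \<in> padd x y \<longleftrightarrow> (\<exists>h h'. k = h + h' \<and> (g, h) \<in> x \<and> (g, h') \<in> y)" by (auto simp: padd_def)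

lemma strong_sum_padd: "strong_sum x y = closure (padd x y)" by (simp add: strong_sum_def padd_def)

lemma linear_graphI:
 assumes "\<And>g h h'. (g, h) \<in> x \<Longrightarrow> (g, h') \<in> x \<Longrightarrow> h = h'" "(0, 0) \<in> x"
  "\<And>g h g' h'. (g, h) \<in> x \<Longrightarrow> (g', h') \<in> x \<Longrightarrow> (g + g', h + h') \<in> x"
  "\<And>c g h. (g, h) \<in> x \<Longrightarrow> (c *\<^sub>C g, c *\<^sub>C h) \<in> x"
 shows "linear_graph x" unfolding linear_graph_def by (intro conjI single_valuedI) (use assms in blast)+

lemma linear_graphD:
 assumes "linear_graph x"
 shows "(0, 0) \<in> x" "(g, h) \<in> x \<Longrightarrow> (g', h') \<in> x \<Longrightarrow> (g + g', h + h') \<in> x"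
  "(g, h) \<in> x \<Longrightarrow> (c *\<^sub>C g, c *\<^sub>C h) \<in> x" using assms unfolding linear_graph_def by blast+

lemma linear_graph_padd:
 assumes x: "linear_graph x" and y: "linear_graph y" shows "linear_graph (padd x y)"
proof (rule linear_graphI)
 show "h = h'" if "(g, h) \<in> padd x y" "(g, h') \<in> padd x y" for g h h'
  using that linear_graph_unique[OF x] linear_graph_unique[OF y] unfolding padd_iff by blast
 show "(0, 0) \<in> padd x y" unfolding padd_iff using linear_graphD(1)[OF x] linear_graphD(1)[OF y] by force
 show "(g + g', h + h') \<in> padd x y" if a: "(g, h) \<in> padd x y" "(g', h') \<in> padd x y" for g h g' h'
 proof -
  obtain k l k' l' where "h = k + l" "(g, k) \<in> x" "(g, l) \<in> y" "h' = k' + l'" "(g', k') \<in> x" "(g', l') \<in> y"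
   using a unfolding padd_iff by blast
  then show ?thesis unfolding padd_iff using linear_graphD(2)[OF x] linear_graphD(2)[OF y]
   by (intro exI[of _ "k + k'"] exI[of _ "l + l'"]) auto
 qed
 show "(c *\<^sub>C g, c *\<^sub>C h) \<in> padd x y" if "(g, h) \<in> padd x y" for c g h
  using that linear_graphD(3)[OF x] linear_graphD(3)[OF y] unfolding padd_iff by (metis scaleC_add_right)
qed

lemma linear_graph_lmul:
 assumes x: "linear_graph x" and a: "a \<in> bounded_ops" shows "linear_graph (x O op_graph a)"
proof (rule linear_graphI)
 show "h = h'" if hh: "(g, h) \<in> x O op_graph a" "(g, h') \<in> x O op_graph a" for g h h'
 proof -
  obtain l l' where l: "(g, l) \<in> x" "h = a l" "(g, l') \<in> x" "h' = a l'" using hh by auto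
  then show ?thesis using linear_graph_unique[OF x l(1,3)] by simp
 qed
 show "(0, 0) \<in> x O op_graph a" using linear_graphD(1)[OF x] by (auto simp: relcomp_unfold intro!: exI[of _ 0] simp: blinfun.zero_right)
 show "(g + g', h + h') \<in> x O op_graph a" if hh: "(g, h) \<in> x O op_graph a" "(g', h') \<in> x O op_graph a" for g h g' h'
 proof -
  obtain l l' where l: "(g, l) \<in> x" "h = a l" "(g', l') \<in> x" "h' = a l'" using hh by auto
  show ?thesis by (rule relcompI[OF linear_graphD(2)[OF x l(1,3)]]) (simp add: l blin)
 qed
 show "(c *\<^sub>C g, c *\<^sub>C h) \<in> x O op_graph a" if hh: "(g, h) \<in> x O op_graph a" for c g h
 proof -
  obtain l where l: "(g, l) \<in> x" "h = a l" using hh by auto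
  show ?thesis by (rule relcompI[OF linear_graphD(3)[OF x l(1)]]) (simp add: l bounded_opsD[OF a])
 qed
qed

lemma linear_graph_rmul:
 assumes x: "linear_graph x" and a: "a \<in> bounded_ops" shows "linear_graph (op_graph a O x)"
proof (rule linear_graphI)
 show "h = h'" if "(g, h) \<in> op_graph a O x" "(g, h') \<in> op_graph a O x" for g h h' using that linear_graph_unique[OF x] by auto
 show "(0, 0) \<in> op_graph a O x" using linear_graphD(1)[OF x] by (auto simp: relcomp_unfold blinfun.zero_right)
 show "(g + g', h + h') \<in> op_graph a O x" if "(g, h) \<in> op_graph a O x" "(g', h') \<in> op_graph a O x" for g h g' h'
  using that linear_graphD(2)[OF x] by (auto simp: relcomp_unfold blin)
 show "(c *\<^sub>C g, c *\<^sub>C h) \<in> op_graph a O x" if "(g, h) \<in> op_graph a O x" for c g h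
  using that linear_graphD(3)[OF x] by (auto simp: relcomp_unfold bounded_opsD[OF a])
qed

lemma linear_graph_op: "a \<in> bounded_ops \<Longrightarrow> linear_graph (op_graph a)"
 by (rule linear_graphI) (auto simp: blinfun.zero_right blin bounded_opsD)

lemma closed_op_graph: "closed (op_graph a)"
proof -
 have "closed {p. snd p = a (fst p)}" by (intro closed_Collect_eq continuous_intros)
 moreover have "{p. snd p = a (fst p)} = op_graph a" by (auto simp: op_graph_def)
 ultimately show ?thesis by simp
qed

text \<open>The spectral measure of h - sf x s h is carried by [0, s], so this vector lies in the
  domain by \<open>modulus_domain\<close>, and \<open>sf_off_norm\<close> bounds its image.\<close>

lemma spectral_cut:
 assumes x: "closed_op x" and s: "0 \<le> s"
 shows "\<exists>k. (h - sf x s h, k) \<in> x \<and> norm k \<le> s * norm h"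
proof -
 define w where "w = h - sf x s h"
 note R = sf_resolution[OF x]
 have w0: "sf x s w = 0" by (simp add: w_def blin isproj_idem[OF sf_isproj[OF x]])
 interpret finite_measure "mu (sf x) w" by (rule mu_finite[OF R])
 have "AE t in mu (sf x) w. t \<notin> {s<..}" by (rule AE_I[of _ _ "{s<..}"]) (auto simp: mu_Ioi[OF R] w0)
 then have "AE t in mu (sf x) w. norm (t\<^sup>2) \<le> s\<^sup>2" using mu_nonneg[OF R, of w] by eventually_elim (auto intro!: power_mono)
 then have "integrable (mu (sf x) w) (\<lambda>t. t\<^sup>2)" by (rule integrable_const_bound) auto
 then obtain g where g: "w = ct x g" using modulus_domain[OF x] by blast
 have "ct x (sf x s g) = 0" using w0 by (simp add: g sf_ct[OF x])
 then have "sf x s g = 0" by (rule ct_inj[OF x])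
 from sf_off_norm[OF x this s] have "(norm (dt x g))\<^sup>2 \<le> (s * norm (ct x g))\<^sup>2" by (simp add: dt_norm[OF x] power_mult_distrib)
 then have "norm (dt x g) \<le> s * norm w" unfolding g by (rule power2_le_imp_le) (use s in simp)
 also have "\<dots> \<le> s * norm h"
  using isproj_norm[OF isproj_compl[OF sf_isproj[OF x]], of s h] s by (simp add: w_def blin mult_left_mono)
 finally show ?thesis using dt_in[OF x, of g] unfolding w_def[symmetric] g by blast
qed

section \<open>Affiliation and the min-max description of singular values\<close>

context nc_algebra
begin

lemma unitary_commutant:
 assumes u: "u \<in> commutant M" "unitary_op u"
 shows "radj u \<in> commutant M" "unitary_op (radj u)" "radj u (u h) = h" "u (radj u h) = h"
  "inner (u g) (u h) = inner g h"
proof -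
 have ub: "u \<in> bounded_ops" using u by (simp add: commutant_iff)
 show ru: "radj u \<in> commutant M" by (rule commutant_radj[OF u(1)])
 have rub: "radj u \<in> bounded_ops" using ru by (simp add: commutant_iff)
 have 1: "radj u o\<^sub>L u = I" "u o\<^sub>L radj u = I" using u(2) adj_radj[OF ub] by (auto simp: unitary_op_def)
 show "unitary_op (radj u)" using 1 by (simp add: unitary_op_def adj_radj[OF rub] radj_radj rub)
 show 2: "radj u (u h) = h" for h using 1(1) by (metis blinfun_apply_blinfun_compose id_blinfun.rep_eq id_apply)
 show "u (radj u h) = h" using 1(2) by (metis blinfun_apply_blinfun_compose id_blinfun.rep_eq id_apply)
 show "inner (u g) (u h) = inner g h" by (simp add: radj 2)
qed

lemma affiliatedI:
 assumes "\<And>u g h. u \<in> commutant M \<Longrightarrow> unitary_op u \<Longrightarrow> (g, h) \<in> x \<Longrightarrow> (u g, u h) \<in> x"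
 shows "affiliated M x" unfolding affiliated_def
proof (intro ballI impI)
 fix u assume u: "u \<in> commutant M" "unitary_op u"
 have "(g, h) \<in> (\<lambda>(g, h). (u g, u h)) ` x" if "(g, h) \<in> x" for g h
  using assms[OF unitary_commutant(1,2)[OF u] that] unitary_commutant(4)[OF u]
  by (intro image_eqI[of _ _ "(radj u g, radj u h)"]) auto
 then show "(\<lambda>(g, h). (u g, u h)) ` x = x" using assms[OF u] by auto
qed

lemma affiliatedD: "affiliated M x \<Longrightarrow> u \<in> commutant M \<Longrightarrow> unitary_op u \<Longrightarrow> (g, h) \<in> x \<Longrightarrow> (u g, u h) \<in> x"
 unfolding affiliated_def by (metis (mono_tags, lifting) case_prod_conv image_eqI)

lemma unitary_commute: "a \<in> M \<Longrightarrow> u \<in> commutant M \<Longrightarrow> u (a h) = a (u h)" using mem_commute commuteD by blast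

abbreviation "meas \<equiv> measurable_ops M \<tau>"

lemma meas_closed: "x \<in> meas \<Longrightarrow> closed_op x" and meas_affiliated: "x \<in> meas \<Longrightarrow> affiliated M x"
 by (auto simp: measurable_ops_def closed_op_def)

lemma meas_linear: "x \<in> meas \<Longrightarrow> linear_graph x" by (simp add: measurable_ops_def)

lemma meas_preserves:
 assumes "x \<in> meas" "u \<in> commutant M" "unitary_op u"
 shows "preserves u x" using assms unitary_commutant(5) by (auto simp: preserves_def measurable_ops_def affiliated_def)

lemma meas_mem:
 assumes x: "x \<in> meas"
 shows "ct x \<in> M" "dt x \<in> M" "sf x s \<in> Proj"
proof -
 note c = meas_closed[OF x]
 note p = preserves_bt[OF c meas_preserves[OF x]]
 show ct: "ct x \<in> M" by (rule memI_unitary[OF ct_bounded[OF c] ct_commute[OF c p]])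
 show "dt x \<in> M" by (rule memI_unitary[OF dt_bounded[OF c] preserves_dt[OF c meas_preserves[OF x]]])
 have "sf x s \<in> M" by (rule memI_unitary[OF sf_bounded[OF c] sf_commute[OF c ct_commute[OF c p] st_commute[OF c p]]])
 then show "sf x s \<in> Proj" by (simp add: projections_iff sf_isproj[OF c])
qed

definition bdd_on :: "('a \<times> 'a) set \<Rightarrow> 'a op \<Rightarrow> real \<Rightarrow> bool"
 where "bdd_on T p c \<longleftrightarrow> p \<in> Proj \<and> (\<forall>h. \<exists>k. (p h, k) \<in> T \<and> norm k \<le> c * norm h)"

text \<open>\<open>Sm T f\<close> expresses \<open>\<mu>\<^sub>t(T) \<le> f(t)\<close> for \<open>t > 0\<close> through the min-max description of the singular
 values; it also makes sense for graphs that are not closed.\<close>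

definition Sm :: "('a \<times> 'a) set \<Rightarrow> (real \<Rightarrow> real) \<Rightarrow> bool"
 where "Sm T f \<longleftrightarrow> (\<forall>t>0. \<exists>p. bdd_on T p (f t) \<and> \<tau>c p \<le> ennreal t)"

text \<open>The form in which density is used throughout. The infimum P of the projections I - q_n
  fixes d, while its trace is at most 1/(n+1) for every n; faithfulness gives P = 0.\<close>

lemma tau_dense:
 assumes "\<And>t. t > 0 \<Longrightarrow> \<exists>q\<in>Proj. \<tau>c q \<le> ennreal t \<and> q d = 0"
 shows "d = 0"
proof -
 have "\<exists>q\<in>Proj. \<tau>c q \<le> ennreal (1 / real (Suc n)) \<and> q d = 0" for n by (rule assms) simp
 then obtain q where q: "\<And>n. q n \<in> Proj" "\<And>n. \<tau>c (q n) \<le> ennreal (1 / real (Suc n))" "\<And>n. q n d = 0" by metis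
 obtain P where P: "P \<in> Proj" "\<And>n h. (I - q n) (P h) = P h"
  "\<And>h. (\<And>n. (I - q n) h = h) \<Longrightarrow> P h = h" using tau_inf[of "\<lambda>n. I - q n", OF proj_compl[OF q(1)]] by metis
 have "\<tau> P \<le> ennreal \<epsilon>" if e: "\<epsilon> > 0" for \<epsilon>
 proof -
  obtain n where n: "inverse (real (Suc n)) < \<epsilon>" using reals_Archimedean[OF e] by blast
  have "\<tau> P \<le> \<tau>c (q n)" by (rule tau_proj_mono[OF P(1) proj_compl[OF q(1)] P(2)])
  also have "\<dots> \<le> ennreal (1 / real (Suc n))" by (rule q)
  also have "\<dots> \<le> ennreal \<epsilon>" using n by (intro ennreal_leI) (simp add: inverse_eq_divide)
  finally show ?thesis .
 qed
 then have "P = 0" by (rule tau_compl_zero[OF P(1)])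
 moreover have "P d = d" by (rule P(3)) (simp add: blin q(3))
 ultimately show ?thesis by simp
qed

lemma bdd_on_op:
 assumes lin: "linear_graph T" and aff: "affiliated M T" and b: "bdd_on T p c"
 obtains a where "a \<in> M" "\<And>h. (p h, a h) \<in> T" "\<And>h. norm (a h) \<le> c * norm h"
proof -
 have p: "p \<in> Proj" using b by (simp add: bdd_on_def)
 obtain f where f: "\<And>h. (p h, f h) \<in> T" "\<And>h. norm (f h) \<le> c * norm h" using b unfolding bdd_on_def by metis
 have fu: "f h = k" if "(p h, k) \<in> T" for h k using linear_graph_unique[OF lin f(1) that] .
 have bl: "bounded_linear f"
 proof (rule bounded_linear_intro[where K = c])
  show "f (g + h) = f g + f h" for g h by (rule fu) (simp add: blin linear_graphD(2)[OF lin] f)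
  show "f (r *\<^sub>R h) = r *\<^sub>R f h" for r h
   by (rule fu) (use linear_graphD(3)[OF lin f(1)[of h], of "complex_of_real r"] in \<open>simp add: blinfun.scaleR_right scaleC_of_real\<close>)
  show "norm (f h) \<le> norm h * c" for h using f(2)[of h] by (simp add: mult.commute)
 qed
 define a where "a = Blinfun f"
 have a: "a h = f h" for h by (simp add: a_def bounded_linear_Blinfun_apply[OF bl])
 have "a \<in> M"
 proof (rule memI_unitary)
  show "a \<in> bounded_ops"
  proof (rule bounded_opsI)
   show "a (\<i> *\<^sub>C h) = \<i> *\<^sub>C a h" for h
    unfolding a by (rule fu) (simp add: bounded_opsD[OF mem_bounded[OF proj_mem[OF p]]] linear_graphD(3)[OF lin] f)
  qed
  fix u assume u: "u \<in> commutant M" "unitary_op u"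
  show "commute u a" unfolding commute_def a
  proof
   fix h
   have "(p (u h), u (f h)) \<in> T" using affiliatedD[OF aff u f(1)[of h]] unitary_commute[OF proj_mem[OF p] u(1)] by simp
   then show "u (f h) = f (u h)" using fu by metis
  qed
 qed
 then show ?thesis using that f a by metis
qed

lemma meas_bdd:
 assumes x: "x \<in> meas" and t: "t > 0"
 obtains p c where "bdd_on x p c" "0 \<le> c" "\<tau>c p \<le> ennreal t"
proof -
 obtain p a where p: "p \<in> Proj" "\<tau>c p < ennreal t" "op_graph p O x = op_graph a" using x t unfolding measurable_ops_def by blast
 have "bdd_on x p (norm a)" unfolding bdd_on_def
 proof (intro conjI allI p(1))
  fix h
  have "(h, a h) \<in> op_graph p O x" unfolding p(3) by simp
  then have "(p h, a h) \<in> x" by auto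
  then show "\<exists>k. (p h, k) \<in> x \<and> norm k \<le> norm a * norm h" using norm_blinfun by blast
 qed
 then show ?thesis using that[of p "norm a"] p(2) by auto
qed

text \<open>The heart of the min-max principle: x is bounded by s on p, while above s it is strictly
  larger, so p and \<open>sf x s\<close> have no common nonzero vector. Then \<open>sf x s\<close>
  is the right support of (1 - p) sf x s, and \<open>tau_pull\<close> bounds its trace.\<close>

lemma spectral_le:
 assumes x: "x \<in> meas" and b: "bdd_on x p s" and s: "0 \<le> s"
 shows "\<tau> (sf x s) \<le> \<tau>c p"
proof -
 note c = meas_closed[OF x] and E = meas_mem(3)[OF x, of s]
 have p: "p \<in> Proj" using b by (simp add: bdd_on_def)
 have zero: "h = 0" if h: "p h = h" "sf x s h = h" for h
 proof -
  obtain k where k: "(h, k) \<in> x" "norm k \<le> s * norm h" using b h(1) unfolding bdd_on_def by metis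
  obtain g where g: "h = ct x g" "k = dt x g" using graph_param[OF c k(1)] .
  have "ct x (sf x s g - g) = 0" using h(2) by (simp add: g sf_ct[OF c] blin)
  then have "sf x s g = g" using ct_inj[OF c] by (metis eq_iff_diff_eq_0)
  then have "g = 0" using sf_on_strict[OF c _ s] k(2) by (simp add: g dt_norm[OF c])
  then show ?thesis by (simp add: g blinfun.zero_right)
 qed
 have "kerp ((I - p) o\<^sub>L sf x s) = I - sf x s"
 proof (rule isproj_eqI[OF kerp_isproj isproj_compl[OF proj_isproj[OF E]]])
  fix h
  have "kerp ((I - p) o\<^sub>L sf x s) h = h \<longleftrightarrow> p (sf x s h) = sf x s h" unfolding kerp_fix by (auto simp: blin)
  also have "\<dots> \<longleftrightarrow> sf x s h = 0" using zero[of "sf x s h"] pr_idem[OF E] by (auto simp: blinfun.zero_right)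
  finally show "kerp ((I - p) o\<^sub>L sf x s) h = h \<longleftrightarrow> (I - sf x s) h = h" by (auto simp: blin)
 qed
 then show ?thesis using tau_pull(2)[OF proj_mem[OF E] p] by simp
qed

lemma singular_value_sf:
 "x \<in> meas \<Longrightarrow> singular_value \<tau> x t = Inf {ennreal s | s. 0 \<le> s \<and> \<tau> (sf x s) \<le> ennreal t}"
 unfolding singular_value_def using spectral_measure_abs[OF meas_closed] by simp

lemma singular_fun_le:
 assumes x: "x \<in> meas" and b: "bdd_on x p s" and s: "0 \<le> s" and t: "\<tau>c p \<le> ennreal t"
 shows "singular_fun \<tau> x t \<le> s"
proof -
 have "\<tau> (sf x s) \<le> ennreal t" using spectral_le[OF x b s] t by (rule order_trans)
 then have "singular_value \<tau> x t \<le> ennreal s" unfolding singular_value_sf[OF x] using s by (intro Inf_lower) blast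
 then show ?thesis unfolding singular_fun_def using s by (rule enn2real_leI[rotated])
qed

text \<open>The infimum defining the singular value is attained: the projections just above it
  increase to \<open>sf\<close> at the infimum by right continuity, and the trace is normal.
  Measurability of x makes the infimum finite.\<close>

lemma tau_sf_singular:
 assumes x: "x \<in> meas" and t: "t > 0"
 shows "\<tau> (sf x (singular_fun \<tau> x t)) \<le> ennreal t"
proof -
 note c = meas_closed[OF x] and E = meas_mem(3)[OF x]
 define s0 where "s0 = singular_fun \<tau> x t"
 obtain p b where p: "bdd_on x p b" "0 \<le> b" "\<tau>c p \<le> ennreal t" using meas_bdd[OF x t] .
 have "\<tau> (sf x b) \<le> ennreal t" using spectral_le[OF x p(1,2)] p(3) by (rule order_trans)
 then have "singular_value \<tau> x t \<le> ennreal b" unfolding singular_value_sf[OF x] using p(2) by (intro Inf_lower) blast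
 then have fin: "singular_value \<tau> x t = ennreal s0"
  unfolding s0_def singular_fun_def by (metis ennreal_enn2real ennreal_less_top le_less_trans)
 have above: "\<tau> (sf x s) \<le> ennreal t" if s: "s0 < s" for s
 proof -
  have "0 \<le> s0" by (simp add: s0_def singular_fun_def)
  then have "singular_value \<tau> x t < ennreal s" unfolding fin using s by (simp add: ennreal_less_iff)
  then obtain r where r: "0 \<le> r" "\<tau> (sf x r) \<le> ennreal t" "ennreal r < ennreal s"
   unfolding singular_value_sf[OF x] Inf_less_iff by blast
  then have "r \<le> s" by (simp add: ennreal_less_iff)
  have "\<tau> (sf x s) \<le> \<tau> (sf x r)" by (rule tau_proj_mono[OF E E sf_le[OF c \<open>r \<le> s\<close>]])
  then show ?thesis using r(2) by (rule order_trans)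
 qed
 have "sf x (s0 + 1 / real (Suc (Suc n))) (sf x (s0 + 1 / real (Suc n)) h) = sf x (s0 + 1 / real (Suc n)) h" for n h
  by (rule sf_le[OF c]) (simp add: frac_le)
 then obtain P where P: "P \<in> Proj" "\<And>h. (\<lambda>n. sf x (s0 + 1 / real (Suc n)) h) \<longlonglongrightarrow> P h"
  "\<tau> P = (SUP n. \<tau> (sf x (s0 + 1 / real (Suc n))))" using tau_incseq[of "\<lambda>n. sf x (s0 + 1 / real (Suc n))", OF E] by metis
 have "(\<lambda>n. sf x (s0 + 1 / real (Suc n)) h) \<longlonglongrightarrow> sf x s0 h" for h using sf_resolution[OF c] by (simp add: resolution_def)
 then have "P h = sf x s0 h" for h using P(2) LIMSEQ_unique by blast
 then have "P = sf x s0" by (rule blinfun_eqI)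
 then show ?thesis unfolding s0_def[symmetric] using P(3) above by (simp add: SUP_le_iff)
qed

lemma Sm_singular: "x \<in> meas \<Longrightarrow> Sm x (singular_fun \<tau> x)" unfolding Sm_def bdd_on_def
proof (intro allI impI)
 fix t :: real assume x: "x \<in> meas" and t: "t > 0"
 let ?s = "singular_fun \<tau> x t"
 have "\<exists>k. ((I - sf x ?s) h, k) \<in> x \<and> norm k \<le> ?s * norm h" for h
  using spectral_cut[OF meas_closed[OF x], of ?s h] by (simp add: blin singular_fun_def)
 then show "\<exists>p. (p \<in> Proj \<and> (\<forall>h. \<exists>k. (p h, k) \<in> x \<and> norm k \<le> ?s * norm h)) \<and> \<tau>c p \<le> ennreal t"
  using tau_sf_singular[OF x t] proj_compl[OF meas_mem(3)[OF x]] by (intro exI[of _ "I - sf x ?s"]) auto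
qed

lemma singular_fun_le_Sm: "x \<in> meas \<Longrightarrow> Sm x f \<Longrightarrow> t > 0 \<Longrightarrow> 0 \<le> f t \<Longrightarrow> singular_fun \<tau> x t \<le> f t"
 unfolding Sm_def using singular_fun_le by blast

lemma singular_fun_nonneg: "0 \<le> singular_fun \<tau> x t" by (simp add: singular_fun_def)

lemma singular_fun_antimono:
 assumes x: "x \<in> meas" and t: "0 < t" "t \<le> t'" shows "singular_fun \<tau> x t' \<le> singular_fun \<tau> x t"
proof -
 obtain p where p: "bdd_on x p (singular_fun \<tau> x t)" "\<tau>c p \<le> ennreal t" using Sm_singular[OF x] t unfolding Sm_def by blast
 show ?thesis by (rule singular_fun_le[OF x p(1) singular_fun_nonneg]) (use p(2) t in \<open>auto intro: order_trans ennreal_leI\<close>)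
qed

lemma SmD: "Sm T f \<Longrightarrow> t > 0 \<Longrightarrow> \<exists>p. bdd_on T p (f t) \<and> \<tau>c p \<le> ennreal t" by (simp add: Sm_def)

lemma bdd_on_mono: "bdd_on T p c \<Longrightarrow> T \<subseteq> U \<Longrightarrow> c \<le> d \<Longrightarrow> bdd_on U p d"
 unfolding bdd_on_def by (meson mult_right_mono norm_ge_zero order_trans subsetD)

lemma Sm_mono: "Sm T f \<Longrightarrow> T \<subseteq> U \<Longrightarrow> (\<And>t. t > 0 \<Longrightarrow> f t \<le> g t) \<Longrightarrow> Sm U g" unfolding Sm_def using bdd_on_mono by metis

lemma Sm_lmul: "Sm T f \<Longrightarrow> Sm (T O op_graph a) (\<lambda>t. norm a * f t)" unfolding Sm_def bdd_on_def
proof (intro allI impI)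
 fix t :: real
 assume "\<forall>t>0. \<exists>p. (p \<in> Proj \<and> (\<forall>h. \<exists>k. (p h, k) \<in> T \<and> norm k \<le> f t * norm h)) \<and> \<tau>c p \<le> ennreal t"
  and "0 < t"
 then obtain p where p: "p \<in> Proj" "\<And>h. \<exists>k. (p h, k) \<in> T \<and> norm k \<le> f t * norm h" "\<tau>c p \<le> ennreal t" by blast
 have "\<exists>k. (p h, k) \<in> T O op_graph a \<and> norm k \<le> norm a * f t * norm h" for h
 proof -
  obtain k where k: "(p h, k) \<in> T" "norm k \<le> f t * norm h" using p by blast
  have "norm (a k) \<le> norm a * norm k" by (rule norm_blinfun)
  also have "\<dots> \<le> norm a * (f t * norm h)" by (intro mult_left_mono k) simp
  finally show ?thesis using k(1) by (intro exI[of _ "a k"]) (auto simp: relcomp_unfold mult.assoc)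
 qed
 then show "\<exists>p. (p \<in> Proj \<and> (\<forall>h. \<exists>k. (p h, k) \<in> T O op_graph a \<and> norm k \<le> norm a * f t * norm h)) \<and> \<tau>c p \<le> ennreal t"
  using p by blast
qed

lemma Sm_rmul:
 assumes T: "Sm T f" and a: "a \<in> M" and f: "\<And>t. t > 0 \<Longrightarrow> 0 \<le> f t"
 shows "Sm (op_graph a O T) (\<lambda>t. norm a * f t)" unfolding Sm_def
proof (intro allI impI)
 fix t :: real assume t: "t > 0"
 obtain q where q: "bdd_on T q (f t)" "\<tau>c q \<le> ennreal t" using SmD[OF T t] by blast
 have qP: "q \<in> Proj" using q by (simp add: bdd_on_def)
 define p where "p = kerp ((I - q) o\<^sub>L a)"
 note p = tau_pull[OF a qP, folded p_def]
 have "bdd_on (op_graph a O T) p (norm a * f t)" unfolding bdd_on_def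
 proof (intro conjI allI p(1))
  fix h
  obtain k where k: "(q (a (p h)), k) \<in> T" "norm k \<le> f t * norm (a (p h))" using q(1) unfolding bdd_on_def by blast
  note k(2)
  also have "f t * norm (a (p h)) \<le> f t * (norm a * norm h)"
  proof (rule mult_left_mono[OF _ f[OF t]])
   show "norm (a (p h)) \<le> norm a * norm h" by (rule order_trans[OF norm_blinfun mult_left_mono[OF pr_norm[OF p(1)]]]) simp
  qed
  finally show "\<exists>k. (p h, k) \<in> op_graph a O T \<and> norm k \<le> norm a * f t * norm h"
   using k(1) by (intro exI[of _ k]) (auto simp: p(3) relcomp_unfold mult_ac)
 qed
 then show "\<exists>p. bdd_on (op_graph a O T) p (norm a * f t) \<and> \<tau>c p \<le> ennreal t" using p(2) q(2) order_trans by blast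
qed

text \<open>The meet of two projections whose complements have trace at most t/2 has a complement of
  trace at most t. This is where the argument is halved.\<close>

lemma Sm_padd:
 assumes T: "Sm T f" and U: "Sm U g" and fg: "\<And>t. t > 0 \<Longrightarrow> 0 \<le> f t" "\<And>t. t > 0 \<Longrightarrow> 0 \<le> g t"
 shows "Sm (padd T U) (\<lambda>t. f (t / 2) + g (t / 2))" unfolding Sm_def
proof (intro allI impI)
 fix t :: real assume t: "t > 0"
 have t2: "t / 2 > 0" using t by simp
 obtain p where p: "bdd_on T p (f (t / 2))" "\<tau>c p \<le> ennreal (t / 2)" using SmD[OF T t2] by blast
 obtain q where q: "bdd_on U q (g (t / 2))" "\<tau>c q \<le> ennreal (t / 2)" using SmD[OF U t2] by blast
 have pq: "p \<in> Proj" "q \<in> Proj" using p q by (auto simp: bdd_on_def)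
 note m = pmeet[OF pq]
 have nm: "norm (pmeet p q h) \<le> norm h" for h by (rule pr_norm[OF m(1)])
 have "bdd_on (padd T U) (pmeet p q) (f (t / 2) + g (t / 2))" unfolding bdd_on_def
 proof (intro conjI allI m(1))
  fix h
  obtain k where k: "(pmeet p q h, k) \<in> T" "norm k \<le> f (t / 2) * norm (pmeet p q h)" using p(1) m(3) unfolding bdd_on_def by metis
  obtain l where l: "(pmeet p q h, l) \<in> U" "norm l \<le> g (t / 2) * norm (pmeet p q h)" using q(1) m(4) unfolding bdd_on_def by metis
  have "norm (k + l) \<le> f (t / 2) * norm (pmeet p q h) + g (t / 2) * norm (pmeet p q h)"
   using norm_triangle_ineq[of k l] k(2) l(2) by linarith
  also have "\<dots> \<le> f (t / 2) * norm h + g (t / 2) * norm h" by (intro add_mono mult_left_mono nm fg t2)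
  finally show "\<exists>k. (pmeet p q h, k) \<in> padd T U \<and> norm k \<le> (f (t / 2) + g (t / 2)) * norm h"
   using k(1) l(1) by (intro exI[of _ "k + l"]) (auto simp: padd_iff distrib_right)
 qed
 moreover have "\<tau>c (pmeet p q) \<le> ennreal t"
 proof -
  have "\<tau>c (pmeet p q) \<le> ennreal (t / 2) + ennreal (t / 2)" using m(5) add_mono[OF p(2) q(2)] by (rule order_trans)
  also have "\<dots> = ennreal t" using t by (simp flip: ennreal_plus)
  finally show ?thesis .
 qed
 ultimately show "\<exists>p. bdd_on (padd T U) p (f (t / 2) + g (t / 2)) \<and> \<tau>c p \<le> ennreal t" by blast
qed

lemma Sm_op:
 assumes "a \<in> M"
  and "\<And>t. t > 0 \<Longrightarrow> \<exists>p\<in>Proj. \<tau>c p \<le> ennreal t \<and> (\<forall>h. norm (a (p h)) \<le> f t * norm h)"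
 shows "Sm (op_graph a) f" using assms(2) by (simp add: Sm_def bdd_on_def) blast

lemma Sm_opD:
 assumes "Sm (op_graph a) f" "t > 0"
 shows "\<exists>p\<in>Proj. \<tau>c p \<le> ennreal t \<and> (\<forall>h. norm (a (p h)) \<le> f t * norm h)" using SmD[OF assms] by (auto simp: bdd_on_def)

lemma proj_id_mem: "I \<in> Proj" by (simp add: projections_iff mem_id isproj_id)

lemma Sm_op_bounded: "a \<in> M \<Longrightarrow> Sm (op_graph a) (\<lambda>_. norm a)"
 by (rule Sm_op) (auto intro!: bexI[OF _ proj_id_mem] simp: tau_zero norm_blinfun)

text \<open>Boundedness after cutting on the left. It is the source of closability, and unlike
  closability it is visibly stable under sums and products.\<close>

definition LB :: "('a \<times> 'a) set \<Rightarrow> bool"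
 where "LB T \<longleftrightarrow> (\<forall>t>0. \<exists>q\<in>Proj. \<tau>c q \<le> ennreal t \<and> (\<exists>c. \<forall>g k. (g, k) \<in> T \<longrightarrow> norm (q k) \<le> c * norm g))"

text \<open>Let a be the bounded operator x p. The difference W of x and a, composed with
  \<open>ct x\<close>, vanishes on the pullback of p along \<open>ct x\<close>, so its right support
  has small trace, and then so has its left support. Off that left support x agrees with a.\<close>

lemma left_cut:
 assumes x: "x \<in> meas" and b: "bdd_on x p c"
 obtains q where "q \<in> Proj" "\<tau>c q \<le> \<tau>c p" "\<And>g k. (g, k) \<in> x \<Longrightarrow> norm (q k) \<le> c * norm g"
proof -
 note cl = meas_closed[OF x]
 obtain a where a: "a \<in> M" "\<And>h. (p h, a h) \<in> x" "\<And>h. norm (a h) \<le> c * norm h"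
  using bdd_on_op[OF meas_linear[OF x] meas_affiliated[OF x] b] by blast
 have p: "p \<in> Proj" using b by (simp add: bdd_on_def)
 define W where "W = dt x - (a o\<^sub>L ct x)"
 have WM: "W \<in> M" unfolding W_def by (intro mem_intros meas_mem[OF x] a)
 define q where "q = kerp (radj W)"
 have q: "q \<in> Proj" unfolding q_def by (rule proj_kerp[OF mem_radj[OF WM]])
 have qW: "q (W h) = 0" for h
 proof -
  have "inner y (q (W h)) = inner y 0" for y
   using pr_inner[OF q, of y "W h"] radj'[of "q y" W h] kerp_apply[of "radj W" y] by (simp add: q_def)
  then show ?thesis by (rule inner_eqI)
 qed
 define r where "r = kerp ((I - p) o\<^sub>L ct x)"
 note r = tau_pull[OF meas_mem(1)[OF x] p, folded r_def]
 have "W (r h) = 0" for h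
 proof -
  have "(ct x (r h), a (ct x (r h))) \<in> x" using a(2)[of "ct x (r h)"] by (simp add: r(3))
  then show ?thesis using dt_unique[OF cl] by (simp add: W_def blin)
 qed
 then have kW: "kerp W (r h) = r h" for h by (simp add: kerp_fix)
 have "\<tau>c q = \<tau>c (kerp W)" unfolding q_def by (rule tau_range[OF WM])
 also have "\<dots> \<le> \<tau>c r"
 proof (rule tau_proj_mono[OF proj_compl[OF proj_kerp[OF WM]] proj_compl[OF r(1)]])
  show "(I - r) ((I - kerp W) h) = (I - kerp W) h" for h
   using isproj_le_norm[OF proj_isproj[OF r(1)] kerp_isproj kW, of h] by (simp add: blin)
 qed
 also have "\<dots> \<le> \<tau>c p" by (rule r(2))
 finally have t: "\<tau>c q \<le> \<tau>c p" .
 have "norm (q k) \<le> c * norm g" if gk: "(g, k) \<in> x" for g k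
 proof -
  obtain h where h: "g = ct x h" "k = dt x h" using graph_param[OF cl gk] .
  have "q k = q (a g)" using qW[of h] by (simp add: h W_def blin)
  then show ?thesis using pr_norm[OF q, of "a g"] a(3)[of g] by simp
 qed
 then show ?thesis using that q t by blast
qed

lemma LB_meas: "x \<in> meas \<Longrightarrow> LB x" unfolding LB_def
proof (intro allI impI)
 fix t :: real assume x: "x \<in> meas" and t: "t > 0"
 obtain p c where p: "bdd_on x p c" "\<tau>c p \<le> ennreal t" using meas_bdd[OF x t] by metis
 obtain q where q: "q \<in> Proj" "\<tau>c q \<le> \<tau>c p" "\<And>g k. (g, k) \<in> x \<Longrightarrow> norm (q k) \<le> c * norm g" using left_cut[OF x p(1)] by blast
 then show "\<exists>q\<in>Proj. \<tau>c q \<le> ennreal t \<and> (\<exists>c. \<forall>g k. (g, k) \<in> x \<longrightarrow> norm (q k) \<le> c * norm g)"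
  using p(2) by (intro bexI[OF _ q(1)] conjI exI[of _ c]) (auto intro: order_trans)
qed

lemma LB_padd:
 assumes T: "LB T" and U: "LB U" shows "LB (padd T U)" unfolding LB_def
proof (intro allI impI)
 fix t :: real assume t: "t > 0"
 have t2: "t / 2 > 0" using t by simp
 obtain p c where p: "p \<in> Proj" "\<tau>c p \<le> ennreal (t / 2)" "\<And>g k. (g, k) \<in> T \<Longrightarrow> norm (p k) \<le> c * norm g"
  using T t2 unfolding LB_def by blast
 obtain q d where q: "q \<in> Proj" "\<tau>c q \<le> ennreal (t / 2)" "\<And>g k. (g, k) \<in> U \<Longrightarrow> norm (q k) \<le> d * norm g"
  using U t2 unfolding LB_def by blast
 note m = pmeet[OF p(1) q(1)]
 have mp: "pmeet p q (p h) = pmeet p q h" "pmeet p q (q h) = pmeet p q h" for h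
  using isproj_le_norm[OF proj_isproj[OF m(1)] proj_isproj[OF p(1)] m(3)] isproj_le_norm[OF proj_isproj[OF m(1)] proj_isproj[OF q(1)] m(4)] by auto
 have "norm (pmeet p q k) \<le> (c + d) * norm g" if gk: "(g, k) \<in> padd T U" for g k
 proof -
  obtain h l where h: "k = h + l" "(g, h) \<in> T" "(g, l) \<in> U" using gk by (auto simp: padd_iff)
  have "norm (pmeet p q h) \<le> c * norm g" "norm (pmeet p q l) \<le> d * norm g"
   using pr_norm[OF m(1), of "p h"] pr_norm[OF m(1), of "q l"]
    p(3)[OF h(2)] q(3)[OF h(3)] by (simp_all add: mp)
  then show ?thesis using norm_triangle_ineq[of "pmeet p q h" "pmeet p q l"] by (simp add: h(1) blin distrib_right)
 qed
 moreover have "\<tau>c (pmeet p q) \<le> ennreal t"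
 proof -
  have "\<tau>c (pmeet p q) \<le> ennreal (t / 2) + ennreal (t / 2)" using m(5) add_mono[OF p(2) q(2)] by (rule order_trans)
  also have "\<dots> = ennreal t" using t by (simp flip: ennreal_plus)
  finally show ?thesis .
 qed
 ultimately show "\<exists>q\<in>Proj. \<tau>c q \<le> ennreal t \<and> (\<exists>c. \<forall>g k. (g, k) \<in> padd T U \<longrightarrow> norm (q k) \<le> c * norm g)" using m(1) by blast
qed

lemma LB_lmul:
 assumes T: "LB T" and a: "a \<in> M" shows "LB (T O op_graph a)" unfolding LB_def
proof (intro allI impI)
 fix t :: real assume t: "t > 0"
 obtain q c where q: "q \<in> Proj" "\<tau>c q \<le> ennreal t" "\<And>g k. (g, k) \<in> T \<Longrightarrow> norm (q k) \<le> c * norm g"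
  using T t unfolding LB_def by blast
 \<comment> \<open>r pulls q back along the adjoint, which means r a = r a q; so boundedness of q T
   carries over to r a T.\<close>
 define r where "r = kerp ((I - q) o\<^sub>L radj a)"
 note r = tau_pull[OF mem_radj[OF a] q(1), folded r_def]
 have ra: "r (a (q h)) = r (a h)" for h
 proof (rule inner_eqI)
  fix y
  have "inner y (r (a (q h))) = inner (q (radj a (r y))) h" using pr_inner[OF r(1), of y "a (q h)"] radj'[of "r y" a "q h"]
    pr_inner[OF q(1), of "radj a (r y)" h] by simp
  then show "inner y (r (a (q h))) = inner y (r (a h))"
   using pr_inner[OF r(1), of y "a h"] radj'[of "r y" a h] by (simp add: r(3))
 qed
 have "norm (r k) \<le> (norm a * c) * norm g" if gk: "(g, k) \<in> T O op_graph a" for g k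
 proof -
  obtain l where l: "(g, l) \<in> T" "k = a l" using gk by auto
  have "norm (r k) \<le> norm (a (q l))" using pr_norm[OF r(1), of "a (q l)"] by (simp add: ra l)
  also have "\<dots> \<le> norm a * (c * norm g)" by (rule order_trans[OF norm_blinfun mult_left_mono[OF q(3)[OF l(1)]]]) simp
  finally show ?thesis by (simp add: mult.assoc)
 qed
 then show "\<exists>q\<in>Proj. \<tau>c q \<le> ennreal t \<and> (\<exists>c. \<forall>g k. (g, k) \<in> T O op_graph a \<longrightarrow> norm (q k) \<le> c * norm g)"
  using r(1,2) q(2) order_trans by blast
qed

lemma LB_rmul: "LB T \<Longrightarrow> LB (op_graph a O T)" unfolding LB_def
proof (intro allI impI)
 fix t :: real
 assume "\<forall>t>0. \<exists>q\<in>Proj. \<tau>c q \<le> ennreal t \<and> (\<exists>c. \<forall>g k. (g, k) \<in> T \<longrightarrow> norm (q k) \<le> c * norm g)" "0 < t"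
 then obtain q c where q: "q \<in> Proj" "\<tau>c q \<le> ennreal t" "\<And>g k. (g, k) \<in> T \<Longrightarrow> norm (q k) \<le> c * norm g" by blast
 have "norm (q k) \<le> (\<bar>c\<bar> * norm a) * norm g" if "(g, k) \<in> op_graph a O T" for g k
 proof -
  have "norm (q k) \<le> c * norm (a g)" using that q(3) by auto
  also have "\<dots> \<le> \<bar>c\<bar> * (norm a * norm g)" by (intro mult_mono norm_blinfun) auto
  finally show ?thesis by (simp add: mult.assoc)
 qed
 then show "\<exists>q\<in>Proj. \<tau>c q \<le> ennreal t \<and> (\<exists>c. \<forall>g k. (g, k) \<in> op_graph a O T \<longrightarrow> norm (q k) \<le> c * norm g)" using q by blast
qed

lemma bdd_on_ex:
 assumes "linear_graph T" "affiliated M T" "bdd_on T p c"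
 shows "\<exists>a\<in>M. \<forall>h. (p h, a h) \<in> T" by (rule bdd_on_op[OF assms]) blast

text \<open>Single-valuedness is the point: if graph points converge to (0, d), every projection q
  from \<open>LB\<close> gives q d = 0, and these projections suffice by
  \<open>tau_dense\<close>.\<close>

lemma closure_linear_graph:
 assumes lin: "linear_graph T" and LB: "LB T" shows "linear_graph (closure T)"
proof (rule linear_graphI)
 have sub: "subspace (closure T)" by (rule subspace_closure[OF linear_graph_subspace[OF lin]])
 show "(0, 0) \<in> closure T" using subspace_0[OF sub] by (simp add: zero_prod_def)
 show "(g + g', h + h') \<in> closure T" if "(g, h) \<in> closure T" "(g', h') \<in> closure T" for g h g' h'
  using subspace_add[OF sub that] by simp
 show "(c *\<^sub>C g, c *\<^sub>C h) \<in> closure T" if gh: "(g, h) \<in> closure T" for c g h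
 proof -
  have "continuous_on (closure T) (\<lambda>p. (sc c (fst p), sc c (snd p)))" by (intro continuous_intros)
  moreover have "(\<lambda>p. (sc c (fst p), sc c (snd p))) ` T \<subseteq> closure T" using linear_graphD(3)[OF lin] closure_subset[of T] by auto
  ultimately have "(\<lambda>p. (sc c (fst p), sc c (snd p))) ` closure T \<subseteq> closure T" by (intro image_closure_subset) auto
  then show ?thesis using gh by (auto simp: image_subset_iff)
 qed
 show "h = h'" if a: "(g, h) \<in> closure T" "(g, h') \<in> closure T" for g h h'
 proof -
  have "(0, h - h') \<in> closure T" using subspace_diff[OF sub a] by simp
  then obtain s where s: "\<And>n. s n \<in> T" "s \<longlonglongrightarrow> (0, h - h')" unfolding closure_sequential by metis
  have lim: "(\<lambda>n. fst (s n)) \<longlonglongrightarrow> 0" "(\<lambda>n. snd (s n)) \<longlonglongrightarrow> h - h'" using tendsto_fst[OF s(2)] tendsto_snd[OF s(2)] by simp_all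
  have "h - h' = 0"
  proof (rule tau_dense)
   fix t :: real assume "t > 0"
   then obtain q c where q: "q \<in> Proj" "\<tau>c q \<le> ennreal t" "\<And>g k. (g, k) \<in> T \<Longrightarrow> norm (q k) \<le> c * norm g"
    using LB unfolding LB_def by blast
   have "norm (q (snd (s n))) \<le> c * norm (fst (s n))" for n using q(3)[of "fst (s n)" "snd (s n)"] s(1) by simp
   moreover have "(\<lambda>n. norm (q (snd (s n)))) \<longlonglongrightarrow> norm (q (h - h'))" by (intro tendsto_intros lim)
   moreover have "(\<lambda>n. c * norm (fst (s n))) \<longlonglongrightarrow> c * norm (0::'a)" by (intro tendsto_intros lim)
   ultimately have "norm (q (h - h')) \<le> c * norm (0::'a)" by (intro LIMSEQ_le[of _ _ "\<lambda>n. c * norm (fst (s n))"]) auto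
   then show "\<exists>q\<in>Proj. \<tau>c q \<le> ennreal t \<and> q (h - h') = 0" using q by auto
  qed
  then show ?thesis by simp
 qed
qed

lemma affiliated_closure:
 assumes "affiliated M T" shows "affiliated M (closure T)"
proof (rule affiliatedI)
 fix u g h assume u: "u \<in> commutant M" "unitary_op u" and gh: "(g, h) \<in> closure T"
 have "(\<lambda>p. (u (fst p), u (snd p))) ` T \<subseteq> closure T" using affiliatedD[OF assms u] closure_subset[of T] by auto
 then have "(\<lambda>p. (u (fst p), u (snd p))) ` closure T \<subseteq> closure T" by (intro image_closure_subset continuous_intros) auto
 then show "(u g, u h) \<in> closure T" using gh by (auto simp: image_subset_iff)
qed

lemma Sm_dense: assumes lin: "linear_graph T" and T: "Sm T f" shows "closure (Domain T) = UNIV"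
proof (rule closed_subspace_eq_UNIV)
 have "subspace (Domain T)"
  using linear_subspace_image[OF bounded_linear.linear[OF bounded_linear_fst] linear_graph_subspace[OF lin]]
  by (simp add: Domain_fst)
 then show "subspace (closure (Domain T))" by (rule subspace_closure)
 fix d assume d: "\<And>s. s \<in> closure (Domain T) \<Longrightarrow> inner d s = 0"
 show "d = 0"
 proof (rule tau_dense)
  fix t :: real assume "t > 0"
  then obtain p where p: "bdd_on T p (f t)" "\<tau>c p \<le> ennreal t" using SmD[OF T] by blast
  have pP: "p \<in> Proj" using p by (simp add: bdd_on_def)
  have "p d \<in> Domain T" using p unfolding bdd_on_def by blast
  then have "inner d (p d) = 0" using d closure_subset by blast
  then have "p d = 0" using isproj_inner[OF proj_isproj[OF pP], of d] by (simp add: inner_commute)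
  then show "\<exists>q\<in>Proj. \<tau>c q \<le> ennreal t \<and> q d = 0" using p pP by blast
 qed
qed simp

theorem closure_meas:
 assumes lin: "linear_graph T" and aff: "affiliated M T" and T: "Sm T f" and LB: "LB T"
 shows "closure T \<in> meas"
proof -
 note cl = closure_linear_graph[OF lin LB] and ca = affiliated_closure[OF aff]
 have "closure (Domain T) \<subseteq> closure (Domain (closure T))" using closure_subset[of T] by (intro closure_mono Domain_mono)
 then have dd: "densely_defined (closure T)" unfolding densely_defined_def using Sm_dense[OF lin T] by blast
 have "\<exists>p\<in>Proj. range (blinfun_apply p) \<subseteq> Domain (closure T) \<and> \<tau>c p < ennreal \<epsilon> \<and>
   (\<exists>a\<in>M. op_graph p O closure T = op_graph a)" if e: "\<epsilon> > 0" for \<epsilon>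
 proof -
  obtain p where p: "bdd_on T p (f (\<epsilon> / 2))" "\<tau>c p \<le> ennreal (\<epsilon> / 2)" using SmD[OF T, of "\<epsilon> / 2"] e by auto
  have b: "bdd_on (closure T) p (f (\<epsilon> / 2))" by (rule bdd_on_mono[OF p(1) closure_subset order_refl])
  obtain a where a: "a \<in> M" "\<And>h. (p h, a h) \<in> closure T" using bdd_on_ex[OF cl ca b] by blast
  have "op_graph p O closure T = op_graph a" using a(2) linear_graph_unique[OF cl] by (auto simp: set_eq_iff relcomp_unfold)
  moreover have "\<tau>c p < ennreal \<epsilon>" using p(2) e by (auto intro: le_less_trans simp: ennreal_less_iff)
  moreover have "range (blinfun_apply p) \<subseteq> Domain (closure T)" "p \<in> Proj" using b by (auto simp: bdd_on_def)
  ultimately show ?thesis using a(1) by blast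
 qed
 then show ?thesis unfolding measurable_ops_def using cl ca dd by simp
qed

text \<open>Identities between strong sums and products are checked only on a common subgraph with
  some bound \<open>Sm\<close>. Those h for which (ct h, dt h) belongs to y form a closed subspace;
  it contains the pullbacks along \<open>ct\<close> of the projections on which x and y agree, so it
  is everything.\<close>

theorem meas_eqI:
 assumes x: "x \<in> meas" and y: "y \<in> meas" and S: "Sm (x \<inter> y) f"
 shows "x = y"
proof -
 have le: "x \<subseteq> y" if x: "x \<in> meas" and y: "y \<in> meas" and S: "Sm (x \<inter> y) f" for x y
 proof -
  note c = meas_closed[OF x] and ly = meas_linear[OF y]
  let ?S = "{h. (ct x h, dt x h) \<in> y}"
  have "?S = UNIV"
  proof (rule closed_subspace_eq_UNIV)
   have "closed y" using y by (simp add: measurable_ops_def)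
   then have "closed ((\<lambda>h. (ct x h, dt x h)) -` y)" by (intro closed_vimage continuous_intros)
   then show "closed ?S" by (simp add: vimage_def)
   show "subspace ?S"
    using subspace_add[OF linear_graph_subspace[OF ly]] subspace_scale[OF linear_graph_subspace[OF ly]] linear_graphD(1)[OF ly]
    by (auto intro!: subspaceI simp: blinfun.zero_right blin blinfun.scaleR_right)
   fix d assume d: "\<And>s. s \<in> ?S \<Longrightarrow> inner d s = 0"
   show "d = 0"
   proof (rule tau_dense)
    fix t :: real assume "t > 0"
    then obtain p where p: "bdd_on (x \<inter> y) p (f t)" "\<tau>c p \<le> ennreal t" using SmD[OF S] by blast
    have pP: "p \<in> Proj" using p by (simp add: bdd_on_def)
    define r where "r = kerp ((I - p) o\<^sub>L ct x)"
    note r = tau_pull[OF meas_mem(1)[OF x] pP, folded r_def]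
    have "r d \<in> ?S"
    proof -
     obtain k where "(p (ct x (r d)), k) \<in> x \<inter> y" using p(1) unfolding bdd_on_def by blast
     then have "(ct x (r d), k) \<in> x" "(ct x (r d), k) \<in> y" by (auto simp: r(3))
     then show ?thesis using dt_unique[OF c] by auto
    qed
    then have "inner d (r d) = 0" by (rule d)
    then have "r d = 0" using isproj_inner[OF proj_isproj[OF r(1)], of d] by (simp add: inner_commute)
    then show "\<exists>q\<in>Proj. \<tau>c q \<le> ennreal t \<and> q d = 0" using r(1,2) p(2) order_trans by blast
   qed
  qed
  then show "x \<subseteq> y" using graph_param[OF c] by (auto, metis UNIV_I mem_Collect_eq)
 qed
 show ?thesis using le[OF x y S] le[OF y x] S by (simp add: Int_commute)
qed

section \<open>Stability of measurable operators under sums and products\<close>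

lemma affiliated_op: "a \<in> M \<Longrightarrow> affiliated M (op_graph a)" by (rule affiliatedI) (auto intro: unitary_commute)

lemma affiliated_padd: "affiliated M x \<Longrightarrow> affiliated M y \<Longrightarrow> affiliated M (padd x y)"
 by (rule affiliatedI) (auto simp: padd_iff blin dest: affiliatedD, blast dest: affiliatedD)

lemma affiliated_lmul: "affiliated M x \<Longrightarrow> a \<in> M \<Longrightarrow> affiliated M (x O op_graph a)"
proof (rule affiliatedI)
 fix u g h assume x: "affiliated M x" and a: "a \<in> M" and u: "u \<in> commutant M" "unitary_op u" and gh: "(g, h) \<in> x O op_graph a"
 obtain k where k: "(g, k) \<in> x" "h = a k" using gh by auto
 show "(u g, u h) \<in> x O op_graph a" by (rule relcompI[OF affiliatedD[OF x u k(1)]]) (simp add: k(2) unitary_commute[OF a u(1)])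
qed

lemma affiliated_rmul: "affiliated M x \<Longrightarrow> a \<in> M \<Longrightarrow> affiliated M (op_graph a O x)"
proof (rule affiliatedI)
 fix u g h assume x: "affiliated M x" and a: "a \<in> M" and u: "u \<in> commutant M" "unitary_op u" and gh: "(g, h) \<in> op_graph a O x"
 have "(a g, h) \<in> x" using gh by auto
 then have "(a (u g), u h) \<in> x" using affiliatedD[OF x u] unitary_commute[OF a u(1)] by metis
 then show "(u g, u h) \<in> op_graph a O x" by (intro relcompI[of _ "a (u g)"]) simp_all
qed

lemma meas_op: "a \<in> M \<Longrightarrow> op_graph a \<in> meas"
proof -
 assume a: "a \<in> M"
 have "LB (op_graph a)" unfolding LB_def by (auto intro!: bexI[OF _ proj_id_mem] exI[of _ "norm a"] norm_blinfun simp: tau_zero)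
 from closure_meas[OF linear_graph_op[OF mem_bounded[OF a]] affiliated_op[OF a] Sm_op_bounded[OF a] this]
 show ?thesis using closed_op_graph closure_closed by metis
qed

lemma meas_sum: "x \<in> meas \<Longrightarrow> y \<in> meas \<Longrightarrow> strong_sum x y \<in> meas" unfolding strong_sum_padd
 by (rule closure_meas[OF linear_graph_padd _ Sm_padd[OF Sm_singular Sm_singular] LB_padd])
  (auto intro: meas_linear affiliated_padd meas_affiliated LB_meas singular_fun_nonneg)

lemma meas_lmul: "x \<in> meas \<Longrightarrow> a \<in> M \<Longrightarrow> closure (x O op_graph a) \<in> meas"
 by (rule closure_meas[OF linear_graph_lmul _ Sm_lmul[OF Sm_singular] LB_lmul])
  (auto intro: meas_linear affiliated_lmul meas_affiliated LB_meas mem_bounded)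

lemma meas_rmul: "x \<in> meas \<Longrightarrow> a \<in> M \<Longrightarrow> closure (op_graph a O x) \<in> meas"
 by (rule closure_meas[OF linear_graph_rmul _ Sm_rmul[OF Sm_singular] LB_rmul])
  (auto intro: meas_linear affiliated_rmul meas_affiliated LB_meas mem_bounded singular_fun_nonneg)

lemma meas_compress: "x \<in> meas \<Longrightarrow> e \<in> M \<Longrightarrow> compress e x \<in> meas"
 unfolding compress_def strong_prod_def by (intro meas_rmul meas_lmul)

lemma compress_superset: "op_graph e O (x O op_graph e) \<subseteq> compress e x"
proof -
 have "op_graph e O (x O op_graph e) \<subseteq> op_graph e O closure (x O op_graph e)" by (intro relcomp_mono order_refl closure_subset)
 then show ?thesis unfolding compress_def strong_prod_def by (rule order_trans[OF _ closure_subset])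
qed

lemma proj_norm1: "e \<in> Proj \<Longrightarrow> norm e \<le> 1" by (intro isproj_norm1 proj_isproj)

section \<open>The two parts x - exe and exe\<close>

lemma Sm_cmp:
 assumes T: "Sm T f" and f: "\<And>t. t > 0 \<Longrightarrow> 0 \<le> f t" and a: "a \<in> M" "norm a \<le> 1" and b: "norm b \<le> 1"
 shows "Sm (op_graph a O (T O op_graph b)) f"
proof (rule Sm_mono[OF Sm_rmul[OF Sm_lmul[OF T] a(1)] order_refl])
 show "0 \<le> norm b * f t" if "t > 0" for t using f[OF that] by simp
 show "norm a * (norm b * f t) \<le> f t" if "t > 0" for t
  using f[OF that] a(2) b by (metis mult_left_le_one_le mult_nonneg_nonneg norm_ge_zero order_trans)
qed

text \<open>The measurable operator x - exe. The sign is a composition with -I, so that the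
  stability results for sums and left products apply directly.\<close>

definition phi_part :: "('a \<times> 'a) set \<Rightarrow> 'a op \<Rightarrow> ('a \<times> 'a) set"
 where "phi_part x e = strong_sum x (closure (compress e x O op_graph (- I)))"

text \<open>\<open>App x X F\<close>: the bounded operator \<open>X\<close> approximates \<open>x\<close> with an error whose singular values are
 dominated by \<open>F\<close>.\<close>

definition App :: "('a \<times> 'a) set \<Rightarrow> 'a op \<Rightarrow> (real \<Rightarrow> real) \<Rightarrow> bool"
 where "App x X F \<longleftrightarrow> (\<exists>Z. padd (op_graph X) Z \<subseteq> x \<and> Sm Z F)"

lemma mem_neg_id: "- I \<in> M" using mem_scaleR[OF mem_id, of "-1"] by simp

context
 fixes x e
 assumes x: "x \<in> meas" and e: "e \<in> Proj"
begin

private lemma eM: "e \<in> M" and ee: "e (e h) = e h" and e1: "norm e \<le> 1" using proj_mem[OF e] pr_idem[OF e] proj_norm1[OF e] by auto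

lemma zeta_meas: "compress e x \<in> meas" by (rule meas_compress[OF x eM])

lemma phi_meas: "phi_part x e \<in> meas" unfolding phi_part_def by (intro meas_sum meas_lmul x zeta_meas mem_neg_id)

lemma zeta_in: "(e g, k) \<in> x \<Longrightarrow> (g, e k) \<in> compress e x" using compress_superset[of e x] by (auto simp: relcomp_unfold subset_iff)

lemma phi_in: "(g, k) \<in> x \<Longrightarrow> (g, l) \<in> compress e x \<Longrightarrow> (g, k - l) \<in> phi_part x e"
proof -
 assume kl: "(g, k) \<in> x" "(g, l) \<in> compress e x"
 have "(g, - l) \<in> compress e x O op_graph (- I)" using kl(2) by (auto simp: relcomp_unfold blin)
 then have "(g, - l) \<in> closure (compress e x O op_graph (- I))" by (rule subsetD[OF closure_subset])
 then have "(g, k - l) \<in> padd x (closure (compress e x O op_graph (- I)))"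
  using kl(1) unfolding padd_iff by (intro exI[of _ k] exI[of _ "- l"]) simp
 then show ?thesis unfolding phi_part_def strong_sum_padd by (rule subsetD[OF closure_subset])
qed

private lemma Smx: "Sm x (singular_fun \<tau> x)" by (rule Sm_singular[OF x])

private lemma nn: "0 \<le> singular_fun \<tau> x t" by (rule singular_fun_nonneg)

lemma phi_zeta_sum: "x = strong_sum (phi_part x e) (compress e x)"
proof (rule meas_eqI[OF x meas_sum[OF phi_meas zeta_meas]])
 \<comment> \<open>The summand multiplied by 0 changes no value of x; it only restricts the graph to
   those g for which e g also lies in the domain, where the identity is algebraic.\<close>
 let ?T = "padd x ((op_graph e O (x O op_graph e)) O op_graph 0)"
 show "Sm (x \<inter> strong_sum (phi_part x e) (compress e x)) (\<lambda>t. singular_fun \<tau> x (t / 2) + norm (0::'a op) * singular_fun \<tau> x (t / 2))"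
 proof (rule Sm_mono[OF Sm_padd[OF Smx Sm_lmul[OF Sm_cmp[OF Smx nn eM e1 e1]]] _ order_refl])
  show "?T \<subseteq> x \<inter> strong_sum (phi_part x e) (compress e x)"
  proof (rule subrelI)
   fix g k assume "(g, k) \<in> ?T"
   then obtain l where l: "(g, k) \<in> x" "(e g, l) \<in> x" by (auto simp: padd_iff relcomp_unfold)
   note z = zeta_in[OF l(2)]
   have "(g, (k - e l) + e l) \<in> padd (phi_part x e) (compress e x)" using phi_in[OF l(1) z] z unfolding padd_iff by blast
   then have "(g, (k - e l) + e l) \<in> strong_sum (phi_part x e) (compress e x)"
    unfolding strong_sum_padd by (rule subsetD[OF closure_subset])
   then show "(g, k) \<in> x \<inter> strong_sum (phi_part x e) (compress e x)" using l(1) by simp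
  qed
 qed (simp_all add: nn)
qed

lemma phi_compress: "compress e (phi_part x e) = op_graph 0"
proof (rule meas_eqI[OF meas_compress[OF phi_meas eM] meas_op[OF mem_zero]])
 let ?T = "(op_graph e O (x O op_graph e)) O op_graph 0"
 show "Sm (compress e (phi_part x e) \<inter> op_graph 0) (\<lambda>t. norm (0::'a op) * singular_fun \<tau> x t)"
 proof (rule Sm_mono[OF Sm_lmul[OF Sm_cmp[OF Smx nn eM e1 e1]] _ order_refl])
  show "?T \<subseteq> compress e (phi_part x e) \<inter> op_graph 0"
  proof (rule subrelI)
   fix g k assume "(g, k) \<in> ?T"
   then obtain l where l: "(e g, l) \<in> x" "k = 0" by (auto simp: relcomp_unfold)
   have "(e g, e l) \<in> compress e x" by (rule zeta_in) (simp add: ee l)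
   from phi_in[OF l(1) this] have "(g, e (l - e l)) \<in> op_graph e O (phi_part x e O op_graph e)" by (auto simp: relcomp_unfold)
   moreover have "e (l - e l) = 0" by (simp add: blin ee)
   ultimately show "(g, k) \<in> compress e (phi_part x e) \<inter> op_graph 0" using compress_superset[of e "phi_part x e"] l(2) by auto
  qed
 qed
qed

lemma zeta_compress: "compress e (compress e x) = compress e x"
proof (rule meas_eqI[OF meas_compress[OF zeta_meas eM] zeta_meas])
 let ?T = "op_graph e O (x O op_graph e)"
 show "Sm (compress e (compress e x) \<inter> compress e x) (singular_fun \<tau> x)"
 proof (rule Sm_mono[OF Sm_cmp[OF Smx nn eM e1 e1] _ order_refl])
  show "?T \<subseteq> compress e (compress e x) \<inter> compress e x"
  proof (rule subrelI)
   fix g k assume "(g, k) \<in> ?T"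
   then obtain l where l: "(e g, l) \<in> x" "k = e l" by (auto simp: relcomp_unfold)
   have "(e g, e l) \<in> compress e x" by (rule zeta_in) (simp add: ee l)
   then have "(g, e (e l)) \<in> op_graph e O (compress e x O op_graph e)" by (auto simp: relcomp_unfold)
   then show "(g, k) \<in> compress e (compress e x) \<inter> compress e x"
    using compress_superset[of e "compress e x"] zeta_in[OF l(1)] l(2) by (auto simp: ee)
  qed
 qed
qed

lemma zeta_Sm: "Sm (compress e x) (singular_fun \<tau> x)"
 by (rule Sm_mono[OF Sm_cmp[OF Smx nn eM e1 e1] compress_superset order_refl])

lemma phi_App:
 assumes A: "App x X F" and F: "\<And>t. t > 0 \<Longrightarrow> 0 \<le> F t" and X: "X \<in> M"
 shows "App (phi_part x e) (X - (e o\<^sub>L X o\<^sub>L e)) (\<lambda>t. F (t / 2) + F (t / 2))"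
proof -
 obtain Z where Z: "padd (op_graph X) Z \<subseteq> x" "Sm Z F" using A unfolding App_def by blast
 let ?Z = "padd Z (op_graph e O (Z O op_graph (- e)))"
 have "Sm ?Z (\<lambda>t. F (t / 2) + F (t / 2))" by (rule Sm_padd[OF Z(2) Sm_cmp[OF Z(2) F eM e1]]) (use F e1 in auto)
 moreover have "padd (op_graph (X - (e o\<^sub>L X o\<^sub>L e))) ?Z \<subseteq> phi_part x e"
 proof (rule subrelI)
  fix g k assume "(g, k) \<in> padd (op_graph (X - (e o\<^sub>L X o\<^sub>L e))) ?Z"
  then obtain z w where zw: "(g, z) \<in> Z" "(e g, w) \<in> Z" "k = (X g - e (X (e g))) + (z - e w)"
   by (auto simp: padd_iff relcomp_unfold blin)
  have 1: "(g, X g + z) \<in> x" and 2: "(e g, X (e g) + w) \<in> x" using Z(1) zw by (auto simp: padd_iff subset_iff)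
  have "k = (X g + z) - e (X (e g) + w)" by (simp add: zw(3) blin)
  then show "(g, k) \<in> phi_part x e" using phi_in[OF 1 zeta_in[OF 2]] by simp
 qed
 ultimately show ?thesis unfolding App_def by blast
qed

lemma phi_Sm: "Sm (phi_part x e) (\<lambda>t. singular_fun \<tau> x (t / 2) + singular_fun \<tau> x (t / 2))"
proof -
 have "App x 0 (singular_fun \<tau> x)" unfolding App_def by (rule exI[of _ x]) (auto simp: padd_iff Smx)
 from phi_App[OF this nn mem_zero] obtain Z where
  Z: "padd (op_graph (0 - (e o\<^sub>L 0 o\<^sub>L e))) Z \<subseteq> phi_part x e" "Sm Z (\<lambda>t. singular_fun \<tau> x (t / 2) + singular_fun \<tau> x (t / 2))"
  unfolding App_def by blast
 have "Z \<subseteq> padd (op_graph (0 - (e o\<^sub>L 0 o\<^sub>L e))) Z" by (auto simp: padd_iff blin blinfun.zero_right)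
 from Sm_mono[OF Z(2) order_trans[OF this Z(1)] order_refl] show ?thesis .
qed

end

lemma App_compress:
 assumes A: "App x X F" and F: "\<And>t. t > 0 \<Longrightarrow> 0 \<le> F t" and e: "e \<in> Proj"
  and G: "Sm (op_graph (e o\<^sub>L X o\<^sub>L e)) G" "\<And>t. t > 0 \<Longrightarrow> 0 \<le> G t"
 shows "Sm (compress e x) (\<lambda>t. G (t / 2) + F (t / 2))"
proof -
 obtain Z where Z: "padd (op_graph X) Z \<subseteq> x" "Sm Z F" using A unfolding App_def by blast
 have "padd (op_graph (e o\<^sub>L X o\<^sub>L e)) (op_graph e O (Z O op_graph e)) \<subseteq> op_graph e O (x O op_graph e)"
 proof (rule subrelI)
  fix g k assume "(g, k) \<in> padd (op_graph (e o\<^sub>L X o\<^sub>L e)) (op_graph e O (Z O op_graph e))"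
  then obtain z where z: "(e g, z) \<in> Z" "k = e (X (e g)) + e z" by (auto simp: padd_iff relcomp_unfold)
  then have "(e g, X (e g) + z) \<in> x" using Z(1) by (auto simp: padd_iff subset_iff)
  then show "(g, k) \<in> op_graph e O (x O op_graph e)" by (auto simp: relcomp_unfold z(2) blinfun.add_right[symmetric])
 qed
 note sub = order_trans[OF this compress_superset]
 have "Sm (padd (op_graph (e o\<^sub>L X o\<^sub>L e)) (op_graph e O (Z O op_graph e))) (\<lambda>t. G (t / 2) + F (t / 2))"
  by (rule Sm_padd[OF G(1) Sm_cmp[OF Z(2) F proj_mem[OF e] proj_norm1[OF e] proj_norm1[OF e]]]) (use G F in auto)
 from Sm_mono[OF this sub order_refl] show ?thesis .
qed

section \<open>Bounded operators with support of finite trace\<close>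

lemma tau_support_right:
 assumes a: "a \<in> M" and r: "r \<in> Proj" and ar: "\<And>h. a (r h) = a h"
 shows "\<tau>c (kerp a) \<le> \<tau> r"
proof (rule tau_proj_mono[OF proj_compl[OF proj_kerp[OF a]] r])
 have "kerp a ((I - r) h) = (I - r) h" for h unfolding kerp_fix by (simp add: blin ar)
 from isproj_le_norm[OF isproj_compl[OF proj_isproj[OF r]] kerp_isproj this]
 show "r ((I - kerp a) h) = (I - kerp a) h" for h by (simp add: blin algebra_simps)
qed

lemma tau_support_left:
 assumes a: "a \<in> M" and r: "r \<in> Proj" and ra: "\<And>h. r (a h) = a h"
 shows "\<tau>c (kerp a) \<le> \<tau> r"
proof -
 have "radj a (r h) = radj a h" for h
 proof (rule inner_eqI)
  fix y
  show "inner y (radj a (r h)) = inner y (radj a h)"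
   using radj[of a y "r h"] radj[of a y h] pr_inner[OF r, of "a y" h] by (simp add: ra)
 qed
 from tau_support_right[OF mem_radj[OF a] r this] show ?thesis by (simp add: tau_range[OF a])
qed

lemma Sm_op_support:
 assumes S: "Sm (op_graph a) f" and a: "a \<in> M" and T: "\<tau>c (kerp a) \<le> ennreal T"
 shows "Sm (op_graph a) (\<lambda>t. if t < T then f t else 0)"
proof (rule Sm_op[OF a])
 fix t :: real assume t: "t > 0"
 show "\<exists>p\<in>Proj. \<tau>c p \<le> ennreal t \<and> (\<forall>h. norm (a (p h)) \<le> (if t < T then f t else 0) * norm h)"
 proof (cases "t < T")
  case True then show ?thesis using Sm_opD[OF S t] by simp
 next
  case False
  then have "ennreal T \<le> ennreal t" by (intro ennreal_leI) simp
  then show ?thesis using False T by (intro bexI[OF _ proj_kerp[OF a]]) (auto simp: kerp_apply intro: order_trans)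
 qed
qed

lemma Sm_op_min:
 assumes "a \<in> M" "Sm (op_graph a) f" "Sm (op_graph a) g"
 shows "Sm (op_graph a) (\<lambda>t. min (f t) (g t))"
 by (rule Sm_op[OF assms(1)]) (use Sm_opD[OF assms(2)] Sm_opD[OF assms(3)] in \<open>auto simp: min_def\<close>)

lemma Sm_op_add:
 assumes "Sm (op_graph a) f" "Sm (op_graph b) g" "\<And>t. t > 0 \<Longrightarrow> 0 \<le> f t" "\<And>t. t > 0 \<Longrightarrow> 0 \<le> g t"
 shows "Sm (op_graph (a + b)) (\<lambda>t. f (t / 2) + g (t / 2))"
proof -
 have "padd (op_graph a) (op_graph b) = op_graph (a + b)" by (auto simp: padd_iff blin)
 then show ?thesis using Sm_padd[OF assms] by simp
qed

lemma Sm_op_comp: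
 assumes S: "Sm (op_graph a) f" and f: "\<And>t. t > 0 \<Longrightarrow> 0 \<le> f t" and b: "b \<in> M" "norm b \<le> 1" and c: "norm c \<le> 1"
 shows "Sm (op_graph (c o\<^sub>L a o\<^sub>L b)) f"
proof -
 have "op_graph b O (op_graph a O op_graph c) = op_graph (c o\<^sub>L a o\<^sub>L b)" by (auto simp: relcomp_unfold)
 then show ?thesis using Sm_cmp[OF S f b c] by simp
qed

lemma norm_id_le: "norm (I :: 'a op) \<le> 1" by (rule norm_blinfun_bound) auto

text \<open>If a p is bounded by f t, so is its adjoint p radj a, and this equals radj a on the
  pullback of p along radj a, whose complement has no larger trace.\<close>

lemma Sm_op_radj:
 assumes S: "Sm (op_graph a) f" and f: "\<And>t. t > 0 \<Longrightarrow> 0 \<le> f t" and a: "a \<in> M"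
 shows "Sm (op_graph (radj a)) f"
proof (rule Sm_op[OF mem_radj[OF a]])
 fix t :: real assume t: "t > 0"
 obtain p where p: "p \<in> Proj" "\<tau>c p \<le> ennreal t" "\<And>h. norm (a (p h)) \<le> f t * norm h" using Sm_opD[OF S t] by blast
 define q where "q = kerp ((I - p) o\<^sub>L radj a)"
 note q = tau_pull[OF mem_radj[OF a] p(1), folded q_def]
 have "norm (radj a (q h)) \<le> f t * norm h" for h
 proof -
  have "norm (a o\<^sub>L p) \<le> f t" by (rule norm_blinfun_bound) (use f[OF t] p(3) in auto)
  then have n: "norm (radj (a o\<^sub>L p)) \<le> f t" by (simp add: norm_radj)
  have "radj a (q h) = radj (a o\<^sub>L p) (q h)" using q(3)[of h] by (simp add: radj_comp pr_radj[OF p(1)])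
  then have "norm (radj a (q h)) \<le> norm (radj (a o\<^sub>L p)) * norm (q h)" by (simp add: norm_blinfun)
  also have "\<dots> \<le> f t * norm h" by (intro mult_mono n isproj_norm proj_isproj q f t) simp
  finally show ?thesis .
 qed
 then show "\<exists>q\<in>Proj. \<tau>c q \<le> ennreal t \<and> (\<forall>h. norm (radj a (q h)) \<le> f t * norm h)" using q p(2) by (meson order_trans)
qed

text \<open>\<open>X = xp(1 - p\<^sub>0)\<close>, where \<open>x\<close> is small on \<open>p\<^sub>0\<close>, \<open>1 - p\<^sub>0\<close> has trace at most \<open>T\<close>, and \<open>x\<close> is bounded on
 \<open>p\<close>, with \<open>1 - p\<close> of trace at most \<open>\<delta>\<close>.\<close>

lemma approximation:
 assumes x: "x \<in> meas" and T: "T > 0" and d: "\<delta> > 0"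
 obtains X where "X \<in> M" "Sm (op_graph X) (singular_fun \<tau> x)" "\<tau>c (kerp X) \<le> ennreal T"
  "App x X (\<lambda>t. min (singular_fun \<tau> x (t / 2)) (singular_fun \<tau> x T) + (if t / 2 < \<delta> then singular_fun \<tau> x (t / 2) else 0))"
proof -
 let ?m = "singular_fun \<tau> x"
 note lin = meas_linear[OF x] and S = Sm_singular[OF x] and m0 = singular_fun_nonneg
 obtain p0 where p0: "bdd_on x p0 (?m T)" "\<tau>c p0 \<le> ennreal T" using SmD[OF S T] by blast
 obtain p where p: "bdd_on x p (?m \<delta>)" "\<tau>c p \<le> ennreal \<delta>" using SmD[OF S d] by blast
 have P: "p0 \<in> Proj" "p \<in> Proj" using p0 p by (auto simp: bdd_on_def)
 obtain a where a: "a \<in> M" "\<And>h. (p h, a h) \<in> x" using bdd_on_ex[OF lin meas_affiliated[OF x] p(1)] by blast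
 define X where "X = a o\<^sub>L (I - p0)"
 have idp: "p0 (p0 h) = p0 h" for h by (rule pr_idem[OF P(1)])
 have XM: "X \<in> M" unfolding X_def by (intro mem_intros a proj_mem P)
 \<comment> \<open>1 = v + p0 + w: on v the operator x becomes the bounded X, on p0 it is bounded by
   its singular value at T, and on w its support has trace at most \<delta>. The last two terms form
   the error.\<close>
 define w where "w = (I - p) o\<^sub>L (I - p0)"
 define v where "v = p o\<^sub>L (I - p0)"
 have wM: "w \<in> M" "v \<in> M" unfolding w_def v_def by (intro mem_intros proj_mem P)+
 have n: "norm (q o\<^sub>L r) \<le> 1" if "q \<in> Proj" "r \<in> Proj" for q r
 proof -
  have "norm (q o\<^sub>L r) \<le> norm q * norm r" by (rule norm_blinfun_compose)
  also have "\<dots> \<le> 1 * 1" by (intro mult_mono proj_norm1 that) auto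
  finally show ?thesis by simp
 qed
 have nw: "norm w \<le> 1" "norm v \<le> 1" unfolding w_def v_def by (intro n proj_compl P)+
 have rm: "Sm (op_graph b O x) ?m" if "b \<in> M" "norm b \<le> 1" for b
  by (rule Sm_mono[OF Sm_rmul[OF S that(1) m0] order_refl]) (use that(2) m0 in \<open>auto intro: mult_left_le_one_le\<close>)
 have Xg: "(v g, X g) \<in> x" for g using a(2)[of "g - p0 g"] by (simp add: v_def X_def blin)
 have "op_graph v O x = op_graph X" using Xg linear_graph_unique[OF lin] by (auto simp: relcomp_unfold set_eq_iff)
 then have XS: "Sm (op_graph X) ?m" using rm[OF wM(2) nw(2)] by simp
 have "X ((I - p0) h) = X h" for h by (simp add: X_def blin idp)
 from tau_support_right[OF XM proj_compl[OF P(1)] this] have XT: "\<tau>c (kerp X) \<le> ennreal T" using p0(2) by (rule order_trans)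
 have Z1: "Sm (op_graph p0 O x) (\<lambda>t. min (?m t) (?m T))" unfolding Sm_def
 proof (intro allI impI)
  fix t :: real assume t: "t > 0"
  show "\<exists>q. bdd_on (op_graph p0 O x) q (min (?m t) (?m T)) \<and> \<tau>c q \<le> ennreal t"
  proof (cases "?m t \<le> ?m T")
   case True
   then show ?thesis using SmD[OF rm[OF proj_mem[OF P(1)] proj_norm1[OF P(1)]] t] by simp
  next
   case False
   have "bdd_on (op_graph p0 O x) I (?m T)" unfolding bdd_on_def
   proof (intro conjI proj_id_mem allI)
    fix h
    obtain k where "(p0 h, k) \<in> x" "norm k \<le> ?m T * norm h" using p0(1) unfolding bdd_on_def by blast
    then show "\<exists>k. (I h, k) \<in> op_graph p0 O x \<and> norm k \<le> ?m T * norm h" by (auto simp: relcomp_unfold)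
   qed
   then show ?thesis using False by (intro exI[of _ I]) (simp add: tau_zero)
  qed
 qed
 have Z2: "Sm (op_graph w O x) (\<lambda>t. if t < \<delta> then ?m t else 0)" unfolding Sm_def
 proof (intro allI impI)
  fix t :: real assume t: "t > 0"
  show "\<exists>q. bdd_on (op_graph w O x) q (if t < \<delta> then ?m t else 0) \<and> \<tau>c q \<le> ennreal t"
  proof (cases "t < \<delta>")
   case True
   then show ?thesis using SmD[OF rm[OF wM(1) nw(1)] t] by simp
  next
   case False
   have "w (kerp w h) = 0" for h by (rule kerp_apply)
   then have b: "bdd_on (op_graph w O x) (kerp w) 0"
    using proj_kerp[OF wM(1)] linear_graphD(1)[OF lin] by (auto simp: bdd_on_def relcomp_unfold)
   have "p (w h) = 0" for h by (simp add: w_def blin pr_idem[OF P(2)])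
   then have "(I - p) (w h) = w h" for h by (simp add: blin)
   from tau_support_left[OF wM(1) proj_compl[OF P(2)] this]
   have "\<tau>c (kerp w) \<le> ennreal \<delta>" using p(2) by (rule order_trans)
   also have "\<dots> \<le> ennreal t" using False by (intro ennreal_leI) simp
   finally show ?thesis using b False by auto
  qed
 qed
 have "Sm (padd (op_graph p0 O x) (op_graph w O x)) (\<lambda>t. min (?m (t / 2)) (?m T) + (if t / 2 < \<delta> then ?m (t / 2) else 0))"
  by (rule Sm_padd[OF Z1 Z2]) (simp_all add: m0)
 moreover have "padd (op_graph X) (padd (op_graph p0 O x) (op_graph w O x)) \<subseteq> x"
 proof (rule subrelI)
  fix g k assume "(g, k) \<in> padd (op_graph X) (padd (op_graph p0 O x) (op_graph w O x))"
  then obtain k1 k2 where k: "k = X g + (k1 + k2)" "(p0 g, k1) \<in> x" "(w g, k2) \<in> x" by (auto simp: padd_iff relcomp_unfold)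
  have "(v g + (p0 g + w g), X g + (k1 + k2)) \<in> x" by (intro linear_graphD(2)[OF lin] Xg k)
  moreover have "v g + (p0 g + w g) = g" by (simp add: v_def w_def blin)
  ultimately show "(g, k) \<in> x" using k(1) by simp
 qed
 ultimately have "App x X (\<lambda>t. min (?m (t / 2)) (?m T) + (if t / 2 < \<delta> then ?m (t / 2) else 0))" unfolding App_def by blast
 then show ?thesis using that XM XS XT by blast
qed

end

section \<open>Symmetric function spaces\<close>

text \<open>Normalized decreasing functions: the value 0 on the negative half-line and at 0 makes
  them Borel functions on the line and keeps infinite limits at 0 harmless.\<close>

definition decf :: "(real \<Rightarrow> real) \<Rightarrow> bool"
 where "decf f \<longleftrightarrow> (\<forall>t\<le>0. f t = 0) \<and> (\<forall>t. 0 \<le> f t) \<and> (\<forall>s t. 0 < s \<longrightarrow> s \<le> t \<longrightarrow> f t \<le> f s)"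

definition chi :: "real \<Rightarrow> real \<Rightarrow> real"
 where "chi T t = (if 0 < t \<and> t < T then 1 else 0)"

lemma decfD: "decf f \<Longrightarrow> t \<le> 0 \<Longrightarrow> f t = 0" "decf f \<Longrightarrow> 0 \<le> f t" "decf f \<Longrightarrow> 0 < s \<Longrightarrow> s \<le> t \<Longrightarrow> f t \<le> f s" by (auto simp: decf_def)

lemma decf_intros:
 shows decf_chi: "decf (chi T)"
  and decf_add: "decf f \<Longrightarrow> decf g \<Longrightarrow> decf (\<lambda>t. f t + g t)"
  and decf_scale: "0 \<le> c \<Longrightarrow> decf f \<Longrightarrow> decf (\<lambda>t. c * f t)"
  and decf_minc: "0 \<le> c \<Longrightarrow> decf f \<Longrightarrow> decf (\<lambda>t. min (f t) c)"
  and decf_mult: "decf f \<Longrightarrow> decf g \<Longrightarrow> decf (\<lambda>t. f t * g t)"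
  and decf_half: "decf f \<Longrightarrow> decf (\<lambda>t. f (t / 2))" unfolding decf_def chi_def
 by (auto intro: add_mono mult_mono mult_left_mono min.coboundedI1 min.coboundedI2)

lemma decf_measurable: "decf f \<Longrightarrow> f \<in> borel_measurable borel"
proof -
 assume f: "decf f"
 have "(\<lambda>t. - f t) \<in> borel_measurable borel"
 proof (rule borel_measurable_piecewise_mono[of "{{..0}, {0<..}}"])
  show "mono_on c (\<lambda>t. - f t)" if "c \<in> {{..0}, {0<..}}" for c using that f by (auto simp: decf_def intro!: mono_onI)
 qed (auto simp: not_le)
 then have "(\<lambda>t. - (- f t)) \<in> borel_measurable borel" by measurable
 then show ?thesis by simp
qed

lemma halfline_measurable: "f \<in> borel_measurable borel \<Longrightarrow> f \<in> borel_measurable halfline"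
 by (intro measurable_restrict_space1 measurable_completion) simp

lemma decf_halfline: "decf f \<Longrightarrow> f \<in> borel_measurable halfline" by (intro halfline_measurable decf_measurable)

lemma emeasure_halfline: "A \<in> sets borel \<Longrightarrow> emeasure halfline {u \<in> space halfline. u \<in> A} = emeasure lborel ({0..} \<inter> A)"
proof -
 assume A: "A \<in> sets borel"
 have "{u \<in> space halfline. u \<in> A} = {0..} \<inter> A" by auto
 then show ?thesis using A by (simp add: emeasure_restrict_space)
qed

lemma emeasure_halfline_pos:
 fixes h :: "real \<Rightarrow> real"
 assumes h: "h \<in> borel_measurable borel" "\<And>t. 0 \<le> h t" "\<And>t. t \<le> 0 \<Longrightarrow> h t = 0" and s: "0 \<le> s"
 shows "emeasure halfline {u \<in> space halfline. s < \<bar>h u\<bar>} = emeasure lborel {t. s < h t}"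
proof -
 have "{t. s < h t} \<in> sets borel" using h(1) by measurable
 moreover have "{0..} \<inter> {t. s < h t} = {t. s < h t}"
 proof -
  have "0 \<le> t" if "s < h t" for t using that h(3)[of t] s by (cases "t \<le> 0") auto
  then show ?thesis by auto
 qed
 ultimately show ?thesis using emeasure_halfline[of "{t. s < h t}"] h(2) by simp
qed

lemma decreasing_rearrangement_cong:
 fixes f g :: "real \<Rightarrow> real"
 assumes "f \<in> borel_measurable borel" "\<And>t. 0 \<le> f t" "\<And>t. t \<le> 0 \<Longrightarrow> f t = 0"
  and "g \<in> borel_measurable borel" "\<And>t. 0 \<le> g t" "\<And>t. t \<le> 0 \<Longrightarrow> g t = 0"
  and eq: "\<And>s. 0 \<le> s \<Longrightarrow> emeasure lborel {t. s < g t} = emeasure lborel {t. s < f t}"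
 shows "decreasing_rearrangement g t = decreasing_rearrangement f t"
proof -
 define A where "A s = emeasure halfline {u \<in> space halfline. s < \<bar>g u\<bar>}" for s
 define B where "B s = emeasure halfline {u \<in> space halfline. s < \<bar>f u\<bar>}" for s
 have "A s = B s" if s: "0 \<le> s" for s
 proof -
  have "A s = emeasure lborel {t. s < g t}" unfolding A_def by (rule emeasure_halfline_pos[OF assms(4-6) s])
  also have "\<dots> = emeasure lborel {t. s < f t}" by (rule eq[OF s])
  also have "\<dots> = B s" unfolding B_def by (rule emeasure_halfline_pos[OF assms(1-3) s, symmetric])
  finally show ?thesis .
 qed
 then have "{ennreal s | s. 0 \<le> s \<and> A s \<le> ennreal t} = {ennreal s | s. 0 \<le> s \<and> B s \<le> ennreal t}" by auto
 then show ?thesis unfolding decreasing_rearrangement_def A_def B_def by simp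
qed

lemma AE_halfline: "(\<And>t. t > 0 \<Longrightarrow> P t) \<Longrightarrow> AE t in halfline. P t"
proof -
 assume P: "\<And>t. t > 0 \<Longrightarrow> P t"
 show ?thesis
 proof (rule AE_I[of _ _ "{0}"])
  show "{t \<in> space halfline. \<not> P t} \<subseteq> {0}" using P by (auto simp: not_less_iff_gr_or_eq less_le)
  show "emeasure halfline {0} = 0" by (simp add: emeasure_restrict_space)
  show "{0} \<in> sets halfline" by (simp add: sets_restrict_space_iff)
 qed
qed

section \<open>Equimeasurable copies and dilation\<close>

lemma emeasure_lborel_shift:
 assumes "B \<in> sets borel" shows "emeasure lborel ((\<lambda>t::real. t - c) -` B) = emeasure lborel B"
proof -
 have "lborel = distr lborel borel ((+) (- c))" using lborel_distr_plus[of "- c"] by simp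
 then have "emeasure lborel B = emeasure (distr lborel borel ((+) (- c))) B" by simp
 also have "\<dots> = emeasure lborel (((+) (- c)) -` B \<inter> space lborel)" by (rule emeasure_distr) (use assms in auto)
 finally show ?thesis by (simp add: vimage_def)
qed

lemma emeasure_lborel_half:
 assumes "B \<in> sets borel" shows "emeasure lborel ((\<lambda>t::real. t / 2) -` B) = 2 * emeasure lborel B"
proof -
 have "emeasure lborel ((\<lambda>t::real. t / 2) -` B) = emeasure (distr lborel borel ((*) (1/2))) B"
  by (subst emeasure_distr) (use assms in \<open>auto simp: vimage_def\<close>)
 also have "\<dots> = emeasure (density lborel (\<lambda>_. ennreal (inverse \<bar>1/2\<bar>))) B" by (subst lborel_distr_mult) auto
 also have "\<dots> = 2 * emeasure lborel B" using assms by (subst emeasure_density) (auto simp: nn_integral_cmult)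
 finally show ?thesis .
qed

text \<open>Moves the piece of f over [m, m+1) to [2m + r, 2m + r + 1). For r = 0 and r = 1 this
  produces two disjointly supported functions equimeasurable with f.\<close>

definition spread :: "int \<Rightarrow> (real \<Rightarrow> real) \<Rightarrow> real \<Rightarrow> real"
 where "spread r f t = (if 0 \<le> t \<and> \<lfloor>t\<rfloor> mod 2 = r then f (t - of_int ((\<lfloor>t\<rfloor> + r) div 2)) else 0)"

lemma spread_measurable: "f \<in> borel_measurable borel \<Longrightarrow> spread r f \<in> borel_measurable borel"
proof -
 assume [measurable]: "f \<in> borel_measurable borel"
 show ?thesis unfolding spread_def by measurable
qed

lemma emeasure_spread:
 assumes f: "decf f" and s: "0 \<le> s" and r: "r = 0 \<or> r = 1"
 shows "emeasure lborel {t. s < spread r f t} = emeasure lborel {t. s < f t}"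
proof -
 have fm[measurable]: "f \<in> borel_measurable borel" by (rule decf_measurable[OF f])
 define B where "B = {t. s < f t}"
 have Bm: "B \<in> sets borel" unfolding B_def by measurable
 have Bp: "0 < t" if "t \<in> B" for t using that s decfD(1)[OF f, of t] by (force simp: B_def)
 define A where "A m = (\<lambda>t. t - (real m + of_int r)) -` (B \<inter> {real m..<real m + 1})" for m :: nat
 have rr: "0 \<le> r" "r \<le> 1" using r by auto
 have U: "{t. s < spread r f t} = (\<Union>m. A m)"
 proof (intro equalityI subsetI)
  fix t assume "t \<in> {t. s < spread r f t}"
  then have t: "0 \<le> t" "\<lfloor>t\<rfloor> mod 2 = r" "s < f (t - of_int ((\<lfloor>t\<rfloor> + r) div 2))" using s by (auto simp: spread_def split: if_splits)
  define m where "m = nat (\<lfloor>t\<rfloor> div 2)"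
  have m: "int m = \<lfloor>t\<rfloor> div 2" using t(1) by (simp add: m_def)
  have fl: "\<lfloor>t\<rfloor> = 2 * int m + r" using m t(2) by presburger
  have d: "(\<lfloor>t\<rfloor> + r) div 2 = int m + r" using fl by simp
  have "of_int \<lfloor>t\<rfloor> \<le> t" "t < of_int \<lfloor>t\<rfloor> + 1" by linarith+
  then have "2 * real m + of_int r \<le> t" "t < 2 * real m + of_int r + 1" unfolding fl by simp_all
  moreover have "s < f (t - (real m + of_int r))" using t(3) unfolding d by simp
  ultimately have "t \<in> A m" by (simp add: A_def B_def)
  then show "t \<in> (\<Union>m. A m)" by blast
 next
  fix t assume "t \<in> (\<Union>m. A m)"
  then obtain m where "t \<in> A m" by blast
  then have t: "s < f (t - (real m + of_int r))" "2 * real m + of_int r \<le> t" "t < 2 * real m + of_int r + 1"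
   by (auto simp: A_def B_def)
  have fl: "\<lfloor>t\<rfloor> = 2 * int m + r" using t by (intro floor_unique) auto
  have "\<lfloor>t\<rfloor> mod 2 = r" using r by (auto simp: fl)
  moreover have "0 \<le> t" using t(2) rr by (smt (verit) of_int_0_le_iff of_nat_0_le_iff)
  moreover have "(\<lfloor>t\<rfloor> + r) div 2 = int m + r" using fl by simp
  ultimately show "t \<in> {t. s < spread r f t}" using t(1) by (simp add: spread_def)
 qed
 have Am: "A m \<in> sets lborel" for m
  using measurable_sets_borel[of "\<lambda>t. t - (real m + of_int r)" borel "B \<inter> {real m..<real m + 1}"] Bm
  unfolding A_def by (auto simp: sets_lborel)
 have fA: "\<lfloor>t\<rfloor> = 2 * int m + r" if "t \<in> A m" for t m using that by (intro floor_unique) (auto simp: A_def)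
 have dA: "disjoint_family A"
  unfolding disjoint_family_on_def using fA by (smt (verit, best) disjoint_iff mult_cancel_left of_nat_eq_iff)
 have "emeasure lborel (\<Union>m. A m) = (\<Sum>m. emeasure lborel (A m))" by (rule suminf_emeasure[symmetric]) (use Am dA in auto)
 also have "\<dots> = (\<Sum>m. emeasure lborel (B \<inter> {real m..<real m + 1}))"
  unfolding A_def by (subst emeasure_lborel_shift) (use Bm in auto)
 also have "\<dots> = emeasure lborel (\<Union>m. B \<inter> {real m..<real m + 1})"
 proof (rule suminf_emeasure)
  have fl: "\<lfloor>t\<rfloor> = int m" if "t \<in> B \<inter> {real m..<real m + 1}" for t m using that by (intro floor_unique) auto
  then show "disjoint_family (\<lambda>m. B \<inter> {real m..<real m + 1})"
   unfolding disjoint_family_on_def by (smt (verit, best) disjoint_iff of_nat_eq_iff)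
 qed (use Bm in auto)
 also have "(\<Union>m. B \<inter> {real m..<real m + 1}) = B"
 proof (intro equalityI subsetI)
  fix t assume t: "t \<in> B"
  have "real (nat \<lfloor>t\<rfloor>) = of_int \<lfloor>t\<rfloor>" using Bp[OF t] by simp
  then have "t \<in> B \<inter> {real (nat \<lfloor>t\<rfloor>)..<real (nat \<lfloor>t\<rfloor>) + 1}" using t by simp
  then show "t \<in> (\<Union>m. B \<inter> {real m..<real m + 1})" by blast
 qed auto
 finally show ?thesis unfolding U B_def .
qed

locale sym_space = symmetric_function_space E N for E :: "(real \<Rightarrow> real) set" and N +
 assumes oc: "order_continuous E N" and fatou: "fatou_property E N"
begin

lemma dom_in:
 assumes "f \<in> E" "g \<in> borel_measurable halfline" "\<And>t. t > 0 \<Longrightarrow> \<bar>g t\<bar> \<le> \<bar>f t\<bar>"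
 shows "g \<in> E" "N g \<le> N f"
 using ideal[OF assms(1,2) AE_halfline] norm_mono[OF assms(1) ideal[OF assms(1,2) AE_halfline] AE_halfline] assms(3) by auto

lemma dom_decf:
 assumes "f \<in> E" "decf g" "\<And>t. t > 0 \<Longrightarrow> g t \<le> f t"
 shows "g \<in> E" "N g \<le> N f" using dom_in[OF assms(1) decf_halfline[OF assms(2)]] assms(3) decfD(2)[OF assms(2)] by force+

lemma N_cong:
 assumes "f \<in> E" "g \<in> E" "\<And>t. t > 0 \<Longrightarrow> f t = g t"
 shows "N f = N g" using norm_mono[OF assms(1,2) AE_halfline] norm_mono[OF assms(2,1) AE_halfline] assms(3) by fastforce

lemma chi_in: "chi T \<in> E"
proof (rule simple_functions)
 have m: "chi T \<in> borel_measurable halfline" by (rule decf_halfline[OF decf_chi])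
 have "chi T ` space halfline \<subseteq> {0, 1}" by (auto simp: chi_def)
 then show "simple_function halfline (chi T)" using m finite_subset by (subst simple_function_borel_measurable) auto
 have "{t \<in> space halfline. chi T t \<noteq> 0} = {u \<in> space halfline. u \<in> {0<..<T}}" by (auto simp: chi_def)
 then have "emeasure halfline {t \<in> space halfline. chi T t \<noteq> 0} = emeasure lborel ({0..} \<inter> {0<..<T})"
  by (simp only: emeasure_halfline[OF borel_open[OF open_greaterThanLessThan]])
 also have "{0..} \<inter> {0<..<T} = {0<..<T}" by auto
 also have "emeasure lborel {0<..<T} < \<infinity>" by (cases "0 \<le> T") auto
 finally show "emeasure halfline {t \<in> space halfline. chi T t \<noteq> 0} < \<infinity>" .
qed

lemma zero_in: "(\<lambda>_. 0) \<in> E" and N_zero: "N (\<lambda>_. 0) = 0"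
 using scale_closed[OF chi_in, of 0 1] norm_scale[OF chi_in, of 0 1] by simp_all

lemma N_nonneg: "f \<in> E \<Longrightarrow> 0 \<le> N f" using norm_mono[of f "\<lambda>_. 0"] zero_in N_zero by auto

lemma dominated_decreasing:
 assumes G: "\<And>n. G n \<in> E" and dec: "\<And>n t. t > 0 \<Longrightarrow> 0 \<le> G (Suc n) t \<and> G (Suc n) t \<le> G n t"
  and lim: "\<And>t. t > 0 \<Longrightarrow> (\<lambda>n. G n t) \<longlonglongrightarrow> 0"
 shows "(\<lambda>n. N (G n)) \<longlonglongrightarrow> 0"
proof -
 have mono: "G m t \<le> G n t" if "t > 0" "n \<le> m" for n m t
  using that(2) by (induction m rule: dec_induct) (use dec that(1) in \<open>auto intro: order_trans\<close>)
 have nn: "0 \<le> G n t" if "t > 0" for n t using dec[OF that, of n] by linarith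
 have key: "\<forall>\<epsilon>>0. \<exists>f\<in>range G. \<forall>g\<in>range G. (AE t in halfline. g t \<le> f t) \<longrightarrow> N g < \<epsilon>"
 proof (rule oc[unfolded order_continuous_def, THEN spec, THEN mp], intro conjI)
  show "range G \<subseteq> E" "range G \<noteq> {}" using G by auto
  show "\<forall>f\<in>range G. \<forall>g\<in>range G. \<exists>h\<in>range G. (AE t in halfline. h t \<le> f t) \<and> (AE t in halfline. h t \<le> g t)"
  proof clarify
   fix i j
   show "\<exists>h\<in>range G. (AE t in halfline. h t \<le> G i t) \<and> (AE t in halfline. h t \<le> G j t)"
    by (rule bexI[of _ "G (max i j)"]) (auto intro!: AE_halfline mono)
  qed
  show "\<forall>f\<in>range G. AE t in halfline. 0 \<le> f t" using nn by (auto intro!: AE_halfline)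
  show "\<forall>g\<in>E. (\<forall>f\<in>range G. AE t in halfline. g t \<le> f t) \<longrightarrow> (AE t in halfline. g t \<le> 0)"
  proof (intro ballI impI)
   fix g assume "\<forall>f\<in>range G. AE t in halfline. g t \<le> f t"
   then have "AE t in halfline. \<forall>n. g t \<le> G n t" by (simp add: AE_all_countable)
   moreover have "AE t in halfline. (\<lambda>n. G n t) \<longlonglongrightarrow> 0" by (rule AE_halfline[OF lim])
   ultimately show "AE t in halfline. g t \<le> 0" by eventually_elim (auto intro: LIMSEQ_le_const)
  qed
 qed
 have ex: "\<exists>n. \<forall>m\<ge>n. N (G m) < \<epsilon>" if e: "\<epsilon> > 0" for \<epsilon>
 proof -
  from key[rule_format, OF e] obtain f where f: "f \<in> range G"
   "\<forall>g\<in>range G. (AE t in halfline. g t \<le> f t) \<longrightarrow> N g < \<epsilon>" by (rule bexE)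
  obtain n where n: "f = G n" using f(1) by (rule rangeE)
  have "N (G m) < \<epsilon>" if "m \<ge> n" for m
  proof -
   have "AE t in halfline. G m t \<le> f t" unfolding n by (rule AE_halfline) (rule mono[OF _ that])
   then show ?thesis using f(2) by simp
  qed
  then show ?thesis by blast
 qed
 show ?thesis
 proof (rule LIMSEQ_I)
  fix r :: real assume "0 < r"
  then show "\<exists>no. \<forall>n\<ge>no. norm (N (G n) - 0) < r" using ex[of r] N_nonneg[OF G] by auto
 qed
qed

lemma dominated:
 assumes F: "\<And>n. F n \<in> borel_measurable halfline" and G: "G \<in> E"
  and le: "\<And>n t. t > 0 \<Longrightarrow> \<bar>F n t\<bar> \<le> G t" and lim: "\<And>t. t > 0 \<Longrightarrow> (\<lambda>n. F n t) \<longlonglongrightarrow> 0"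
 shows "(\<lambda>n. N (F n)) \<longlonglongrightarrow> 0"
proof -
 \<comment> \<open>Suprema of tails turn the dominated sequence into a decreasing one. The passage
   through extended reals loses nothing at t > 0, where G bounds the suprema.\<close>
 define H where "H n t = enn2real (SUP m. ennreal \<bar>F (n + m) t\<bar>)" for n t
 have Hm: "H n \<in> borel_measurable halfline" for n unfolding H_def using F by measurable
 have G0: "0 \<le> G t" if "t > 0" for t using le[OF that, of 0] by linarith
 have sup: "(SUP m. ennreal \<bar>F (n + m) t\<bar>) \<le> ennreal c" if "\<And>m. m \<ge> n \<Longrightarrow> \<bar>F m t\<bar> \<le> c" for n t c
  using that by (intro SUP_least ennreal_leI) simp
 have Hle: "H n t \<le> c" if "\<And>m. m \<ge> n \<Longrightarrow> \<bar>F m t\<bar> \<le> c" "0 \<le> c" for n t c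
  unfolding H_def by (rule enn2real_leI[OF that(2) sup]) (rule that(1))
 have fin: "(SUP m. ennreal \<bar>F (n + m) t\<bar>) < \<infinity>" if "t > 0" for n t
  using sup[of n t "G t"] le[OF that] by (auto intro: le_less_trans)
 have Fle: "\<bar>F (n + m) t\<bar> \<le> H n t" if "t > 0" for n m t
 proof -
  have "ennreal \<bar>F (n + m) t\<bar> \<le> (SUP m. ennreal \<bar>F (n + m) t\<bar>)" by (rule SUP_upper) simp
  then have "enn2real (ennreal \<bar>F (n + m) t\<bar>) \<le> H n t" unfolding H_def by (rule enn2real_mono) (use fin[OF that] in simp)
  then show ?thesis by simp
 qed
 have H0: "0 \<le> H n t" for n t by (simp add: H_def)
 have HE: "H n \<in> E" for n by (rule dom_in(1)[OF G Hm]) (use Hle le G0 H0 in \<open>auto intro!: order_trans[OF Hle]\<close>)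
 have "(\<lambda>n. N (H n)) \<longlonglongrightarrow> 0"
 proof (rule dominated_decreasing[OF HE])
  show "0 \<le> H (Suc n) t \<and> H (Suc n) t \<le> H n t" if "t > 0" for n t
  proof (intro conjI H0 Hle)
   fix m assume "Suc n \<le> m"
   then show "\<bar>F m t\<bar> \<le> H n t" using Fle[OF that, of n "m - n"] by simp
  qed
  show "(\<lambda>n. H n t) \<longlonglongrightarrow> 0" if t: "t > 0" for t
  proof (rule LIMSEQ_I)
   fix r :: real assume r: "0 < r"
   then obtain n0 where n0: "\<And>n. n \<ge> n0 \<Longrightarrow> norm (F n t - 0) < r / 2" using LIMSEQ_D[OF lim[OF t], of "r / 2"] by auto
   have "H n t \<le> r / 2" if "n \<ge> n0" for n by (rule Hle) (use n0 that r in \<open>auto simp: less_imp_le\<close>)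
   then show "\<exists>no. \<forall>n\<ge>no. norm (H n t - 0) < r" using r H0 by (intro exI[of _ n0]) (fastforce simp: abs_of_nonneg)
  qed
 qed
 moreover have "N (F n) \<le> N (H n)" for n by (rule dom_in(2)[OF HE F]) (use Fle[of _ n 0] H0 in auto)
 moreover have "F n \<in> E" for n by (rule dom_in(1)[OF HE F]) (use Fle[of _ n 0] H0 in auto)
 ultimately show ?thesis
  by (intro tendsto_sandwich[of "\<lambda>_. 0" "\<lambda>n. N (F n)" sequentially "\<lambda>n. N (H n)"]) (auto intro!: always_eventually N_nonneg)
qed

lemma rearrange:
 assumes "f \<in> E" "decf f" "g \<in> borel_measurable borel" "\<And>t. 0 \<le> g t" "\<And>t. t \<le> 0 \<Longrightarrow> g t = 0"
  and eq: "\<And>s. 0 \<le> s \<Longrightarrow> emeasure lborel {t. s < g t} = emeasure lborel {t. s < f t}"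
 shows "g \<in> E" "N g = N f"
proof -
 have "decreasing_rearrangement g t = decreasing_rearrangement f t" for t
  by (rule decreasing_rearrangement_cong[OF decf_measurable[OF assms(2)] decfD(2)[OF assms(2)] decfD(1)[OF assms(2)] assms(3-5) eq])
 then have "g \<in> E \<and> N g = N f" by (intro rearrangement_invariant assms halfline_measurable) auto
 then show "g \<in> E" "N g = N f" by auto
qed

text \<open>f (t/2) has the distribution of a sum of two disjoint copies of f, so rearrangement
  invariance and the triangle inequality give the constant 2.\<close>

lemma dilation:
 assumes f: "f \<in> E" "decf f"
 shows "(\<lambda>t. f (t / 2)) \<in> E" "N (\<lambda>t. f (t / 2)) \<le> 2 * N f"
proof -
 have fm[measurable]: "f \<in> borel_measurable borel" by (rule decf_measurable[OF f(2)])
 have z: "spread r f t = 0" if "t \<le> 0" for r t using that decfD(1)[OF f(2)] by (auto simp: spread_def)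
 have nn: "0 \<le> spread r f t" for r t using decfD(2)[OF f(2)] by (simp add: spread_def)
 have s0: "spread 0 f \<in> E" "N (spread 0 f) = N f" and s1: "spread 1 f \<in> E" "N (spread 1 f) = N f"
  using rearrange[OF f spread_measurable[OF fm] nn z emeasure_spread[OF f(2)]] by auto
 let ?F = "\<lambda>t. spread 0 f t + spread 1 f t" and ?D = "\<lambda>t. f (t / 2)"
 have FE: "?F \<in> E" by (rule add_closed[OF s0(1) s1(1)])
 have Dd: "decf ?D" by (rule decf_half[OF f(2)])
 have "\<lfloor>t\<rfloor> mod 2 = 0 \<or> \<lfloor>t\<rfloor> mod 2 = 1" for t :: real by presburger
 then have alt: "(s < ?F t) \<longleftrightarrow> s < spread 0 f t \<or> s < spread 1 f t" "\<not> (s < spread 0 f t \<and> s < spread 1 f t)" if "0 \<le> s" for s t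
  using that by (auto simp: spread_def)
 have eq: "emeasure lborel {t. s < ?F t} = emeasure lborel {t. s < ?D t}" if s: "0 \<le> s" for s
 proof -
  have "{t. s < ?F t} = {t. s < spread 0 f t} \<union> {t. s < spread 1 f t}" using alt(1)[OF s] by auto
  moreover have "{t. s < spread 0 f t} \<inter> {t. s < spread 1 f t} = {}" using alt(2)[OF s] by auto
  moreover have "{t. s < spread r f t} \<in> sets lborel" for r using spread_measurable[OF fm, of r] by measurable
  ultimately have "emeasure lborel {t. s < ?F t} = emeasure lborel {t. s < spread 0 f t} + emeasure lborel {t. s < spread 1 f t}"
   using plus_emeasure by metis
  also have "\<dots> = 2 * emeasure lborel {t. s < f t}" using emeasure_spread[OF f(2) s] by (simp add: mult_2)
  also have "\<dots> = emeasure lborel ((\<lambda>t. t / 2) -` {t. s < f t})" by (rule emeasure_lborel_half[symmetric]) measurable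
  finally show ?thesis by (simp add: vimage_def)
 qed
 have Fm: "?F \<in> borel_measurable borel" using spread_measurable[OF fm] by measurable
 have "?D \<in> E \<and> N ?D = N ?F"
 proof -
  have "decreasing_rearrangement ?D t = decreasing_rearrangement ?F t" for t
   by (rule decreasing_rearrangement_cong[OF Fm _ _ decf_measurable[OF Dd] decfD(2)[OF Dd] decfD(1)[OF Dd]])
    (simp_all add: nn z eq)
  then show ?thesis by (intro rearrangement_invariant FE decf_halfline Dd) auto
 qed
 then show "?D \<in> E" "N ?D \<le> 2 * N f" using norm_triangle[OF s0(1) s1(1)] s0(2) s1(2) by auto
qed

lemma chi_small: "(\<lambda>n. N (chi (1 / real (Suc n)))) \<longlonglongrightarrow> 0"
proof (rule dominated[OF decf_halfline[OF decf_chi] chi_in[of 2]])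
 show "\<bar>chi (1 / real (Suc n)) t\<bar> \<le> chi 2 t" if "t > 0" for n t
 proof -
  have "1 / real (Suc n) \<le> 1" by simp
  then have "t < 2" if "t < 1 / real (Suc n)" using that by linarith
  then show ?thesis using that by (cases "t < 1 / real (Suc n)") (simp_all add: chi_def del: of_nat_Suc)
 qed
 show "(\<lambda>n. chi (1 / real (Suc n)) t) \<longlonglongrightarrow> 0" if t: "t > 0" for t
 proof -
  obtain n0 where n0: "1 / real (Suc n0) < t" using reals_Archimedean[OF t] by (auto simp: inverse_eq_divide)
  have "chi (1 / real (Suc n)) t = 0" if "n \<ge> n0" for n
  proof -
   have "1 / real (Suc n) \<le> 1 / real (Suc n0)" using that by (simp add: frac_le)
   then show ?thesis using n0 by (simp add: chi_def)
  qed
  then show ?thesis by (intro tendsto_eventually eventually_sequentiallyI)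
 qed
qed

text \<open>If the norms were bounded, the Fatou property would put the constant 1 into E. Its
  restrictions to (n, \<infinity>) are equimeasurable with it but decrease to 0, so order continuity
  would give it norm 0.\<close>

lemma chi_unbounded: "\<exists>n. B < N (chi (real n))"
proof (rule ccontr)
 assume "\<not> (\<exists>n. B < N (chi (real n)))"
 then have B: "N (chi (real n)) \<le> B" for n by (simp add: not_less)
 define one :: "real \<Rightarrow> real" where "one t = (if t \<le> 0 then 0 else 1)" for t
 have d1: "decf one" by (simp add: decf_def one_def)
 have lim: "(\<lambda>n. chi (real n) t) \<longlonglongrightarrow> one t" if t: "t > 0" for t
 proof -
  obtain n0 where "t < real n0" using reals_Archimedean2 by blast
  then have "chi (real n) t = one t" if "n \<ge> n0" for n using that t by (simp add: chi_def one_def)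
  then show ?thesis by (intro tendsto_eventually eventually_sequentiallyI)
 qed
 have oneE: "one \<in> E"
 proof -
  have "one \<in> E \<and> N one = (SUP n. N (chi (real n)))"
   by (rule fatou[unfolded fatou_property_def, rule_format, of "\<lambda>n. chi (real n)"])
    (use B lim in \<open>auto intro!: chi_in decf_halfline d1 AE_halfline bdd_aboveI2[of _ _ B] simp: chi_def\<close>)
  then show ?thesis ..
 qed
 define G where "G n t = (if t \<le> real n then 0 else (1::real))" for n :: nat and t
 have Gm: "G n \<in> borel_measurable borel" for n unfolding G_def by measurable
 have "G n \<in> E \<and> N (G n) = N one" for n
 proof -
  have "emeasure lborel {t. s < G n t} = emeasure lborel {t. s < one t}" if s: "0 \<le> s" for s
  proof (cases "s < 1")
   case True
   have inf: "emeasure lborel {a<..} = \<infinity>" for a :: real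
   proof -
    have "ennreal (real k) \<le> emeasure lborel {a<..}" for k :: nat
    proof -
     have "ennreal (real k) = emeasure lborel {a<..a + real k}" by simp
     also have "\<dots> \<le> emeasure lborel {a<..}" by (rule emeasure_mono) auto
     finally show ?thesis .
    qed
    then show ?thesis by (metis ennreal_of_nat_eq_real_of_nat ennreal_SUP_of_nat_eq_top SUP_le_iff infinity_ennreal_def top_unique)
   qed
   have "{t. s < G n t} = {real n<..}" "{t. s < one t} = {0<..}" using True s by (auto simp: G_def one_def)
   then show ?thesis by (simp only: inf)
  next
   case False
   have "{t. s < G n t} = {}" "{t. s < one t} = {}" using False by (auto simp: G_def one_def)
   then show ?thesis by simp
  qed
  then show ?thesis using rearrange[OF oneE d1 Gm, of n] by (auto simp: G_def)
 qed
 then have GE: "G n \<in> E" and GN: "N (G n) = N one" for n by auto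
 have "(\<lambda>n. N (G n)) \<longlonglongrightarrow> 0"
 proof (rule dominated_decreasing[OF GE])
  show "(\<lambda>n. G n t) \<longlonglongrightarrow> 0" for t
  proof -
   obtain n0 where "t < real n0" using reals_Archimedean2 by blast
   then have "G n t = 0" if "n \<ge> n0" for n using that by (simp add: G_def)
   then show ?thesis by (intro tendsto_eventually eventually_sequentiallyI)
  qed
 qed (auto simp: G_def)
 then have "N one = 0" using GN LIMSEQ_unique[OF tendsto_const] by simp
 then have "AE t in halfline. one t = 0" by (rule norm_definite[OF oneE])
 then have "AE t in halfline. t \<notin> {1<..<2}" by eventually_elim (auto simp: one_def)
 then have "emeasure halfline {u \<in> space halfline. u \<in> {1<..<2}} = 0" by (rule emeasure_eq_0_AE)
 then have "emeasure lborel ({0..} \<inter> {1<..<2::real}) = 0" using emeasure_halfline[of "{1<..<2}"] by simp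
 moreover have "{0..} \<inter> {1<..<2::real} = {1<..<2}" by auto
 ultimately show False by simp
qed

text \<open>Yields the pointwise bound N f / N (chi t), uniform over decreasing functions of bounded
  norm.\<close>

lemma decf_bound: "f \<in> E \<Longrightarrow> decf f \<Longrightarrow> t > 0 \<Longrightarrow> f t * N (chi t) \<le> N f"
proof -
 assume f: "f \<in> E" "decf f" and t: "t > 0"
 have "N (\<lambda>u. f t * chi t u) \<le> N f" by (rule dom_decf(2)[OF f(1) decf_scale[OF decfD(2)[OF f(2)] decf_chi]])
   (use decfD(2,3)[OF f(2)] in \<open>auto simp: chi_def\<close>)
 then show ?thesis using norm_scale[OF chi_in, of "f t" t] decfD(2)[OF f(2)] by simp
qed

text \<open>The convergence is only pointwise and not monotone; the Fatou property is applied to the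
  infima of the tails, which increase to the same limit.\<close>

lemma limit_in:
 assumes h: "\<And>n. h n \<in> E" "\<And>n. decf (h n)" "\<And>n. N (h n) \<le> C" and g: "\<And>t. (\<lambda>n. h n t) \<longlonglongrightarrow> g t"
 shows "g \<in> E" "decf g"
proof -
 have gd: "decf g" unfolding decf_def
 proof (intro conjI allI impI)
  show "g t = 0" if "t \<le> 0" for t
  proof -
   have "(\<lambda>n. 0) \<longlonglongrightarrow> g t" using g[of t] that decfD(1)[OF h(2)] by simp
   from LIMSEQ_unique[OF this tendsto_const] show ?thesis .
  qed
  show "0 \<le> g t" for t by (rule LIMSEQ_le_const[OF g]) (use decfD(2)[OF h(2)] in auto)
  show "g t \<le> g s" if "0 < s" "s \<le> t" for s t by (rule LIMSEQ_le[OF g g]) (use decfD(3)[OF h(2) that] in auto)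
 qed
 then show "decf g" .
 define F where "F n t = enn2real (INF m. ennreal (h (n + m) t))" for n t
 have hm[measurable]: "h n \<in> borel_measurable halfline" for n by (rule decf_halfline[OF h(2)])
 have Fm: "F n \<in> borel_measurable halfline" for n unfolding F_def by measurable
 have Fle: "F n t \<le> h (n + m) t" for n m t
  unfolding F_def using INF_lower[of m UNIV "\<lambda>m. ennreal (h (n + m) t)"] decfD(2)[OF h(2)] by (intro enn2real_leI) auto
 have Fge: "c \<le> F n t" if "\<And>m. m \<ge> n \<Longrightarrow> c \<le> h m t" "0 \<le> c" for c n t
 proof -
  have "ennreal c \<le> (INF m. ennreal (h (n + m) t))" by (intro INF_greatest ennreal_leI) (use that in auto)
  moreover have "(INF m. ennreal (h (n + m) t)) < \<infinity>"
   using INF_lower[of 0 UNIV "\<lambda>m. ennreal (h (n + m) t)"] by (auto intro: le_less_trans)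
  ultimately have "enn2real (ennreal c) \<le> F n t" unfolding F_def by (intro enn2real_mono) auto
  then show ?thesis using that(2) by simp
 qed
 have F0: "0 \<le> F n t" for n t by (simp add: F_def)
 have FE: "F n \<in> E" "N (F n) \<le> N (h n)" for n using dom_in[OF h(1)[of n] Fm[of n]] Fle[of n _ 0] F0 decfD(2)[OF h(2)] by auto
 have Fmono: "F n t \<le> F (Suc n) t" for n t
 proof (rule Fge[OF _ F0])
  fix m assume "m \<ge> Suc n"
  then show "F n t \<le> h m t" using Fle[of n t "m - n"] by simp
 qed
 have Flim: "(\<lambda>n. F n t) \<longlonglongrightarrow> g t" for t
 proof (rule LIMSEQ_I)
  fix r :: real assume r: "0 < r"
  then obtain n0 where n0: "\<And>n. n \<ge> n0 \<Longrightarrow> norm (h n t - g t) < r / 2" using LIMSEQ_D[OF g, of "r / 2" t] by auto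
  have "norm (F n t - g t) < r" if n: "n \<ge> n0" for n
  proof -
   have "F n t \<le> h n t" using Fle[of n t 0] by simp
   moreover have "max 0 (g t - r / 2) \<le> F n t"
   proof (rule Fge)
    show "max 0 (g t - r / 2) \<le> h m t" if "m \<ge> n" for m
    proof -
     have "norm (h m t - g t) < r / 2" by (rule n0) (use n that in simp)
     then have "g t - r / 2 \<le> h m t" unfolding real_norm_def abs_less_iff by linarith
     then show ?thesis using decfD(2)[OF h(2)] by simp
    qed
   qed simp
   ultimately show ?thesis using n0[OF n] r unfolding real_norm_def by linarith
  qed
  then show "\<exists>no. \<forall>n\<ge>no. norm (F n t - g t) < r" by blast
 qed
 have "g \<in> E \<and> N g = (SUP n. N (F n))" by (rule fatou[unfolded fatou_property_def, rule_format, of F g])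
   (use FE h(3) F0 Fmono Flim decf_halfline[OF gd] in \<open>auto intro!: bdd_aboveI2[of _ _ C] intro: order_trans\<close>)
 then show "g \<in> E" ..
qed

end

text \<open>The diagonal argument, as sequential compactness of a countable product of
  intervals.\<close>

lemma bounded_functions_subsequence:
 fixes v :: "nat \<Rightarrow> 'i::countable \<Rightarrow> real"
 assumes v: "\<And>n i. \<bar>v n i\<bar> \<le> B i"
 obtains s where "strict_mono s" "\<And>i. convergent (\<lambda>n. v (s n) i)"
proof -
 have "compactin (product_topology (\<lambda>_. euclidean) UNIV) (PiE UNIV (\<lambda>i. {- B i..B i}))" by (simp add: compactin_PiE)
 then have "compact (PiE UNIV (\<lambda>i. {- B i..B i}))" by (simp add: euclidean_product_topology)
 moreover have "\<forall>n. v n \<in> PiE UNIV (\<lambda>i. {- B i..B i})" using v by (auto simp: abs_le_iff minus_le_iff)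
 ultimately obtain l s where s: "strict_mono (s :: nat \<Rightarrow> nat)" "(v \<circ> s) \<longlonglongrightarrow> l"
  unfolding compact_eq_seq_compact_metric seq_compact_def by blast
 have "(\<lambda>n. v (s n) i) \<longlonglongrightarrow> l i" for i
  using continuous_on_tendsto_compose[OF continuous_on_product_coordinates s(2), of i] by (simp add: o_def)
 then show thesis using that[OF s(1)] by (auto simp: convergent_def)
qed

context sym_space
begin

lemma dilation_add:
 assumes f: "f \<in> E" "decf f" and g: "g \<in> E" "decf g"
 shows "(\<lambda>t. f (t / 2) + g (t / 2)) \<in> E" "decf (\<lambda>t. f (t / 2) + g (t / 2))"
  "N (\<lambda>t. f (t / 2) + g (t / 2)) \<le> 2 * (N f + N g)"
proof -
 show "(\<lambda>t. f (t / 2) + g (t / 2)) \<in> E" by (rule add_closed[OF dilation(1)[OF f] dilation(1)[OF g]])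
 show "decf (\<lambda>t. f (t / 2) + g (t / 2))" by (rule decf_add[OF decf_half[OF f(2)] decf_half[OF g(2)]])
 have "N (\<lambda>t. f (t / 2) + g (t / 2)) \<le> N (\<lambda>t. f (t / 2)) + N (\<lambda>t. g (t / 2))"
  by (rule norm_triangle[OF dilation(1)[OF f] dilation(1)[OF g]])
 also have "\<dots> \<le> 2 * N f + 2 * N g" by (intro add_mono dilation f g)
 finally show "N (\<lambda>t. f (t / 2) + g (t / 2)) \<le> 2 * (N f + N g)" by simp
qed

lemma chi_pos: "0 < t \<Longrightarrow> 0 < N (chi t)"
proof -
 assume t: "0 < t"
 have "N (chi t) \<noteq> 0"
 proof
  assume "N (chi t) = 0"
  then have "AE u in halfline. chi t u = 0" by (rule norm_definite[OF chi_in])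
  then have "AE u in halfline. u \<notin> {0<..<t}" by eventually_elim (auto simp: chi_def split: if_splits)
  then have "emeasure halfline {u \<in> space halfline. u \<in> {0<..<t}} = 0" by (rule emeasure_eq_0_AE)
  then have "emeasure lborel ({0..} \<inter> {0<..<t}) = 0" using emeasure_halfline[of "{0<..<t}"] by simp
  moreover have "{0..} \<inter> {0<..<t} = {0<..<t}" by auto
  ultimately show False using t by simp
 qed
 then show ?thesis using N_nonneg[OF chi_in, of t] by linarith
qed

lemma chi_mono: "s \<le> t \<Longrightarrow> N (chi s) \<le> N (chi t)" by (rule dom_decf(2)[OF chi_in decf_chi]) (auto simp: chi_def)

lemma chi_smallE:
 assumes "0 < \<epsilon>" obtains \<delta> where "0 < \<delta>" "\<delta> \<le> 1" "N (chi \<delta>) \<le> \<epsilon>"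
proof -
 obtain n where "N (chi (1 / real (Suc n))) < \<epsilon>"
  using order_tendstoD(2)[OF chi_small assms] by (auto simp: eventually_sequentially)
 then show thesis by (intro that[of "1 / real (Suc n)"]) auto
qed

lemma bnd_tendsto: "(\<lambda>n. B / N (chi (real (Suc n)))) \<longlonglongrightarrow> 0"
proof -
 have "filterlim (\<lambda>n. N (chi (real (Suc n)))) at_top sequentially" unfolding filterlim_at_top eventually_sequentially
 proof
  fix Z
  obtain n where n: "Z < N (chi (real n))" using chi_unbounded by blast
  show "\<exists>M. \<forall>n\<ge>M. Z \<le> N (chi (real (Suc n)))"
  proof (intro exI allI impI)
   fix m assume "n \<le> m"
   then show "Z \<le> N (chi (real (Suc m)))" using n chi_mono[of "real n" "real (Suc m)"] by simp
  qed
 qed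
 then show ?thesis by (intro real_tendsto_divide_at_top[OF tendsto_const])
qed

lemma decf_vanish: assumes "f \<in> E" "decf f" shows "(\<lambda>n. f (real (Suc n))) \<longlonglongrightarrow> 0"
proof (rule tendsto_sandwich[OF _ _ tendsto_const bnd_tendsto[of "N f"]])
 show "\<forall>\<^sub>F n in sequentially. f (real (Suc n)) \<le> N f / N (chi (real (Suc n)))"
  using decf_bound[OF assms] chi_pos by (auto intro!: always_eventually simp: pos_le_divide_eq)
qed (auto intro!: always_eventually decfD(2)[OF assms(2)])

lemma decf_truncation:
 assumes f: "f \<in> E" "decf f"
 shows "(\<lambda>n. N (\<lambda>t. min (f t) (f (real (Suc n))))) \<longlonglongrightarrow> 0"
  and "(\<lambda>n. N (\<lambda>t. f t * chi (1 / real (Suc n)) t)) \<longlonglongrightarrow> 0"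
proof -
 show "(\<lambda>n. N (\<lambda>t. min (f t) (f (real (Suc n))))) \<longlonglongrightarrow> 0"
 proof (rule dominated[OF decf_halfline[OF decf_minc[OF decfD(2)[OF f(2)] f(2)]] f(1)])
  show "\<bar>min (f t) (f (real (Suc n)))\<bar> \<le> f t" for n t using decfD(2)[OF f(2)] by (simp add: abs_of_nonneg)
  show "(\<lambda>n. min (f t) (f (real (Suc n)))) \<longlonglongrightarrow> 0" for t
   using tendsto_min[OF tendsto_const decf_vanish[OF f], of "f t"] decfD(2)[OF f(2), of t] by (simp add: min_absorb2)
 qed
 show "(\<lambda>n. N (\<lambda>t. f t * chi (1 / real (Suc n)) t)) \<longlonglongrightarrow> 0"
 proof (rule dominated[OF decf_halfline[OF decf_mult[OF f(2) decf_chi]] f(1)])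
  show "\<bar>f t * chi (1 / real (Suc n)) t\<bar> \<le> f t" for n t using decfD(2)[OF f(2)] by (simp add: chi_def)
  show "(\<lambda>n. f t * chi (1 / real (Suc n)) t) \<longlonglongrightarrow> 0" if t: "t > 0" for t
  proof -
   obtain n0 where n0: "1 / real (Suc n0) < t" using reals_Archimedean[OF t] by (auto simp: inverse_eq_divide)
   have "f t * chi (1 / real (Suc n)) t = 0" if "n \<ge> n0" for n
   proof -
    have "1 / real (Suc n) \<le> 1 / real (Suc n0)" using that by (simp add: frac_le)
    then show ?thesis using n0 by (simp add: chi_def)
   qed
   then show ?thesis by (intro tendsto_eventually eventually_sequentiallyI)
  qed
 qed
qed

text \<open>A decreasing majorant of \<open>f\<close> that is determined by the values of \<open>f\<close> at the countably many dyadic points.\<close>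

definition dyadic :: "(real \<Rightarrow> real) \<Rightarrow> real \<Rightarrow> real"
 where "dyadic f t = (if t \<le> 0 then 0 else f (2 powr of_int \<lfloor>log 2 t\<rfloor>))"

lemma dyadic:
 assumes "decf f"
 shows decf_dyadic: "decf (dyadic f)" and dyadic_ge: "f t \<le> dyadic f t" and dyadic_le: "dyadic f t \<le> f (t / 2)"
proof -
 have b: "2 powr of_int \<lfloor>log 2 t\<rfloor> \<le> t" "t / 2 \<le> 2 powr of_int \<lfloor>log 2 t\<rfloor>" if "0 < t" for t :: real
 proof -
  have "2 powr of_int \<lfloor>log 2 t\<rfloor> \<le> 2 powr log 2 t" by (intro powr_mono) auto
  then show "2 powr of_int \<lfloor>log 2 t\<rfloor> \<le> t" using that by simp
  have "2 powr log 2 t \<le> 2 powr (of_int \<lfloor>log 2 t\<rfloor> + 1)" by (intro powr_mono) linarith+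
  then show "t / 2 \<le> 2 powr of_int \<lfloor>log 2 t\<rfloor>" using that by (simp add: powr_add)
 qed
 show "f t \<le> dyadic f t" using b decfD[OF assms] by (simp add: dyadic_def)
 show "dyadic f t \<le> f (t / 2)" using b decfD[OF assms] by (simp add: dyadic_def)
 show "decf (dyadic f)" unfolding decf_def
 proof (intro conjI allI impI)
  show "dyadic f t \<le> dyadic f s" if "0 < s" "s \<le> t" for s t
  proof -
   have "\<lfloor>log 2 s\<rfloor> \<le> \<lfloor>log 2 t\<rfloor>" by (intro floor_mono) (use that in simp)
   then have "2 powr of_int \<lfloor>log 2 s\<rfloor> \<le> (2::real) powr of_int \<lfloor>log 2 t\<rfloor>" by (intro powr_mono) auto
   then show ?thesis using decfD(3)[OF assms, of "2 powr of_int \<lfloor>log 2 s\<rfloor>"] that by (simp add: dyadic_def)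
  qed
 qed (use decfD(2)[OF assms] in \<open>auto simp: dyadic_def\<close>)
qed

end

section \<open>Noncommutative symmetric spaces\<close>

locale nc_sym = nc_algebra M \<tau> + sym_space E N
 for M :: "('a::complex_hilbert op) set" and \<tau> and E :: "(real \<Rightarrow> real) set" and N
begin

text \<open>An infinite singular value at 0 would become the real number 0 and break monotonicity
  there, so t \<le> 0 is set aside.\<close>

definition sv :: "('a \<times> 'a) set \<Rightarrow> real \<Rightarrow> real"
 where "sv x t = (if t \<le> 0 then 0 else singular_fun \<tau> x t)"

lemma sv_pos [simp]: "t > 0 \<Longrightarrow> sv x t = singular_fun \<tau> x t" by (simp add: sv_def)

lemma decf_sv: "x \<in> meas \<Longrightarrow> decf (sv x)" by (auto simp: decf_def sv_def singular_fun_nonneg intro: singular_fun_antimono)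

lemma singular_fun_halfline: "x \<in> meas \<Longrightarrow> singular_fun \<tau> x \<in> borel_measurable halfline"
proof -
 assume x: "x \<in> meas"
 have [measurable]: "sv x \<in> borel_measurable borel" by (rule decf_measurable[OF decf_sv[OF x]])
 have "(\<lambda>t. if t = 0 then singular_fun \<tau> x 0 else sv x t) \<in> borel_measurable halfline" by (intro halfline_measurable) measurable
 then show ?thesis by (subst measurable_cong) (auto simp: sv_def)
qed

lemma nc_normI:
 assumes x: "x \<in> meas" and S: "Sm x f" and f: "f \<in> E" "\<And>t. t > 0 \<Longrightarrow> 0 \<le> f t"
 shows "x \<in> nc_space M \<tau> E" "nc_norm \<tau> N x \<le> N f"
proof -
 have "\<bar>singular_fun \<tau> x t\<bar> \<le> \<bar>f t\<bar>" if "t > 0" for t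
  using singular_fun_le_Sm[OF x S that f(2)[OF that]] f(2)[OF that] by (simp add: singular_fun_nonneg)
 from dom_in[OF f(1) singular_fun_halfline[OF x] this] show "x \<in> nc_space M \<tau> E" "nc_norm \<tau> N x \<le> N f"
  using x by (auto simp: nc_space_def nc_norm_def)
qed

lemma sv_in: "x \<in> nc_space M \<tau> E \<Longrightarrow> sv x \<in> E" "x \<in> nc_space M \<tau> E \<Longrightarrow> N (sv x) = nc_norm \<tau> N x"
proof -
 assume x: "x \<in> nc_space M \<tau> E"
 then have xm: "x \<in> meas" and xE: "singular_fun \<tau> x \<in> E" by (auto simp: nc_space_def)
 show 1: "sv x \<in> E" by (rule dom_decf(1)[OF xE decf_sv[OF xm]]) simp
 show "N (sv x) = nc_norm \<tau> N x" unfolding nc_norm_def by (rule N_cong[OF 1 xE]) simp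
qed

lemma nc_norm_nonneg: "x \<in> nc_space M \<tau> E \<Longrightarrow> 0 \<le> nc_norm \<tau> N x" by (simp add: nc_norm_def nc_space_def N_nonneg)

text \<open>\<open>small a r\<close> bounds the norm of \<open>a\<close> in \<open>E(M,\<tau>)\<close> without mentioning its singular values.\<close>

definition small :: "'a op \<Rightarrow> real \<Rightarrow> bool"
 where "small a r \<longleftrightarrow> a \<in> M \<and> (\<exists>f. f \<in> E \<and> decf f \<and> N f \<le> r \<and> Sm (op_graph a) f)"

lemma smallI:
 assumes "a \<in> M" "Sm (op_graph a) f" "F \<in> E" "decf F" "\<And>t. t > 0 \<Longrightarrow> f t \<le> F t" "N F \<le> r"
 shows "small a r" using assms Sm_mono[OF assms(2) order_refl] unfolding small_def by blast

lemma smallE: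
 assumes "small a r" obtains f where "a \<in> M" "f \<in> E" "decf f" "N f \<le> r" "Sm (op_graph a) f"
 using assms unfolding small_def by blast

lemma small_mono: "small a r \<Longrightarrow> r \<le> s \<Longrightarrow> small a s" unfolding small_def by (meson order_trans)

text \<open>The factor 2 is the dilation constant caused by halving the argument, in place of the
  triangle inequality of E(M,\<tau>).\<close>

lemma small_add:
 assumes "small a r" "small b s" shows "small (a + b) (2 * (r + s))"
proof -
 obtain f where f: "a \<in> M" "f \<in> E" "decf f" "N f \<le> r" "Sm (op_graph a) f" using assms(1) by (rule smallE)
 obtain g where g: "b \<in> M" "g \<in> E" "decf g" "N g \<le> s" "Sm (op_graph b) g" using assms(2) by (rule smallE)
 let ?F = "\<lambda>t. f (t / 2) + g (t / 2)"
 have "Sm (op_graph (a + b)) ?F" by (rule Sm_op_add[OF f(5) g(5)]) (use decfD(2) f(3) g(3) in auto)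
 moreover have "N ?F \<le> 2 * (r + s)" by (rule order_trans[OF dilation_add(3)[OF f(2,3) g(2,3)]]) (use f(4) g(4) in simp)
 ultimately show ?thesis unfolding small_def using mem_add[OF f(1) g(1)] dilation_add(1,2)[OF f(2,3) g(2,3)] by blast
qed

lemma small_comp:
 assumes "small a r" "b \<in> M" "norm b \<le> 1" "c \<in> M" "norm c \<le> 1" shows "small (c o\<^sub>L a o\<^sub>L b) r"
 using assms Sm_op_comp[of a _ b c] decfD(2) unfolding small_def by (meson mem_comp)

lemma small_radj: "small a r \<Longrightarrow> small (radj a) r" using Sm_op_radj[of a] decfD(2) mem_radj unfolding small_def by meson

lemma small_lmul:
 assumes "small a r" "b \<in> M" "norm b \<le> c" shows "small (b o\<^sub>L a) (c * r)"
proof -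
 obtain f where f: "a \<in> M" "f \<in> E" "decf f" "N f \<le> r" "Sm (op_graph a) f" using assms(1) by (rule smallE)
 have c: "0 \<le> c" using assms(3) norm_ge_zero order_trans by blast
 have "op_graph a O op_graph b = op_graph (b o\<^sub>L a)" by (auto simp: relcomp_unfold)
 then have S: "Sm (op_graph (b o\<^sub>L a)) (\<lambda>t. norm b * f t)" using Sm_lmul[OF f(5), of b] by simp
 show ?thesis
 proof (rule smallI[OF mem_comp[OF assms(2) f(1)] S scale_closed[OF f(2)] decf_scale[OF c f(3)]])
  show "norm b * f t \<le> c * f t" for t using decfD(2)[OF f(3)] assms(3) by (simp add: mult_right_mono)
  show "N (\<lambda>t. c * f t) \<le> c * r" using norm_scale[OF f(2), of c] f(4) c by (simp add: mult_left_mono)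
 qed
qed

section \<open>Sufficient conditions for small norm\<close>

lemma small_supported:
 assumes a: "a \<in> M" and S: "Sm (op_graph a) f" and T: "\<tau>c (kerp a) \<le> ennreal T"
  and d: "decf (\<lambda>t. f t * chi T t)" and e: "(\<lambda>t. f t * chi T t) \<in> E" and r: "N (\<lambda>t. f t * chi T t) \<le> r"
 shows "small a r" by (rule smallI[OF a Sm_op_support[OF S a T] e d _ r]) (simp add: chi_def)

lemma Sm_op_const:
 fixes a :: "'a op"
 assumes "a \<in> M" "\<And>h. norm (a h) \<le> c * norm h" shows "Sm (op_graph a) (\<lambda>_. c)"
proof (rule Sm_op[OF assms(1)])
 show "\<exists>p\<in>Proj. \<tau>c p \<le> ennreal t \<and> (\<forall>h. norm (a (p h)) \<le> c * norm h)" for t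
  by (rule bexI[OF _ proj_id_mem]) (use assms(2) tau_zero in auto)
qed

lemma small_bounded:
 fixes a :: "'a op"
 assumes a: "a \<in> M" and b: "\<And>h. norm (a h) \<le> c * norm h" and c: "0 \<le> c" and T: "\<tau>c (kerp a) \<le> ennreal T"
 shows "small a (c * N (chi T))"
 by (rule small_supported[OF a Sm_op_const[OF a b] T decf_scale[OF c decf_chi] scale_closed[OF chi_in]])
  (use norm_scale[OF chi_in, of c] c in simp)

text \<open>Interpolates between the uniform norm and L^2 on a support of finite trace: by Chebyshev
  a is bounded by s off a projection of trace \<eta> / s^2, and everywhere it is bounded by
  c.\<close>

lemma small_L2:
 fixes a :: "'a op"
 assumes a: "a \<in> M" and b: "\<And>h. norm (a h) \<le> c * norm h" and c: "0 \<le> c" and T: "\<tau>c (kerp a) \<le> ennreal T"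
  and \<eta>: "\<tau> (radj a o\<^sub>L a) \<le> ennreal \<eta>" "0 \<le> \<eta>" and s: "0 < s"
 shows "small a (c * N (chi (\<eta> / s\<^sup>2)) + s * N (chi T))"
proof -
 define f where "f t = c * chi (\<eta> / s\<^sup>2) t + s" for t
 have "Sm (op_graph a) f"
 proof (rule Sm_op[OF a])
  fix t :: real assume t: "t > 0"
  show "\<exists>p\<in>Proj. \<tau>c p \<le> ennreal t \<and> (\<forall>h. norm (a (p h)) \<le> f t * norm h)"
  proof (cases "t < \<eta> / s\<^sup>2")
   case True
   have "norm (a h) \<le> f t * norm h" for h
   proof -
    have "c * norm h \<le> f t * norm h" using True t s by (intro mult_right_mono) (auto simp: f_def chi_def)
    then show ?thesis using b[of h] by linarith
   qed
   then show ?thesis by (intro bexI[OF _ proj_id_mem]) (auto simp: tau_zero)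
  next
   case False
   obtain p where p: "p \<in> Proj" "\<And>h. norm (a (p h)) \<le> s * norm h"
    "ennreal (s\<^sup>2) * \<tau>c p \<le> \<tau> (radj a o\<^sub>L a)" using tau_chebyshev[OF a s] by metis
   have "ennreal (s\<^sup>2) * \<tau>c p \<le> ennreal \<eta>" using p(3) \<eta>(1) by (rule order_trans)
   also have "\<dots> \<le> ennreal (s\<^sup>2 * t)" using False s by (intro ennreal_leI) (simp add: not_less pos_divide_le_eq mult.commute)
   also have "\<dots> = ennreal (s\<^sup>2) * ennreal t" using t by (simp add: ennreal_mult)
   finally have "\<tau>c p \<le> ennreal t" using s by (subst (asm) ennreal_mult_le_mult_iff) auto
   moreover have "s \<le> f t" using c by (simp add: f_def chi_def)
   then have "s * norm h \<le> f t * norm h" for h by (intro mult_right_mono) auto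
   ultimately show ?thesis using p(1,2) by (meson order_trans)
  qed
 qed
 then have S: "Sm (op_graph a) (\<lambda>t. if t < T then f t else 0)" by (rule Sm_op_support[OF _ a T])
 let ?F = "\<lambda>t. c * chi (\<eta> / s\<^sup>2) t + s * chi T t"
 have in1: "(\<lambda>t. c * chi (\<eta> / s\<^sup>2) t) \<in> E" "(\<lambda>t. s * chi T t) \<in> E" by (intro scale_closed chi_in)+
 show ?thesis
 proof (rule smallI[OF a S add_closed[OF in1] decf_add[OF decf_scale[OF c decf_chi] decf_scale[OF less_imp_le[OF s] decf_chi]]])
  show "(if t < T then f t else 0) \<le> ?F t" if "t > 0" for t using that c s by (auto simp: f_def chi_def)
  show "N ?F \<le> c * N (chi (\<eta> / s\<^sup>2)) + s * N (chi T)"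
   using norm_triangle[OF in1] norm_scale[OF chi_in, of c "\<eta> / s\<^sup>2"] norm_scale[OF chi_in, of s T] c s by simp
 qed
qed

lemma supp_left:
 assumes "a \<in> M" "b \<in> M" shows "\<tau>c (kerp (a o\<^sub>L b)) \<le> \<tau>c (kerp a)"
proof -
 have "\<tau>c (kerp (a o\<^sub>L b)) \<le> \<tau>c (kerp (radj a))"
 proof (rule tau_support_left[OF mem_comp[OF assms] proj_compl[OF proj_kerp[OF mem_radj[OF assms(1)]]]])
  fix h
  have "kerp (radj a) (a k) = 0" for k
  proof (rule inner_eqI)
   fix y
   show "inner y (kerp (radj a) (a k)) = inner y 0"
    using saD[OF isproj_sa[OF kerp_isproj], of "radj a" y "a k"] radj[of a k "kerp (radj a) y"]
    by (simp add: kerp_apply inner_commute)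
  qed
  then show "(I - kerp (radj a)) ((a o\<^sub>L b) h) = (a o\<^sub>L b) h" by (simp add: blin)
 qed
 then show ?thesis by (simp add: tau_range[OF assms(1)])
qed

text \<open>f e_n is a contraction with left support below f, and its L^2 norm equals that of its
  adjoint e_n f, which tends to 0; \<open>small_L2\<close> turns this into smallness in E.\<close>

lemma small_range_to_zero:
 assumes e: "decreases_to_zero M e" and f: "f \<in> Proj" and fin: "\<tau> f < \<infinity>" and \<epsilon>: "0 < \<epsilon>"
 shows "\<exists>n0. \<forall>n\<ge>n0. small (f o\<^sub>L e n) \<epsilon>"
proof -
 define T where "T = enn2real (\<tau> f)"
 have T: "\<tau> f = ennreal T" using fin by (simp add: T_def)
 have eM: "e n \<in> M" "norm (e n) \<le> 1" for n using decreases_to_zero_strong(2)[OF e] by (auto intro: proj_mem proj_norm1)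
 \<comment> \<open>Makes s N (chi T) at most \<epsilon>/2; the summand 1 avoids a division by
   0.\<close>
 define s where "s = \<epsilon> / (2 * (N (chi T) + 1))"
 have nT: "0 \<le> N (chi T)" by (rule N_nonneg[OF chi_in])
 have s: "0 < s" "s * N (chi T) \<le> \<epsilon> / 2" using \<epsilon> nT by (auto simp: s_def field_simps)
 obtain \<delta> where \<delta>: "0 < \<delta>" "N (chi \<delta>) \<le> \<epsilon> / 2" using chi_smallE[of "\<epsilon> / 2"] \<epsilon> by auto
 have "(\<lambda>n. \<tau> (radj (e n o\<^sub>L f) o\<^sub>L (e n o\<^sub>L f))) \<longlonglongrightarrow> 0" by (rule tau_compress_to_zero[OF e f fin])
 moreover have "0 < ennreal (\<delta> * s\<^sup>2)" using \<delta>(1) s(1) by simp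
 ultimately have "\<forall>\<^sub>F n in sequentially. \<tau> (radj (e n o\<^sub>L f) o\<^sub>L (e n o\<^sub>L f)) < ennreal (\<delta> * s\<^sup>2)" by (rule order_tendstoD(2))
 then obtain n0 where n0: "\<And>n. n \<ge> n0 \<Longrightarrow> \<tau> (radj (e n o\<^sub>L f) o\<^sub>L (e n o\<^sub>L f)) < ennreal (\<delta> * s\<^sup>2)"
  by (auto simp: eventually_sequentially)
 have fM: "f \<in> M" "norm f \<le> 1" using f by (auto intro: proj_mem proj_norm1)
 have "small (f o\<^sub>L e n) \<epsilon>" if n: "n \<ge> n0" for n
 proof -
  have r: "radj (e n o\<^sub>L f) = f o\<^sub>L e n" using pr_radj[OF f] pr_radj[OF decreases_to_zero_strong(2)[OF e]]
   by (simp add: radj_comp)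
  have a: "f o\<^sub>L e n \<in> M" by (intro mem_comp fM eM)
  have "\<tau> (radj (f o\<^sub>L e n) o\<^sub>L (f o\<^sub>L e n)) = \<tau> (radj (e n o\<^sub>L f) o\<^sub>L (e n o\<^sub>L f))" using tau_radj[OF a] by (metis r radj_radj)
  then have \<eta>: "\<tau> (radj (f o\<^sub>L e n) o\<^sub>L (f o\<^sub>L e n)) \<le> ennreal (\<delta> * s\<^sup>2)" using n0[OF n] by simp
  have supp: "\<tau>c (kerp (f o\<^sub>L e n)) \<le> ennreal T" unfolding T[symmetric]
   by (rule tau_support_left[OF a f]) (simp add: pr_idem[OF f])
  have b: "norm ((f o\<^sub>L e n) h) \<le> 1 * norm h" for h
   using pr_norm[OF f, of "e n h"] pr_norm[OF decreases_to_zero_strong(2)[OF e], of n h] by simp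
  have "small (f o\<^sub>L e n) (1 * N (chi (\<delta> * s\<^sup>2 / s\<^sup>2)) + s * N (chi T))"
   by (rule small_L2[OF a b _ supp \<eta> _ s(1)]) (use \<delta>(1) in auto)
  then show ?thesis by (rule small_mono) (use \<delta> s in simp)
 qed
 then show ?thesis by blast
qed

lemma small_compress:
 assumes e: "decreases_to_zero M e" and f: "f \<in> Proj" and fin: "\<tau> f < \<infinity>" and c: "0 \<le> c" and \<epsilon>: "0 < \<epsilon>"
 shows "\<exists>n0. \<forall>n\<ge>n0. \<forall>u\<in>M. norm u \<le> c \<longrightarrow> small (e n o\<^sub>L (u o\<^sub>L f) o\<^sub>L e n) \<epsilon> \<and> small (e n o\<^sub>L (f o\<^sub>L u) o\<^sub>L e n) \<epsilon>"
proof -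
 obtain n0 where n0: "\<And>n. n \<ge> n0 \<Longrightarrow> small (f o\<^sub>L e n) (\<epsilon> / (c + 1))"
  using small_range_to_zero[OF e f fin, of "\<epsilon> / (c + 1)"] \<epsilon> c by auto
 have en: "e n \<in> Proj" for n by (rule decreases_to_zero_strong(2)[OF e])
 have A: "small (e n o\<^sub>L (u o\<^sub>L f) o\<^sub>L e n) \<epsilon>" if n: "n \<ge> n0" and u: "u \<in> M" "norm u \<le> c" for n u
 proof -
  have "norm (e n o\<^sub>L u) \<le> norm (e n) * norm u" by (rule norm_blinfun_compose)
  also have "\<dots> \<le> 1 * c" by (intro mult_mono proj_norm1 en u) auto
  finally have "small ((e n o\<^sub>L u) o\<^sub>L (f o\<^sub>L e n)) (c * (\<epsilon> / (c + 1)))"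
   by (intro small_lmul[OF n0[OF n] mem_comp[OF proj_mem[OF en] u(1)]]) simp
  moreover have "(e n o\<^sub>L u) o\<^sub>L (f o\<^sub>L e n) = e n o\<^sub>L (u o\<^sub>L f) o\<^sub>L e n" by (rule blinfun_eqI) simp
  moreover have "c * (\<epsilon> / (c + 1)) \<le> \<epsilon>" using c \<epsilon> by (simp add: field_simps)
  ultimately show ?thesis using small_mono by metis
 qed
 have "small (e n o\<^sub>L (f o\<^sub>L u) o\<^sub>L e n) \<epsilon>" if n: "n \<ge> n0" and u: "u \<in> M" "norm u \<le> c" for n u
 proof -
  have "small (radj (e n o\<^sub>L (radj u o\<^sub>L f) o\<^sub>L e n)) \<epsilon>"
   by (rule small_radj, rule A[OF n mem_radj[OF u(1)]]) (simp add: norm_radj u)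
  moreover have "radj (e n o\<^sub>L (radj u o\<^sub>L f) o\<^sub>L e n) = e n o\<^sub>L (f o\<^sub>L u) o\<^sub>L e n" using pr_radj[OF f] pr_radj[OF en]
   by (auto intro!: blinfun_eqI simp: radj_comp radj_radj)
  ultimately show ?thesis by simp
 qed
 then show ?thesis using A by blast
qed

text \<open>The main terms \<open>uf\<close> and \<open>fw\<close>, with \<open>f\<close> a projection of finite trace, are harmless for equi-integrability:
 if \<open>e\<^sub>n\<close> decreases to \<open>0\<close> then \<open>\<tau>(f e\<^sub>n f)\<close> tends to \<open>0\<close>.\<close>

definition essential :: "'a op \<Rightarrow> real \<Rightarrow> 'a op \<Rightarrow> real \<Rightarrow> bool"
 where "essential X \<epsilon> f c \<longleftrightarrow> (\<exists>u\<in>M. \<exists>w\<in>M. norm u \<le> c \<and> norm w \<le> c \<and> small (X - ((u o\<^sub>L f) + (f o\<^sub>L w))) \<epsilon>)"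

definition approx :: "('a \<times> 'a) set \<Rightarrow> real \<Rightarrow> 'a op \<Rightarrow> real \<Rightarrow> bool"
 where "approx x \<epsilon> f c \<longleftrightarrow> (\<exists>X\<in>M. \<exists>F\<in>E. App x X F \<and> decf F \<and> N F \<le> \<epsilon> \<and> essential X \<epsilon> f c)"

section \<open>A criterion for equi-integrability\<close>

lemma approx_compress:
 assumes A: "approx x \<epsilon> f c" and x: "x \<in> meas" and e: "e \<in> Proj" and f: "f \<in> Proj"
  and s: "\<And>u. u \<in> M \<Longrightarrow> norm u \<le> c \<Longrightarrow> small (e o\<^sub>L (u o\<^sub>L f) o\<^sub>L e) \<epsilon> \<and> small (e o\<^sub>L (f o\<^sub>L u) o\<^sub>L e) \<epsilon>"
 shows "nc_norm \<tau> N (compress e x) \<le> 22 * \<epsilon>"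
proof -
 obtain X F u w where X: "X \<in> M" "App x X F" and F: "decf F" "F \<in> E" "N F \<le> \<epsilon>" and uw: "u \<in> M" "w \<in> M" "norm u \<le> c" "norm w \<le> c"
  and sm: "small (X - ((u o\<^sub>L f) + (f o\<^sub>L w))) \<epsilon>" using A unfolding approx_def essential_def by blast
 have "small (e o\<^sub>L (X - ((u o\<^sub>L f) + (f o\<^sub>L w))) o\<^sub>L e) \<epsilon>" by (intro small_comp sm proj_mem e proj_norm1)
 from small_add[OF this small_add[OF s[OF uw(1,3), THEN conjunct1] s[OF uw(2,4), THEN conjunct2]]]
 have "small (e o\<^sub>L X o\<^sub>L e) (2 * (\<epsilon> + 2 * (\<epsilon> + \<epsilon>)))"
  by (rule back_subst[of "\<lambda>a. small a _"]) (auto intro!: blinfun_eqI simp: blin)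
 then obtain G where G: "G \<in> E" "decf G" "N G \<le> 2 * (\<epsilon> + 2 * (\<epsilon> + \<epsilon>))" "Sm (op_graph (e o\<^sub>L X o\<^sub>L e)) G" by (rule smallE)
 have S: "Sm (compress e x) (\<lambda>t. G (t / 2) + F (t / 2))" by (rule App_compress[OF X(2) _ e G(4)]) (use decfD(2) F G in auto)
 have "nc_norm \<tau> N (compress e x) \<le> N (\<lambda>t. G (t / 2) + F (t / 2))"
  by (rule nc_normI(2)[OF meas_compress[OF x proj_mem[OF e]] S]) (use decfD(2)[OF G(2)] decfD(2)[OF F(1)] dilation_add(1)[OF G(1,2) F(2,1)] in auto)
 \<comment> \<open>22 = 2 (10 + 1): the two main terms and the remainder of X contribute 2 (1 + 2 (1
   + 1)) = 10, the error F contributes 1, and the last sum doubles.\<close>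
 also have "\<dots> \<le> 22 * \<epsilon>" by (rule order_trans[OF dilation_add(3)[OF G(1,2) F(2,1)]]) (use G(3) F(3) in simp)
 finally show ?thesis .
qed

text \<open>The two errors of \<open>approximation\<close>, for T = n + 1 and \<delta> = 1/T, are
  the truncations of the singular value function in height and near 0; order continuity makes both
  small.\<close>

lemma finite_approximation:
 assumes x: "x \<in> nc_space M \<tau> E" and \<epsilon>: "0 < \<epsilon>"
 obtains X F where "X \<in> M" "Sm (op_graph X) (sv x)" "\<tau>c (kerp X) < \<infinity>" "App x X F" "decf F" "F \<in> E" "N F \<le> \<epsilon>"
proof -
 have xm: "x \<in> meas" using x by (simp add: nc_space_def)
 let ?D = "sv x"
 have D: "?D \<in> E" "decf ?D" by (rule sv_in[OF x], rule decf_sv[OF xm])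
 have "\<forall>\<^sub>F n in sequentially. N (\<lambda>t. min (?D t) (?D (real (Suc n)))) < \<epsilon> / 4 \<and> N (\<lambda>t. ?D t * chi (1 / real (Suc n)) t) < \<epsilon> / 4"
  by (intro eventually_conj order_tendstoD(2)[OF decf_truncation(1)[OF D]] order_tendstoD(2)[OF decf_truncation(2)[OF D]]) (use \<epsilon> in auto)
 then obtain n where n: "N (\<lambda>t. min (?D t) (?D (real (Suc n)))) < \<epsilon> / 4" "N (\<lambda>t. ?D t * chi (1 / real (Suc n)) t) < \<epsilon> / 4"
  by (auto simp: eventually_sequentially)
 let ?T = "real (Suc n)"
 have d: "decf (\<lambda>t. min (?D t) (?D ?T))" "decf (\<lambda>t. ?D t * chi (1 / ?T) t)"
  by (rule decf_minc[OF decfD(2)[OF D(2)] D(2)], rule decf_mult[OF D(2) decf_chi])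
 have dE: "(\<lambda>t. min (?D t) (?D ?T)) \<in> E" "(\<lambda>t. ?D t * chi (1 / ?T) t) \<in> E"
  by (rule dom_decf(1)[OF D(1) d(1)], simp, rule dom_decf(1)[OF D(1) d(2)], simp add: chi_def singular_fun_nonneg)
 define G where "G t = min (?D t) (?D ?T) + ?D t * chi (1 / ?T) t" for t
 have G: "G \<in> E" "decf G" "N G \<le> \<epsilon> / 2" unfolding G_def using add_closed[OF dE] decf_add[OF d] norm_triangle[OF dE] n by auto
 obtain X where X: "X \<in> M" "Sm (op_graph X) (singular_fun \<tau> x)" "\<tau>c (kerp X) \<le> ennreal ?T"
  "App x X (\<lambda>t. min (singular_fun \<tau> x (t / 2)) (singular_fun \<tau> x ?T) + (if t / 2 < 1 / ?T then singular_fun \<tau> x (t / 2) else 0))"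
  using approximation[OF xm, of ?T "1 / ?T"] by auto
 obtain Z where Z: "padd (op_graph X) Z \<subseteq> x"
  "Sm Z (\<lambda>t. min (singular_fun \<tau> x (t / 2)) (singular_fun \<tau> x ?T) + (if t / 2 < 1 / ?T then singular_fun \<tau> x (t / 2) else 0))"
  using X(4) unfolding App_def by blast
 have "Sm Z (\<lambda>t. G (t / 2))" by (rule Sm_mono[OF Z(2) order_refl]) (simp add: G_def chi_def singular_fun_nonneg)
 then have A: "App x X (\<lambda>t. G (t / 2))" using Z(1) unfolding App_def by blast
 have S: "Sm (op_graph X) ?D" by (rule Sm_mono[OF X(2) order_refl]) simp
 have fin: "\<tau>c (kerp X) < \<infinity>" using X(3) by (auto intro: le_less_trans)
 show thesis
  by (rule that[OF X(1) S fin A decf_half[OF G(2)] dilation(1)[OF G(1,2)]]) (use dilation(2)[OF G(1,2)] G(3) in linarith)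
qed

lemma approx_single:
 assumes x: "x \<in> nc_space M \<tau> E" and \<epsilon>: "0 < \<epsilon>"
 shows "\<exists>f c. f \<in> Proj \<and> \<tau> f < \<infinity> \<and> 0 \<le> c \<and> approx x \<epsilon> f c"
proof -
 obtain X F where X: "X \<in> M" "Sm (op_graph X) (sv x)" "\<tau>c (kerp X) < \<infinity>" "App x X F" and F: "decf F" "F \<in> E" "N F \<le> \<epsilon>"
  using finite_approximation[OF assms] .
 let ?f = "I - kerp X"
 have "X o\<^sub>L ?f = X" by (rule blinfun_eqI) (simp add: blin kerp_apply)
 moreover have "small (0 :: 'a op) \<epsilon>"
  by (rule smallI[OF mem_zero Sm_op_bounded[OF mem_zero] F(2,1) _ F(3)]) (simp add: decfD(2)[OF F(1)])
 ultimately have "essential X \<epsilon> ?f (norm X)"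
  unfolding essential_def using X(1) mem_zero by (intro bexI[of _ X] bexI[of _ 0]) (auto simp: radj_id)
 then have "approx x \<epsilon> ?f (norm X)" unfolding approx_def using X F by blast
 then show ?thesis using proj_compl[OF proj_kerp[OF X(1)]] X(3) norm_ge_zero by blast
qed

text \<open>One pair f, c has to serve only for large i. The finitely many remaining elements are
  handled one at a time by \<open>approx_single\<close>, and the maximum of their thresholds is
  taken.\<close>

theorem equi_integrableI:
 fixes \<phi> :: "nat \<Rightarrow> ('a \<times> 'a) set"
 assumes b: "nc_bounded M \<tau> E N (range \<phi>)"
  and A: "\<And>\<epsilon>. 0 < \<epsilon> \<Longrightarrow> \<exists>f c i0. f \<in> Proj \<and> \<tau> f < \<infinity> \<and> 0 \<le> c \<and> (\<forall>i\<ge>i0. approx (\<phi> i) \<epsilon> f c)"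
 shows "equi_integrable M \<tau> E N (range \<phi>)" unfolding equi_integrable_def
proof (intro conjI b allI impI)
 fix e assume e: "decreases_to_zero M e"
 have en: "e n \<in> Proj" for n by (rule decreases_to_zero_strong(2)[OF e])
 have \<phi>: "\<phi> i \<in> nc_space M \<tau> E" "\<phi> i \<in> meas" for i using b by (auto simp: nc_bounded_def nc_space_def)
 have *: "\<exists>n0. \<forall>n\<ge>n0. \<forall>x\<in>meas. approx x \<epsilon> f c \<longrightarrow> nc_norm \<tau> N (compress (e n) x) \<le> 22 * \<epsilon>"
  if f: "f \<in> Proj" "\<tau> f < \<infinity>" and c: "0 \<le> c" and \<epsilon>: "0 < \<epsilon>" for f c \<epsilon>
  using small_compress[OF e f c \<epsilon>] approx_compress[OF _ _ en f(1)] by meson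
 show "(\<lambda>n. SUP x\<in>range \<phi>. ennreal (nc_norm \<tau> N (compress (e n) x))) \<longlonglongrightarrow> 0"
 proof (rule order_tendstoI)
  fix a :: ennreal assume "0 < a"
  then obtain r where r: "0 < r" "ennreal r < a"
  proof -
   obtain b where b: "0 < b" "b < a" using dense[OF \<open>0 < a\<close>] by blast
   have "b < top" using b(2) top_greatest by (rule less_le_trans)
   then show ?thesis using b that[of "enn2real b"] by (simp add: enn2real_positive_iff)
  qed
  define \<epsilon> where "\<epsilon> = r / 22"
  have \<epsilon>: "0 < \<epsilon>" using r(1) by (simp add: \<epsilon>_def)
  obtain f c i0 where f: "f \<in> Proj" "\<tau> f < \<infinity>" "0 \<le> c" "\<And>i. i \<ge> i0 \<Longrightarrow> approx (\<phi> i) \<epsilon> f c" using A[OF \<epsilon>] by blast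
  obtain n0 where n0: "\<And>n x. n \<ge> n0 \<Longrightarrow> x \<in> meas \<Longrightarrow> approx x \<epsilon> f c \<Longrightarrow> nc_norm \<tau> N (compress (e n) x) \<le> 22 * \<epsilon>"
   using *[OF f(1-3) \<epsilon>] by blast
  have "\<exists>n1. \<forall>n\<ge>n1. nc_norm \<tau> N (compress (e n) (\<phi> i)) \<le> 22 * \<epsilon>" for i
   using approx_single[OF \<phi>(1)[of i] \<epsilon>] * \<epsilon> \<phi>(2)[of i] by meson
  then obtain n1 where n1: "\<And>i n. n \<ge> n1 i \<Longrightarrow> nc_norm \<tau> N (compress (e n) (\<phi> i)) \<le> 22 * \<epsilon>" by metis
  have "(SUP x\<in>range \<phi>. ennreal (nc_norm \<tau> N (compress (e n) x))) < a" if n: "n \<ge> max n0 (Max (n1 ` {..i0}))" for n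
  proof -
   have "nc_norm \<tau> N (compress (e n) (\<phi> i)) \<le> r" for i
   proof (cases "i \<ge> i0")
    case True
    then show ?thesis using n0[OF _ \<phi>(2) f(4), of n i] n by (simp add: \<epsilon>_def)
   next
    case False
    then have "n1 i \<le> Max (n1 ` {..i0})" by (intro Max_ge) auto
    then have "n1 i \<le> n" using n by linarith
    then show ?thesis using n1[of i n] by (simp add: \<epsilon>_def)
   qed
   then have "(SUP x\<in>range \<phi>. ennreal (nc_norm \<tau> N (compress (e n) x))) \<le> ennreal r" by (auto intro!: SUP_least ennreal_leI)
   then show ?thesis using r(2) by (rule le_less_trans)
  qed
  then show "\<forall>\<^sub>F n in sequentially. (SUP x\<in>range \<phi>. ennreal (nc_norm \<tau> N (compress (e n) x))) < a"
   by (intro eventually_sequentiallyI)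
 qed simp
qed

section \<open>Truncations and their L^2 mass\<close>

lemma tau_dominated:
 fixes a :: "'a op"
 assumes a: "a \<in> M" and r: "r \<in> Proj" and b: "0 \<le> b" and le: "\<And>h. norm (a h) \<le> b * norm (r h)"
 shows "\<tau> (radj a o\<^sub>L a) \<le> ennreal (b\<^sup>2) * \<tau> r"
proof -
 have "pos (b\<^sup>2 *\<^sub>R r - (radj a o\<^sub>L a))" unfolding pos_def
 proof (intro conjI allI)
  show "sa (b\<^sup>2 *\<^sub>R r - (radj a o\<^sub>L a))" using pos_radj_self[of a] by (intro sa_intros pr_sa[OF r]) (simp add: pos_def)
  fix h
  have "inner (radj a (a h)) h = (norm (a h))\<^sup>2" using radj'[of "a h" a h] by (simp add: power2_norm_eq_inner inner_commute)
  moreover have "inner (b\<^sup>2 *\<^sub>R r h) h = (b * norm (r h))\<^sup>2"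
   using isproj_inner[OF proj_isproj[OF r], of h] by (simp add: power_mult_distrib)
  moreover have "(norm (a h))\<^sup>2 \<le> (b * norm (r h))\<^sup>2" by (intro power_mono le) simp
  ultimately show "0 \<le> inner ((b\<^sup>2 *\<^sub>R r - (radj a o\<^sub>L a)) h) h" by (simp add: blin blinfun.scaleR_left inner_diff_left)
 qed
 moreover have "pos (b\<^sup>2 *\<^sub>R r)" using isproj_inner[OF proj_isproj[OF r]]
  by (auto simp: pos_def blinfun.scaleR_left intro!: sa_intros pr_sa[OF r])
 ultimately have "\<tau> (radj a o\<^sub>L a) \<le> \<tau> (b\<^sup>2 *\<^sub>R r)"
  by (intro tau_mono cone_radj a) (simp_all add: positive_cone_iff mem_scaleR proj_mem[OF r])
 then show ?thesis using homogeneous[OF proj_cone[OF r], of "b\<^sup>2"] by simp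
qed

text \<open>f - (f \<and> W) is orthogonal to the pullback of W along f, whose complement has trace
  at most that of 1 - W.\<close>

lemma tau_difference_meet:
 assumes f: "f \<in> Proj" and W: "W \<in> Proj"
 shows "f - pmeet f W \<in> Proj" "\<tau> (f - pmeet f W) \<le> \<tau>c W"
proof -
 note m = pmeet[OF f W]
 show g: "f - pmeet f W \<in> Proj" unfolding projections_iff by (intro conjI mem_diff proj_mem f m isproj_diff proj_isproj)
 define K where "K = kerp ((I - W) o\<^sub>L f)"
 have K: "K \<in> Proj" "\<tau>c K \<le> \<tau>c W" "\<And>h. W (f (K h)) = f (K h)" using tau_pull[OF proj_mem[OF f] W] by (auto simp: K_def)
 have "K (f h - pmeet f W h) = 0" for h
 proof (rule inner_eqI)
  fix y
  have "pmeet f W (f (K y)) = f (K y)" using m(2) K(3) by (simp add: pr_idem[OF f])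
  then have "inner (pmeet f W h) (f (K y)) = inner h (f (K y))" using pr_inner[OF m(1), of h "f (K y)"] by simp
  moreover have "inner (pmeet f W h) (f (K y)) = inner (pmeet f W h) (K y)"
   using pr_inner[OF f, of "pmeet f W h" "K y"] m(3) by simp
  moreover have "inner h (f (K y)) = inner (f h) (K y)" using pr_inner[OF f, of h "K y"] by simp
  ultimately have "inner (f h - pmeet f W h) (K y) = 0" by (simp add: inner_diff_left)
  then show "inner y (K (f h - pmeet f W h)) = inner y 0"
   using pr_inner[OF K(1), of "f h - pmeet f W h" y] by (simp add: inner_commute)
 qed
 then have "\<tau> (f - pmeet f W) \<le> \<tau>c K" by (intro tau_proj_mono[OF g proj_compl[OF K(1)]]) (simp add: blin)
 then show "\<tau> (f - pmeet f W) \<le> \<tau>c W" using K(2) by (rule order_trans)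
qed

text \<open>The squared L^2 norm of y f. It is a number that increases with f, and its increments
  are the squared L^2 norms of y (f' - f).\<close>

definition beta :: "'a op \<Rightarrow> 'a op \<Rightarrow> real"
 where "beta y f = enn2real (\<tau> (y o\<^sub>L f o\<^sub>L radj y))"

lemma beta:
 assumes y: "y \<in> M" and B: "\<tau> (radj y o\<^sub>L y) \<le> ennreal B" "0 \<le> B"
  and f: "f \<in> Proj" and f': "f' \<in> Proj" and le: "\<And>h. f' (f h) = f h"
 shows "0 \<le> beta y f" "beta y f \<le> B" "beta y f \<le> beta y f'"
  and "\<tau> (radj (y o\<^sub>L (f' - f)) o\<^sub>L (y o\<^sub>L (f' - f))) = ennreal (beta y f' - beta y f)"
proof -
 have sq: "y o\<^sub>L p o\<^sub>L radj y = (y o\<^sub>L p) o\<^sub>L radj (y o\<^sub>L p)" "y o\<^sub>L p o\<^sub>L radj y \<in> positive_cone M"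
  "\<tau> (y o\<^sub>L p o\<^sub>L radj y) = \<tau> (radj (y o\<^sub>L p) o\<^sub>L (y o\<^sub>L p))" if p: "p \<in> Proj" for p
 proof -
  show 1: "y o\<^sub>L p o\<^sub>L radj y = (y o\<^sub>L p) o\<^sub>L radj (y o\<^sub>L p)" using pr_radj[OF p]
   by (auto intro!: blinfun_eqI simp: radj_comp pr_idem[OF p])
  show "y o\<^sub>L p o\<^sub>L radj y \<in> positive_cone M"
   using cone_radj[OF mem_radj[OF mem_comp[OF y proj_mem[OF p]]]] unfolding 1 by (simp add: radj_radj)
  show "\<tau> (y o\<^sub>L p o\<^sub>L radj y) = \<tau> (radj (y o\<^sub>L p) o\<^sub>L (y o\<^sub>L p))"
   unfolding 1 by (rule tau_radj[OF mem_comp[OF y proj_mem[OF p]], symmetric])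
 qed
 have dp: "f' - f \<in> Proj" "\<And>p. p \<in> Proj \<Longrightarrow> I - p \<in> Proj"
  unfolding projections_iff by (intro conjI mem_diff proj_mem f f' isproj_diff proj_isproj le, use proj_compl projections_iff in blast)
 have B': "\<tau> (y o\<^sub>L p o\<^sub>L radj y) \<le> ennreal B" if p: "p \<in> Proj" for p
 proof -
  have "(y o\<^sub>L p o\<^sub>L radj y) + (y o\<^sub>L (I - p) o\<^sub>L radj y) = y o\<^sub>L radj y" by (rule blinfun_eqI) (simp add: blin)
  then have "\<tau> (y o\<^sub>L radj y) = \<tau> (y o\<^sub>L p o\<^sub>L radj y) + \<tau> (y o\<^sub>L (I - p) o\<^sub>L radj y)"
   using additive[OF sq(2)[OF p] sq(2)[OF dp(2)[OF p]]] by simp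
  then have "\<tau> (y o\<^sub>L p o\<^sub>L radj y) \<le> \<tau> (y o\<^sub>L radj y)" by simp
  also have "\<dots> \<le> ennreal B" using tau_radj[OF y] B(1) by simp
  finally show ?thesis .
 qed
 have fin: "\<tau> (y o\<^sub>L p o\<^sub>L radj y) = ennreal (beta y p)" if p: "p \<in> Proj" for p
  unfolding beta_def by (rule ennreal_enn2real[symmetric]) (use B'[OF p] in \<open>auto intro: le_less_trans\<close>)
 show "0 \<le> beta y f" by (simp add: beta_def)
 show "beta y f \<le> B" unfolding beta_def by (rule enn2real_leI[OF B(2) B'[OF f]])
 have "(y o\<^sub>L f o\<^sub>L radj y) + (y o\<^sub>L (f' - f) o\<^sub>L radj y) = y o\<^sub>L f' o\<^sub>L radj y" by (rule blinfun_eqI) (simp add: blin)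
 then have "ennreal (beta y f') = ennreal (beta y f) + ennreal (beta y (f' - f))"
  using additive[OF sq(2)[OF f] sq(2)[OF dp(1)]] fin[OF f] fin[OF f'] fin[OF dp(1)] by simp
 then have "ennreal (beta y f') = ennreal (beta y f + beta y (f' - f))" by (subst ennreal_plus) (simp_all add: beta_def)
 then have eq: "beta y f' = beta y f + beta y (f' - f)" by (subst (asm) ennreal_inj) (simp_all add: beta_def)
 then show "beta y f \<le> beta y f'" by (simp add: beta_def)
 show "\<tau> (radj (y o\<^sub>L (f' - f)) o\<^sub>L (y o\<^sub>L (f' - f))) = ennreal (beta y f' - beta y f)"
  using sq(3)[OF dp(1)] fin[OF dp(1)] eq by simp
qed

text \<open>The truncated operator has height at most b and lives on 1 - p, which has trace at most
  T; so its squared L^2 norm is at most b^2 T.\<close>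

lemma truncation_trace:
 assumes "Z \<in> M" "p \<in> Proj" "q \<in> Proj" and b: "0 \<le> b" "\<And>h. norm (q (Z h)) \<le> b * norm h" and T: "\<tau>c p \<le> ennreal T" "0 \<le> T"
  and y: "y = q o\<^sub>L Z o\<^sub>L (I - p)"
 shows "y \<in> M" "norm y \<le> b" "\<tau> (radj y o\<^sub>L y) \<le> ennreal (b\<^sup>2 * T)"
proof -
 show yM: "y \<in> M" unfolding y by (intro mem_comp mem_diff mem_id proj_mem assms)
 have le: "norm (y h) \<le> b * norm ((I - p) h)" for h using b(2)[of "(I - p) h"] by (simp add: y)
 have "norm (y h) \<le> b * norm h" for h by (rule order_trans[OF le mult_left_mono[OF pr_norm[OF proj_compl[OF assms(2)]] b(1)]])
 then show "norm y \<le> b" by (rule norm_blinfun_bound[OF b(1)])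
 have "\<tau> (radj y o\<^sub>L y) \<le> ennreal (b\<^sup>2) * \<tau>c p" by (rule tau_dominated[OF yM proj_compl[OF assms(2)] b(1) le])
 also have "\<dots> \<le> ennreal (b\<^sup>2) * ennreal T" by (intro mult_left_mono T) simp
 finally show "\<tau> (radj y o\<^sub>L y) \<le> ennreal (b\<^sup>2 * T)" using T(2) by (simp add: ennreal_mult)
qed

text \<open>Replaces Z R, where R may grow with the index, by y fl for a fixed level fl. Each error
  term is small for its own reason: short support, low height, small L^2 norm, or short support
  again.\<close>

lemma right_estimate:
 fixes Z p q R fm fl :: "'a op"
 assumes Z: "Z \<in> M" "Sm (op_graph Z) H" and H: "H \<in> E" "decf H"
  and P: "p \<in> Proj" "q \<in> Proj" "R \<in> Proj" "fm \<in> Proj" "fl \<in> Proj"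
  and le: "\<And>h. fm (R h) = R h" "\<And>h. fm (fl h) = fl h"
  and c: "\<And>h. norm (Z (R h)) \<le> c * norm h" and a: "\<And>h. norm (Z (p h)) \<le> a * norm h" "0 \<le> a" "a \<le> c"
  and b: "\<And>h. norm (q (Z h)) \<le> b * norm h" "0 \<le> b"
  and T: "\<tau>c p \<le> ennreal T" and \<delta>: "\<tau>c q \<le> ennreal \<delta>"
  and T': "\<tau> R \<le> ennreal T'" and \<gamma>: "\<tau> (fm - R) \<le> ennreal \<gamma>"
  and y: "y = q o\<^sub>L Z o\<^sub>L (I - p)"
  and \<eta>: "\<tau> (radj (y o\<^sub>L (fm - fl)) o\<^sub>L (y o\<^sub>L (fm - fl))) \<le> ennreal \<eta>" "0 \<le> \<eta>" and s: "0 < s"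
  and r1: "N (\<lambda>t. min (H t) (2 * c) * chi \<delta> t) \<le> r1" and r2: "N (\<lambda>t. min (H t) a * chi T' t) \<le> r2"
 shows "small ((Z o\<^sub>L R) - (y o\<^sub>L fl)) (4 * (r1 + r2 + b * N (chi (\<eta> / s\<^sup>2)) + s * N (chi T) + b * N (chi \<gamma>)))"
proof -
 note pm = P[THEN proj_mem] and pi = P[THEN proj_isproj]
 have c0: "0 \<le> c" using a by linarith
 have idM: "I - p \<in> Proj" "I - q \<in> Proj" using P proj_compl by auto
 have yM: "y \<in> M" unfolding y by (intro mem_comp pm Z proj_mem[OF idM(1)])
 have yb: "norm (y h) \<le> b * norm h" for h
 proof -
  have "norm (y h) \<le> b * norm ((I - p) h)" unfolding y using b(1)[of "(I - p) h"] by simp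
  also have "\<dots> \<le> b * norm h" by (intro mult_left_mono b isproj_norm proj_isproj idM)
  finally show ?thesis .
 qed
 \<comment> \<open>Telescoping: ?a1 + ?a2 = Z R - y R passes from Z to its truncation, ?a3 = y R - y
   fl R lowers the level, and ?a4 = y fl - y fl R removes R. Two layers of \<open>small_add\<close>
   give the factor 4.\<close>
 let ?a1 = "(I - q) o\<^sub>L Z o\<^sub>L ((I - p) o\<^sub>L R)"
 let ?a2 = "Z o\<^sub>L (p o\<^sub>L R)"
 let ?a3 = "(y o\<^sub>L (fm - fl)) o\<^sub>L R"
 let ?a4 = "y o\<^sub>L (fl o\<^sub>L (fm - R))"
 have decomp: "(Z o\<^sub>L R) - (y o\<^sub>L fl) = (?a1 + ?a2) + (?a3 + (- I o\<^sub>L ?a4))"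
 proof (rule blinfun_eqI)
  fix h
  have "fl (fm h) = fl h"
  proof (rule inner_eqI)
   fix k
   show "inner k (fl (fm h)) = inner k (fl h)"
    using saD[OF isproj_sa[OF pi(5)], of k "fm h"] saD[OF isproj_sa[OF pi(5)], of k h] saD[OF isproj_sa[OF pi(4)], of "fl k" h] le(2)[of k]
    by simp
  qed
  then show "((Z o\<^sub>L R) - (y o\<^sub>L fl)) h = ((?a1 + ?a2) + (?a3 + (- I o\<^sub>L ?a4))) h" by (simp add: y blin le)
 qed
 have M1: "?a1 \<in> M" "?a2 \<in> M" "?a4 \<in> M" and M3: "y o\<^sub>L (fm - fl) \<in> M" by (intro mem_comp mem_diff mem_id pm Z yM)+
 have n1: "norm ((I - p) o\<^sub>L R) \<le> 1" "norm (p o\<^sub>L R) \<le> 1"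
  using order_trans[OF norm_blinfun_compose mult_mono[OF proj_norm1[OF idM(1)] proj_norm1[OF P(3)]]]
   order_trans[OF norm_blinfun_compose mult_mono[OF proj_norm1[OF P(1)] proj_norm1[OF P(3)]]] by auto
 have H0: "0 \<le> H t" for t by (rule decfD(2)[OF H(2)])
 have 1: "small ?a1 r1"
 proof (rule small_supported[OF M1(1) _ _ _ _ r1])
  have "Sm (op_graph ?a1) H" by (rule Sm_op_comp[OF Z(2) H0 mem_comp[OF proj_mem[OF idM(1)] pm(3)] n1(1) proj_norm1[OF idM(2)]])
  moreover have "Sm (op_graph ?a1) (\<lambda>_. 2 * c)"
  proof (rule Sm_op_const[OF M1(1)])
   fix h
   have "norm (Z (R h) - Z (p (R h))) \<le> norm (Z (R h)) + norm (Z (p (R h)))" by (rule norm_triangle_ineq4)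
   also have "\<dots> \<le> c * norm h + c * norm h"
   proof (rule add_mono[OF c])
    have "norm (Z (p (R h))) \<le> a * norm (R h)" by (rule a(1))
    also have "\<dots> \<le> c * norm h" by (intro mult_mono a isproj_norm pi c0) auto
    finally show "norm (Z (p (R h))) \<le> c * norm h" .
   qed
   finally have "norm (Z (R h) - Z (p (R h))) \<le> 2 * c * norm h" by simp
   moreover have "norm (?a1 h) \<le> norm (Z (R h) - Z (p (R h)))"
    using pr_norm[OF idM(2), of "Z (R h) - Z (p (R h))"] by (simp add: blin)
   ultimately show "norm (?a1 h) \<le> 2 * c * norm h" by linarith
  qed
  ultimately show "Sm (op_graph ?a1) (\<lambda>t. min (H t) (2 * c))" by (rule Sm_op_min[OF M1(1)])
  show "\<tau> (I - kerp ?a1) \<le> ennreal \<delta>"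
  proof (rule order_trans[OF tau_support_left[OF M1(1) idM(2)] \<delta>])
   show "(I - q) (?a1 h) = ?a1 h" for h using pr_idem[OF idM(2)] by simp
  qed
  show d: "decf (\<lambda>t. min (H t) (2 * c) * chi \<delta> t)" by (rule decf_mult[OF decf_minc[OF _ H(2)] decf_chi]) (use c0 in simp)
  show "(\<lambda>t. min (H t) (2 * c) * chi \<delta> t) \<in> E" by (rule dom_decf(1)[OF H(1) d]) (use H0 c0 in \<open>simp add: chi_def\<close>)
 qed
 have 2: "small ?a2 r2"
 proof (rule small_supported[OF M1(2) _ _ _ _ r2])
  have "I o\<^sub>L Z o\<^sub>L (p o\<^sub>L R) = ?a2" by (rule blinfun_eqI) simp
  then have "Sm (op_graph ?a2) H" using Sm_op_comp[OF Z(2) H0 mem_comp[OF pm(1,3)] n1(2) norm_id_le] by simp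
  moreover have "Sm (op_graph ?a2) (\<lambda>_. a)"
  proof (rule Sm_op_const[OF M1(2)])
   fix h
   have "norm (?a2 h) \<le> a * norm (R h)" using a(1) by simp
   also have "\<dots> \<le> a * norm h" by (intro mult_left_mono isproj_norm pi a)
   finally show "norm (?a2 h) \<le> a * norm h" .
  qed
  ultimately show "Sm (op_graph ?a2) (\<lambda>t. min (H t) a)" by (rule Sm_op_min[OF M1(2)])
  show "\<tau> (I - kerp ?a2) \<le> ennreal T'"
   by (rule order_trans[OF tau_support_right[OF M1(2) P(3)] T']) (simp add: isproj_idem[OF pi(3)])
  show d: "decf (\<lambda>t. min (H t) a * chi T' t)" by (rule decf_mult[OF decf_minc[OF a(2) H(2)] decf_chi])
  show "(\<lambda>t. min (H t) a * chi T' t) \<in> E" by (rule dom_decf(1)[OF H(1) d]) (use H0 a in \<open>simp add: chi_def\<close>)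
 qed
 have 3: "small ?a3 (b * N (chi (\<eta> / s\<^sup>2)) + s * N (chi T))"
 proof -
  have dp: "fm - fl \<in> Proj" unfolding projections_iff by (intro conjI mem_diff pm isproj_diff pi le)
  have "small (y o\<^sub>L (fm - fl)) (b * N (chi (\<eta> / s\<^sup>2)) + s * N (chi T))"
  proof (rule small_L2[OF M3 _ b(2) _ \<eta> s])
   fix h
   have "norm ((y o\<^sub>L (fm - fl)) h) \<le> b * norm ((fm - fl) h)" using yb by simp
   also have "\<dots> \<le> b * norm h" by (intro mult_left_mono isproj_norm proj_isproj dp b)
   finally show "norm ((y o\<^sub>L (fm - fl)) h) \<le> b * norm h" .
  next
   have "\<tau> (I - kerp (y o\<^sub>L (fm - fl))) \<le> \<tau>c (kerp y)" by (rule supp_left[OF yM proj_mem[OF dp]])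
   also have "\<dots> \<le> \<tau>c p" by (rule tau_support_right[OF yM idM(1)])
     (simp add: y blin isproj_idem[OF pi(1)])
   finally show "\<tau> (I - kerp (y o\<^sub>L (fm - fl))) \<le> ennreal T" using T by (rule order_trans)
  qed
  from small_comp[OF this pm(3) proj_norm1[OF P(3)] mem_id norm_id_le]
  show ?thesis by (rule back_subst[of "\<lambda>a. small a _"]) (rule blinfun_eqI, simp)
 qed
 have 4: "small (- I o\<^sub>L ?a4) (b * N (chi \<gamma>))"
 proof -
  have gp: "fm - R \<in> Proj" unfolding projections_iff by (intro conjI mem_diff pm isproj_diff pi le)
  have "small ?a4 (b * N (chi \<gamma>))"
  proof (rule small_bounded[OF M1(3) _ b(2)])
   fix h
   have "norm (?a4 h) \<le> b * norm (fl ((fm - R) h))" using yb by simp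
   also have "\<dots> \<le> b * norm h" by (intro mult_left_mono b order_trans[OF isproj_norm[OF pi(5)] isproj_norm] proj_isproj gp)
   finally show "norm (?a4 h) \<le> b * norm h" .
  next
   show "\<tau> (I - kerp ?a4) \<le> ennreal \<gamma>" by (rule order_trans[OF tau_support_right[OF M1(3) gp] \<gamma>]) (simp add: pr_idem[OF gp])
  qed
  from small_lmul[OF this mem_neg_id, of 1] show ?thesis using norm_id_le by simp
 qed
 show ?thesis unfolding decomp by (rule small_mono[OF small_add[OF small_add[OF 1 2] small_add[OF 3 4]]]) simp
qed

text \<open>At stage j the right cut p makes Z p low, since B / N (chi (j+1)) tends to 0, at the
  price of trace j + 1; the left cut q costs trace 1/(j+1) and leaves q Z of finite height.\<close>

definition cuts :: "'a op \<Rightarrow> real \<Rightarrow> nat \<Rightarrow> 'a op \<Rightarrow> 'a op \<Rightarrow> bool"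
 where "cuts Z B j p q \<longleftrightarrow> p \<in> Proj \<and> q \<in> Proj \<and> \<tau>c p \<le> ennreal (real (Suc j)) \<and> \<tau>c q \<le> ennreal (1 / real (Suc j)) \<and>
  (\<forall>h. norm (Z (p h)) \<le> B / N (chi (real (Suc j))) * norm h) \<and> (\<forall>h. norm (q (Z h)) \<le> B / N (chi (1 / real (Suc j))) * norm h)"

lemma cutsD:
 assumes "cuts Z B j p q"
 shows "p \<in> Proj" "q \<in> Proj" "\<tau>c p \<le> ennreal (real (Suc j))" "\<tau>c q \<le> ennreal (1 / real (Suc j))"
  "norm (Z (p h)) \<le> B / N (chi (real (Suc j))) * norm h" "norm (q (Z h)) \<le> B / N (chi (1 / real (Suc j))) * norm h"
 using assms unfolding cuts_def by blast+

lemma left_right_cuts: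
 fixes Z :: "'a op"
 assumes Z: "Z \<in> M" "Sm (op_graph Z) H" and H: "decf H" "\<And>t. t > 0 \<Longrightarrow> H t \<le> B / N (chi t)"
 shows "\<exists>p q. cuts Z B j p q"
proof -
 let ?T = "real (Suc j)" and ?\<delta> = "1 / real (Suc j)"
 have t: "0 < ?T" "0 < ?\<delta>" by simp_all
 obtain p where p: "p \<in> Proj" "\<tau>c p \<le> ennreal ?T" "\<And>h. norm (Z (p h)) \<le> H ?T * norm h" using Sm_opD[OF Z(2) t(1)] by blast
 obtain q where q: "q \<in> Proj" "\<tau>c q \<le> ennreal ?\<delta>" "\<And>h. norm (radj Z (q h)) \<le> H ?\<delta> * norm h"
  using Sm_opD[OF Sm_op_radj[OF Z(2) decfD(2)[OF H(1)] Z(1)] t(2)] by blast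
 have "norm (radj Z o\<^sub>L q) \<le> H ?\<delta>" by (rule norm_blinfun_bound[OF decfD(2)[OF H(1)]]) (use q(3) in simp)
 moreover have "radj (radj Z o\<^sub>L q) = q o\<^sub>L Z" using pr_radj[OF q(1)] by (simp add: radj_comp radj_radj)
 ultimately have qZ: "norm (q o\<^sub>L Z) \<le> H ?\<delta>" using norm_radj[of "radj Z o\<^sub>L q"] by simp
 have "norm (Z (p h)) \<le> B / N (chi ?T) * norm h" for h using p(3)[of h] mult_right_mono[OF H(2)[OF t(1)], of "norm h"] by simp
 moreover have "norm (q (Z h)) \<le> B / N (chi ?\<delta>) * norm h" for h
  using norm_blinfun[of "q o\<^sub>L Z" h] mult_right_mono[OF order_trans[OF qZ H(2)[OF t(2)]], of "norm h"] by simp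
 ultimately show ?thesis unfolding cuts_def using p(1,2) q(1,2) by blast
qed

section \<open>The splitting of bounded approximants\<close>

text \<open>R Z is the adjoint of radj Z R. Running the one-sided estimate for Z and its adjoint at
  once, with the same R, covers both sides.\<close>

definition flip :: "bool \<Rightarrow> 'a op \<Rightarrow> 'a op"
 where "flip b a = (if b then a else radj a)"

lemma flip_mem: "a \<in> M \<Longrightarrow> flip b a \<in> M" by (simp add: flip_def mem_radj)

lemma Sm_flip: "Sm (op_graph a) f \<Longrightarrow> decf f \<Longrightarrow> a \<in> M \<Longrightarrow> Sm (op_graph (flip b a)) f"
 using Sm_op_radj[OF _ decfD(2)] by (auto simp: flip_def)

text \<open>\<open>Z i\<close> is the approximant chosen at step \<open>i\<close>, \<open>m i\<close> a level fixed before that choice and \<open>m (Suc i)\<close> one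
 that supports \<open>Z i\<close>. The part of \<open>Z i\<close> above the height \<open>B / N (chi (\<delta> i))\<close> has support of trace at most \<open>\<delta> i\<close>, and
 \<open>\<delta> (Suc i)\<close> is chosen so small that projections of that trace no longer see \<open>Z i\<close>.\<close>

context
 fixes Z f :: "nat \<Rightarrow> 'a op" and H :: "nat \<Rightarrow> real \<Rightarrow> real" and g :: "real \<Rightarrow> real" and B :: real
  and m :: "nat \<Rightarrow> nat" and \<delta> :: "nat \<Rightarrow> real" and p q y :: "bool \<Rightarrow> nat \<Rightarrow> nat \<Rightarrow> 'a op"
  and bl :: "bool \<Rightarrow> nat \<Rightarrow> nat \<Rightarrow> real"
 assumes f: "\<And>n. f n \<in> Proj" "\<And>n k h. n \<le> k \<Longrightarrow> f k (f n h) = f n h" "\<And>n. \<tau> (f n) < \<infinity>"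
  and Z: "\<And>i. Z i \<in> M" "\<And>i h. f (m (Suc i)) (Z i h) = Z i h" "\<And>i h. Z i (f (m (Suc i)) h) = Z i h"
  and m: "\<And>i. m i \<le> m (Suc i)" "\<And>i. i \<le> m i"
  and H: "\<And>i. Sm (op_graph (Z i)) (H i)" "\<And>i. decf (H i)" "\<And>i. H i \<in> E" "\<And>i t. t > 0 \<Longrightarrow> H i t \<le> B / N (chi t)"
  and B: "0 \<le> B" and g: "g \<in> E" "decf g"
  and \<delta>: "\<And>i. 0 < \<delta> i" "\<And>i. \<delta> i \<le> 1" "\<And>i. \<delta> (Suc i) \<le> \<delta> i / 2"
  and tail: "\<And>i. norm (Z i) * N (chi (4 * \<delta> (Suc i))) \<le> 1 / real (Suc i)"
  and conv: "\<And>i. N (\<lambda>t. min \<bar>H i t - g t\<bar> (2 * (B / N (chi (\<delta> i)))) * chi (enn2real (\<tau> (f (m i))) + 1) t) \<le> 1 / real (Suc i)"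
  and pq_cuts: "\<And>b j i. cuts (flip b (Z i)) B j (p b j i) (q b j i)"
  and y: "\<And>b j i. y b j i = q b j i o\<^sub>L flip b (Z i) o\<^sub>L (I - p b j i)"
  and bl: "\<And>b j i l. j \<le> i \<Longrightarrow> l \<le> m i \<Longrightarrow> \<bar>beta (y b j i) (f l) - bl b j l\<bar> \<le> 1 / real (Suc i)"
begin

private lemmas pq = cutsD[OF pq_cuts]

private lemma bnd_nonneg: "0 \<le> B / N (chi t)" using B N_nonneg[OF chi_in] by simp

private lemma conv_in: "0 \<le> K \<Longrightarrow> (\<lambda>t. min \<bar>H i t - g t\<bar> K * chi T t) \<in> E"
proof (rule dom_in(1)[OF scale_closed[OF chi_in]])
 have [measurable]: "H i \<in> borel_measurable borel" "g \<in> borel_measurable borel" "chi T \<in> borel_measurable borel"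
  by (intro decf_measurable H g decf_chi)+
 show "(\<lambda>t. min \<bar>H i t - g t\<bar> K * chi T t) \<in> borel_measurable halfline" by (rule halfline_measurable) measurable
 show "\<bar>min \<bar>H i t - g t\<bar> K * chi T t\<bar> \<le> \<bar>K * chi T t\<bar>" if "0 \<le> K" for t using that by (simp add: chi_def)
qed

private abbreviation "c i \<equiv> B / N (chi (\<delta> i))"
text \<open>The summand 1 ensures T i \<ge> 1 \<ge> 1/(j+1), so that this cut-off does not interfere
  near 0.\<close>

private abbreviation "T i \<equiv> enn2real (\<tau> (f (m i))) + 1"
private abbreviation "D i t \<equiv> min \<bar>H i t - g t\<bar> (2 * c i) * chi (T i) t"

text \<open>H i is near g only after a cut in height and length. The inequality min (H i) (2 c)
  \<le> g + min |H i - g| (2 c) transfers the smallness near 0 from the fixed function g to all H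
  i.\<close>

private lemma top_estimate:
 "N (\<lambda>t. min (H i t) (2 * c i) * chi (1 / real (Suc j)) t) \<le> N (\<lambda>t. g t * chi (1 / real (Suc j)) t) + 1 / real (Suc i)"
proof -
 have c: "0 \<le> 2 * c i" by (intro mult_nonneg_nonneg bnd_nonneg) simp
 let ?\<delta> = "1 / real (Suc j)"
 have \<delta>1: "?\<delta> \<le> T i" by (rule order_trans[of _ 1]) auto
 have d: "decf (\<lambda>t. min (H i t) (2 * c i) * chi ?\<delta> t)" "decf (\<lambda>t. g t * chi ?\<delta> t)"
  by (rule decf_mult[OF decf_minc[OF c H(2)] decf_chi], rule decf_mult[OF g(2) decf_chi])
 have gE: "(\<lambda>t. g t * chi ?\<delta> t) \<in> E" by (rule dom_decf(1)[OF g(1) d(2)]) (use decfD(2)[OF g(2)] in \<open>simp add: chi_def\<close>)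
 have "N (\<lambda>t. min (H i t) (2 * c i) * chi ?\<delta> t)
  \<le> N (\<lambda>t. g t * chi ?\<delta> t + D i t)"
 proof (rule dom_decf(2)[OF add_closed[OF gE conv_in[OF c]] d(1)])
  fix t :: real assume "t > 0"
  then have "t < ?\<delta> \<Longrightarrow> chi (T i) t = 1" using \<delta>1 by (simp add: chi_def)
  moreover have "min (H i t) (2 * c i) \<le> g t + min \<bar>H i t - g t\<bar> (2 * c i)" using decfD(2)[OF g(2), of t] c by linarith
  moreover have "0 \<le> D i t" using c by (simp add: chi_def)
  ultimately show "min (H i t) (2 * c i) * chi ?\<delta> t \<le> g t * chi ?\<delta> t + D i t"
   by (cases "t < ?\<delta>") (simp_all add: chi_def del: of_nat_Suc)
 qed
 also have "\<dots> \<le> N (\<lambda>t. g t * chi ?\<delta> t) + N (D i)" by (rule norm_triangle[OF gE conv_in[OF c]])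
 finally show ?thesis using conv[of i] by linarith
qed

private lemma bnd_antimono: "0 < s \<Longrightarrow> s \<le> t \<Longrightarrow> B / N (chi t) \<le> B / N (chi s)"
 using B chi_pos[of s] chi_mono[of s t] by (intro divide_left_mono) (auto intro: mult_pos_pos)

private lemma bottom_estimate:
 "N (\<lambda>t. min (H i t) (B / N (chi (real (Suc j)))) * chi (T i) t) \<le> N (\<lambda>t. min (g t) (B / N (chi (real (Suc j))))) + 1 / real (Suc i)"
proof -
 have c: "0 \<le> 2 * c i" by (intro mult_nonneg_nonneg bnd_nonneg) simp
 define a where "a = B / N (chi (real (Suc j)))"
 have a0: "0 \<le> a" by (simp add: a_def bnd_nonneg del: of_nat_Suc)
 have "a \<le> c i" unfolding a_def by (rule bnd_antimono[OF \<delta>(1)]) (rule order_trans[OF \<delta>(2)], simp)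
 then have ac: "a \<le> 2 * c i" using a0 by linarith
 have d: "decf (\<lambda>t. min (H i t) a * chi (T i) t)" "decf (\<lambda>t. min (g t) a)"
  by (rule decf_mult[OF decf_minc[OF a0 H(2)] decf_chi], rule decf_minc[OF a0 g(2)])
 have gE: "(\<lambda>t. min (g t) a) \<in> E" by (rule dom_decf(1)[OF g(1) d(2)]) simp
 have "N (\<lambda>t. min (H i t) a * chi (T i) t) \<le> N (\<lambda>t. min (g t) a + D i t)"
 proof (rule dom_decf(2)[OF add_closed[OF gE conv_in[OF c]] d(1)])
  fix t :: real assume "t > 0"
  have "min (H i t) a \<le> min (g t) a + min \<bar>H i t - g t\<bar> (2 * c i)" using decfD(2)[OF g(2), of t] ac a0 by linarith
  moreover have "0 \<le> min (g t) a" using decfD(2)[OF g(2), of t] a0 by simp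
  ultimately show "min (H i t) a * chi (T i) t \<le> min (g t) a + D i t" by (simp add: chi_def)
 qed
 also have "\<dots> \<le> N (\<lambda>t. min (g t) a) + N (D i)" by (rule norm_triangle[OF gE conv_in[OF c]])
 finally show ?thesis using conv[of i] unfolding a_def by linarith
qed

private lemma \<delta>_geometric: "\<delta> (i + n) \<le> \<delta> i * (1/2) ^ n"
proof (induction n)
 case (Suc n)
 then show ?case using \<delta>(3)[of "i + n"] by simp
qed simp

text \<open>D n is a projection on which Z n and its adjoint are both bounded by c n. R i is the
  infimum of f (m i) and of all D n with n \<ge> i; it increases because the levels do and because
  fewer D n remain. The discarded trace is at most the sum of 2 \<delta> n over n \<ge> i, which is
  at most 4 \<delta> i since \<delta> at least halves.\<close>

private lemma cut_projections:
 obtains R where "\<And>i. R i \<in> Proj" "\<And>i h. f (m i) (R i h) = R i h" "\<And>i h. R (Suc i) (R i h) = R i h"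
  "\<And>i. \<tau> (f (m i) - R i) \<le> ennreal (4 * \<delta> i)" "\<And>b i h. norm (flip b (Z i) (R i h)) \<le> c i * norm h"
proof -
 have "\<exists>d. \<forall>b i. d b i \<in> Proj \<and> \<tau>c (d b i) \<le> ennreal (\<delta> i) \<and>
  (\<forall>h. norm (flip b (Z i) (d b i h)) \<le> H i (\<delta> i) * norm h)"
  using Sm_opD[OF Sm_flip[OF H(1,2) Z(1)] \<delta>(1)] by (intro choice allI) blast
 then obtain d where d: "\<And>b i. d b i \<in> Proj" "\<And>b i. \<tau>c (d b i) \<le> ennreal (\<delta> i)"
  "\<And>b i h. norm (flip b (Z i) (d b i h)) \<le> H i (\<delta> i) * norm h" by blast
 define D where "D i = pmeet (d True i) (d False i)" for i
 have Dm: "D i \<in> Proj" "d True i (D i h) = D i h" "d False i (D i h) = D i h" for i h unfolding D_def by (intro pmeet d)+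
 have D\<tau>: "\<tau>c (D i) \<le> ennreal (2 * \<delta> i)" for i
 proof -
  have "\<tau>c (D i) \<le> ennreal (\<delta> i) + ennreal (\<delta> i)"
   by (rule order_trans[OF pmeet(5)[OF d(1)[of True i] d(1)[of False i], folded D_def] add_mono[OF d(2) d(2)]])
  also have "\<dots> = ennreal (2 * \<delta> i)" using \<delta>(1)[of i] by (subst ennreal_plus[symmetric]) auto
  finally show ?thesis .
 qed
 have W_ex: "\<exists>W. W \<in> Proj \<and> (\<forall>n h. D (i + n) (W h) = W h) \<and> (\<forall>h. (\<forall>n. D (i + n) h = h) \<longrightarrow> W h = h) \<and>
  \<tau>c W \<le> ennreal (4 * \<delta> i)" for i
 proof -
  obtain W where W: "W \<in> Proj" "\<And>n h. D (i + n) (W h) = W h" "\<And>h. (\<And>n. D (i + n) h = h) \<Longrightarrow> W h = h"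
   "\<tau>c W \<le> (\<Sum>n. \<tau>c (D (i + n)))" by (rule tau_inf[of "\<lambda>n. D (i + n)", OF Dm(1)]) (rule that; (assumption | blast))
  have "(\<Sum>n. \<tau>c (D (i + n))) \<le> (\<Sum>n. ennreal (2 * \<delta> i * (1/2) ^ n))"
  proof (rule suminf_le)
   show "\<tau>c (D (i + n)) \<le> ennreal (2 * \<delta> i * (1/2) ^ n)" for n
    by (rule order_trans[OF D\<tau> ennreal_leI]) (use \<delta>_geometric[of i n] in simp)
  qed auto
  also have "\<dots> = ennreal (4 * \<delta> i)"
  proof (rule suminf_ennreal_eq)
   show "(\<lambda>n. 2 * \<delta> i * (1/2) ^ n) sums (4 * \<delta> i)" using sums_mult[OF geometric_sums[of "1/2 :: real"], of "2 * \<delta> i"] by simp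
  qed (use \<delta>(1)[of i] in simp)
  finally show ?thesis using W(1,2,3) order_trans[OF W(4)] by blast
 qed
 obtain W where W': "\<forall>i. W i \<in> Proj \<and> (\<forall>n h. D (i + n) (W i h) = W i h) \<and>
  (\<forall>h. (\<forall>n. D (i + n) h = h) \<longrightarrow> W i h = h) \<and> \<tau>c (W i) \<le> ennreal (4 * \<delta> i)" using choice[OF allI[OF W_ex]] by (rule exE)
 have W: "W i \<in> Proj" "D (i + n) (W i h) = W i h" "(\<And>n. D (i + n) h = h) \<Longrightarrow> W i h = h"
  "\<tau>c (W i) \<le> ennreal (4 * \<delta> i)" for i n h using W'[rule_format, of i] by simp_all
 define R where "R i = pmeet (f (m i)) (W i)" for i
 have R: "R i \<in> Proj" "R i h = h \<longleftrightarrow> f (m i) h = h \<and> W i h = h" "f (m i) (R i h) = R i h" "W i (R i h) = R i h" for i h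
  using pmeet[OF f(1) W(1)] by (auto simp: R_def)
 show thesis
 proof (rule that)
  show "R i \<in> Proj" "f (m i) (R i h) = R i h" for i h by (rule R(1), rule R(3))
  show "R (Suc i) (R i h) = R i h" for i h
  proof (subst R(2), rule conjI)
   show "f (m (Suc i)) (R i h) = R i h" using f(2)[OF m(1), of i "R i h"] by (simp add: R(3))
   show "W (Suc i) (R i h) = R i h"
   proof (rule W(3))
    show "D (Suc i + n) (R i h) = R i h" for n using W(2)[of i "Suc n" "R i h"] by (simp add: R(4))
   qed
  qed
  show "\<tau> (f (m i) - R i) \<le> ennreal (4 * \<delta> i)" for i
   unfolding R_def by (rule order_trans[OF tau_difference_meet(2)[OF f(1) W(1)] W(4)])
  show "norm (flip b (Z i) (R i h)) \<le> c i * norm h" for b i h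
  proof -
   have "D i (R i h) = R i h" using W(2)[of i 0 "R i h"] by (simp add: R(4))
   then have "d b i (R i h) = R i h" using Dm(2,3)[of i "R i h"] by (cases b) simp_all
   then have "norm (flip b (Z i) (R i h)) \<le> H i (\<delta> i) * norm (R i h)" using d(3)[of b i "R i h"] by simp
   also have "\<dots> \<le> c i * norm h" by (intro mult_mono H(4) \<delta> isproj_norm proj_isproj R(1) bnd_nonneg) auto
   finally show ?thesis .
  qed
 qed
qed

private lemma y_mem: "y b j i \<in> M"
 and y_norm: "norm (y b j i) \<le> B / N (chi (1 / real (Suc j)))"
 and y_beta: "\<tau> (radj (y b j i) o\<^sub>L y b j i) \<le> ennreal ((B / N (chi (1 / real (Suc j))))\<^sup>2 * real (Suc j))"
 by (rule truncation_trace[OF flip_mem[OF Z(1)] pq(1,2) bnd_nonneg pq(6,3) of_nat_0_le_iff y])+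

text \<open>For fixed i the masses increase with the level l and are bounded independently of i;
  both facts survive the limit in i.\<close>

private lemma bl_convergent: "convergent (bl b j)"
proof -
 let ?C = "(B / N (chi (1 / real (Suc j))))\<^sup>2 * real (Suc j)"
 have C: "0 \<le> ?C" by simp
 have lim: "(\<lambda>i. beta (y b j i) (f l)) \<longlonglongrightarrow> bl b j l" for l
 proof (rule Lim_transform_bound[of _ "\<lambda>i. 1 / real (Suc i)", THEN LIM_zero_cancel])
  show "\<forall>\<^sub>F i in sequentially. norm (beta (y b j i) (f l) - bl b j l) \<le> norm (1 / real (Suc i))"
  proof (rule eventually_sequentiallyI)
   fix i assume "max j l \<le> i"
   then have "j \<le> i" "l \<le> m i" using m(2)[of i] by auto
   from bl[OF this, of b] show "norm (beta (y b j i) (f l) - bl b j l) \<le> norm (1 / real (Suc i))" by simp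
  qed
  show "(\<lambda>i. 1 / real (Suc i)) \<longlonglongrightarrow> 0" by (rule LIMSEQ_Suc[OF lim_1_over_n])
 qed
 have "incseq (bl b j)"
 proof (rule incseq_SucI)
  show "bl b j l \<le> bl b j (Suc l)" for l by (rule LIMSEQ_le[OF lim lim]) (use beta(3)[OF y_mem y_beta C f(1) f(1) f(2)] in auto)
 qed
 moreover have "bl b j l \<le> ?C" for l
  by (rule LIMSEQ_le_const2[OF lim]) (use beta(2)[OF y_mem y_beta C f(1) f(1) f(2)[OF order_refl]] in blast)
 ultimately show ?thesis by (metis incseq_convergent convergentI)
qed

context
 fixes R :: "nat \<Rightarrow> 'a op"
 assumes R: "\<And>i. R i \<in> Proj" "\<And>i h. f (m i) (R i h) = R i h" "\<And>i h. R (Suc i) (R i h) = R i h"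
  "\<And>i. \<tau> (f (m i) - R i) \<le> ennreal (4 * \<delta> i)" "\<And>b i h. norm (flip b (Z i) (R i h)) \<le> c i * norm h"
begin

text \<open>The order of quantifiers follows the choices: j makes both truncations of g small, l
  comes from the Cauchy property of \<open>bl\<close> at this j, and i absorbs the errors 1/(i+1)
  and \<delta> i.\<close>

private lemma one_sided:
 assumes \<epsilon>: "0 < \<epsilon>"
 shows "\<exists>j0. \<forall>j\<ge>j0. \<exists>l0. \<forall>l\<ge>l0. \<exists>i0. \<forall>i\<ge>i0. small ((flip b (Z i) o\<^sub>L R i) - (y b j i o\<^sub>L f l)) \<epsilon>"
proof -
 have "(\<lambda>j. N (\<lambda>t. min (g t) (B / N (chi (real (Suc j)))))) \<longlonglongrightarrow> 0"
 proof (rule dominated[OF decf_halfline[OF decf_minc[OF bnd_nonneg g(2)]] g(1)])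
  show "\<bar>min (g t) (B / N (chi (real (Suc j))))\<bar> \<le> g t" for j t
   using decfD(2)[OF g(2), of t] bnd_nonneg[of "real (Suc j)"] by (simp add: abs_of_nonneg)
  show "(\<lambda>j. min (g t) (B / N (chi (real (Suc j))))) \<longlonglongrightarrow> 0" for t
   using tendsto_min[OF tendsto_const bnd_tendsto[of B], of "g t"] decfD(2)[OF g(2), of t] by (simp add: min_absorb2)
 qed
 then have "\<forall>\<^sub>F j in sequentially. N (\<lambda>t. min (g t) (B / N (chi (real (Suc j))))) < \<epsilon> / 24 \<and> N (\<lambda>t. g t * chi (1 / real (Suc j)) t) < \<epsilon> / 24"
  by (intro eventually_conj order_tendstoD(2)[OF decf_truncation(2)[OF g]] order_tendstoD(2)) (use \<epsilon> in auto)
 then obtain j0 where j0: "\<And>j. j \<ge> j0 \<Longrightarrow> N (\<lambda>t. min (g t) (B / N (chi (real (Suc j))))) < \<epsilon> / 24"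
   "\<And>j. j \<ge> j0 \<Longrightarrow> N (\<lambda>t. g t * chi (1 / real (Suc j)) t) < \<epsilon> / 24" unfolding eventually_sequentially by blast
 have "\<exists>l0. \<forall>l\<ge>l0. \<exists>i0. \<forall>i\<ge>i0. small ((flip b (Z i) o\<^sub>L R i) - (y b j i o\<^sub>L f l)) \<epsilon>" if j: "j \<ge> j0" for j
 proof -
  define T' where "T' = real (Suc j)"
  define bj where "bj = B / N (chi (1 / T'))"
  have bj: "0 \<le> bj" by (simp add: bj_def bnd_nonneg)
  have nT: "0 \<le> N (chi T')" by (rule N_nonneg[OF chi_in])
  \<comment> \<open>24 = 4 * 6: the factor of \<open>right_estimate\<close> times the budget of six,
    five terms of size \<epsilon>/24 and two of size \<epsilon>/48.\<close>
  define s where "s = \<epsilon> / (24 * (N (chi T') + 1))"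
  have s: "0 < s" "s * N (chi T') \<le> \<epsilon> / 24" using \<epsilon> nT by (auto simp: s_def field_simps)
  obtain \<delta>' where \<delta>'_small: "0 < \<delta>'" "N (chi \<delta>') \<le> \<epsilon> / (24 * (bj + 1))" using chi_smallE[of "\<epsilon> / (24 * (bj + 1))"] \<epsilon> bj by auto
  have "bj * (\<epsilon> / (24 * (bj + 1))) \<le> \<epsilon> / 24" using bj \<epsilon> by (simp add: field_simps)
  then have \<delta>': "0 < \<delta>'" "bj * N (chi \<delta>') \<le> \<epsilon> / 24" using \<delta>'_small(1) mult_left_mono[OF \<delta>'_small(2) bj] by linarith+
  \<comment> \<open>Makes \<eta> / s^2 = \<delta>', the length of support that height bj can afford.
    Half of \<eta> is left to the oscillation of \<open>bl\<close>, a quarter to each of two errors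
    1/(i+1).\<close>
  define \<eta> where "\<eta> = \<delta>' * s\<^sup>2"
  have \<eta>: "0 < \<eta>" using \<delta>' s by (simp add: \<eta>_def)
  obtain l0 where l0: "\<And>l n. l \<ge> l0 \<Longrightarrow> n \<ge> l0 \<Longrightarrow> \<bar>bl b j n - bl b j l\<bar> < \<eta> / 2"
   using convergent_Cauchy[OF bl_convergent, of b j] \<eta> half_gt_zero[OF \<eta>] unfolding Cauchy_def dist_real_def by metis
  have "\<exists>i0. \<forall>i\<ge>i0. small ((flip b (Z i) o\<^sub>L R i) - (y b j i o\<^sub>L f l)) \<epsilon>" if l: "l \<ge> l0" for l
  proof -
   have "\<forall>\<^sub>F i in sequentially. 1 / real (Suc i) < \<eta> / 4 \<and> 1 / real (Suc i) < \<epsilon> / 48 \<and> 4 * (1/2) ^ i < \<delta>'"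
   proof (intro eventually_conj)
    have l: "(\<lambda>i. 1 / real (Suc i)) \<longlonglongrightarrow> 0" by (rule LIMSEQ_Suc[OF lim_1_over_n])
    show "\<forall>\<^sub>F i in sequentially. 1 / real (Suc i) < \<eta> / 4" "\<forall>\<^sub>F i in sequentially. 1 / real (Suc i) < \<epsilon> / 48"
     by (rule order_tendstoD(2)[OF l], use \<eta> \<epsilon> in simp)+
    have "(\<lambda>i. 4 * (1/2 :: real) ^ i) \<longlonglongrightarrow> 0" by (intro tendsto_mult_right_zero LIMSEQ_realpow_zero) auto
    then show "\<forall>\<^sub>F i in sequentially. 4 * (1/2) ^ i < \<delta>'" by (rule order_tendstoD(2)[OF _ \<delta>'(1)])
   qed
   then obtain i0 where i0: "\<And>i. i \<ge> i0 \<Longrightarrow> 1 / real (Suc i) < \<eta> / 4" "\<And>i. i \<ge> i0 \<Longrightarrow> 1 / real (Suc i) < \<epsilon> / 48"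
    "\<And>i. i \<ge> i0 \<Longrightarrow> 4 * (1/2) ^ i < \<delta>'" unfolding eventually_sequentially by blast
   have "small ((flip b (Z i) o\<^sub>L R i) - (y b j i o\<^sub>L f l)) \<epsilon>" if i: "i \<ge> max i0 (max j l)" for i
   proof -
    have i': "i0 \<le> i" "j \<le> i" "l \<le> m i" "l0 \<le> m i" using i l m(2)[of i] by auto
    let ?r1 = "N (\<lambda>t. g t * chi (1 / T') t) + 1 / real (Suc i)"
    let ?r2 = "N (\<lambda>t. min (g t) (B / N (chi T'))) + 1 / real (Suc i)"
    note fb = beta[OF y_mem y_beta[of b j i] _ f(1) f(1) f(2)[OF i'(3)]]
    have "beta (y b j i) (f (m i)) - beta (y b j i) (f l) \<le> \<eta>"
     using bl[OF i'(2,3), of b] bl[OF i'(2) order_refl, of b] l0[OF l i'(4)] i0(1)[OF i'(1)] by linarith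
    then have \<eta>': "\<tau> (radj (y b j i o\<^sub>L (f (m i) - f l)) o\<^sub>L (y b j i o\<^sub>L (f (m i) - f l))) \<le> ennreal \<eta>"
     using fb(4) by (simp add: ennreal_leI)
    have TR: "\<tau> (R i) \<le> ennreal (T i)"
    proof -
     have "\<tau> (R i) \<le> \<tau> (f (m i))" by (rule tau_proj_mono[OF R(1) f(1) R(2)])
     also have "\<dots> = ennreal (enn2real (\<tau> (f (m i))))" using f(3)[of "m i"] by simp
     also have "\<dots> \<le> ennreal (T i)" by (intro ennreal_leI) simp
     finally show ?thesis .
    qed
    have "small ((flip b (Z i) o\<^sub>L R i) - (y b j i o\<^sub>L f l))
     (4 * (?r1 + ?r2 + bj * N (chi (\<eta> / s\<^sup>2)) + s * N (chi T') + bj * N (chi (4 * \<delta> i))))" unfolding bj_def T'_def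
    proof (rule right_estimate[OF flip_mem[OF Z(1)] Sm_flip[OF H(1,2) Z(1)] H(3,2) pq(1,2) R(1) f(1) f(1) R(2) f(2)[OF i'(3)] R(5)
       pq(5) bnd_nonneg _ pq(6) bnd_nonneg pq(3,4) TR R(4) y \<eta>' less_imp_le[OF \<eta>] s(1) top_estimate bottom_estimate])
     show "B / N (chi (real (Suc j))) \<le> c i" by (rule bnd_antimono[OF \<delta>(1)]) (rule order_trans[OF \<delta>(2)], simp)
    qed
    moreover have "\<eta> / s\<^sup>2 = \<delta>'" using s(1) by (simp add: \<eta>_def)
    moreover have "bj * N (chi (4 * \<delta> i)) \<le> bj * N (chi \<delta>')"
    proof (intro mult_left_mono chi_mono bj)
     have "\<delta> 0 * (1/2) ^ i \<le> 1 * (1/2) ^ i" by (intro mult_right_mono \<delta>) simp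
     then show "4 * \<delta> i \<le> \<delta>'" using i0(3)[OF i'(1)] \<delta>_geometric[of 0 i] unfolding add_0 mult_1 by linarith
    qed
    ultimately show ?thesis using j0[OF j, folded T'_def] \<delta>'(2) s(2) i0(2)[OF i'(1)] by (elim small_mono) simp
   qed
   then show ?thesis by blast
  qed
  then show ?thesis by blast
 qed
 then show ?thesis by blast
qed

text \<open>With F = f (m (i+1)), R' = R (i+1), e = R' - R and G = F - R', the relation Z = F Z F
  gives Z - e Z e = Z R + R Z (1 - R) + e Z G + G Z (1 - R). The first two terms are reduced to a
  fixed level by \<open>one_sided\<close>; the terms with G are small by the choice of \<delta>
  (i+1).\<close>

lemma essential_part:
 assumes \<epsilon>: "0 < \<epsilon>"
 shows "\<exists>l c i0. 0 \<le> c \<and> (\<forall>i\<ge>i0. essential (Z i - ((R (Suc i) - R i) o\<^sub>L Z i o\<^sub>L (R (Suc i) - R i))) \<epsilon> (f l) c)"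
proof -
 \<comment> \<open>Four terms added in two layers of \<open>small_add\<close>: 4 * 4 = 16.\<close>
 have e16: "0 < \<epsilon> / 16" using \<epsilon> by simp
 obtain j1 where j1: "\<And>j. j \<ge> j1 \<Longrightarrow> \<exists>l0. \<forall>l\<ge>l0. \<exists>i0. \<forall>i\<ge>i0. small ((flip True (Z i) o\<^sub>L R i) - (y True j i o\<^sub>L f l)) (\<epsilon> / 16)"
  using one_sided[OF e16, of True] by blast
 obtain j2 where j2: "\<And>j. j \<ge> j2 \<Longrightarrow> \<exists>l0. \<forall>l\<ge>l0. \<exists>i0. \<forall>i\<ge>i0. small ((flip False (Z i) o\<^sub>L R i) - (y False j i o\<^sub>L f l)) (\<epsilon> / 16)"
  using one_sided[OF e16, of False] by blast
 define j where "j = max j1 j2"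
 obtain l1 where l1: "\<And>l. l \<ge> l1 \<Longrightarrow> \<exists>i0. \<forall>i\<ge>i0. small ((flip True (Z i) o\<^sub>L R i) - (y True j i o\<^sub>L f l)) (\<epsilon> / 16)"
  using j1[of j] by (auto simp: j_def)
 obtain l2 where l2: "\<And>l. l \<ge> l2 \<Longrightarrow> \<exists>i0. \<forall>i\<ge>i0. small ((flip False (Z i) o\<^sub>L R i) - (y False j i o\<^sub>L f l)) (\<epsilon> / 16)"
  using j2[of j] by (auto simp: j_def)
 define l where "l = max l1 l2"
 obtain i1 where i1: "\<And>i. i \<ge> i1 \<Longrightarrow> small ((flip True (Z i) o\<^sub>L R i) - (y True j i o\<^sub>L f l)) (\<epsilon> / 16)"
  using l1[of l] by (auto simp: l_def)
 obtain i2 where i2: "\<And>i. i \<ge> i2 \<Longrightarrow> small ((flip False (Z i) o\<^sub>L R i) - (y False j i o\<^sub>L f l)) (\<epsilon> / 16)"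
  using l2[of l] by (auto simp: l_def)
 obtain i3 where i3: "1 / real (Suc i3) < \<epsilon> / 16" using reals_Archimedean[OF e16] by (auto simp: inverse_eq_divide)
 define c' where "c' = B / N (chi (1 / real (Suc j)))"
 have c': "0 \<le> c'" by (simp only: c'_def bnd_nonneg)
 have "essential (Z i - ((R (Suc i) - R i) o\<^sub>L Z i o\<^sub>L (R (Suc i) - R i))) \<epsilon> (f l) c'"
  if i: "i \<ge> max (max i1 i2) i3" for i
 proof -
  have "1 / real (Suc i) \<le> 1 / real (Suc i3)" using i by (simp add: frac_le)
  then have si: "1 / real (Suc i) \<le> \<epsilon> / 16" using i3 by linarith
  let ?P = "I - R i" and ?P' = "I - R (Suc i)" and ?G = "f (m (Suc i)) - R (Suc i)" and ?e = "R (Suc i) - R i"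
  have yn: "norm (y b j i) \<le> c'" for b unfolding c'_def by (rule y_norm)
  have P: "?P \<in> Proj" "?P' \<in> Proj" by (intro proj_compl R)+
  have G: "?G \<in> Proj" unfolding projections_iff by (intro conjI mem_diff proj_mem f R isproj_diff proj_isproj)
  have ep: "?e \<in> Proj" unfolding projections_iff by (intro conjI mem_diff proj_mem R isproj_diff proj_isproj)
  note rj = radj_sa[OF isproj_sa[OF proj_isproj]]
  let ?w = "radj (y False j i) o\<^sub>L ?P"
  have wn: "norm ?w \<le> c'"
  proof -
   have "norm ?w \<le> norm (radj (y False j i)) * norm ?P" by (rule norm_blinfun_compose)
   also have "\<dots> \<le> c' * 1" by (intro mult_mono proj_norm1 P c') (simp_all add: norm_radj yn)
   finally show ?thesis by simp
  qed
  have wM: "?w \<in> M" by (intro mem_comp mem_radj y_mem proj_mem P)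
  have A1: "small ((Z i o\<^sub>L R i) - (y True j i o\<^sub>L f l)) (\<epsilon> / 16)" using i1[of i] i by (simp add: flip_def)
  have A2: "small (((R i o\<^sub>L Z i) - (f l o\<^sub>L radj (y False j i))) o\<^sub>L ?P) (\<epsilon> / 16)"
  proof -
   have "small (radj ((radj (Z i) o\<^sub>L R i) - (y False j i o\<^sub>L f l))) (\<epsilon> / 16)"
    using i2[of i] i by (intro small_radj) (simp add: flip_def)
   then have "small ((R i o\<^sub>L Z i) - (f l o\<^sub>L radj (y False j i))) (\<epsilon> / 16)"
    using rj[OF R(1), of i] rj[OF f(1), of l] by (simp add: radj_diff radj_comp radj_radj)
   from small_comp[OF this proj_mem[OF P(1)] proj_norm1[OF P(1)] mem_id norm_id_le] show ?thesis
    by (rule back_subst[of "\<lambda>a. small a _"]) (rule blinfun_eqI, simp)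
  qed
  \<comment> \<open>Only the crude norm of Z i is available on G; this is why \<delta> (i+1) is
    fixed after Z i.\<close>
  have tl: "small (a o\<^sub>L ?G) (\<epsilon> / 16)" if a: "a \<in> M" "norm a = norm (Z i)" for a
  proof (rule small_mono[OF small_bounded])
   show M: "a o\<^sub>L ?G \<in> M" by (intro mem_comp a proj_mem G)
   fix h
   have "norm ((a o\<^sub>L ?G) h) \<le> norm (Z i) * norm (?G h)" using norm_blinfun[of a "?G h"] a(2) by simp
   also have "\<dots> \<le> norm (Z i) * norm h" by (intro mult_left_mono isproj_norm proj_isproj G) simp
   finally show "norm ((a o\<^sub>L ?G) h) \<le> norm (Z i) * norm h" .
  next
   show "\<tau>c (kerp (a o\<^sub>L ?G)) \<le> ennreal (4 * \<delta> (Suc i))"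
    by (rule order_trans[OF tau_support_right[OF mem_comp[OF a(1) proj_mem[OF G]] G] R(4)])
     (simp add: pr_idem[OF G])
   show "norm (Z i) * N (chi (4 * \<delta> (Suc i))) \<le> \<epsilon> / 16" using tail[of i] si by linarith
  qed simp
  have A3: "small (?e o\<^sub>L (Z i o\<^sub>L ?G) o\<^sub>L I) (\<epsilon> / 16)"
   by (rule small_comp[OF tl[OF Z(1)] mem_id norm_id_le proj_mem[OF ep] proj_norm1[OF ep]]) simp
  have A4: "small (I o\<^sub>L (?G o\<^sub>L Z i) o\<^sub>L ?P) (\<epsilon> / 16)"
  proof (rule small_comp[OF _ proj_mem[OF P(1)] proj_norm1[OF P(1)] mem_id norm_id_le])
   have "small (radj (radj (Z i) o\<^sub>L ?G)) (\<epsilon> / 16)" by (intro small_radj tl mem_radj Z norm_radj)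
   then show "small (?G o\<^sub>L Z i) (\<epsilon> / 16)" using rj[OF G] by (simp add: radj_comp radj_radj)
  qed
  have fR: "R (Suc i) (f (m (Suc i)) h) = R (Suc i) h" for h
  proof (rule inner_eqI)
   fix k
   show "inner k (R (Suc i) (f (m (Suc i)) h)) = inner k (R (Suc i) h)"
    using pr_inner[OF R(1), of "Suc i" k "f (m (Suc i)) h"] pr_inner[OF R(1), of "Suc i" k h]
     pr_inner[OF f(1), of "m (Suc i)" "R (Suc i) k" h] by (simp add: R(2))
  qed
  have eq: "(Z i - (?e o\<^sub>L Z i o\<^sub>L ?e)) - ((y True j i o\<^sub>L f l) + (f l o\<^sub>L ?w)) =
   (((Z i o\<^sub>L R i) - (y True j i o\<^sub>L f l)) + (((R i o\<^sub>L Z i) - (f l o\<^sub>L radj (y False j i))) o\<^sub>L ?P)) +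
   ((?e o\<^sub>L (Z i o\<^sub>L ?G) o\<^sub>L I) + (I o\<^sub>L (?G o\<^sub>L Z i) o\<^sub>L ?P))" by (rule blinfun_eqI) (simp add: blin Z)
  have "small ((Z i - (?e o\<^sub>L Z i o\<^sub>L ?e)) - ((y True j i o\<^sub>L f l) + (f l o\<^sub>L ?w))) \<epsilon>"
   unfolding eq by (rule small_mono[OF small_add[OF small_add[OF A1 A2] small_add[OF A3 A4]]]) (use \<epsilon> in simp)
  then show ?thesis unfolding essential_def using yn wn y_mem wM by blast
 qed
 then show ?thesis using c' by blast
qed

end

theorem essential_decomposition:
 "\<exists>R. (\<forall>i. R i \<in> Proj) \<and> (\<forall>i h. R (Suc i) (R i h) = R i h) \<and>
  (\<forall>\<epsilon>>0. \<exists>l c i0. 0 \<le> c \<and> (\<forall>i\<ge>i0. essential (Z i - ((R (Suc i) - R i) o\<^sub>L Z i o\<^sub>L (R (Suc i) - R i))) \<epsilon> (f l) c))"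
proof -
 obtain R where R: "\<And>i. R i \<in> Proj" "\<And>i h. f (m i) (R i h) = R i h" "\<And>i h. R (Suc i) (R i h) = R i h"
  "\<And>i. \<tau> (f (m i) - R i) \<le> ennreal (4 * \<delta> i)" "\<And>b i h. norm (flip b (Z i) (R i h)) \<le> c i * norm h"
  by (rule cut_projections) (rule that; assumption)
 show ?thesis by (intro exI[of _ R] conjI allI impI R essential_part[OF R])
qed

end

section \<open>Choice of the subsequence\<close>

text \<open>The complement of a finite meet of kernels of the X_n and their adjoints has finite
  trace by subadditivity and contains both supports of each of these X_n.\<close>

lemma exhausting_projections:
 fixes X :: "nat \<Rightarrow> 'a op"
 assumes X: "\<And>n. X n \<in> M" and fin: "\<And>n. \<tau>c (kerp (X n)) < \<infinity>"
 obtains f where "\<And>n. f n \<in> Proj" "\<And>n k h. n \<le> k \<Longrightarrow> f k (f n h) = f n h" "\<And>n. \<tau> (f n) < \<infinity>"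
  "\<And>n k h. n \<le> k \<Longrightarrow> f k (X n h) = X n h" "\<And>n k h. n \<le> k \<Longrightarrow> X n (f k h) = X n h"
proof -
 define S where "S n = pmeet (kerp (X n)) (kerp (radj (X n)))" for n
 have S: "S n \<in> Proj" "kerp (X n) (S n h) = S n h" "kerp (radj (X n)) (S n h) = S n h" for n h
  unfolding S_def by (intro pmeet proj_kerp X mem_radj)+
 have S\<tau>: "\<tau>c (S n) < \<infinity>" for n
 proof -
  have "\<tau>c (S n) \<le> \<tau>c (kerp (X n)) + \<tau> (I - kerp (radj (X n)))" unfolding S_def by (intro pmeet proj_kerp X mem_radj)
  also have "\<dots> < \<infinity>" using fin[of n] by (simp add: tau_range[OF X])
  finally show ?thesis .
 qed
 define K where "K = rec_nat (S 0) (\<lambda>n K. pmeet K (S (Suc n)))"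
 have K_simps: "K 0 = S 0" "K (Suc n) = pmeet (K n) (S (Suc n))" for n by (simp_all add: K_def)
 have K: "K n \<in> Proj" for n by (induction n) (simp_all add: K_simps S pmeet)
 note Ki = proj_isproj[OF K]
 have K_step: "K n (K (Suc n) h) = K (Suc n) h" "S (Suc n) (K (Suc n) h) = K (Suc n) h" for n h
  unfolding K_simps by (intro pmeet K S)+
 have K_le: "K n (K k h) = K k h" if "n \<le> k" for n k h using that
 proof (induction k arbitrary: h rule: dec_induct)
  case base
  show ?case by (rule isproj_idem[OF Ki])
 next
  case (step k)
  then show ?case using K_step(1)[of k h] by metis
 qed
 have SK: "S n (K k h) = K k h" if "n \<le> k" for n k h
 proof -
  have "S n (K n g) = K n g" for g by (cases n) (use K_step(2) pr_idem[OF S(1)] in \<open>auto simp: K_simps(1)\<close>)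
  from this[of "K k h"] show ?thesis by (simp add: K_le[OF that])
 qed
 have K_le': "K k (K n h) = K k h" if "n \<le> k" for n k h
 proof (rule inner_eqI)
  fix z
  show "inner z (K k (K n h)) = inner z (K k h)"
   using saD[OF isproj_sa[OF Ki], of k z "K n h"] saD[OF isproj_sa[OF Ki], of n "K k z" h] saD[OF isproj_sa[OF Ki], of k z h]
   by (simp add: K_le[OF that])
 qed
 have XK: "X n (K k h) = 0" "K k (X n h) = 0" if "n \<le> k" for n k h
 proof -
  have *: "kerp (X n) (K k h) = K k h" "kerp (radj (X n)) (K k h) = K k h" for h
   using S(2,3)[of n "K k h"] by (simp_all add: SK[OF that])
  show "X n (K k h) = 0" using kerp_fix[of "X n"] *(1) by blast
  show "K k (X n h) = 0"
  proof (rule inner_eqI)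
   fix z
   have "radj (X n) (K k z) = 0" using kerp_fix[of "radj (X n)"] *(2) by blast
   then show "inner z (K k (X n h)) = inner z 0" using saD[OF isproj_sa[OF Ki], of k z "X n h"] radj'[of "K k z" "X n" h] by simp
  qed
 qed
 show thesis
 proof (rule that)
  show "I - K n \<in> Proj" for n by (rule proj_compl[OF K])
  show "(I - K k) ((I - K n) h) = (I - K n) h" if "n \<le> k" for n k h by (simp add: blin K_le'[OF that])
  show "(I - K k) (X n h) = X n h" "X n ((I - K k) h) = X n h" if "n \<le> k" for n k h by (simp_all add: blin XK[OF that])
  show "\<tau>c (K n) < \<infinity>" for n
  proof (induction n)
   case (Suc n)
   have "\<tau>c (K (Suc n)) \<le> \<tau>c (K n) + \<tau>c (S (Suc n))" unfolding K_simps by (intro pmeet K S)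
   also have "\<dots> < \<infinity>" using Suc S\<tau>[of "Suc n"] by simp
   finally show ?case .
  qed (use S\<tau>[of 0] in \<open>simp add: K_simps\<close>)
 qed
qed

lemma increments_orthogonal:
 fixes R :: "nat \<Rightarrow> 'a op"
 assumes R: "\<And>i. R i \<in> Proj" "\<And>i h. R (Suc i) (R i h) = R i h"
 shows "R (Suc k) - R k \<in> Proj" and "k \<noteq> l \<Longrightarrow> (R (Suc k) - R k) o\<^sub>L (R (Suc l) - R l) = 0"
proof -
 show ep: "R (Suc k) - R k \<in> Proj" for k unfolding projections_iff by (intro conjI mem_diff proj_mem R isproj_diff proj_isproj)
 have le: "R j (R i h) = R i h" if "i \<le> j" for i j h using that
 proof (induction j rule: dec_induct)
  case base
  show ?case by (rule pr_idem[OF R(1)])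
 next
  case (step j)
  then show ?case using R(2)[of j "R i h"] by simp
 qed
 have less: "(R (Suc k) - R k) o\<^sub>L (R (Suc l) - R l) = 0" if "l < k" for k l
  by (rule blinfun_eqI) (use that in \<open>simp add: blin le\<close>)
 have "(R (Suc k) - R k) o\<^sub>L (R (Suc l) - R l) = 0" if "k < l"
 proof -
  have "radj ((R (Suc l) - R l) o\<^sub>L (R (Suc k) - R k)) = radj 0" by (simp only: less[OF that])
  moreover have "radj 0 = (0 :: 'a op)" by (intro radj_sa sa_intros)
  ultimately show ?thesis using pr_radj[OF ep] by (simp add: radj_comp)
 qed
 then show "k \<noteq> l \<Longrightarrow> (R (Suc k) - R k) o\<^sub>L (R (Suc l) - R l) = 0" using less[of l k] by linarith
qed

lemma phi_part_bounded:
 assumes x: "x \<in> nc_space M \<tau> E" and e: "e \<in> Proj"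
 shows "phi_part x e \<in> nc_space M \<tau> E" "nc_norm \<tau> N (phi_part x e) \<le> 4 * nc_norm \<tau> N x"
  and "compress e x \<in> nc_space M \<tau> E" "nc_norm \<tau> N (compress e x) \<le> nc_norm \<tau> N x"
proof -
 have xm: "x \<in> meas" using x by (simp add: nc_space_def)
 note \<sv> = sv_in(1)[OF x] decf_sv[OF xm]
 have S: "Sm (phi_part x e) (\<lambda>t. sv x (t / 2) + sv x (t / 2))" by (rule Sm_mono[OF phi_Sm[OF xm e] order_refl]) simp
 have "N (\<lambda>t. sv x (t / 2) + sv x (t / 2)) \<le> 4 * nc_norm \<tau> N x" using dilation_add(3)[OF \<sv> \<sv>] sv_in(2)[OF x] by simp
 with nc_normI[OF phi_meas[OF xm e] S dilation_add(1)[OF \<sv> \<sv>] decfD(2)[OF dilation_add(2)[OF \<sv> \<sv>]]]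
 show "phi_part x e \<in> nc_space M \<tau> E" "nc_norm \<tau> N (phi_part x e) \<le> 4 * nc_norm \<tau> N x" by auto
 have "Sm (compress e x) (sv x)" by (rule Sm_mono[OF zeta_Sm[OF xm e] order_refl]) simp
 from nc_normI[OF zeta_meas[OF xm e] this \<sv>(1) decfD(2)[OF \<sv>(2)]]
 show "compress e x \<in> nc_space M \<tau> E" "nc_norm \<tau> N (compress e x) \<le> nc_norm \<tau> N x" by (auto simp: sv_in(2)[OF x])
qed

lemma approx_phi_part:
 assumes x: "x \<in> meas" and e: "e \<in> Proj" and X: "X \<in> M" "App x X F" and F: "decf F" "F \<in> E" "4 * N F \<le> \<epsilon>"
  and ess: "essential (X - (e o\<^sub>L X o\<^sub>L e)) \<epsilon> f c"
 shows "approx (phi_part x e) \<epsilon> f c"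
proof -
 have "App (phi_part x e) (X - (e o\<^sub>L X o\<^sub>L e)) (\<lambda>t. F (t / 2) + F (t / 2))" by (rule phi_App[OF x e X(2) decfD(2)[OF F(1)] X(1)])
 moreover have "N (\<lambda>t. F (t / 2) + F (t / 2)) \<le> \<epsilon>" by (rule order_trans[OF dilation_add(3)[OF F(2,1) F(2,1)]]) (use F(3) in simp)
 moreover have "X - (e o\<^sub>L X o\<^sub>L e) \<in> M" by (intro mem_diff mem_comp X proj_mem e)
 ultimately show ?thesis using dilation_add(1,2)[OF F(2,1) F(2,1)] ess unfolding approx_def by blast
qed

end

theorem corollary3p8:
  fixes M :: "('a::complex_hilbert \<Rightarrow>\<^sub>L 'a) set"
    and \<tau> :: "('a \<Rightarrow>\<^sub>L 'a) \<Rightarrow> ennreal"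
    and E :: "(real \<Rightarrow> real) set"
    and N :: "(real \<Rightarrow> real) \<Rightarrow> real"
    and x :: "nat \<Rightarrow> ('a \<times> 'a) set"
  assumes "von_neumann_algebra M"
    and "fns_trace M \<tau>"
    and "symmetric_function_space E N"
    and "order_continuous E N"
    and "fatou_property E N"
    and "nc_bounded M \<tau> E N (range x)"
  shows "\<exists>(r :: nat \<Rightarrow> nat) (\<phi> :: nat \<Rightarrow> ('a \<times> 'a) set) (\<zeta> :: nat \<Rightarrow> ('a \<times> 'a) set)
            (e :: nat \<Rightarrow> ('a \<Rightarrow>\<^sub>L 'a)).
      strict_mono r \<and>
      nc_bounded M \<tau> E N (range \<phi>) \<and>
      nc_bounded M \<tau> E N (range \<zeta>) \<and>
      (\<forall>k. e k \<in> projections M) \<and>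
      (\<forall>k l. k \<noteq> l \<longrightarrow> e k o\<^sub>L e l = 0) \<and>
      (\<forall>k. x (r k) = strong_sum (\<phi> k) (\<zeta> k)) \<and>
      equi_integrable M \<tau> E N (range \<phi>) \<and>
      (\<forall>k. compress (e k) (\<phi> k) = op_graph 0) \<and>
      (\<forall>k. compress (e k) (\<zeta> k) = \<zeta> k)"
proof -
 interpret nc_sym M \<tau> E N
  by (intro nc_sym.intro nc_algebra.intro nc_algebra_axioms.intro sym_space.intro sym_space_axioms.intro assms)
 obtain C where x: "\<And>k. x k \<in> nc_space M \<tau> E" and C: "\<And>k. nc_norm \<tau> N (x k) \<le> C" using assms(6) by (auto simp: nc_bounded_def)
 have xm: "x k \<in> meas" for k using x[of k] by (simp add: nc_space_def)
 have C0: "0 \<le> C" using nc_norm_nonneg[OF x] C order_trans by blast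
 \<comment> \<open>The dyadic majorant depends on countably many values, so one subsequence makes
   all of these functions converge everywhere; its dilation costs the factor 2 in B.\<close>
 define h where "h k = dyadic (sv (x k))" for k
 define B where "B = 2 * C"
 have B: "0 \<le> B" using C0 by (simp add: B_def)
 have h: "decf (h k)" "h k \<in> E" "N (h k) \<le> B" for k
 proof -
  note \<sv> = sv_in(1)[OF x] decf_sv[OF xm]
  show d: "decf (h k)" unfolding h_def by (rule decf_dyadic[OF \<sv>(2)])
  note dl = dom_decf[OF dilation(1)[OF \<sv>] d, unfolded h_def, OF dyadic_le[OF \<sv>(2)], folded h_def]
  show "h k \<in> E" by (rule dl(1))
  show "N (h k) \<le> B" using dl(2) dilation(2)[OF \<sv>, of k] sv_in(2)[OF x, of k] C[of k] by (simp add: B_def)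
 qed
 have h_bound: "h k t \<le> B / N (chi t)" if t: "t > 0" for k t
  using order_trans[OF decf_bound[OF h(2,1) t] h(3)] chi_pos[OF t] by (simp add: pos_le_divide_eq)

 have "\<exists>X F. X \<in> M \<and> Sm (op_graph X) (sv (x k)) \<and> \<tau>c (kerp X) < \<infinity> \<and> App (x k) X F \<and> decf F \<and> F \<in> E \<and> N F \<le> 1 / real (Suc k)" for k
  by (rule finite_approximation[OF x, of "1 / real (Suc k)"]) auto
 then obtain X F where X: "\<And>k. X k \<in> M" "\<And>k. Sm (op_graph (X k)) (sv (x k))" "\<And>k. \<tau>c (kerp (X k)) < \<infinity>"
   "\<And>k. App (x k) (X k) (F k)" and F: "\<And>k. decf (F k)" "\<And>k. F k \<in> E" "\<And>k. N (F k) \<le> 1 / real (Suc k)" by metis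
 have Xh: "Sm (op_graph (X k)) (h k)" for k by (rule Sm_mono[OF X(2) order_refl]) (simp only: h_def dyadic_ge[OF decf_sv[OF xm]])
 obtain f where f: "\<And>n. f n \<in> Proj" "\<And>n k h. n \<le> k \<Longrightarrow> f k (f n h) = f n h" "\<And>n. \<tau> (f n) < \<infinity>"
  and fX: "\<And>n k h. n \<le> k \<Longrightarrow> f k (X n h) = X n h" "\<And>n k h. n \<le> k \<Longrightarrow> X n (f k h) = X n h"
  by (rule exhausting_projections[OF X(1,3)]) (rule that; assumption)

 have "\<forall>b j k. \<exists>p q. cuts (flip b (X k)) B j p q"
  using left_right_cuts[OF flip_mem[OF X(1)] Sm_flip[OF Xh h(1) X(1)] h(1) h_bound] by blast
 then obtain p q where pq_cuts: "\<And>b j k. cuts (flip b (X k)) B j (p b j k) (q b j k)" by (simp only: choice_iff) blast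
 note pq = cutsD[OF pq_cuts]
 define y where "y b j k = q b j k o\<^sub>L flip b (X k) o\<^sub>L (I - p b j k)" for b j k
 have y_beta: "\<bar>beta (y b j k) (f l)\<bar> \<le> (B / N (chi (1 / real (Suc j))))\<^sup>2 * real (Suc j)" for b j k l
 proof -
  have "0 \<le> B / N (chi (1 / real (Suc j)))" using B N_nonneg[OF chi_in] by simp
  note * = truncation_trace[OF flip_mem[OF X(1)] pq(1,2) this pq(6,3) of_nat_0_le_iff y_def[of b j k]]
  show ?thesis using beta(1,2)[OF *(1,3) _ f(1) f(1) f(2)[OF order_refl], of l] by simp
 qed

 \<comment> \<open>All numbers that have to converge, over one countable index: the singular values
   at the powers of 2, and the masses for both sides b, all heights j and all levels l.\<close>
 define v where "v k i = (case i of Inl a \<Rightarrow> sv (x k) (2 powr of_int a) | Inr (b, j, l) \<Rightarrow> beta (y b j k) (f l))"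
  for k and i :: "int + bool \<times> nat \<times> nat"
 obtain s where s: "strict_mono s" and v: "\<And>i. convergent (\<lambda>n. v (s n) i)"
 proof (rule bounded_functions_subsequence[of v])
  show "\<bar>v k i\<bar> \<le> (case i of Inl a \<Rightarrow> B / N (chi (2 powr of_int a)) | Inr (b, j, l) \<Rightarrow> (B / N (chi (1 / real (Suc j))))\<^sup>2 * real (Suc j))" for k i
  proof (cases i)
   case (Inl a)
   have "\<bar>sv (x k) (2 powr of_int a)\<bar> \<le> h k (2 powr of_int a)"
    using dyadic_ge[OF decf_sv[OF xm]] decfD(2)[OF decf_sv[OF xm]] by (simp add: h_def del: sv_pos)
   also have "\<dots> \<le> B / N (chi (2 powr of_int a))" by (rule h_bound) simp
   finally show ?thesis using Inl by (simp add: v_def)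
  next
   case (Inr c)
   then show ?thesis using y_beta by (cases c) (simp add: v_def del: of_nat_Suc)
  qed
 qed (rule that; assumption)
 define g where "g t = lim (\<lambda>n. h (s n) t)" for t
 have hg: "(\<lambda>n. h (s n) t) \<longlonglongrightarrow> g t" for t
 proof -
  have "convergent (\<lambda>n. h (s n) t)"
   using v[of "Inl \<lfloor>log 2 t\<rfloor>"] by (cases "t \<le> 0") (simp_all add: h_def dyadic_def v_def convergent_const)
  then show ?thesis by (simp add: g_def convergent_LIMSEQ_iff)
 qed
 have g: "g \<in> E" "decf g" using limit_in[of "\<lambda>n. h (s n)" B g] h hg by auto
 define bl where "bl b j l = lim (\<lambda>n. beta (y b j (s n)) (f l))" for b j l
 have bl: "(\<lambda>n. beta (y b j (s n)) (f l)) \<longlonglongrightarrow> bl b j l" for b j l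
  using v[of "Inr (b, j, l)"] by (simp add: v_def bl_def convergent_LIMSEQ_iff)

 \<comment> \<open>A state is a level, a threshold and an index: each index is chosen after the level and the threshold of
 its own step (\<open>P\<close>), and these are chosen after the index of the previous step (\<open>Q\<close>).\<close>
 define P where "P n st = (case st of (m, \<delta>, k) \<Rightarrow> 0 < \<delta> \<and> \<delta> \<le> 1 \<and> n \<le> m \<and> m < s k \<and>
   N (\<lambda>t. min \<bar>h (s k) t - g t\<bar> (2 * (B / N (chi \<delta>))) * chi (enn2real (\<tau> (f m)) + 1) t) \<le> 1 / real (Suc n) \<and>
   (\<forall>b. \<forall>j\<le>n. \<forall>l\<le>m. \<bar>beta (y b j (s k)) (f l) - bl b j l\<bar> \<le> 1 / real (Suc n)))" for n and st :: "nat \<times> real \<times> nat"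
 define Q where "Q n st st' = (case st of (m, \<delta>, k) \<Rightarrow> case st' of (m', \<delta>', k') \<Rightarrow> m' = s k \<and> k < k' \<and> \<delta>' \<le> \<delta> / 2 \<and>
   norm (X (s k)) * N (chi (4 * \<delta>')) \<le> 1 / real (Suc n))" for n :: nat and st st' :: "nat \<times> real \<times> nat"
 have extend: "\<exists>k>k0. P n (m, \<delta>, k)" if \<delta>: "0 < \<delta>" "\<delta> \<le> 1" and m: "n \<le> m" for n m \<delta> and k0 :: nat
 proof -
  let ?K = "2 * (B / N (chi \<delta>))" and ?T = "enn2real (\<tau> (f m)) + 1"
  have K: "0 \<le> ?K" using B N_nonneg[OF chi_in, of \<delta>] by simp
  have e: "0 < 1 / real (Suc n)" by simp
  \<comment> \<open>The convergence of h is only pointwise; the cuts in height and length supply the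
    dominating function ?K chi ?T.\<close>
  have "(\<lambda>k. N (\<lambda>t. min \<bar>h (s k) t - g t\<bar> ?K * chi ?T t)) \<longlonglongrightarrow> 0"
  proof (rule dominated[OF _ scale_closed[OF chi_in, of ?K ?T]])
   have [measurable]: "h k \<in> borel_measurable borel" "g \<in> borel_measurable borel" "chi T \<in> borel_measurable borel" for k T
    by (intro decf_measurable h g decf_chi)+
   show "(\<lambda>t. min \<bar>h (s k) t - g t\<bar> ?K * chi ?T t) \<in> borel_measurable halfline" for k by (rule halfline_measurable) measurable
   show "\<bar>min \<bar>h (s k) t - g t\<bar> ?K * chi ?T t\<bar> \<le> ?K * chi ?T t" for k t using K by (simp add: chi_def)
   show "(\<lambda>k. min \<bar>h (s k) t - g t\<bar> ?K * chi ?T t) \<longlonglongrightarrow> 0" for t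
   proof -
    have "(\<lambda>k. \<bar>h (s k) t - g t\<bar>) \<longlonglongrightarrow> 0" using LIM_zero[OF hg[of t]] by (simp add: tendsto_rabs_zero_iff)
    from tendsto_min[OF this tendsto_const, of ?K] have "(\<lambda>k. min \<bar>h (s k) t - g t\<bar> ?K) \<longlonglongrightarrow> 0" using K by simp
    then show ?thesis by (rule tendsto_mult_left_zero)
   qed
  qed
  from order_tendstoD(2)[OF this e]
  have 1: "\<forall>\<^sub>F k in sequentially. N (\<lambda>t. min \<bar>h (s k) t - g t\<bar> ?K * chi ?T t) \<le> 1 / real (Suc n)" by (rule eventually_mono) simp
  have "\<forall>\<^sub>F k in sequentially. \<bar>beta (y b j (s k)) (f l) - bl b j l\<bar> \<le> 1 / real (Suc n)" for b j l
   using tendstoD[OF bl e, of b j l] by (rule eventually_mono) (simp add: dist_real_def)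
  then have 2: "\<forall>\<^sub>F k in sequentially. \<forall>b\<in>UNIV. \<forall>j\<in>{..n}. \<forall>l\<in>{..m}. \<bar>beta (y b j (s k)) (f l) - bl b j l\<bar> \<le> 1 / real (Suc n)"
   by (intro eventually_ball_finite ballI) auto
  have 3: "\<forall>\<^sub>F k in sequentially. max k0 m < k" by (rule eventually_gt_at_top)
  obtain k where k: "max k0 m < k" "N (\<lambda>t. min \<bar>h (s k) t - g t\<bar> ?K * chi ?T t) \<le> 1 / real (Suc n)"
   "\<forall>b\<in>UNIV. \<forall>j\<in>{..n}. \<forall>l\<in>{..m}. \<bar>beta (y b j (s k)) (f l) - bl b j l\<bar> \<le> 1 / real (Suc n)"
   using eventually_happens'[OF sequentially_bot eventually_conj[OF 3 eventually_conj[OF 1 2]]] by blast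
  have "m < s k" using k(1) seq_suble[OF s, of k] by linarith
  then have "P n (m, \<delta>, k)" using \<delta> m k(2,3) unfolding P_def by simp
  then show ?thesis using k(1) by auto
 qed
 have "\<exists>st. \<forall>n. P n (st n) \<and> Q n (st n) (st (Suc n))"
 proof (rule dependent_nat_choice)
  show "\<exists>st. P 0 st" using extend[of 1 0 0 0] by auto
  fix st n assume st: "P n st"
  obtain m \<delta> k where stm: "st = (m, \<delta>, k)" by (cases st)
  have P: "0 < \<delta>" "\<delta> \<le> 1" "Suc n \<le> s k" using st by (auto simp: P_def stm)
  \<comment> \<open>The norm of the chosen X (s k) enters the denominator because it has no bound
    independent of k.\<close>
  have pos: "0 < 1 / (real (Suc n) * (norm (X (s k)) + 1))"
   by (intro divide_pos_pos mult_pos_pos add_nonneg_pos) (simp_all del: of_nat_Suc)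
  obtain \<delta>1 where \<delta>1: "0 < \<delta>1" "\<delta>1 \<le> 1" "N (chi \<delta>1) \<le> 1 / (real (Suc n) * (norm (X (s k)) + 1))" using chi_smallE[OF pos] by blast
  \<comment> \<open>The division by 4 matches the trace 4 \<delta> discarded by
    \<open>cut_projections\<close>; the other entry keeps the thresholds halving.\<close>
  define \<delta>' where "\<delta>' = min (\<delta> / 2) (\<delta>1 / 4)"
  have \<delta>': "0 < \<delta>'" "\<delta>' \<le> 1" "\<delta>' \<le> \<delta> / 2" using P \<delta>1 by (auto simp: \<delta>'_def)
  have "N (chi (4 * \<delta>')) \<le> N (chi \<delta>1)" by (rule chi_mono) (simp add: \<delta>'_def)
  then have "norm (X (s k)) * N (chi (4 * \<delta>')) \<le> norm (X (s k)) * (1 / (real (Suc n) * (norm (X (s k)) + 1)))"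
   using \<delta>1(3) by (intro mult_left_mono) auto
  also have "\<dots> \<le> 1 / real (Suc n)"
  proof -
   have "norm (X (s k)) / (norm (X (s k)) + 1) \<le> 1" by (simp add: divide_le_eq_1 add_nonneg_pos)
   from mult_left_mono[OF this, of "1 / real (Suc n)"] show ?thesis by (simp add: divide_simps)
  qed
  finally have tail: "norm (X (s k)) * N (chi (4 * \<delta>')) \<le> 1 / real (Suc n)" .
  obtain k' where "k < k'" "P (Suc n) (s k, \<delta>', k')" using extend[OF \<delta>'(1,2) P(3)] by blast
  then show "\<exists>st'. P (Suc n) st' \<and> Q n st st'" using \<delta>'(3) tail by (intro exI[of _ "(s k, \<delta>', k')"]) (simp add: Q_def stm)
 qed
 then obtain st where st: "\<And>n. P n (st n)" "\<And>n. Q n (st n) (st (Suc n))" by blast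
 define m where "m n = fst (st n)" for n
 define \<delta> where "\<delta> n = fst (snd (st n))" for n
 define k where "k n = snd (snd (st n))" for n
 have st_eq: "st n = (m n, \<delta> n, k n)" for n by (simp add: m_def \<delta>_def k_def)
 note P' = st(1)[unfolded st_eq P_def prod.case] and Q' = st(2)[unfolded st_eq Q_def prod.case]
 define r where "r n = s (k n)" for n
 \<comment> \<open>The next level is the index just selected: f (r n) already contains both supports
   of X (r n).\<close>
 have mr: "m (Suc n) = r n" for n using Q'[of n] by (simp add: r_def)
 have "strict_mono k" unfolding strict_mono_Suc_iff using Q' by blast
 then have r: "strict_mono r" unfolding r_def using s by (auto simp: strict_mono_def)

 have "\<exists>R. (\<forall>i. R i \<in> Proj) \<and> (\<forall>i h. R (Suc i) (R i h) = R i h) \<and>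
  (\<forall>\<epsilon>>0. \<exists>l c i0. 0 \<le> c \<and> (\<forall>i\<ge>i0. essential (X (r i) - ((R (Suc i) - R i) o\<^sub>L X (r i) o\<^sub>L (R (Suc i) - R i))) \<epsilon> (f l) c))"
 proof (rule essential_decomposition[of f "\<lambda>i. X (r i)" m "\<lambda>i. h (r i)" B g \<delta> "\<lambda>b j i. p b j (r i)" "\<lambda>b j i. q b j (r i)"
    "\<lambda>b j i. y b j (r i)" bl])
  show "f (m (Suc i)) (X (r i) h) = X (r i) h" "X (r i) (f (m (Suc i)) h) = X (r i) h" for i h by (simp_all add: mr fX)
  show "m i \<le> m (Suc i)" for i using P'[of i] by (simp add: mr r_def)
  show "i \<le> m i" "0 < \<delta> i" "\<delta> i \<le> 1" for i using P'[of i] by simp_all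
  show "\<delta> (Suc i) \<le> \<delta> i / 2" "norm (X (r i)) * N (chi (4 * \<delta> (Suc i))) \<le> 1 / real (Suc i)" for i
   using Q'[of i] by (simp_all add: r_def)
  show "N (\<lambda>t. min \<bar>h (r i) t - g t\<bar> (2 * (B / N (chi (\<delta> i)))) * chi (enn2real (\<tau> (f (m i))) + 1) t) \<le> 1 / real (Suc i)" for i
   using P'[of i] by (simp add: r_def)
  show "\<bar>beta (y b j (r i)) (f l) - bl b j l\<bar> \<le> 1 / real (Suc i)" if "j \<le> i" "l \<le> m i" for b j i l
   using P'[of i] that by (simp add: r_def)
 qed (rule f X(1) Xh h(1,2) h_bound B g pq_cuts y_def; assumption)+
 then obtain R where R: "\<And>i. R i \<in> Proj" "\<And>i h. R (Suc i) (R i h) = R i h"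
  and ess: "\<And>\<epsilon>. 0 < \<epsilon> \<Longrightarrow> \<exists>l c i0. 0 \<le> c \<and>
   (\<forall>i\<ge>i0. essential (X (r i) - ((R (Suc i) - R i) o\<^sub>L X (r i) o\<^sub>L (R (Suc i) - R i))) \<epsilon> (f l) c)" by auto
 define e where "e i = R (Suc i) - R i" for i
 have e: "e i \<in> Proj" "i \<noteq> j \<Longrightarrow> e i o\<^sub>L e j = 0" for i j
  unfolding e_def by (rule increments_orthogonal(1)[of R, OF R], rule increments_orthogonal(2)[of R, OF R])
 define \<phi> where "\<phi> i = phi_part (x (r i)) (e i)" for i
 define \<zeta> where "\<zeta> i = compress (e i) (x (r i))" for i
 have "nc_norm \<tau> N (\<phi> i) \<le> 4 * C" for i unfolding \<phi>_def by (rule order_trans[OF phi_part_bounded(2)[OF x e(1)]]) (simp add: C)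
 then have b\<phi>: "nc_bounded M \<tau> E N (range \<phi>)" unfolding nc_bounded_def using phi_part_bounded(1)[OF x e(1)] by (auto simp: \<phi>_def)
 have "nc_norm \<tau> N (\<zeta> i) \<le> C" for i unfolding \<zeta>_def by (rule order_trans[OF phi_part_bounded(4)[OF x e(1)] C])
 then have b\<zeta>: "nc_bounded M \<tau> E N (range \<zeta>)" unfolding nc_bounded_def using phi_part_bounded(3)[OF x e(1)] by (auto simp: \<zeta>_def)
 have eq: "equi_integrable M \<tau> E N (range \<phi>)"
 proof (rule equi_integrableI[OF b\<phi>])
  fix \<epsilon> :: real assume \<epsilon>: "0 < \<epsilon>"
  obtain l c i0 where c: "0 \<le> c" and A: "\<And>i. i \<ge> i0 \<Longrightarrow> essential (X (r i) - (e i o\<^sub>L X (r i) o\<^sub>L e i)) \<epsilon> (f l) c"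
   using ess[OF \<epsilon>] unfolding e_def by blast
  obtain i1 where i1: "1 / real (Suc i1) < \<epsilon> / 4" using reals_Archimedean[of "\<epsilon> / 4"] \<epsilon> by (auto simp: inverse_eq_divide)
  have "approx (\<phi> i) \<epsilon> (f l) c" if i: "i \<ge> max i0 i1" for i
  proof -
   have "i1 \<le> r i" using seq_suble[OF r, of i] i by linarith
   then have "1 / real (Suc (r i)) \<le> 1 / real (Suc i1)" by (simp add: frac_le)
   \<comment> \<open>The error of x - exe consists of two copies of F, and the sum rule doubles: 2
     (1 + 1) = 4.\<close>
   then have "4 * N (F (r i)) \<le> \<epsilon>" using F(3)[of "r i"] i1 by linarith
   then show ?thesis unfolding \<phi>_def by (rule approx_phi_part[OF xm e(1) X(1,4) F(1,2) _ A]) (use i in simp)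
  qed
  then show "\<exists>f c i0. f \<in> Proj \<and> \<tau> f < \<infinity> \<and> 0 \<le> c \<and> (\<forall>i\<ge>i0. approx (\<phi> i) \<epsilon> f c)" using f(1,3) c by blast
 qed
 show ?thesis by (intro exI[of _ r] exI[of _ \<phi>] exI[of _ \<zeta>] exI[of _ e] conjI allI impI r b\<phi> b\<zeta> eq e;
    simp add: \<phi>_def \<zeta>_def phi_zeta_sum[OF xm e(1), symmetric] phi_compress[OF xm e(1)] zeta_compress[OF xm e(1)])
qed

end
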